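(* Let $(M,\Psi)$ be a compact $Spin(7)$ manifold with torsion connection $\nabla$, torsion 3-form $T$ and curvature $R$. Then the following are equivalent: (i) $R$ is a $Spin(7)$-instanton and $d^{\nabla}T=0$ (equivalently, $dT=2\sigma^T$); (ii) the torsion 3-form is parallel with respect to the torsion connection, $\nabla T=0$. In particular (in this case), the Ricci tensor of the torsion connection is symmetric and $\nabla$-parallel, and $\nabla dT=0$.
   Context: Manifolds are smooth; compact means compact without boundary. A $Spin(7)$ manifold $(M,\Psi)$ is an 8-manifold with a 4-form $\Psi$ that near each point can be written, in a local coframe $e_0,\dots,e_7$, as $\Psi=-e_{0127}+e_{0236}-e_{0347}-e_{0567}+e_{0146}+e_{0245}-e_{0135}-e_{3456}-e_{1457}-e_{1256}-e_{1234}-e_{2357}-e_{1367}+e_{2467}$, where $e_{ijkl}=e_i\wedge e_j\wedge e_k\wedge e_l$. It induces the metric $g$ and orientation for which such coframes are oriented orthonormal. Indices refer to a local orthonormal frame, and repeated indices are summed. There is a unique linear connection $\nabla$ (the torsion connection) with $\nabla g=0$, $\nabla\Psi=0$ and totally skew-symmetric torsion, i.e. $T(X,Y,Z)=g(\nabla_XY-\nabla_YX-[X,Y],Z)$ is a 3-form. Curvature: $R(X,Y)Z=[\nabla_X,\nabla_Y]Z-\nabla_{[X,Y]}Z$, $R(X,Y,Z,V)=g(R(X,Y)Z,V)$, and $Ric(X,Y)=\sum_a R(e_a,X,Y,e_a)$. $R$ is a $Spin(7)$-instanton if $R_{abij}\Psi_{abkl}=2R_{klij}$ for all $i,j,k,l$,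 i.e. the curvature 2-form lies in $\mathfrak{spin}(7)\cong\{\alpha\in\Lambda^2:\alpha_{ij}\Psi_{ijkl}=2\alpha_{kl}\}$; equivalently (since $\nabla\Psi=0$) $R\in\mathfrak{spin}(7)\otimes\mathfrak{spin}(7)$. The 4-form $d^\nabla T$ is $d^{\nabla}T(X,Y,Z,V)=(\nabla_XT)(Y,Z,V)+(\nabla_YT)(Z,X,V)+(\nabla_ZT)(X,Y,V)-(\nabla_VT)(X,Y,Z)$, and $\sigma^T=\frac12\sum_j(e_j\lrcorner T)\wedge(e_j\lrcorner T)$ for an orthonormal frame, where $(e_j\lrcorner T)(X,Y)=T(e_j,X,Y)$. One always has $dT=d^{\nabla}T+2\sigma^T$. *)

theory Defs
  imports "HOL-Analysis.Analysis"
begin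

section \<open>Smooth 8-manifolds\<close>

text \<open>
  A manifold is a type \<open>'a\<close> with its topology, together with a smooth atlas modelled on \<open>real^8\<close>.
\<close>

primrec Ck_on :: "nat \<Rightarrow> 'e::euclidean_space set \<Rightarrow> ('e \<Rightarrow> 'f::real_normed_vector) \<Rightarrow> bool" where
  "Ck_on 0 S f \<longleftrightarrow> continuous_on S f"
| "Ck_on (Suc k) S f \<longleftrightarrow>
     f differentiable_on S \<and> (\<forall>b\<in>Basis. Ck_on k S (\<lambda>x. frechet_derivative f (at x) b))"

text \<open>\<open>smooth_on S f\<close> is only used for open \<open>S\<close>.\<close>

definition smooth_on :: "'e::euclidean_space set \<Rightarrow> ('e \<Rightarrow> 'f::real_normed_vector) \<Rightarrow> bool" where
  "smooth_on S f \<longleftrightarrow> (\<forall>k. Ck_on k S f)"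

type_synonym 'a chart = "'a set \<times> ('a \<Rightarrow> real^8)"

definition smooth_atlas :: "'a::topological_space chart set \<Rightarrow> bool" where
  "smooth_atlas A \<longleftrightarrow>
     (\<Union>(U, \<phi>)\<in>A. U) = UNIV \<and>
     (\<forall>(U, \<phi>)\<in>A. open U \<and> open (\<phi> ` U) \<and> homeomorphism U (\<phi> ` U) \<phi> (inv_into U \<phi>)) \<and>
     (\<forall>(U, \<phi>)\<in>A. \<forall>(V, \<psi>)\<in>A. smooth_on (\<phi> ` (U \<inter> V)) (\<psi> \<circ> inv_into U \<phi>))"

definition smooth_fun_on :: "'a::topological_space chart set \<Rightarrow> 'a set \<Rightarrow> ('a \<Rightarrow> real) \<Rightarrow> bool" where
  "smooth_fun_on A U f \<longleftrightarrow> (\<forall>(V, \<phi>)\<in>A. smooth_on (\<phi> ` (U \<inter> V)) (f \<circ> inv_into V \<phi>))"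

definition smooth_funs :: "'a::topological_space chart set \<Rightarrow> ('a \<Rightarrow> real) set" where
  "smooth_funs A = {f. smooth_fun_on A UNIV f}"

text \<open>
  Tangent vectors at \<open>p\<close> are the derivations at \<open>p\<close> of the algebra of smooth functions. They are set
  to 0 on functions that are not smooth, so that equality of tangent vectors is equality in HOL.
\<close>

type_synonym 'a tvec = "('a \<Rightarrow> real) \<Rightarrow> real"
type_synonym 'a vfield = "'a \<Rightarrow> 'a tvec"

definition tangent_space :: "'a::topological_space chart set \<Rightarrow> 'a \<Rightarrow> 'a tvec set" where
  "tangent_space A p = {v.
     (\<forall>f. f \<notin> smooth_funs A \<longrightarrow> v f = 0) \<and>
     (\<forall>f\<in>smooth_funs A. \<forall>c. v (\<lambda>q. c * f q) = c * v f) \<and>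
     (\<forall>f\<in>smooth_funs A. \<forall>h\<in>smooth_funs A. v (\<lambda>q. f q + h q) = v f + v h) \<and>
     (\<forall>f\<in>smooth_funs A. \<forall>h\<in>smooth_funs A. v (\<lambda>q. f q * h q) = f p * v h + h p * v f)}"

definition vfields :: "'a::topological_space chart set \<Rightarrow> 'a vfield set" where
  "vfields A = {X. (\<forall>p. X p \<in> tangent_space A p) \<and>
                   (\<forall>f\<in>smooth_funs A. (\<lambda>p. X p f) \<in> smooth_funs A)}"

definition vf_add :: "'a vfield \<Rightarrow> 'a vfield \<Rightarrow> 'a vfield" where
  "vf_add X Y = (\<lambda>p f. X p f + Y p f)"

definition vf_diff :: "'a vfield \<Rightarrow> 'a vfield \<Rightarrow> 'a vfield" where
  "vf_diff X Y = (\<lambda>p f. X p f - Y p f)"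

definition vf_scale :: "('a \<Rightarrow> real) \<Rightarrow> 'a vfield \<Rightarrow> 'a vfield" where
  "vf_scale u X = (\<lambda>p f. u p * X p f)"

definition lie_bracket :: "'a vfield \<Rightarrow> 'a vfield \<Rightarrow> 'a vfield" where
  "lie_bracket X Y = (\<lambda>p f. X p (\<lambda>q. Y q f) - Y p (\<lambda>q. X q f))"

section \<open>Spin(7) structures\<close>

text \<open>
  Wedge products follow the determinant convention
  \<open>(a \<and> b \<and> c \<and> d)(x\<^sub>0, x\<^sub>1, x\<^sub>2, x\<^sub>3) = \<Sum>\<^sub>\<pi> sgn(\<pi>) a(x\<^bsub>\<pi>0\<^esub>) b(x\<^bsub>\<pi>1\<^esub>) c(x\<^bsub>\<pi>2\<^esub>) d(x\<^bsub>\<pi>3\<^esub>)\<close>, under which the components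
  of the form below in its coframe are 0 and \<open>\<plusminus>1\<close>.
\<close>

definition wedge1111 ::
  "('v \<Rightarrow> real) \<Rightarrow> ('v \<Rightarrow> real) \<Rightarrow> ('v \<Rightarrow> real) \<Rightarrow> ('v \<Rightarrow> real) \<Rightarrow> 'v \<Rightarrow> 'v \<Rightarrow> 'v \<Rightarrow> 'v \<Rightarrow> real" where
  "wedge1111 a b c d x y z v =
     (\<Sum>\<pi> | \<pi> permutes {..<4::nat}. of_int (sign \<pi>) *
        a ([x, y, z, v] ! \<pi> 0) * b ([x, y, z, v] ! \<pi> 1) *
        c ([x, y, z, v] ! \<pi> 2) * d ([x, y, z, v] ! \<pi> 3))"

definition cayley_form :: "(nat \<Rightarrow> 'v \<Rightarrow> real) \<Rightarrow> 'v \<Rightarrow> 'v \<Rightarrow> 'v \<Rightarrow> 'v \<Rightarrow> real" where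
  "cayley_form e x y z v =
     (let w = (\<lambda>i j k l. wedge1111 (e i) (e j) (e k) (e l) x y z v) in
      - w 0 1 2 7 + w 0 2 3 6 - w 0 3 4 7 - w 0 5 6 7 + w 0 1 4 6 + w 0 2 4 5 - w 0 1 3 5
      - w 3 4 5 6 - w 1 4 5 7 - w 1 2 5 6 - w 1 2 3 4 - w 2 3 5 7 - w 1 3 6 7 + w 2 4 6 7)"

definition local_coframe ::
  "'a::topological_space chart set \<Rightarrow> 'a set \<Rightarrow> (nat \<Rightarrow> 'a \<Rightarrow> 'a tvec \<Rightarrow> real) \<Rightarrow> bool" where
  "local_coframe A U \<theta> \<longleftrightarrow> open U \<and>
     (\<forall>i<8. \<forall>q\<in>U. \<forall>v\<in>tangent_space A q. \<forall>w\<in>tangent_space A q. \<forall>a b.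
        \<theta> i q (\<lambda>f. a * v f + b * w f) = a * \<theta> i q v + b * \<theta> i q w) \<and>
     (\<forall>i<8. \<forall>X\<in>vfields A. smooth_fun_on A U (\<lambda>q. \<theta> i q (X q))) \<and>
     (\<forall>q\<in>U. \<forall>c. (\<forall>v\<in>tangent_space A q. (\<Sum>i<8. c i * \<theta> i q v) = 0) \<longrightarrow> (\<forall>i<8. c i = 0))"

type_synonym 'a form4 = "'a \<Rightarrow> 'a tvec \<Rightarrow> 'a tvec \<Rightarrow> 'a tvec \<Rightarrow> 'a tvec \<Rightarrow> real"
type_synonym 'a metric2 = "'a \<Rightarrow> 'a tvec \<Rightarrow> 'a tvec \<Rightarrow> real"

definition adapted_coframe ::
  "'a::topological_space chart set \<Rightarrow> 'a form4 \<Rightarrow> 'a set \<Rightarrow> (nat \<Rightarrow> 'a \<Rightarrow> 'a tvec \<Rightarrow> real) \<Rightarrow> bool" where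
  "adapted_coframe A \<Psi> U \<theta> \<longleftrightarrow> local_coframe A U \<theta> \<and>
     (\<forall>q\<in>U. \<forall>x\<in>tangent_space A q. \<forall>y\<in>tangent_space A q.
        \<forall>z\<in>tangent_space A q. \<forall>v\<in>tangent_space A q.
        \<Psi> q x y z v = cayley_form (\<lambda>i. \<theta> i q) x y z v)"

text \<open>That \<open>\<Psi>\<close> is a smooth 4-form is part of this condition, being local.\<close>

definition spin7_structure :: "'a::topological_space chart set \<Rightarrow> 'a form4 \<Rightarrow> bool" where
  "spin7_structure A \<Psi> \<longleftrightarrow> (\<forall>p. \<exists>U \<theta>. p \<in> U \<and> adapted_coframe A \<Psi> U \<theta>)"

text \<open>
  The metric for which all adapted coframes are orthonormal, i.e. \<open>g = \<Sum>\<^sub>i \<theta>\<^sub>i \<otimes> \<theta>\<^sub>i\<close> for each of them.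
  It exists because the stabiliser of the model form in \<open>GL(8)\<close> lies in \<open>SO(8)\<close>, it is unique on
  tangent vectors, and it is automatically smooth, symmetric and positive definite.
\<close>

definition induced_metric ::
  "'a::topological_space chart set \<Rightarrow> 'a form4 \<Rightarrow> 'a metric2 \<Rightarrow> bool" where
  "induced_metric A \<Psi> g \<longleftrightarrow>
     (\<forall>U \<theta>. adapted_coframe A \<Psi> U \<theta> \<longrightarrow>
        (\<forall>q\<in>U. \<forall>v\<in>tangent_space A q. \<forall>w\<in>tangent_space A q.
           g q v w = (\<Sum>i<8. \<theta> i q v * \<theta> i q w)))"

section \<open>Tensor fields and connections\<close>

text \<open>
  Covariant tensor fields are represented by their action on global smooth vector fields.
\<close>

type_synonym 'a ten2 = "'a vfield \<Rightarrow> 'a vfield \<Rightarrow> 'a \<Rightarrow> real"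
type_synonym 'a ten3 = "'a vfield \<Rightarrow> 'a ten2"
type_synonym 'a ten4 = "'a vfield \<Rightarrow> 'a ten3"

definition metric_tensor :: "'a metric2 \<Rightarrow> 'a ten2" where
  "metric_tensor g X Y = (\<lambda>p. g p (X p) (Y p))"

definition form4_tensor :: "'a form4 \<Rightarrow> 'a ten4" where
  "form4_tensor \<Psi> X Y Z V = (\<lambda>p. \<Psi> p (X p) (Y p) (Z p) (V p))"

definition vanishing2 :: "'a::topological_space chart set \<Rightarrow> 'a ten2 \<Rightarrow> bool" where
  "vanishing2 A S \<longleftrightarrow> (\<forall>X\<in>vfields A. \<forall>Y\<in>vfields A. \<forall>p. S X Y p = 0)"

definition vanishing3 :: "'a::topological_space chart set \<Rightarrow> 'a ten3 \<Rightarrow> bool" where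
  "vanishing3 A S \<longleftrightarrow> (\<forall>X\<in>vfields A. vanishing2 A (S X))"

definition vanishing4 :: "'a::topological_space chart set \<Rightarrow> 'a ten4 \<Rightarrow> bool" where
  "vanishing4 A S \<longleftrightarrow> (\<forall>X\<in>vfields A. vanishing3 A (S X))"

type_synonym 'a connection = "'a vfield \<Rightarrow> 'a vfield \<Rightarrow> 'a vfield"

definition linear_connection :: "'a::topological_space chart set \<Rightarrow> 'a connection \<Rightarrow> bool" where
  "linear_connection A D \<longleftrightarrow>
     (\<forall>X\<in>vfields A. \<forall>Y\<in>vfields A. D X Y \<in> vfields A) \<and>
     (\<forall>X\<in>vfields A. \<forall>Y\<in>vfields A. \<forall>Z\<in>vfields A.
        D (vf_add X Y) Z = vf_add (D X Z) (D Y Z) \<and>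
        D X (vf_add Y Z) = vf_add (D X Y) (D X Z)) \<and>
     (\<forall>u\<in>smooth_funs A. \<forall>X\<in>vfields A. \<forall>Y\<in>vfields A.
        D (vf_scale u X) Y = vf_scale u (D X Y) \<and>
        D X (vf_scale u Y) = vf_add (vf_scale (\<lambda>p. X p u) Y) (vf_scale u (D X Y)))"

text \<open>\<open>cov_deriv D X S\<close> is the covariant derivative of \<open>S\<close> in the direction \<open>X\<close>.\<close>

definition cov_deriv2 :: "'a connection \<Rightarrow> 'a vfield \<Rightarrow> 'a ten2 \<Rightarrow> 'a ten2" where
  "cov_deriv2 D X S Y Z = (\<lambda>p. X p (S Y Z) - S (D X Y) Z p - S Y (D X Z) p)"

definition cov_deriv3 :: "'a connection \<Rightarrow> 'a vfield \<Rightarrow> 'a ten3 \<Rightarrow> 'a ten3" where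
  "cov_deriv3 D X S Y Z V =
     (\<lambda>p. X p (S Y Z V) - S (D X Y) Z V p - S Y (D X Z) V p - S Y Z (D X V) p)"

definition cov_deriv4 :: "'a connection \<Rightarrow> 'a vfield \<Rightarrow> 'a ten4 \<Rightarrow> 'a ten4" where
  "cov_deriv4 D X S Y Z V W =
     (\<lambda>p. X p (S Y Z V W) - S (D X Y) Z V W p - S Y (D X Z) V W p
          - S Y Z (D X V) W p - S Y Z V (D X W) p)"

definition parallel2 :: "'a::topological_space chart set \<Rightarrow> 'a connection \<Rightarrow> 'a ten2 \<Rightarrow> bool" where
  "parallel2 A D S \<longleftrightarrow> (\<forall>X\<in>vfields A. vanishing2 A (cov_deriv2 D X S))"

definition parallel3 :: "'a::topological_space chart set \<Rightarrow> 'a connection \<Rightarrow> 'a ten3 \<Rightarrow> bool" where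
  "parallel3 A D S \<longleftrightarrow> (\<forall>X\<in>vfields A. vanishing3 A (cov_deriv3 D X S))"

definition parallel4 :: "'a::topological_space chart set \<Rightarrow> 'a connection \<Rightarrow> 'a ten4 \<Rightarrow> bool" where
  "parallel4 A D S \<longleftrightarrow> (\<forall>X\<in>vfields A. vanishing4 A (cov_deriv4 D X S))"

definition torsion :: "'a metric2 \<Rightarrow> 'a connection \<Rightarrow> 'a ten3" where
  "torsion g D X Y Z = metric_tensor g (vf_diff (vf_diff (D X Y) (D Y X)) (lie_bracket X Y)) Z"

definition totally_skew3 :: "'a::topological_space chart set \<Rightarrow> 'a ten3 \<Rightarrow> bool" where
  "totally_skew3 A S \<longleftrightarrow>
     (\<forall>X\<in>vfields A. \<forall>Y\<in>vfields A. \<forall>Z\<in>vfields A. \<forall>p.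
        S Y X Z p = - S X Y Z p \<and> S X Z Y p = - S X Y Z p)"

definition torsion_connection ::
  "'a::topological_space chart set \<Rightarrow> 'a form4 \<Rightarrow> 'a metric2 \<Rightarrow> 'a connection \<Rightarrow> bool" where
  "torsion_connection A \<Psi> g D \<longleftrightarrow>
     linear_connection A D \<and>
     parallel2 A D (metric_tensor g) \<and>
     parallel4 A D (form4_tensor \<Psi>) \<and>
     totally_skew3 A (torsion g D)"

definition curvature :: "'a connection \<Rightarrow> 'a vfield \<Rightarrow> 'a vfield \<Rightarrow> 'a vfield \<Rightarrow> 'a vfield" where
  "curvature D X Y Z =
     vf_diff (vf_diff (D X (D Y Z)) (D Y (D X Z))) (D (lie_bracket X Y) Z)"

definition curvature4 :: "'a metric2 \<Rightarrow> 'a connection \<Rightarrow> 'a ten4" where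
  "curvature4 g D X Y Z V = metric_tensor g (curvature D X Y Z) V"

text \<open>
  Expressions in an orthonormal frame are evaluated at each point \<open>p\<close> with smooth vector fields that
  are orthonormal at \<open>p\<close>. The expressions are tensorial, so only the values of these fields at \<open>p\<close>
  matter, and the traces below do not depend on the chosen frame.
\<close>

definition orthonormal_at ::
  "'a::topological_space chart set \<Rightarrow> 'a metric2 \<Rightarrow> 'a \<Rightarrow> (nat \<Rightarrow> 'a vfield) \<Rightarrow> bool" where
  "orthonormal_at A g p E \<longleftrightarrow>
     (\<forall>a<8. E a \<in> vfields A) \<and>
     (\<forall>a<8. \<forall>b<8. g p (E a p) (E b p) = (if a = b then 1 else 0))"

definition frame_at ::
  "'a::topological_space chart set \<Rightarrow> 'a metric2 \<Rightarrow> 'a \<Rightarrow> nat \<Rightarrow> 'a vfield" where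
  "frame_at A g p = (SOME E. orthonormal_at A g p E)"

definition ricci :: "'a::topological_space chart set \<Rightarrow> 'a metric2 \<Rightarrow> 'a connection \<Rightarrow> 'a ten2" where
  "ricci A g D X Y =
     (\<lambda>p. \<Sum>a<8. curvature4 g D (frame_at A g p a) X Y (frame_at A g p a) p)"

definition spin7_instanton ::
  "'a::topological_space chart set \<Rightarrow> 'a form4 \<Rightarrow> 'a metric2 \<Rightarrow> 'a connection \<Rightarrow> bool" where
  "spin7_instanton A \<Psi> g D \<longleftrightarrow>
     (\<forall>p E. orthonormal_at A g p E \<longrightarrow>
        (\<forall>i<8. \<forall>j<8. \<forall>k<8. \<forall>l<8.
           (\<Sum>a<8. \<Sum>b<8. curvature4 g D (E a) (E b) (E i) (E j) p *
                            form4_tensor \<Psi> (E a) (E b) (E k) (E l) p)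
           = 2 * curvature4 g D (E k) (E l) (E i) (E j) p))"

definition d_nabla :: "'a connection \<Rightarrow> 'a ten3 \<Rightarrow> 'a ten4" where
  "d_nabla D T X Y Z V =
     (\<lambda>p. cov_deriv3 D X T Y Z V p + cov_deriv3 D Y T Z X V p
          + cov_deriv3 D Z T X Y V p - cov_deriv3 D V T X Y Z p)"

definition ext_deriv3 :: "'a ten3 \<Rightarrow> 'a ten4" where
  "ext_deriv3 S X Y Z V =
     (\<lambda>p. X p (S Y Z V) - Y p (S X Z V) + Z p (S X Y V) - V p (S X Y Z)
          - S (lie_bracket X Y) Z V p + S (lie_bracket X Z) Y V p - S (lie_bracket X V) Y Z p
          - S (lie_bracket Y Z) X V p + S (lie_bracket Y V) X Z p - S (lie_bracket Z V) X Y p)"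

definition wedge22 :: "'a ten2 \<Rightarrow> 'a ten2 \<Rightarrow> 'a ten4" where
  "wedge22 \<alpha> \<beta> X Y Z V =
     (\<lambda>p. \<alpha> X Y p * \<beta> Z V p - \<alpha> X Z p * \<beta> Y V p + \<alpha> X V p * \<beta> Y Z p
          + \<alpha> Y Z p * \<beta> X V p - \<alpha> Y V p * \<beta> X Z p + \<alpha> Z V p * \<beta> X Y p)"

definition sigma_form :: "'a::topological_space chart set \<Rightarrow> 'a metric2 \<Rightarrow> 'a ten3 \<Rightarrow> 'a ten4" where
  "sigma_form A g T X Y Z V =
     (\<lambda>p. 1/2 * (\<Sum>j<8. wedge22 (T (frame_at A g p j)) (T (frame_at A g p j)) X Y Z V p))"

end

theory Submission
  imports Defs
begin

text \<open>
  Write \<open>N = \<nabla>T\<close>. If \<open>N = 0\<close>, the first Bianchi identity gives \<open>R\<^sub>i\<^sub>j\<^sub>k\<^sub>l = R\<^sub>k\<^sub>l\<^sub>i\<^sub>j\<close>, and since \<open>\<nabla>\<Psi> = 0\<close>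
  puts the last two indices of \<open>R\<close> in \<open>spin(7)\<close>, \<open>R\<close> is an instanton; moreover \<open>6 Ric\<^sub>l\<^sub>m = - \<sigma>\<^sub>i\<^sub>j\<^sub>k\<^sub>l \<Psi>\<^sub>i\<^sub>j\<^sub>k\<^sub>m\<close>
  and \<open>dT = 2 \<sigma>\<close> are built from parallel tensors.

  Conversely, let \<open>R\<close> be an instanton with \<open>d\<^sup>\<nabla>T = 0\<close>. Contracting the first Bianchi identity with \<open>\<Psi>\<close> yields
  \<open>N\<^sub>l\<^sub>i\<^sub>j\<^sub>k \<Psi>\<^sub>i\<^sub>j\<^sub>k\<^sub>m = 3 N\<^sub>a\<^sub>a\<^sub>l\<^sub>m\<close>. Together with the derivatives of the algebraic identities, the second Bianchi
  identity contracted with \<open>\<Psi>\<close>, and the Ricci identity for \<open>T\<close>, this gives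
  \<open>T\<^sub>j\<^sub>k\<^sub>l \<nabla>\<^sub>i\<nabla>\<^sub>i T\<^sub>j\<^sub>k\<^sub>l = - t\<^sub>s N\<^sub>s\<^sub>a\<^sub>b\<^sub>c T\<^sub>a\<^sub>b\<^sub>c / 6\<close> with \<open>t\<^sub>s = T\<^sub>a\<^sub>b\<^sub>c \<Psi>\<^sub>a\<^sub>b\<^sub>c\<^sub>s\<close>, i.e. \<open>\<Delta>\<bar>T\<bar>\<^sup>2 + t(\<bar>T\<bar>\<^sup>2)/6 = 2\<bar>N\<bar>\<^sup>2 \<ge> 0\<close>.
  By Hopf's strong maximum principle \<open>\<bar>T\<bar>\<^sup>2\<close> is locally constant on a compact manifold, so \<open>N = 0\<close>.
\<close>

section \<open>Calculus of \<open>C\<^sup>k\<close> functions\<close>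

text \<open>Two obstacles shape the proof. Computing the rough Laplacian of T produces contractions
  of R with two factors T, and these have no evident sign. They enter two independent relations in
  the same combination: one comes from differentiating the failure of pair symmetry and using the
  second Bianchi identity, the other from commuting two derivatives of T. The derivative of
  d^\<nabla> T = 0 closes the linear system; the coefficient -1/6 is its solution and contains no
  curvature. The remaining first-order term along t would survive integration over M as a multiple
  of div t. The maximum principle is insensitive to such a drift, hence the route through Hopf's
  lemma. Several pointwise identities are also needed in differentiated form. They are therefore
  proved as equalities of tensor fields: tensors of any rank are functions of lists of vector
  fields, with products, traces and \<nabla> satisfying the usual rules. Components are taken at one
  point only, in an adapted frame.\<close>

lemma Ck_on_cong:
  assumes "open S" "\<And>x. x \<in> S \<Longrightarrow> f x = g x"
  shows "Ck_on k S f \<longleftrightarrow> Ck_on k S g"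
  using assms(2)
proof (induction k arbitrary: f g)
  case 0
  then show ?case by (simp cong: continuous_on_cong)
next
  case (Suc k)
  have ev: "\<forall>\<^sub>F y in at x. f y = g y" if "x \<in> S" for x
    using assms(1) that Suc.prems by (auto simp: eventually_at_topological)
  have d: "(f has_derivative f') (at x) \<longleftrightarrow> (g has_derivative f') (at x)" if "x \<in> S" for x f'
    using that Suc.prems has_derivative_transform_within_open[OF _ assms(1) that, of f f' UNIV g]
      has_derivative_transform_within_open[OF _ assms(1) that, of g f' UNIV f] by auto
  have fr: "frechet_derivative f (at x) = frechet_derivative g (at x)" if "x \<in> S" for x
    using d[OF that] by (simp add: frechet_derivative_def)
  have "f differentiable_on S \<longleftrightarrow> g differentiable_on S"
    using Suc.prems by (auto simp: differentiable_on_def at_within_open[OF _ assms(1)] differentiable_def d)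
  moreover have "Ck_on k S (\<lambda>x. frechet_derivative f (at x) b) \<longleftrightarrow> Ck_on k S (\<lambda>x. frechet_derivative g (at x) b)" for b
    by (rule Suc.IH) (simp add: fr)
  ultimately show ?case by simp
qed

lemma Ck_on_subset: "Ck_on k S f \<Longrightarrow> T \<subseteq> S \<Longrightarrow> Ck_on k T f"
  by (induction k arbitrary: f) (auto intro: continuous_on_subset differentiable_on_subset)

lemma Ck_on_local:
  assumes "\<And>x. x \<in> S \<Longrightarrow> \<exists>N. open N \<and> x \<in> N \<and> Ck_on k N f"
  shows "Ck_on k S f"
  using assms
proof (induction k arbitrary: f)
  case 0
  show ?case unfolding Ck_on.simps continuous_on_eq_continuous_within
  proof
    fix x assume "x \<in> S"
    with 0 obtain N where "open N" "x \<in> N" "continuous_on N f" by auto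
    then show "continuous (at x within S) f"
      using continuous_at_imp_continuous_within continuous_on_eq_continuous_at by blast
  qed
next
  case (Suc k)
  have "f differentiable_on S" unfolding differentiable_on_def
  proof
    fix x assume "x \<in> S"
    with Suc.prems obtain N where "open N" "x \<in> N" "f differentiable_on N" by auto
    then show "f differentiable at x within S"
      by (metis at_within_open differentiable_at_withinI differentiable_on_def)
  qed
  moreover have "Ck_on k S (\<lambda>x. frechet_derivative f (at x) b)" if "b \<in> Basis" for b
  proof (rule Suc.IH)
    fix x assume "x \<in> S"
    with Suc.prems obtain N where "open N" "x \<in> N" "Ck_on (Suc k) N f" by blast
    then show "\<exists>N. open N \<and> x \<in> N \<and> Ck_on k N (\<lambda>x. frechet_derivative f (at x) b)"
      using that by auto
  qed
  ultimately show ?case by simp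
qed

lemma Ck_on_SucD: "Ck_on (Suc k) S f \<Longrightarrow> Ck_on k S f"
proof (induction k arbitrary: f)
  case 0 then show ?case by (simp add: differentiable_imp_continuous_on)
next
  case (Suc k)
  then show ?case by (metis Ck_on.simps(2))
qed

lemma Ck_on_le: "Ck_on k S f \<Longrightarrow> j \<le> k \<Longrightarrow> Ck_on j S f"
  by (induction k) (auto simp: le_Suc_eq simp del: Ck_on.simps dest: Ck_on_SucD)

text \<open>\<open>Ck_on\<close> is phrased with the chosen \<open>frechet_derivative\<close>; by
  uniqueness of derivatives on an open set any explicit derivative may replace it. Most closure
  properties below are inductions through this rule.\<close>

lemma Ck_on_SucI:
  assumes "open S" "\<And>x. x \<in> S \<Longrightarrow> (f has_derivative f' x) (at x)"
    "\<And>b. b \<in> Basis \<Longrightarrow> Ck_on k S (\<lambda>x. f' x b)"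
  shows "Ck_on (Suc k) S f"
proof -
  have fr: "frechet_derivative f (at x) = f' x" if "x \<in> S" for x
    using assms(2)[OF that] by (rule frechet_derivative_at[symmetric])
  have "f differentiable_on S"
    using assms(1,2) by (meson differentiableI differentiable_at_withinI differentiable_on_def)
  moreover have "Ck_on k S (\<lambda>x. frechet_derivative f (at x) b)" if "b \<in> Basis" for b
    using assms(3)[OF that] Ck_on_cong[OF assms(1), of "\<lambda>x. frechet_derivative f (at x) b" "\<lambda>x. f' x b"] fr
    by simp
  ultimately show ?thesis by simp
qed

lemma Ck_on_SucE:
  assumes "open S" "Ck_on (Suc k) S f" "x \<in> S"
  shows "(f has_derivative frechet_derivative f (at x)) (at x)"
  using assms frechet_derivative_works at_within_open[OF assms(3,1)] unfolding Ck_on.simps differentiable_on_def by metis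

lemma Ck_on_const: "open S \<Longrightarrow> Ck_on k S (\<lambda>x. c)"
proof (induction k arbitrary: c)
  case (Suc k)
  show ?case by (rule Ck_on_SucI[OF Suc.prems, where f'="\<lambda>x y. 0"]) (use Suc in auto)
qed simp

lemma Ck_on_bounded_linear:
  assumes "bounded_linear h" "open S" "Ck_on k S f"
  shows "Ck_on k S (\<lambda>x. h (f x))"
  using assms(3)
proof (induction k arbitrary: f)
  case 0
  then show ?case using assms(1) by (simp add: bounded_linear.continuous_on)
next
  case (Suc k)
  show ?case
  proof (rule Ck_on_SucI[OF assms(2)])
    fix x assume "x \<in> S"
    show "((\<lambda>x. h (f x)) has_derivative (\<lambda>y. h (frechet_derivative f (at x) y))) (at x)"
      using Ck_on_SucE[OF assms(2) Suc.prems \<open>x \<in> S\<close>] assms(1) by (rule bounded_linear.has_derivative[rotated])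
  qed (use Suc in auto)
qed

lemma Ck_on_id: "open S \<Longrightarrow> Ck_on k S (\<lambda>x. x)"
proof (cases k)
  case (Suc j)
  assume "open S"
  then show ?thesis unfolding Suc
    by (intro Ck_on_SucI[where f'="\<lambda>x y. y"] Ck_on_const) auto
qed simp

lemma Ck_on_add:
  assumes "open S" "Ck_on k S f" "Ck_on k S g"
  shows "Ck_on k S (\<lambda>x. f x + g x)"
  using assms(2,3)
proof (induction k arbitrary: f g)
  case 0
  then show ?case by (simp add: continuous_on_add)
next
  case (Suc k)
  show ?case
  proof (rule Ck_on_SucI[OF assms(1)])
    fix x assume "x \<in> S"
    show "((\<lambda>x. f x + g x) has_derivative (\<lambda>y. frechet_derivative f (at x) y + frechet_derivative g (at x) y)) (at x)"
      using Ck_on_SucE[OF assms(1) _ \<open>x \<in> S\<close>] Suc.prems by (intro has_derivative_add) blast+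
  qed (use Suc in auto)
qed

lemma Ck_on_sum:
  assumes "open S" "\<And>i. i \<in> I \<Longrightarrow> Ck_on k S (f i)"
  shows "Ck_on k S (\<lambda>x. \<Sum>i\<in>I. f i x)"
  using assms(2)
  by (induction I rule: infinite_finite_induct) (auto intro!: Ck_on_const Ck_on_add assms(1))

lemma Ck_on_mult:
  fixes f g :: "'e::euclidean_space \<Rightarrow> real"
  assumes "open S" "Ck_on k S f" "Ck_on k S g"
  shows "Ck_on k S (\<lambda>x. f x * g x)"
  using assms(2,3)
proof (induction k arbitrary: f g)
  case 0
  then show ?case by (simp add: continuous_on_mult)
next
  case (Suc k)
  show ?case
  proof (rule Ck_on_SucI[OF assms(1)])
    fix x assume "x \<in> S"
    show "((\<lambda>x. f x * g x) has_derivative (\<lambda>y. f x * frechet_derivative g (at x) y + frechet_derivative f (at x) y * g x)) (at x)"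
      using Ck_on_SucE[OF assms(1) _ \<open>x \<in> S\<close>] Suc.prems by (intro has_derivative_mult) blast+
  next
    fix b :: 'e assume b: "b \<in> Basis"
    have "Ck_on k S f" "Ck_on k S g" by (rule Ck_on_SucD, rule Suc.prems)+
    then show "Ck_on k S (\<lambda>x. f x * frechet_derivative g (at x) b + frechet_derivative f (at x) b * g x)"
      using Suc.prems b by (intro Ck_on_add assms(1) Suc.IH) auto
  qed
qed

text \<open>Only f varies in the induction. By the chain rule the derivative is a sum of products: a
  partial derivative of f, again composed with h, times a component of the derivative of h.\<close>

lemma Ck_on_compose:
  fixes f :: "'e::euclidean_space \<Rightarrow> real" and h :: "'d::euclidean_space \<Rightarrow> 'e"
  assumes "open S" "open T" "Ck_on k T f" "Ck_on k S h" "h ` S \<subseteq> T"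
  shows "Ck_on k S (\<lambda>x. f (h x))"
  using assms(3,4)
proof (induction k arbitrary: f)
  case 0
  then show ?case using assms(5) by (auto intro: continuous_on_compose2)
next
  case (Suc k)
  have hk: "Ck_on k S h" by (rule Ck_on_SucD[OF Suc.prems(2)])
  let ?f' = "\<lambda>x. frechet_derivative f (at x)" and ?h' = "\<lambda>x. frechet_derivative h (at x)"
  show ?case
  proof (rule Ck_on_SucI[OF assms(1), where f'="\<lambda>x y. \<Sum>c\<in>Basis. ?f' (h x) c * (?h' x y \<bullet> c)"])
    fix x assume x: "x \<in> S"
    have f: "(f has_derivative ?f' (h x)) (at (h x))"
      using Ck_on_SucE[OF assms(2) Suc.prems(1)] x assms(5) by blast
    have "((\<lambda>x. f (h x)) has_derivative (\<lambda>y. ?f' (h x) (?h' x y))) (at x)"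
      using Ck_on_SucE[OF assms(1) Suc.prems(2) x] f by (rule has_derivative_compose)
    moreover have "(\<lambda>y. ?f' (h x) (?h' x y)) = (\<lambda>y. \<Sum>c\<in>Basis. ?f' (h x) c * (?h' x y \<bullet> c))"
    proof
      fix y
      have "linear (?f' (h x))" using f has_derivative_linear by blast
      then have "?f' (h x) (\<Sum>c\<in>Basis. (?h' x y \<bullet> c) *\<^sub>R c) = (\<Sum>c\<in>Basis. (?h' x y \<bullet> c) *\<^sub>R ?f' (h x) c)"
        by (simp add: linear_sum linear_cmul)
      then show "?f' (h x) (?h' x y) = (\<Sum>c\<in>Basis. ?f' (h x) c * (?h' x y \<bullet> c))"
        by (simp add: euclidean_representation mult.commute)
    qed
    ultimately show "((\<lambda>x. f (h x)) has_derivative (\<lambda>y. \<Sum>c\<in>Basis. ?f' (h x) c * (?h' x y \<bullet> c))) (at x)"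
      by (rule arg_cong[THEN iffD1, rotated])
  next
    fix b :: 'd assume b: "b \<in> Basis"
    show "Ck_on k S (\<lambda>x. \<Sum>c\<in>Basis. ?f' (h x) c * (?h' x b \<bullet> c))"
    proof (rule Ck_on_sum[OF assms(1)], rule Ck_on_mult[OF assms(1)])
      fix c :: 'e assume c: "c \<in> Basis"
      show "Ck_on k S (\<lambda>x. ?f' (h x) c)"
        by (rule Suc.IH[OF _ hk]) (use Suc.prems c in simp)
      show "Ck_on k S (\<lambda>x. ?h' x b \<bullet> c)"
        by (rule Ck_on_bounded_linear[OF bounded_linear_inner_left assms(1)]) (use Suc.prems b in simp)
    qed
  qed
qed

text \<open>The derivative -f' (1/f)^2 contains 1/f again, one order lower, so the induction
  hypothesis covers both of its occurrences.\<close>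

lemma Ck_on_inverse:
  fixes f :: "'e::euclidean_space \<Rightarrow> real"
  assumes "open S" "Ck_on k S f" "\<And>x. x \<in> S \<Longrightarrow> f x \<noteq> 0"
  shows "Ck_on k S (\<lambda>x. 1 / f x)"
  using assms(2)
proof (induction k)
  case 0
  then show ?case using assms(3) by (auto intro!: continuous_intros)
next
  case (Suc k)
  have i: "Ck_on k S (\<lambda>x. 1 / f x)" by (rule Suc.IH[OF Ck_on_SucD[OF Suc.prems]])
  show ?case
  proof (rule Ck_on_SucI[OF assms(1), where f'="\<lambda>x y. (-1) * frechet_derivative f (at x) y * ((1 / f x) * (1 / f x))"])
    fix x assume x: "x \<in> S"
    have "((\<lambda>x. inverse (f x)) has_derivative (\<lambda>h. - (inverse (f x) * frechet_derivative f (at x) h * inverse (f x)))) (at x)"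
      by (rule Deriv.has_derivative_inverse[OF assms(3)[OF x] Ck_on_SucE[OF assms(1) Suc.prems x]])
    then show "((\<lambda>x. 1 / f x) has_derivative (\<lambda>y. (-1) * frechet_derivative f (at x) y * ((1 / f x) * (1 / f x)))) (at x)"
      by (simp add: field_simps)
  qed (use Suc.prems in \<open>intro Ck_on_mult Ck_on_const assms(1) i; simp\<close>)
qed

section \<open>A function flat at the origin, and Euclidean bump functions\<close>

text \<open>The factor \<open>(1 / t) ^ n\<close> makes the family closed under differentiation.\<close>

definition flat :: "nat \<Rightarrow> real \<Rightarrow> real" where
  "flat n t = (if t > 0 then (1 / t) ^ n * exp (- (1 / t)) else 0)"

text \<open>With s = 1 / t the limit from the right is that of s ^ n / exp s at infinity.\<close>

lemma flat_tendsto_0: "(flat n \<longlongrightarrow> 0) (at 0)"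
proof -
  have "((\<lambda>t::real. (inverse t) ^ n / exp (inverse t)) \<longlongrightarrow> 0) (at_right 0)"
    using filterlim_compose[OF tendsto_power_div_exp_0 filterlim_inverse_at_top_right] .
  moreover have "\<forall>\<^sub>F t in at_right 0. (inverse t) ^ n / exp (inverse t) = flat n t"
    by (auto simp: eventually_at_right_less flat_def divide_inverse exp_minus eventually_at_topological)
  ultimately have r: "(flat n \<longlongrightarrow> 0) (at_right 0)" by (rule Lim_transform_eventually)
  have "(flat n \<longlongrightarrow> 0) (at_left 0)"
    by (rule Lim_transform_eventually[OF tendsto_const])
      (auto simp: flat_def eventually_at_left_field intro!: exI[of _ "-1"])
  with r show ?thesis by (simp add: filterlim_at_split)
qed

text \<open>The delicate point is the origin: there the difference quotient of \<open>flat n\<close>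
  is \<open>flat (n + 1)\<close>, which tends to 0.\<close>

lemma flat_DERIV: "(flat n has_real_derivative (flat (n + 2) t - real n * flat (n + 1) t)) (at t)"
proof -
  consider "t < 0" | "t > 0" | "t = 0" by linarith
  then show ?thesis
  proof cases
    case 1
    have "((\<lambda>t. 0) has_real_derivative 0) (at t)" by simp
    then have "(flat n has_real_derivative 0) (at t)"
      by (rule DERIV_cong_ev[THEN iffD1, rotated -1, of _ _ t])
        (use 1 in \<open>auto simp: flat_def eventually_nhds intro!: exI[of _ "{..<0}"]\<close>)
    then show ?thesis using 1 by (simp add: flat_def)
  next
    case 2
    have "((\<lambda>t. (1 / t) ^ n * exp (- (1 / t))) has_real_derivative (flat (n + 2) t - real n * flat (n + 1) t)) (at t)"
    proof (cases n)
      case 0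
      then show ?thesis using 2
        by (auto intro!: derivative_eq_intros simp: flat_def field_simps power2_eq_square)
    next
      case (Suc m)
      have "((\<lambda>t. (1 / t) ^ Suc m) has_real_derivative real (Suc m) * (1 / t) ^ m * (- 1 / t\<^sup>2)) (at t)"
        by (rule DERIV_power[THEN DERIV_cong]) (use 2 in \<open>auto intro!: derivative_eq_intros simp: power2_eq_square field_simps\<close>)
      moreover have "((\<lambda>t. exp (- (1 / t))) has_real_derivative exp (- (1 / t)) * (1 / t\<^sup>2)) (at t)"
        using 2 by (auto intro!: derivative_eq_intros simp: power2_eq_square field_simps)
      ultimately show ?thesis unfolding Suc
        by (rule DERIV_mult[THEN DERIV_cong]) (use 2 in \<open>simp add: flat_def field_simps power2_eq_square\<close>)
    qed
    then show ?thesis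
      by (rule DERIV_cong_ev[THEN iffD1, rotated -1, of _ _ t])
        (use 2 in \<open>auto simp: flat_def eventually_nhds intro!: exI[of _ "{0<..}"]\<close>)
  next
    case 3
    have "(\<lambda>h. (flat n (0 + h) - flat n 0) / h) = flat (n + 1)"
      by (auto simp: flat_def fun_eq_iff field_simps)
    then have "(flat n has_real_derivative 0) (at 0)"
      using flat_tendsto_0[of "n + 1"] by (simp add: DERIV_def)
    then show ?thesis using 3 by (simp add: flat_def)
  qed
qed

lemma Ck_on_flat: "Ck_on k UNIV (flat n)"
proof (induction k arbitrary: n)
  case 0
  show ?case using DERIV_isCont[OF flat_DERIV] by (simp add: continuous_on_eq_continuous_at)
next
  case (Suc k)
  show ?case
  proof (rule Ck_on_SucI[where f'="\<lambda>t y. (flat (n + 2) t + (- real n) * flat (n + 1) t) * y"])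
    fix t :: real
    show "(flat n has_derivative (\<lambda>y. (flat (n + 2) t + (- real n) * flat (n + 1) t) * y)) (at t)"
      using flat_DERIV[of n t] by (simp add: has_field_derivative_def)
  qed (intro open_UNIV Ck_on_add Ck_on_mult Suc.IH Ck_on_const)+
qed

text \<open>The usual quotient: with s the squared distance to a in units of r, it is 1 for s \<le>
  1 and 0 for s \<ge> 2. The two flat functions in the denominator never vanish together.\<close>

definition euclid_bump :: "'e::euclidean_space \<Rightarrow> real \<Rightarrow> 'e \<Rightarrow> real" where
  "euclid_bump a r x = (let s = (x - a) \<bullet> (x - a) / r\<^sup>2 in flat 0 (2 - s) / (flat 0 (2 - s) + flat 0 (s - 1)))"

lemma flat_pos: "t > 0 \<Longrightarrow> flat n t > 0" and flat_nonneg: "flat n t \<ge> 0" and flat_zero: "t \<le> 0 \<Longrightarrow> flat n t = 0"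
  by (auto simp: flat_def)

lemma euclid_bump_eq_1:
  assumes "r > 0" "dist x a \<le> r"
  shows "euclid_bump a r x = 1"
proof -
  have "(x - a) \<bullet> (x - a) \<le> r\<^sup>2"
    using assms by (metis dist_norm norm_ge_zero power2_norm_eq_inner power_mono)
  then have "(x - a) \<bullet> (x - a) / r\<^sup>2 \<le> 1" using assms(1) by simp
  then show ?thesis using flat_pos[of "2 - (x - a) \<bullet> (x - a) / r\<^sup>2" 0] by (simp add: euclid_bump_def Let_def flat_zero)
qed

lemma euclid_bump_eq_0:
  assumes "r > 0" "dist x a \<ge> 2 * r"
  shows "euclid_bump a r x = 0"
proof -
  have "(x - a) \<bullet> (x - a) \<ge> (2 * r)\<^sup>2"
    using assms by (metis dist_norm less_eq_real_def mult_pos_pos power2_norm_eq_inner power_mono zero_less_numeral)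
  then have "(x - a) \<bullet> (x - a) / r\<^sup>2 \<ge> 4" using assms(1) by (simp add: field_simps power2_eq_square)
  then show ?thesis by (simp add: euclid_bump_def Let_def flat_zero)
qed

lemma Ck_on_inner_self: "open S \<Longrightarrow> Ck_on k S (\<lambda>x::'e::euclidean_space. (x - a) \<bullet> (x - a))"
proof -
  assume "open S"
  have "Ck_on k S (\<lambda>x. \<Sum>b\<in>Basis. ((x + (-a)) \<bullet> b) * ((x + (-a)) \<bullet> b))"
    by (intro Ck_on_sum Ck_on_mult Ck_on_bounded_linear[OF bounded_linear_inner_left] Ck_on_add Ck_on_const Ck_on_id \<open>open S\<close>)
  moreover have "(\<lambda>x. (x - a) \<bullet> (x - a)) = (\<lambda>x. \<Sum>b\<in>Basis. ((x + (-a)) \<bullet> b) * ((x + (-a)) \<bullet> b))"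
    by (rule ext, subst euclidean_inner) simp
  ultimately show ?thesis by simp
qed

lemma smooth_on_euclid_bump:
  assumes "open S"
  shows "smooth_on S (euclid_bump a r)"
  unfolding smooth_on_def
proof
  fix k
  let ?s = "\<lambda>x. (x - a) \<bullet> (x - a) * (1 / r\<^sup>2)"
  have s: "Ck_on k S ?s" by (rule Ck_on_mult[OF assms Ck_on_inner_self[OF assms] Ck_on_const[OF assms]])
  have f1: "Ck_on k S (\<lambda>x. flat 0 (2 + (-1) * ?s x))"
    by (rule Ck_on_compose[OF assms open_UNIV Ck_on_flat
          Ck_on_add[OF assms Ck_on_const[OF assms] Ck_on_mult[OF assms Ck_on_const[OF assms] s]] subset_UNIV])
  have f2: "Ck_on k S (\<lambda>x. flat 0 (?s x + (-1)))"
    by (rule Ck_on_compose[OF assms open_UNIV Ck_on_flat Ck_on_add[OF assms s Ck_on_const[OF assms]] subset_UNIV])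
  have nz: "flat 0 (2 + (-1) * u) + flat 0 (u + (-1)) \<noteq> 0" for u
  proof (cases "u < 2")
    case True
    then have "flat 0 (2 + (-1) * u) > 0" by (simp add: flat_pos)
    then show ?thesis using flat_nonneg[of 0 "u + (-1)"] by linarith
  next
    case False
    then have "flat 0 (u + (-1)) > 0" by (simp add: flat_pos)
    then show ?thesis using flat_nonneg[of 0 "2 + (-1) * u"] by linarith
  qed
  have "Ck_on k S (\<lambda>x. flat 0 (2 + (-1) * ?s x) * (1 / (flat 0 (2 + (-1) * ?s x) + flat 0 (?s x + (-1)))))"
    by (rule Ck_on_mult[OF assms f1 Ck_on_inverse[OF assms Ck_on_add[OF assms f1 f2] nz]])
  moreover have "euclid_bump a r = (\<lambda>x. flat 0 (2 + (-1) * ?s x) * (1 / (flat 0 (2 + (-1) * ?s x) + flat 0 (?s x + (-1)))))"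
    by (rule ext) (simp add: euclid_bump_def Let_def)
  ultimately show "Ck_on k S (euclid_bump a r)" by simp
qed

section \<open>Radial integrals and Hadamard's lemma\<close>

lemma Ck_on_continuous: "Ck_on k S f \<Longrightarrow> continuous_on S f"
  using Ck_on_le[of k S f 0] by simp

text \<open>Differentiation under the integral sign. The weight t ^ m is generalised because each
  derivative of f (a + t (x - a)) in x contributes one more factor t.\<close>

lemma Ck_on_radial_integral:
  fixes f :: "'e::euclidean_space \<Rightarrow> real"
  assumes S: "S = ball a r" and f: "Ck_on k S f"
  shows "Ck_on k S (\<lambda>x. integral {0..1} (\<lambda>t. t ^ m * f (a + t *\<^sub>R (x - a))))"
  using f
proof (induction k arbitrary: f m)
  case (0 f m)
  have "continuous_on (S \<times> cbox 0 1) (\<lambda>p. f (a + snd p *\<^sub>R (fst p - a)))"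
  proof (rule continuous_on_compose2[of S f])
    show "continuous_on S f" using 0 by simp
    show "(\<lambda>p. a + snd p *\<^sub>R (fst p - a)) ` (S \<times> cbox 0 1) \<subseteq> S"
    proof clarsimp
      fix x and t :: real assume x: "x \<in> S" "0 \<le> t" "t \<le> 1"
      have "norm (t *\<^sub>R (x - a)) \<le> norm (x - a)" using x by (simp add: mult_left_le_one_le)
      then show "a + t *\<^sub>R (x - a) \<in> S" using x unfolding S by (simp add: dist_norm norm_minus_commute)
    qed
  qed (intro continuous_intros)
  then have "continuous_on (S \<times> cbox 0 1) (\<lambda>(x, t::real). t ^ m * f (a + t *\<^sub>R (x - a)))"
    unfolding split_beta by (intro continuous_intros)
  from integral_continuous_on_param[OF this] show ?case by simp
next
  case (Suc k f m)
  have oS: "open S" unfolding S by simp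
  have star: "a + t *\<^sub>R (x - a) \<in> S" if "x \<in> S" "0 \<le> t" "t \<le> 1" for x t
  proof -
    have "norm (t *\<^sub>R (x - a)) \<le> norm (x - a)" using that by (simp add: mult_left_le_one_le)
    then show ?thesis using that unfolding S by (simp add: dist_norm norm_minus_commute)
  qed
  let ?d = "\<lambda>b x. frechet_derivative f (at x) b"
  \<comment> \<open>The Leibniz rule for parametric integrals wants the derivative as a bounded
    linear function, so it is assembled from the coordinate functionals.\<close>
  let ?fx = "\<lambda>x t. \<Sum>b\<in>Basis. (t ^ Suc m * ?d b (a + t *\<^sub>R (x - a))) *\<^sub>R blinfun_inner_right b"
  have cd: "continuous_on S (?d b)" if "b \<in> Basis" for b
    using Suc.prems that Ck_on_continuous by auto
  have comp: "continuous_on (S \<times> cbox 0 1) (\<lambda>p. h (a + snd p *\<^sub>R (fst p - a)))" if "continuous_on S h" for h :: "'e \<Rightarrow> real"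
    by (rule continuous_on_compose2[OF that]) (auto intro!: continuous_intros star)
  have cfx: "continuous_on (S \<times> cbox 0 1) (\<lambda>(x, t). ?fx x t)"
    unfolding split_beta by (intro continuous_intros comp cd)
  have deriv: "((\<lambda>x. t ^ m * f (a + t *\<^sub>R (x - a))) has_derivative blinfun_apply (?fx x t)) (at x within S)"
    if x: "x \<in> S" and t: "t \<in> cbox 0 1" for x t
  proof -
    let ?y = "a + t *\<^sub>R (x - a)"
    have f': "(f has_derivative frechet_derivative f (at ?y)) (at ?y)"
      using Ck_on_SucE[OF oS Suc.prems star] x t by auto
    have "((\<lambda>x. a + t *\<^sub>R (x - a)) has_derivative (\<lambda>h. t *\<^sub>R h)) (at x within S)"
      by (auto intro!: derivative_eq_intros)
    from has_derivative_compose[OF this f']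
    have "((\<lambda>x. t ^ m * f (a + t *\<^sub>R (x - a))) has_derivative
        (\<lambda>h. t ^ m * frechet_derivative f (at ?y) (t *\<^sub>R h))) (at x within S)"
      by (rule has_derivative_mult_right)
    moreover have "(\<lambda>h. t ^ m * frechet_derivative f (at ?y) (t *\<^sub>R h)) = blinfun_apply (?fx x t)"
    proof
      fix h
      have lin: "linear (frechet_derivative f (at ?y))" using f' has_derivative_linear by blast
      have "frechet_derivative f (at ?y) (\<Sum>b\<in>Basis. (h \<bullet> b) *\<^sub>R b) = (\<Sum>b\<in>Basis. (h \<bullet> b) *\<^sub>R ?d b ?y)"
        using lin by (simp add: linear_sum linear_cmul)
      then have "frechet_derivative f (at ?y) h = (\<Sum>b\<in>Basis. (h \<bullet> b) * ?d b ?y)"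
        by (simp add: euclidean_representation)
      then show "t ^ m * frechet_derivative f (at ?y) (t *\<^sub>R h) = blinfun_apply (?fx x t) h"
        using lin by (simp add: linear_cmul blinfun.sum_left blinfun.scaleR_left sum_distrib_left inner_commute mult_ac)
    qed
    ultimately show ?thesis by simp
  qed
  have cont: "continuous_on (cbox 0 1) (\<lambda>t. h (a + t *\<^sub>R (x - a)))" if "continuous_on S h" "x \<in> S" for h :: "'e \<Rightarrow> real" and x
    by (rule continuous_on_compose2[OF that(1)]) (use that(2) in \<open>auto intro!: continuous_intros star\<close>)
  have int: "(\<lambda>t. t ^ m * f (a + t *\<^sub>R (x - a))) integrable_on cbox 0 1" if "x \<in> S" for x
    by (intro integrable_continuous continuous_intros cont Ck_on_continuous[OF Suc.prems] that)
  have der: "((\<lambda>x. integral (cbox 0 1) (\<lambda>t. t ^ m * f (a + t *\<^sub>R (x - a)))) has_derivative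
      blinfun_apply (integral (cbox 0 1) (?fx x))) (at x)" if "x \<in> S" for x
    using leibniz_rule[OF deriv int cfx that] at_within_open[OF that oS] unfolding S by simp
  show ?case
  proof (rule Ck_on_SucI[OF oS])
    show "((\<lambda>x. integral {0..1} (\<lambda>t. t ^ m * f (a + t *\<^sub>R (x - a)))) has_derivative
      blinfun_apply (integral (cbox 0 1) (?fx x))) (at x)" if "x \<in> S" for x
      using der[OF that] by simp
    fix b :: 'e assume b: "b \<in> Basis"
    have eq: "blinfun_apply (integral (cbox 0 1) (?fx x)) b = integral {0..1} (\<lambda>t. t ^ Suc m * ?d b (a + t *\<^sub>R (x - a)))"
      if "x \<in> S" for x
    proof -
      have "?fx x integrable_on cbox 0 1"
        by (intro integrable_continuous continuous_intros cont cd that)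
      then have "blinfun_apply (integral (cbox 0 1) (?fx x)) b = integral (cbox 0 1) (\<lambda>t. blinfun_apply (?fx x t) b)"
        by (rule blinfun_apply_integral)
      also have "(\<lambda>t. blinfun_apply (?fx x t) b) = (\<lambda>t. t ^ Suc m * ?d b (a + t *\<^sub>R (x - a)))"
        using b by (simp add: blinfun.sum_left blinfun.scaleR_left inner_Basis if_distrib sum.delta cong: if_cong)
      finally show ?thesis by simp
    qed
    have "Ck_on k S (\<lambda>x. integral {0..1} (\<lambda>t. t ^ Suc m * ?d b (a + t *\<^sub>R (x - a))))"
      by (rule Suc.IH) (use Suc.prems b in simp)
    then show "Ck_on k S (\<lambda>x. blinfun_apply (integral (cbox 0 1) (?fx x)) b)"
      by (rule Ck_on_cong[OF oS, THEN iffD2, rotated]) (rule eq)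
  qed
qed

text \<open>The fundamental theorem of calculus along the segment from a to x; h b is the mean of
  the partial derivative over that segment. This expansion is what makes every derivation a
  combination of coordinate derivatives.\<close>

lemma Hadamard:
  fixes f :: "'e::euclidean_space \<Rightarrow> real"
  assumes r: "r > 0" and f: "smooth_on (ball a r) f"
  obtains h where "\<And>b. b \<in> Basis \<Longrightarrow> smooth_on (ball a r) (h b)"
    "\<And>b. b \<in> Basis \<Longrightarrow> h b a = frechet_derivative f (at a) b"
    "\<And>x. x \<in> ball a r \<Longrightarrow> f x = f a + (\<Sum>b\<in>Basis. ((x - a) \<bullet> b) * h b x)"
proof -
  let ?S = "ball a r"
  let ?d = "\<lambda>b x. frechet_derivative f (at x) b"
  \<comment> \<open>The factor t ^ 0 places the integral in the weighted family of
    \<open>Ck_on_radial_integral\<close>.\<close>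
  define h where "h b x = integral {0..1} (\<lambda>t. t ^ 0 * ?d b (a + t *\<^sub>R (x - a)))" for b x
  have fC: "Ck_on (Suc k) ?S f" for k using f by (simp add: smooth_on_def del: Ck_on.simps)
  have d: "Ck_on k ?S (?d b)" if "b \<in> Basis" for b k
    using fC[of k] that by simp
  have "smooth_on ?S (h b)" if "b \<in> Basis" for b
    unfolding smooth_on_def h_def[abs_def] using Ck_on_radial_integral[OF refl d[OF that]] by blast
  moreover have "h b a = ?d b a" for b by (simp add: h_def)
  moreover have "f x = f a + (\<Sum>b\<in>Basis. ((x - a) \<bullet> b) * h b x)" if x: "x \<in> ?S" for x
  proof -
    have star: "a + t *\<^sub>R (x - a) \<in> ?S" if "0 \<le> t" "t \<le> 1" for t
    proof -
      have "norm (t *\<^sub>R (x - a)) \<le> norm (x - a)" using that by (simp add: mult_left_le_one_le)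
      then show ?thesis using x by (simp add: dist_norm norm_minus_commute)
    qed
    have cont: "continuous_on {0..1} (\<lambda>t. ?d b (a + t *\<^sub>R (x - a)))" if "b \<in> Basis" for b
      by (rule continuous_on_compose2[OF Ck_on_continuous[OF d[OF that]]]) (auto intro!: continuous_intros star simp del: mem_ball)
    have deriv: "((\<lambda>t. f (a + t *\<^sub>R (x - a))) has_vector_derivative
        (\<Sum>b\<in>Basis. ((x - a) \<bullet> b) * ?d b (a + t *\<^sub>R (x - a)))) (at t within {0..1})" if "t \<in> {0..1}" for t
    proof -
      let ?y = "a + t *\<^sub>R (x - a)"
      have "?y \<in> ?S" using star that by auto
      then have f': "(f has_derivative frechet_derivative f (at ?y)) (at ?y)"
        using Ck_on_SucE[OF open_ball fC] by blast
      have "((\<lambda>t. a + t *\<^sub>R (x - a)) has_derivative (\<lambda>s. s *\<^sub>R (x - a))) (at t within {0..1})"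
        by (auto intro!: derivative_eq_intros)
      from has_derivative_compose[OF this f']
      have "((\<lambda>t. f (a + t *\<^sub>R (x - a))) has_derivative (\<lambda>s. frechet_derivative f (at ?y) (s *\<^sub>R (x - a)))) (at t within {0..1})" .
      moreover have lin: "linear (frechet_derivative f (at ?y))" using f' has_derivative_linear by blast
      moreover have "frechet_derivative f (at ?y) (x - a) = (\<Sum>b\<in>Basis. ((x - a) \<bullet> b) * ?d b ?y)"
      proof -
        have "frechet_derivative f (at ?y) (\<Sum>b\<in>Basis. ((x - a) \<bullet> b) *\<^sub>R b) = (\<Sum>b\<in>Basis. ((x - a) \<bullet> b) *\<^sub>R ?d b ?y)"
          using lin by (simp add: linear_sum linear_cmul)
        then show ?thesis by (simp add: euclidean_representation)
      qed
      ultimately show ?thesis by (simp add: has_vector_derivative_def linear_cmul)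
    qed
    have "((\<lambda>t. \<Sum>b\<in>Basis. ((x - a) \<bullet> b) * ?d b (a + t *\<^sub>R (x - a))) has_integral f (a + 1 *\<^sub>R (x - a)) - f (a + 0 *\<^sub>R (x - a))) {0..1}"
      by (rule fundamental_theorem_of_calculus) (use deriv in auto)
    then have "f x - f a = integral {0..1} (\<lambda>t. \<Sum>b\<in>Basis. ((x - a) \<bullet> b) * ?d b (a + t *\<^sub>R (x - a)))"
      by (simp add: integral_unique)
    also have "\<dots> = (\<Sum>b\<in>Basis. integral {0..1} (\<lambda>t. ((x - a) \<bullet> b) * ?d b (a + t *\<^sub>R (x - a))))"
      by (intro integral_sum integrable_continuous_interval continuous_intros cont) auto
    also have "\<dots> = (\<Sum>b\<in>Basis. ((x - a) \<bullet> b) * h b x)" by (simp add: h_def)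
    finally show ?thesis by simp
  qed
  ultimately show thesis using that by blast
qed

section \<open>Closure properties of smooth maps on open sets\<close>

lemma smooth_on_cong: "open S \<Longrightarrow> (\<And>x. x \<in> S \<Longrightarrow> f x = g x) \<Longrightarrow> smooth_on S f \<longleftrightarrow> smooth_on S g"
  unfolding smooth_on_def by (simp cong: Ck_on_cong)

lemma smooth_on_subset: "smooth_on S f \<Longrightarrow> T \<subseteq> S \<Longrightarrow> smooth_on T f"
  unfolding smooth_on_def by (auto intro: Ck_on_subset)

lemma smooth_on_local:
  assumes "\<And>x. x \<in> S \<Longrightarrow> \<exists>N. open N \<and> x \<in> N \<and> smooth_on N f"
  shows "smooth_on S f"
  unfolding smooth_on_def
proof
  fix k
  show "Ck_on k S f"
    by (rule Ck_on_local) (use assms in \<open>unfold smooth_on_def, blast\<close>)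
qed

lemma smooth_on_const: "open S \<Longrightarrow> smooth_on S (\<lambda>x. c)"
  and smooth_on_id: "open S \<Longrightarrow> smooth_on S (\<lambda>x. x)"
  and smooth_on_add: "open S \<Longrightarrow> smooth_on S f \<Longrightarrow> smooth_on S f' \<Longrightarrow> smooth_on S (\<lambda>x. f x + f' x)"
  and smooth_on_mult: "open S \<Longrightarrow> smooth_on S g \<Longrightarrow> smooth_on S g' \<Longrightarrow> smooth_on S (\<lambda>x. g x * g' x :: real)"
  and smooth_on_inverse: "open S \<Longrightarrow> smooth_on S g \<Longrightarrow> (\<And>x. x \<in> S \<Longrightarrow> g x \<noteq> 0) \<Longrightarrow> smooth_on S (\<lambda>x. 1 / g x :: real)"
  and smooth_on_bounded_linear: "bounded_linear h \<Longrightarrow> open S \<Longrightarrow> smooth_on S f \<Longrightarrow> smooth_on S (\<lambda>x. h (f x))"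
  and smooth_on_compose: "open S \<Longrightarrow> open T \<Longrightarrow> smooth_on T g \<Longrightarrow> smooth_on S k \<Longrightarrow> k ` S \<subseteq> T \<Longrightarrow> smooth_on S (\<lambda>x. g (k x) :: real)"
  unfolding smooth_on_def
  by (simp_all add: Ck_on_const Ck_on_id Ck_on_add Ck_on_mult Ck_on_inverse Ck_on_bounded_linear Ck_on_compose)

lemma smooth_on_frechet_derivative:
  assumes "smooth_on S f" "b \<in> Basis"
  shows "smooth_on S (\<lambda>x. frechet_derivative f (at x) b)"
  unfolding smooth_on_def
proof
  fix k
  have "Ck_on (Suc k) S f" using assms(1) unfolding smooth_on_def by blast
  then show "Ck_on k S (\<lambda>x. frechet_derivative f (at x) b)" using assms(2) by simp
qed

lemma smooth_on_has_derivative: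
  assumes "open S" "smooth_on S f" "x \<in> S"
  shows "(f has_derivative frechet_derivative f (at x)) (at x)"
  using Ck_on_SucE[OF assms(1) _ assms(3)] assms(2) unfolding smooth_on_def by blast

section \<open>Smooth functions and vector fields\<close>

locale manifold =
  fixes A :: "'a::t2_space chart set"
  assumes atlas: "smooth_atlas A"
begin

lemma chart_ex: "\<exists>U \<phi>. (U, \<phi>) \<in> A \<and> p \<in> U"
proof -
  have "p \<in> (\<Union>(U, \<phi>)\<in>A. U)" using atlas unfolding smooth_atlas_def by simp
  then show ?thesis by auto
qed

lemma chartD: "(U, \<phi>) \<in> A \<Longrightarrow> open U \<and> open (\<phi> ` U) \<and> homeomorphism U (\<phi> ` U) \<phi> (inv_into U \<phi>)"
  using atlas unfolding smooth_atlas_def by (elim conjE) (drule(1) bspec, simp)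

context
  fixes U \<phi>
  assumes chart: "(U, \<phi>) \<in> A"
begin

lemma chart_open: "open U" and chart_open_image: "open (\<phi> ` U)"
  and chart_homeo: "homeomorphism U (\<phi> ` U) \<phi> (inv_into U \<phi>)"
  using chartD[OF chart] by simp_all

lemma chart_cont: "continuous_on U \<phi>" and chart_inv_cont: "continuous_on (\<phi> ` U) (inv_into U \<phi>)"
  and chart_inv: "q \<in> U \<Longrightarrow> inv_into U \<phi> (\<phi> q) = q"
  using chart_homeo by (auto simp: homeomorphism_def)

lemma chart_inv_mem: "x \<in> \<phi> ` U \<Longrightarrow> inv_into U \<phi> x \<in> U \<and> \<phi> (inv_into U \<phi> x) = x"
  by (simp add: inv_into_into f_inv_into_f)

lemma chart_open_image_subset:
  assumes "open W" "W \<subseteq> U"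
  shows "open (\<phi> ` W)"
proof -
  have "openin (top_of_set U) W" using assms openin_open_eq[OF chart_open] by blast
  then have "openin (top_of_set (\<phi> ` U)) (\<phi> ` W)" by (rule homeomorphism_imp_open_map[OF chart_homeo])
  then show ?thesis using openin_open_eq[OF chart_open_image] by blast
qed

lemma chart_inv_image: "S \<subseteq> \<phi> ` U \<Longrightarrow> inv_into U \<phi> ` S = {q \<in> U. \<phi> q \<in> S}"
proof (intro equalityI subsetI)
  fix q assume S: "S \<subseteq> \<phi> ` U" and "q \<in> inv_into U \<phi> ` S"
  then obtain x where "x \<in> S" "q = inv_into U \<phi> x" by blast
  then show "q \<in> {q \<in> U. \<phi> q \<in> S}" using chart_inv_mem[of x] S by auto
next
  fix q assume "q \<in> {q \<in> U. \<phi> q \<in> S}"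
  then show "q \<in> inv_into U \<phi> ` S" using chart_inv[of q] by (metis (mono_tags, lifting) imageI mem_Collect_eq)
qed

end

lemma transition_smooth: "(U, \<phi>) \<in> A \<Longrightarrow> (V, \<psi>) \<in> A \<Longrightarrow> smooth_on (\<phi> ` (U \<inter> V)) (\<psi> \<circ> inv_into U \<phi>)"
  using atlas unfolding smooth_atlas_def by (elim conjE) (drule(1) bspec, simp, drule(1) bspec, simp)

lemma smooth_fun_onD: "smooth_fun_on A W f \<Longrightarrow> (U, \<phi>) \<in> A \<Longrightarrow> smooth_on (\<phi> ` (W \<inter> U)) (\<lambda>x. f (inv_into U \<phi> x))"
  unfolding smooth_fun_on_def comp_def by (drule(1) bspec) simp

lemma smooth_fun_onI: "(\<And>U \<phi>. (U, \<phi>) \<in> A \<Longrightarrow> smooth_on (\<phi> ` (W \<inter> U)) (\<lambda>x. f (inv_into U \<phi> x))) \<Longrightarrow> smooth_fun_on A W f"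
  unfolding smooth_fun_on_def comp_def by auto

text \<open>One chart suffices: in any other chart the representative is the given one composed with
  a smooth transition map.\<close>

lemma smooth_fun_on_chartI:
  assumes c: "(U, \<phi>) \<in> A" and W: "open W" "W \<subseteq> U" and f: "smooth_on (\<phi> ` W) (\<lambda>x. f (inv_into U \<phi> x))"
  shows "smooth_fun_on A W f"
proof (rule smooth_fun_onI)
  fix V \<psi> assume d: "(V, \<psi>) \<in> A"
  have o: "open (\<psi> ` (W \<inter> V))" using chart_open_image_subset[OF d] W chart_open[OF d] by auto
  have "smooth_on (\<psi> ` (W \<inter> V)) (\<lambda>x. \<phi> (inv_into V \<psi> x))"
    using smooth_on_subset[OF transition_smooth[OF d c], of "\<psi> ` (W \<inter> V)"] W unfolding comp_def by blast
  moreover have "(\<lambda>x. \<phi> (inv_into V \<psi> x)) ` \<psi> ` (W \<inter> V) \<subseteq> \<phi> ` W" using chart_inv[OF d] by auto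
  ultimately have "smooth_on (\<psi> ` (W \<inter> V)) (\<lambda>x. f (inv_into U \<phi> (\<phi> (inv_into V \<psi> x))))"
    by (rule smooth_on_compose[OF o chart_open_image_subset[OF c W] f])
  then show "smooth_on (\<psi> ` (W \<inter> V)) (\<lambda>x. f (inv_into V \<psi> x))"
    by (rule smooth_on_cong[OF o, THEN iffD1, rotated]) (use W chart_inv[OF d] chart_inv[OF c] in auto)
qed

lemma open_chart_Int: "open W \<Longrightarrow> (U, \<phi>) \<in> A \<Longrightarrow> open (\<phi> ` (W \<inter> U))"
  using chart_open_image_subset chart_open by (metis Int_lower2 open_Int)

lemma smooth_fun_on_local:
  assumes W: "open W" and loc: "\<And>p. p \<in> W \<Longrightarrow> \<exists>N. open N \<and> p \<in> N \<and> smooth_fun_on A N f"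
  shows "smooth_fun_on A W f"
proof (rule smooth_fun_onI, rule smooth_on_local)
  fix U \<phi> x assume c: "(U, \<phi>) \<in> A" and "x \<in> \<phi> ` (W \<inter> U)"
  then obtain p where p: "p \<in> W" "p \<in> U" "x = \<phi> p" by blast
  obtain N where N: "open N" "p \<in> N" "smooth_fun_on A N f" using loc[OF p(1)] by blast
  show "\<exists>N. open N \<and> x \<in> N \<and> smooth_on N (\<lambda>x. f (inv_into U \<phi> x))"
    by (rule exI[of _ "\<phi> ` (N \<inter> U)"]) (use open_chart_Int[OF N(1) c] N(2) p smooth_fun_onD[OF N(3) c] in auto)
qed

lemma smooth_fun_on_subset: "smooth_fun_on A W f \<Longrightarrow> W' \<subseteq> W \<Longrightarrow> smooth_fun_on A W' f"
  by (rule smooth_fun_onI, rule smooth_on_subset[OF smooth_fun_onD], assumption+, blast)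

lemma smooth_fun_on_cong: "open W \<Longrightarrow> (\<And>q. q \<in> W \<Longrightarrow> f q = h q) \<Longrightarrow> smooth_fun_on A W f \<Longrightarrow> smooth_fun_on A W h"
proof (rule smooth_fun_onI)
  fix U \<phi> assume a: "open W" "\<And>q. q \<in> W \<Longrightarrow> f q = h q" "smooth_fun_on A W f" "(U, \<phi>) \<in> A"
  show "smooth_on (\<phi> ` (W \<inter> U)) (\<lambda>x. h (inv_into U \<phi> x))"
    by (rule smooth_on_cong[OF open_chart_Int[OF a(1,4)], THEN iffD1, OF _ smooth_fun_onD[OF a(3,4)]])
      (use a chart_inv[OF a(4)] in auto)
qed

lemma smooth_fun_on_const: "open W \<Longrightarrow> smooth_fun_on A W (\<lambda>q. c)"
  by (rule smooth_fun_onI, rule smooth_on_const, rule open_chart_Int)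

lemma smooth_fun_on_add: "open W \<Longrightarrow> smooth_fun_on A W f \<Longrightarrow> smooth_fun_on A W h \<Longrightarrow> smooth_fun_on A W (\<lambda>q. f q + h q)"
  by (rule smooth_fun_onI, rule smooth_on_add) (rule open_chart_Int smooth_fun_onD; assumption)+

lemma smooth_fun_on_mult: "open W \<Longrightarrow> smooth_fun_on A W f \<Longrightarrow> smooth_fun_on A W h \<Longrightarrow> smooth_fun_on A W (\<lambda>q. f q * h q)"
  by (rule smooth_fun_onI, rule smooth_on_mult) (rule open_chart_Int smooth_fun_onD; assumption)+

lemma smooth_fun_on_inverse:
  assumes "open W" "smooth_fun_on A W f" "\<And>q. q \<in> W \<Longrightarrow> f q \<noteq> 0"
  shows "smooth_fun_on A W (\<lambda>q. 1 / f q)"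
proof (rule smooth_fun_onI, rule smooth_on_inverse)
  fix U \<phi> assume c: "(U, \<phi>) \<in> A"
  show "open (\<phi> ` (W \<inter> U))" by (rule open_chart_Int[OF assms(1) c])
  show "smooth_on (\<phi> ` (W \<inter> U)) (\<lambda>x. f (inv_into U \<phi> x))" by (rule smooth_fun_onD[OF assms(2) c])
  show "f (inv_into U \<phi> x) \<noteq> 0" if "x \<in> \<phi> ` (W \<inter> U)" for x using that assms(3) chart_inv[OF c] by auto
qed

lemma smooth_fun_on_sum: "open W \<Longrightarrow> (\<And>i. i \<in> I \<Longrightarrow> smooth_fun_on A W (f i)) \<Longrightarrow> smooth_fun_on A W (\<lambda>q. \<Sum>i\<in>I. f i q)"
  by (induction I rule: infinite_finite_induct) (simp_all add: smooth_fun_on_const smooth_fun_on_add)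

lemma smooth_fun_on_continuous:
  assumes "open W" "smooth_fun_on A W f"
  shows "continuous_on W f"
  unfolding continuous_on_eq_continuous_within
proof
  fix p assume "p \<in> W"
  obtain U \<phi> where c: "(U, \<phi>) \<in> A" "p \<in> U" using chart_ex by blast
  have "continuous_on (\<phi> ` (W \<inter> U)) (\<lambda>x. f (inv_into U \<phi> x))"
    using smooth_fun_onD[OF assms(2) c(1)] Ck_on_continuous unfolding smooth_on_def by blast
  then have "continuous_on (W \<inter> U) (\<lambda>q. f (inv_into U \<phi> (\<phi> q)))"
    by (rule continuous_on_compose2) (auto intro: continuous_on_subset[OF chart_cont[OF c(1)]])
  then have "continuous_on (W \<inter> U) f"
    by (rule continuous_on_cong[THEN iffD1, rotated -1]) (auto simp: chart_inv[OF c(1)])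
  then show "continuous (at p within W) f"
    using \<open>p \<in> W\<close> c chart_open[OF c(1)] assms(1)
    by (metis IntI continuous_at_imp_continuous_within continuous_on_eq_continuous_at open_Int)
qed

lemma smooth_funs_on: "f \<in> smooth_funs A \<Longrightarrow> smooth_fun_on A W f"
  unfolding smooth_funs_def using smooth_fun_on_subset[of UNIV f W] by simp

lemma smooth_funs_local: "(\<And>p. \<exists>N. open N \<and> p \<in> N \<and> smooth_fun_on A N f) \<Longrightarrow> f \<in> smooth_funs A"
  unfolding smooth_funs_def using smooth_fun_on_local[of UNIV f] by auto

lemma smooth_const: "(\<lambda>q. c) \<in> smooth_funs A"
  and smooth_add: "f \<in> smooth_funs A \<Longrightarrow> h \<in> smooth_funs A \<Longrightarrow> (\<lambda>q. f q + h q) \<in> smooth_funs A"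
  and smooth_mult: "f \<in> smooth_funs A \<Longrightarrow> h \<in> smooth_funs A \<Longrightarrow> (\<lambda>q. f q * h q) \<in> smooth_funs A"
  unfolding smooth_funs_def by (simp_all add: smooth_fun_on_const smooth_fun_on_add smooth_fun_on_mult)

lemma smooth_diff: "f \<in> smooth_funs A \<Longrightarrow> h \<in> smooth_funs A \<Longrightarrow> (\<lambda>q. f q - h q) \<in> smooth_funs A"
  using smooth_add[OF _ smooth_mult[OF smooth_const[of "-1"]], of f h] by simp

lemma smooth_uminus: "f \<in> smooth_funs A \<Longrightarrow> (\<lambda>q. - f q) \<in> smooth_funs A"
  using smooth_mult[OF smooth_const[of "-1"], of f] by simp

lemma smooth_sum: "(\<And>i. i \<in> I \<Longrightarrow> f i \<in> smooth_funs A) \<Longrightarrow> (\<lambda>q. \<Sum>i\<in>I. f i q) \<in> smooth_funs A"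
  unfolding smooth_funs_def by (simp add: smooth_fun_on_sum)

lemma smooth_power: "f \<in> smooth_funs A \<Longrightarrow> (\<lambda>q. f q ^ n) \<in> smooth_funs A"
  by (induction n) (simp_all add: smooth_const smooth_mult)

lemma smooth_continuous: "f \<in> smooth_funs A \<Longrightarrow> continuous_on W f"
  using smooth_fun_on_continuous[OF open_UNIV smooth_funs_on] continuous_on_subset[OF _ subset_UNIV] by metis

section \<open>Cut-off functions and extension from open sets\<close>

lemma chart_smooth_fun_on:
  assumes c: "(U, \<phi>) \<in> A" and h: "smooth_on (\<phi> ` U) h"
  shows "smooth_fun_on A U (\<lambda>q. h (\<phi> q))"
proof (rule smooth_fun_on_chartI[OF c chart_open[OF c] order_refl])
  show "smooth_on (\<phi> ` U) (\<lambda>x. h (\<phi> (inv_into U \<phi> x)))"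
    by (rule smooth_on_cong[OF chart_open_image[OF c], THEN iffD1, OF _ h]) (simp add: chart_inv_mem[OF c])
qed

text \<open>A Euclidean bump transported by a chart and continued by zero. The closed set K inside
  W, off which the bump vanishes, is recorded because it is what allows functions on W to be
  extended by zero.\<close>

lemma bump_ex:
  assumes W: "open W" "p \<in> W"
  obtains \<rho> N K where "\<rho> \<in> smooth_funs A" "open N" "p \<in> N" "N \<subseteq> W" "\<And>q. q \<in> N \<Longrightarrow> \<rho> q = 1"
    "closed K" "K \<subseteq> W" "\<And>q. q \<notin> K \<Longrightarrow> \<rho> q = 0"
proof -
  obtain U \<phi> where c: "(U, \<phi>) \<in> A" "p \<in> U" using chart_ex by blast
  have "open (\<phi> ` (W \<inter> U))" "\<phi> p \<in> \<phi> ` (W \<inter> U)" using open_chart_Int[OF W(1) c(1)] W c by auto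
  then obtain e where e: "e > 0" "cball (\<phi> p) e \<subseteq> \<phi> ` (W \<inter> U)" 
    using open_contains_cball_eq[of "\<phi> ` (W \<inter> U)"] by meson
  define r where "r = e / 2"
  have r: "r > 0" "cball (\<phi> p) (2 * r) \<subseteq> \<phi> ` (W \<inter> U)" using e by (simp_all add: r_def)
  define \<rho> where "\<rho> q = (if q \<in> U then euclid_bump (\<phi> p) r (\<phi> q) else 0)" for q
  define K where "K = inv_into U \<phi> ` cball (\<phi> p) (2 * r)"
  define N where "N = inv_into U \<phi> ` ball (\<phi> p) r"
  have sub: "cball (\<phi> p) (2 * r) \<subseteq> \<phi> ` U" using r by blast
  \<comment> \<open>The image of a compact ball is compact, hence closed in a Hausdorff space;
    smoothness of the bump outside the chart domain rests on this.\<close>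
  have cK: "closed K" unfolding K_def
    by (rule compact_imp_closed, rule compact_continuous_image[OF continuous_on_subset[OF chart_inv_cont[OF c(1)] sub] compact_cball])
  have "ball (\<phi> p) r \<subseteq> \<phi> ` U"
    by (rule order_trans[OF order_trans[OF ball_subset_cball subset_cball] sub]) (use r(1) in simp)
  then have Nin: "q \<in> N \<longleftrightarrow> q \<in> U \<and> dist (\<phi> p) (\<phi> q) < r" for q
    unfolding N_def by (simp add: chart_inv_image[OF c(1)])
  have Kin: "q \<in> K \<longleftrightarrow> q \<in> U \<and> dist (\<phi> p) (\<phi> q) \<le> 2 * r" for q
    unfolding K_def chart_inv_image[OF c(1) sub] by simp
  have KW: "K \<subseteq> W \<inter> U"
  proof
    fix q assume "q \<in> K"
    then have "q \<in> U" "\<phi> q \<in> \<phi> ` (W \<inter> U)" using Kin[of q] r(2) by auto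
    then obtain q' where q': "q' \<in> W \<inter> U" "\<phi> q = \<phi> q'" by auto
    have "q = q'" using chart_inv[OF c(1) \<open>q \<in> U\<close>] chart_inv[OF c(1), of q'] q' by simp
    then show "q \<in> W \<inter> U" using q' by simp
  qed
  have oN: "open N"
  proof -
    have "open (\<phi> -` ball (\<phi> p) r \<inter> U)"
      using chart_cont[OF c(1)] unfolding continuous_on_open_vimage[OF chart_open[OF c(1)]] by simp
    moreover have "N = \<phi> -` ball (\<phi> p) r \<inter> U" by (rule set_eqI) (simp add: Nin conj_commute)
    ultimately show ?thesis by simp
  qed
  have z: "\<rho> q = 0" if "q \<notin> K" for q
  proof (cases "q \<in> U")
    case True
    then have "2 * r \<le> dist (\<phi> q) (\<phi> p)" using that unfolding Kin by (simp add: dist_commute)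
    then show ?thesis using True euclid_bump_eq_0[OF r(1), of "\<phi> q" "\<phi> p"] by (simp add: \<rho>_def)
  qed (simp add: \<rho>_def)
  have "\<rho> \<in> smooth_funs A"
  proof (rule smooth_funs_local)
    fix q
    show "\<exists>N. open N \<and> q \<in> N \<and> smooth_fun_on A N \<rho>"
    proof (cases "q \<in> U")
      case True
      have "smooth_fun_on A U \<rho>"
        by (rule smooth_fun_on_cong[OF chart_open[OF c(1)] _ chart_smooth_fun_on[OF c(1) smooth_on_euclid_bump[OF chart_open_image[OF c(1)]]]])
          (simp add: \<rho>_def)
      then show ?thesis using True chart_open[OF c(1)] by blast
    next
      case False
      have "smooth_fun_on A (- K) \<rho>"
        by (rule smooth_fun_on_cong[OF _ _ smooth_fun_on_const[of _ 0]]) (use cK z in auto)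
      then show ?thesis using False KW cK by blast
    qed
  qed
  moreover have "\<rho> q = 1" if "q \<in> N" for q
    using that unfolding Nin \<rho>_def by (simp add: dist_commute euclid_bump_eq_1[OF r(1)])
  moreover have "p \<in> N" using Nin c r by simp
  moreover have "N \<subseteq> W"
  proof
    fix q assume "q \<in> N"
    then have "q \<in> K" using r(1) unfolding Nin Kin by simp
    then show "q \<in> W" using KW by blast
  qed
  moreover have "K \<subseteq> W" using KW by simp
  ultimately show thesis using oN cK z by (intro that[of \<rho> N K])
qed

text \<open>W and the complement of K are open and cover the manifold; on the second the function is
  zero.\<close>

lemma extension_by_zero_smooth:
  assumes W: "open W" and u: "smooth_fun_on A W u" and \<rho>: "\<rho> \<in> smooth_funs A"
    and K: "closed K" "K \<subseteq> W" "\<And>q. q \<notin> K \<Longrightarrow> \<rho> q = 0"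
  shows "(\<lambda>q. if q \<in> W then \<rho> q * u q else 0) \<in> smooth_funs A"
proof (rule smooth_funs_local)
  fix q
  let ?f = "\<lambda>q. if q \<in> W then \<rho> q * u q else 0"
  show "\<exists>N. open N \<and> q \<in> N \<and> smooth_fun_on A N ?f"
  proof (cases "q \<in> W")
    case True
    have "smooth_fun_on A W ?f"
      by (rule smooth_fun_on_cong[OF W _ smooth_fun_on_mult[OF W smooth_funs_on[OF \<rho>] u]]) simp
    then show ?thesis using True W by blast
  next
    case False
    have "smooth_fun_on A (- K) ?f"
      by (rule smooth_fun_on_cong[OF _ _ smooth_fun_on_const[of _ 0]]) (use K in auto)
    then show ?thesis using False K by blast
  qed
qed

text \<open>Tangent vectors act on globally smooth functions only, so a function given near p is
  replaced by a global one with the same germ.\<close>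

lemma smooth_extension:
  assumes W: "open W" "p \<in> W" and u: "smooth_fun_on A W u"
  obtains f N where "f \<in> smooth_funs A" "open N" "p \<in> N" "N \<subseteq> W" "\<And>q. q \<in> N \<Longrightarrow> f q = u q"
proof -
  obtain \<rho> N K where b: "\<rho> \<in> smooth_funs A" "open N" "p \<in> N" "N \<subseteq> W" "\<And>q. q \<in> N \<Longrightarrow> \<rho> q = 1"
    "closed K" "K \<subseteq> W" "\<And>q. q \<notin> K \<Longrightarrow> \<rho> q = 0" using bump_ex[OF W] by blast
  show thesis
    by (rule that[OF extension_by_zero_smooth[OF W(1) u b(1,6,7,8)] b(2,3,4)]) (use b(4,5) in auto)
qed

end

section \<open>Tangent vectors as derivations, in coordinates\<close>

context manifold
begin

lemma tangentD:
  assumes "v \<in> tangent_space A p"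
  shows tangent_nonsmooth: "f \<notin> smooth_funs A \<Longrightarrow> v f = 0"
    and tangent_scale: "f \<in> smooth_funs A \<Longrightarrow> v (\<lambda>q. c * f q) = c * v f"
    and tangent_add: "f \<in> smooth_funs A \<Longrightarrow> h \<in> smooth_funs A \<Longrightarrow> v (\<lambda>q. f q + h q) = v f + v h"
    and tangent_mult: "f \<in> smooth_funs A \<Longrightarrow> h \<in> smooth_funs A \<Longrightarrow> v (\<lambda>q. f q * h q) = f p * v h + h p * v f"
  using assms unfolding tangent_space_def by simp_all

lemma tangentI:
  assumes "\<And>f. f \<notin> smooth_funs A \<Longrightarrow> v f = 0"
    and "\<And>f c. f \<in> smooth_funs A \<Longrightarrow> v (\<lambda>q. c * f q) = c * v f"
    and "\<And>f h. f \<in> smooth_funs A \<Longrightarrow> h \<in> smooth_funs A \<Longrightarrow> v (\<lambda>q. f q + h q) = v f + v h"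
    and "\<And>f h. f \<in> smooth_funs A \<Longrightarrow> h \<in> smooth_funs A \<Longrightarrow> v (\<lambda>q. f q * h q) = f p * v h + h p * v f"
  shows "v \<in> tangent_space A p"
  using assms unfolding tangent_space_def by blast

lemma tangent_lin:
  assumes "v \<in> tangent_space A p" "w \<in> tangent_space A p"
  shows "(\<lambda>f. a * v f + b * w f) \<in> tangent_space A p"
  using assms by (intro tangentI) (simp_all add: tangentD algebra_simps)

lemma tangent_zero: "(\<lambda>f. 0) \<in> tangent_space A p"
  by (intro tangentI) simp_all

lemma tangent_sum:
  assumes "\<And>i. i \<in> I \<Longrightarrow> v i \<in> tangent_space A p"
  shows "(\<lambda>f. \<Sum>i\<in>I. c i * v i f) \<in> tangent_space A p"
  using assms
proof (induction I rule: infinite_finite_induct)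
  case (insert i I)
  then show ?case using tangent_lin[of "v i" p "\<lambda>f. \<Sum>i\<in>I. c i * v i f" "c i" 1] by simp
qed (simp_all add: tangent_zero)

lemma tangent_const: "v \<in> tangent_space A p \<Longrightarrow> v (\<lambda>q. c) = 0"
proof -
  assume v: "v \<in> tangent_space A p"
  have "v (\<lambda>q. 1 * 1) = 1 * v (\<lambda>q. 1) + 1 * v (\<lambda>q. 1)" by (rule tangent_mult[OF v smooth_const smooth_const])
  then have "v (\<lambda>q. 1) = 0" by simp
  then show ?thesis using tangent_scale[OF v smooth_const, of c 1] by simp
qed

lemma tangent_diff: "v \<in> tangent_space A p \<Longrightarrow> f \<in> smooth_funs A \<Longrightarrow> h \<in> smooth_funs A \<Longrightarrow> v (\<lambda>q. f q - h q) = v f - v h"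
  using tangent_add[OF _ _ smooth_uminus, of v p f h] tangent_scale[of v p h "-1"] by simp

lemma tangent_uminus: "v \<in> tangent_space A p \<Longrightarrow> f \<in> smooth_funs A \<Longrightarrow> v (\<lambda>q. - f q) = - v f"
  using tangent_scale[of v p f "-1"] by simp

lemma tangent_sum_fun:
  assumes v: "v \<in> tangent_space A p"
  shows "(\<And>i. i \<in> I \<Longrightarrow> f i \<in> smooth_funs A) \<Longrightarrow> v (\<lambda>q. \<Sum>i\<in>I. f i q) = (\<Sum>i\<in>I. v (f i))"
proof (induction I rule: infinite_finite_induct)
  case (insert i I)
  then show ?case using tangent_add[OF v, of "f i" "\<lambda>q. \<Sum>i\<in>I. f i q"] smooth_sum[of I f] by simp
qed (simp_all add: tangent_const[OF v])

text \<open>Multiplied by a bump function supported where f and h agree, the two become equal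
  everywhere; the product rule at p, where the bump is 1, then compares v f with v h.\<close>

lemma tangent_local:
  assumes v: "v \<in> tangent_space A p" and s: "f \<in> smooth_funs A" "h \<in> smooth_funs A"
    and N: "open N" "p \<in> N" "\<And>q. q \<in> N \<Longrightarrow> f q = h q"
  shows "v f = v h"
proof -
  obtain \<rho> N' K where b: "\<rho> \<in> smooth_funs A" "open N'" "p \<in> N'" "N' \<subseteq> N" "\<And>q. q \<in> N' \<Longrightarrow> \<rho> q = 1"
    "closed K" "K \<subseteq> N" "\<And>q. q \<notin> K \<Longrightarrow> \<rho> q = 0" using bump_ex[OF N(1,2)] by metis
  have "\<rho> q * f q = \<rho> q * h q" for q
    using N(3)[of q] b(7) b(8)[of q] by (cases "q \<in> K") auto
  then have "v (\<lambda>q. \<rho> q * f q) = v (\<lambda>q. \<rho> q * h q)" by (intro arg_cong[of _ _ v] ext)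
  then have "\<rho> p * v f + f p * v \<rho> = \<rho> p * v h + h p * v \<rho>" by (simp add: tangent_mult[OF v] b(1) s)
  then show ?thesis using b(5)[OF b(3)] N(3)[OF N(2)] by simp
qed

text \<open>The value 0 on functions that are not smooth matches the convention in
  \<open>tangent_space\<close>.\<close>

definition coord_deriv :: "'a set \<Rightarrow> ('a \<Rightarrow> real^8) \<Rightarrow> real^8 \<Rightarrow> 'a \<Rightarrow> 'a tvec" where
  "coord_deriv U \<phi> b q f = (if f \<in> smooth_funs A then frechet_derivative (\<lambda>x. f (inv_into U \<phi> x)) (at (\<phi> q)) b else 0)"

context
  fixes U \<phi>
  assumes chart: "(U, \<phi>) \<in> A"
begin

lemma chart_rep_smooth: "f \<in> smooth_funs A \<Longrightarrow> smooth_on (\<phi> ` U) (\<lambda>x. f (inv_into U \<phi> x))"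
  using smooth_fun_onD[OF smooth_funs_on chart, of f UNIV] by simp

lemma chart_rep_deriv:
  assumes "f \<in> smooth_funs A" "q \<in> U"
  shows "((\<lambda>x. f (inv_into U \<phi> x)) has_derivative frechet_derivative (\<lambda>x. f (inv_into U \<phi> x)) (at (\<phi> q))) (at (\<phi> q))"
  by (rule smooth_on_has_derivative[OF chart_open_image[OF chart] chart_rep_smooth[OF assms(1)]]) (use assms in simp)

lemma coord_deriv_tangent:
  assumes q: "q \<in> U"
  shows "coord_deriv U \<phi> b q \<in> tangent_space A q"
proof (rule tangentI)
  fix f h :: "'a \<Rightarrow> real" and c :: real
  let ?r = "\<lambda>f x. f (inv_into U \<phi> x)" and ?F = "\<lambda>f. frechet_derivative (\<lambda>x. f (inv_into U \<phi> x)) (at (\<phi> q))"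
  show "coord_deriv U \<phi> b q f = 0" if "f \<notin> smooth_funs A" using that by (simp add: coord_deriv_def)
  assume f: "f \<in> smooth_funs A"
  note df = chart_rep_deriv[OF f q]
  have "(?r (\<lambda>q. c * f q) has_derivative (\<lambda>y. c * ?F f y)) (at (\<phi> q))"
    by (rule has_derivative_mult_right[OF df])
  from frechet_derivative_at[OF this, symmetric]
  show "coord_deriv U \<phi> b q (\<lambda>q. c * f q) = c * coord_deriv U \<phi> b q f"
    using f smooth_mult[OF smooth_const f] by (simp add: coord_deriv_def)
  assume h: "h \<in> smooth_funs A"
  note dh = chart_rep_deriv[OF h q]
  have "(?r (\<lambda>q. f q + h q) has_derivative (\<lambda>y. ?F f y + ?F h y)) (at (\<phi> q))"
    by (rule has_derivative_add[OF df dh])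
  from frechet_derivative_at[OF this, symmetric]
  show "coord_deriv U \<phi> b q (\<lambda>q. f q + h q) = coord_deriv U \<phi> b q f + coord_deriv U \<phi> b q h"
    using f h smooth_add[OF f h] by (simp add: coord_deriv_def)
  have "(?r (\<lambda>q. f q * h q) has_derivative (\<lambda>y. f q * ?F h y + ?F f y * h q)) (at (\<phi> q))"
    using has_derivative_mult[OF df dh] by (simp add: chart_inv[OF chart q])
  from frechet_derivative_at[OF this, symmetric]
  show "coord_deriv U \<phi> b q (\<lambda>q. f q * h q) = f q * coord_deriv U \<phi> b q h + h q * coord_deriv U \<phi> b q f"
    using f h smooth_mult[OF f h] by (simp add: coord_deriv_def mult.commute)
qed

lemma coord_deriv_smooth:
  assumes "f \<in> smooth_funs A" "b \<in> Basis"
  shows "smooth_fun_on A U (\<lambda>q. coord_deriv U \<phi> b q f)"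
proof -
  have "smooth_on (\<phi> ` U) (\<lambda>x. frechet_derivative (\<lambda>x. f (inv_into U \<phi> x)) (at x) b)"
    by (rule smooth_on_frechet_derivative[OF chart_rep_smooth[OF assms(1)] assms(2)])
  from chart_smooth_fun_on[OF chart this] show ?thesis using assms(1) by (simp add: coord_deriv_def)
qed

lemma coord_deriv_of_local:
  assumes f: "f \<in> smooth_funs A" and q: "q \<in> N" "open N" "N \<subseteq> U"
    and h: "\<And>q'. q' \<in> N \<Longrightarrow> f q' = h (\<phi> q')" "(h has_derivative h') (at (\<phi> q))"
  shows "coord_deriv U \<phi> b q f = h' b"
proof -
  have "((\<lambda>x. f (inv_into U \<phi> x)) has_derivative h') (at (\<phi> q))"
  proof (rule has_derivative_transform_within_open[OF h(2), of "\<phi> ` N"])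
    show "open (\<phi> ` N)" by (rule chart_open_image_subset[OF chart q(2,3)])
    show "\<phi> q \<in> \<phi> ` N" using q by simp
    show "h x = f (inv_into U \<phi> x)" if "x \<in> \<phi> ` N" for x
    proof -
      obtain q' where q': "q' \<in> N" "x = \<phi> q'" using \<open>x \<in> \<phi> ` N\<close> by blast
      then have "inv_into U \<phi> x = q'" using chart_inv[OF chart, of q'] q(3) by auto
      then show ?thesis using h(1)[OF q'(1)] q'(2) by simp
    qed
  qed
  then show ?thesis using f frechet_derivative_at[of "\<lambda>x. f (inv_into U \<phi> x)" h' "\<phi> q"] by (simp add: coord_deriv_def)
qed

lemma coord_funs_ex:
  assumes p: "p \<in> U"
  obtains x N where "\<And>b. b \<in> Basis \<Longrightarrow> x b \<in> smooth_funs A" "open N" "p \<in> N" "N \<subseteq> U"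
    "\<And>b q. b \<in> Basis \<Longrightarrow> q \<in> N \<Longrightarrow> x b q = (\<phi> q - \<phi> p) \<bullet> b"
proof -
  have "\<exists>f N. f \<in> smooth_funs A \<and> open N \<and> p \<in> N \<and> N \<subseteq> U \<and> (\<forall>q\<in>N. f q = (\<phi> q - \<phi> p) \<bullet> b)" for b
  proof -
    have "smooth_on (\<phi> ` U) (\<lambda>x. (x + - \<phi> p) \<bullet> b)"
      by (rule smooth_on_bounded_linear[OF bounded_linear_inner_left]; (rule smooth_on_add smooth_on_id smooth_on_const)?; (rule smooth_on_id smooth_on_const)?; rule chart_open_image[OF chart])
    from chart_smooth_fun_on[OF chart this] have "smooth_fun_on A U (\<lambda>q. (\<phi> q - \<phi> p) \<bullet> b)" by simp
    from smooth_extension[OF chart_open[OF chart] p this] show ?thesis by metis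
  qed
  then obtain x N where x: "\<And>b. x b \<in> smooth_funs A \<and> open (N b) \<and> p \<in> N b \<and> N b \<subseteq> U \<and> (\<forall>q\<in>N b. x b q = (\<phi> q - \<phi> p) \<bullet> b)" by metis
  show thesis
  proof (rule that[of x "U \<inter> (\<Inter>b\<in>Basis. N b)"])
    show "open (U \<inter> (\<Inter>b\<in>Basis. N b))" using x by (intro open_Int chart_open[OF chart] open_INT) auto
  qed (use x p in auto)
qed

text \<open>By Hadamard's lemma f equals f p plus a sum of products x b times k b near p. A
  derivation kills the constant, and since x b vanishes at p only v (x b) times k b p remains, where
  k b p is the coordinate derivative of f.\<close>

lemma tangent_expansion:
  assumes p: "p \<in> U" and v: "v \<in> tangent_space A p"
    and x: "\<And>b. b \<in> Basis \<Longrightarrow> x b \<in> smooth_funs A" and N: "open N" "p \<in> N" "N \<subseteq> U"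
    and xN: "\<And>b q. b \<in> Basis \<Longrightarrow> q \<in> N \<Longrightarrow> x b q = (\<phi> q - \<phi> p) \<bullet> b"
  shows "v = (\<lambda>f. \<Sum>b\<in>Basis. v (x b) * coord_deriv U \<phi> b p f)"
proof
  fix f
  show "v f = (\<Sum>b\<in>Basis. v (x b) * coord_deriv U \<phi> b p f)"
  proof (cases "f \<in> smooth_funs A")
    case False
    then show ?thesis by (simp add: tangent_nonsmooth[OF v] coord_deriv_def)
  next
    case f: True
    have oN: "open (\<phi> ` N)" by (rule chart_open_image_subset[OF chart N(1,3)])
    have "\<phi> p \<in> \<phi> ` N" using N(2) by simp
    then obtain r where r: "r > 0" "ball (\<phi> p) r \<subseteq> \<phi> ` N" using oN open_contains_ball by metis
    have sub: "\<phi> ` N \<subseteq> \<phi> ` U" using N(3) by blast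
    have sm: "smooth_on (ball (\<phi> p) r) (\<lambda>x. f (inv_into U \<phi> x))"
      by (rule smooth_on_subset[OF chart_rep_smooth[OF f]]) (use r(2) sub in blast)
    obtain h where
      h: "\<And>b. b \<in> Basis \<Longrightarrow> smooth_on (ball (\<phi> p) r) (h b)"
        "\<And>b. b \<in> Basis \<Longrightarrow> h b (\<phi> p) = frechet_derivative (\<lambda>x. f (inv_into U \<phi> x)) (at (\<phi> p)) b"
        "\<And>x. x \<in> ball (\<phi> p) r \<Longrightarrow> f (inv_into U \<phi> x) = f (inv_into U \<phi> (\<phi> p)) + (\<Sum>b\<in>Basis. ((x - \<phi> p) \<bullet> b) * h b x)"
      by (rule Hadamard[OF r(1) sm], rule that)
    define B where "B = {q \<in> U. \<phi> q \<in> ball (\<phi> p) r}"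
    have Bim: "B = inv_into U \<phi> ` ball (\<phi> p) r"
      unfolding B_def by (rule chart_inv_image[OF chart, symmetric]) (use r(2) sub in blast)
    have oB: "open B"
    proof -
      have "open (\<phi> -` ball (\<phi> p) r \<inter> U)"
        using chart_cont[OF chart] unfolding continuous_on_open_vimage[OF chart_open[OF chart]] by simp
      moreover have "B = \<phi> -` ball (\<phi> p) r \<inter> U" unfolding B_def by auto
      ultimately show ?thesis by simp
    qed
    have pB: "p \<in> B" using p r(1) by (simp add: B_def)
    have BU: "B \<subseteq> U" by (auto simp: B_def)
    have BN: "q \<in> N" if "q \<in> B" for q
    proof -
      have "q \<in> U" "\<phi> q \<in> \<phi> ` N" using that r(2) by (auto simp: B_def)
      then obtain q' where "q' \<in> N" "\<phi> q = \<phi> q'" by auto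
      then show ?thesis using chart_inv[OF chart, of q] chart_inv[OF chart, of q'] \<open>q \<in> U\<close> N(3) by auto
    qed
    have "\<exists>k M. k \<in> smooth_funs A \<and> open M \<and> p \<in> M \<and> M \<subseteq> B \<and> (\<forall>q\<in>M. k q = h b (\<phi> q))" if b: "b \<in> Basis" for b
    proof -
      have "smooth_fun_on A B (\<lambda>q. h b (\<phi> q))"
      proof (rule smooth_fun_on_chartI[OF chart oB BU])
        have "\<phi> ` B \<subseteq> ball (\<phi> p) r" by (auto simp: B_def)
        then have "smooth_on (\<phi> ` B) (h b)" by (rule smooth_on_subset[OF h(1)[OF b]])
        then show "smooth_on (\<phi> ` B) (\<lambda>x. h b (\<phi> (inv_into U \<phi> x)))"
        proof (rule smooth_on_cong[OF chart_open_image_subset[OF chart oB BU], THEN iffD1, rotated])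
          fix x assume "x \<in> \<phi> ` B"
          then show "h b x = h b (\<phi> (inv_into U \<phi> x))" using chart_inv_mem[OF chart, of x] BU by auto
        qed
      qed
      from smooth_extension[OF oB pB this] show ?thesis by metis
    qed
    then obtain k M where k: "\<And>b. b \<in> Basis \<Longrightarrow> k b \<in> smooth_funs A \<and> open (M b) \<and> p \<in> M b \<and> M b \<subseteq> B \<and> (\<forall>q\<in>M b. k b q = h b (\<phi> q))" by metis
    define M' where "M' = B \<inter> (\<Inter>b\<in>Basis. M b)"
    have oM: "open M'" unfolding M'_def using k by (intro open_Int oB open_INT) auto
    have pM: "p \<in> M'" using pB k by (auto simp: M'_def)
    have eq: "f q = f p + (\<Sum>b\<in>Basis. x b q * k b q)" if "q \<in> M'" for q
    proof -
      have q: "q \<in> B" "q \<in> N" using that BN by (auto simp: M'_def)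
      have "f (inv_into U \<phi> (\<phi> q)) = f (inv_into U \<phi> (\<phi> p)) + (\<Sum>b\<in>Basis. ((\<phi> q - \<phi> p) \<bullet> b) * h b (\<phi> q))"
        by (rule h(3)) (use q in \<open>simp add: B_def\<close>)
      moreover have "(\<Sum>b\<in>Basis. ((\<phi> q - \<phi> p) \<bullet> b) * h b (\<phi> q)) = (\<Sum>b\<in>Basis. x b q * k b q)"
      proof (rule sum.cong[OF refl])
        fix b :: "real^8" assume b: "b \<in> Basis"
        have "k b q = h b (\<phi> q)" using k[OF b] that b by (auto simp: M'_def)
        then show "((\<phi> q - \<phi> p) \<bullet> b) * h b (\<phi> q) = x b q * k b q" using xN[OF b q(2)] by simp
      qed
      moreover have "q \<in> U" using q BU by blast
      ultimately show ?thesis by (simp add: chart_inv[OF chart] p)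
    qed
    have sk: "(\<lambda>q. x b q * k b q) \<in> smooth_funs A" if "b \<in> Basis" for b
      using smooth_mult x[OF that] k[OF that] by simp
    have "v f = v (\<lambda>q. f p + (\<Sum>b\<in>Basis. x b q * k b q))"
      by (rule tangent_local[OF v f smooth_add[OF smooth_const smooth_sum[OF sk]] oM pM eq])
    also have "\<dots> = v (\<lambda>q. \<Sum>b\<in>Basis. x b q * k b q)"
      using tangent_add[OF v smooth_const[of "f p"] smooth_sum[OF sk]] by (simp add: tangent_const[OF v])
    also have "\<dots> = (\<Sum>b\<in>Basis. v (\<lambda>q. x b q * k b q))" by (rule tangent_sum_fun[OF v sk])
    also have "\<dots> = (\<Sum>b\<in>Basis. v (x b) * coord_deriv U \<phi> b p f)"
    proof (rule sum.cong[OF refl])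
      fix b :: "real^8" assume b: "b \<in> Basis"
      have "k b p = h b (\<phi> p)" using k[OF b] by simp
      then have "k b p = coord_deriv U \<phi> b p f" using h(2)[OF b] f by (simp add: coord_deriv_def)
      moreover have "x b p = 0" using xN[OF b N(2)] by simp
      ultimately show "v (\<lambda>q. x b q * k b q) = v (x b) * coord_deriv U \<phi> b p f"
        using tangent_mult[OF v x[OF b], of "k b"] k[OF b] by simp
    qed
    finally show ?thesis .
  qed
qed

end

section \<open>Smooth vector fields\<close>

lemma vfieldsD: "X \<in> vfields A \<Longrightarrow> X p \<in> tangent_space A p" "X \<in> vfields A \<Longrightarrow> f \<in> smooth_funs A \<Longrightarrow> (\<lambda>p. X p f) \<in> smooth_funs A"
  unfolding vfields_def by simp_all

lemma vfieldsI: "(\<And>p. X p \<in> tangent_space A p) \<Longrightarrow> (\<And>f. f \<in> smooth_funs A \<Longrightarrow> (\<lambda>p. X p f) \<in> smooth_funs A) \<Longrightarrow> X \<in> vfields A"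
  unfolding vfields_def by simp

lemma vf_add_vfields: "X \<in> vfields A \<Longrightarrow> Y \<in> vfields A \<Longrightarrow> vf_add X Y \<in> vfields A"
  unfolding vf_add_def using tangent_lin[of _ _ _ 1 1] by (intro vfieldsI) (simp_all add: vfieldsD smooth_add)

lemma vf_diff_vfields: "X \<in> vfields A \<Longrightarrow> Y \<in> vfields A \<Longrightarrow> vf_diff X Y \<in> vfields A"
  unfolding vf_diff_def using tangent_lin[of _ _ _ 1 "-1"] by (intro vfieldsI) (simp_all add: vfieldsD smooth_diff)

lemma vf_scale_vfields: "u \<in> smooth_funs A \<Longrightarrow> X \<in> vfields A \<Longrightarrow> vf_scale u X \<in> vfields A"
proof (rule vfieldsI)
  fix p assume "u \<in> smooth_funs A" "X \<in> vfields A"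
  then show "vf_scale u X p \<in> tangent_space A p"
    using tangent_lin[OF vfieldsD(1)[of X p] tangent_zero, of "u p" 0] by (simp add: vf_scale_def)
qed (simp add: vf_scale_def vfieldsD smooth_mult)

definition vf_zero :: "'a vfield" where "vf_zero = (\<lambda>p f. 0)"

lemma vf_zero_vfields: "vf_zero \<in> vfields A"
  unfolding vf_zero_def by (intro vfieldsI tangent_zero smooth_const)

definition vf_sum :: "('i \<Rightarrow> 'a vfield) \<Rightarrow> 'i set \<Rightarrow> 'a vfield" where
  "vf_sum X I = (\<lambda>p f. \<Sum>i\<in>I. X i p f)"

lemma vf_sum_vfields: "(\<And>i. i \<in> I \<Longrightarrow> X i \<in> vfields A) \<Longrightarrow> vf_sum X I \<in> vfields A"
  unfolding vf_sum_def using tangent_sum[of I "\<lambda>i. X i _" _ "\<lambda>_. 1"] by (intro vfieldsI) (simp_all add: vfieldsD smooth_sum)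

lemma vf_sum_insert: "finite I \<Longrightarrow> i \<notin> I \<Longrightarrow> vf_sum X (insert i I) = vf_add (X i) (vf_sum X I)"
  by (simp add: vf_sum_def vf_add_def)

lemma vf_sum_empty: "vf_sum X {} = vf_zero"
  by (simp add: vf_sum_def vf_zero_def)

lemma lie_bracket_vfields:
  assumes X: "X \<in> vfields A" and Y: "Y \<in> vfields A"
  shows "lie_bracket X Y \<in> vfields A"
proof (rule vfieldsI)
  fix p
  note D = vfieldsD[OF X] vfieldsD[OF Y] tangentD[OF vfieldsD(1)[OF X]] tangentD[OF vfieldsD(1)[OF Y]]
  show "lie_bracket X Y p \<in> tangent_space A p"
  proof (rule tangentI)
    fix f h c assume f: "f \<in> smooth_funs A"
    show "lie_bracket X Y p (\<lambda>q. c * f q) = c * lie_bracket X Y p f"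
      using f by (simp add: lie_bracket_def D algebra_simps)
    assume h: "h \<in> smooth_funs A"
    show "lie_bracket X Y p (\<lambda>q. f q + h q) = lie_bracket X Y p f + lie_bracket X Y p h"
      using f h by (simp add: lie_bracket_def D algebra_simps)
    show "lie_bracket X Y p (\<lambda>q. f q * h q) = f p * lie_bracket X Y p h + h p * lie_bracket X Y p f"
      using f h by (simp add: lie_bracket_def D smooth_mult algebra_simps)
  next
    fix f assume "f \<notin> smooth_funs A"
    then show "lie_bracket X Y p f = 0"
      by (simp add: lie_bracket_def D tangent_const[OF vfieldsD(1)[OF X]] tangent_const[OF vfieldsD(1)[OF Y]])
  qed
next
  fix f assume "f \<in> smooth_funs A"
  then show "(\<lambda>p. lie_bracket X Y p f) \<in> smooth_funs A"
    by (simp add: lie_bracket_def smooth_diff vfieldsD X Y)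
qed

lemma coord_field_ex:
  assumes c: "(U, \<phi>) \<in> A" and p: "p \<in> U"
  obtains X N where "\<And>b. b \<in> Basis \<Longrightarrow> X b \<in> vfields A" "open N" "p \<in> N" "N \<subseteq> U"
    "\<And>b q. b \<in> Basis \<Longrightarrow> q \<in> N \<Longrightarrow> X b q = coord_deriv U \<phi> b q"
proof -
  obtain \<rho> N K where \<rho>: "\<rho> \<in> smooth_funs A" "open N" "p \<in> N" "N \<subseteq> U" "\<And>q. q \<in> N \<Longrightarrow> \<rho> q = 1"
    "closed K" "K \<subseteq> U" "\<And>q. q \<notin> K \<Longrightarrow> \<rho> q = 0" using bump_ex[OF chart_open[OF c] p] by metis
  define X where "X b = (\<lambda>q f. if q \<in> U then \<rho> q * coord_deriv U \<phi> b q f else 0)" for b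
  have "X b \<in> vfields A" if b: "b \<in> Basis" for b
  proof (rule vfieldsI)
    fix q show "X b q \<in> tangent_space A q"
      using tangent_lin[OF coord_deriv_tangent[OF c, of q b] tangent_zero, of "\<rho> q" 0] tangent_zero
      by (cases "q \<in> U") (simp_all add: X_def)
  next
    fix f assume "f \<in> smooth_funs A"
    from extension_by_zero_smooth[OF chart_open[OF c] coord_deriv_smooth[OF c this b] \<rho>(1,6,7,8)]
    show "(\<lambda>q. X b q f) \<in> smooth_funs A" by (simp add: X_def)
  qed
  moreover have "X b q = coord_deriv U \<phi> b q" if "q \<in> N" for b q
    using that \<rho>(4,5) by (auto simp: X_def)
  ultimately show thesis using that \<rho>(2-4) by metis
qed

text \<open>Tensors take global fields as arguments; this supplies one for every tangent vector, as
  a combination of cut-off coordinate fields with constant coefficients.\<close>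

lemma vfield_through:
  assumes v: "v \<in> tangent_space A p"
  obtains X where "X \<in> vfields A" "X p = v"
proof -
  obtain U \<phi> where c: "(U, \<phi>) \<in> A" "p \<in> U" using chart_ex by blast
  obtain x N where x: "\<And>b. b \<in> Basis \<Longrightarrow> x b \<in> smooth_funs A" "open N" "p \<in> N" "N \<subseteq> U"
    "\<And>b q. b \<in> Basis \<Longrightarrow> q \<in> N \<Longrightarrow> x b q = (\<phi> q - \<phi> p) \<bullet> b" using coord_funs_ex[OF c] by metis
  obtain X M where X: "\<And>b. b \<in> Basis \<Longrightarrow> X b \<in> vfields A" "open M" "p \<in> M" "M \<subseteq> U"
    "\<And>b q. b \<in> Basis \<Longrightarrow> q \<in> M \<Longrightarrow> X b q = coord_deriv U \<phi> b q" using coord_field_ex[OF c] by metis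
  let ?Y = "vf_sum (\<lambda>b. vf_scale (\<lambda>q. v (x b)) (X b)) Basis"
  have "?Y \<in> vfields A" by (intro vf_sum_vfields vf_scale_vfields smooth_const X(1))
  moreover have "?Y p = v"
    by (subst tangent_expansion[OF c v x]) (simp_all add: vf_sum_def vf_scale_def X(3,5))
  ultimately show thesis by (rule that)
qed

end

section \<open>The Cayley form and its stabiliser\<close>

lemma wedge1111_expand:
  "wedge1111 a b c d x y z v =
     a x * b y * c z * d v - a x * b y * c v * d z - a x * b z * c y * d v + a x * b z * c v * d y
     + a x * b v * c y * d z - a x * b v * c z * d y - a y * b x * c z * d v + a y * b x * c v * d z
     + a y * b z * c x * d v - a y * b z * c v * d x - a y * b v * c x * d z + a y * b v * c z * d x
     + a z * b x * c y * d v - a z * b x * c v * d y - a z * b y * c x * d v + a z * b y * c v * d x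
     + a z * b v * c x * d y - a z * b v * c y * d x - a v * b x * c y * d z + a v * b x * c z * d y
     + a v * b y * c x * d z - a v * b y * c z * d x - a v * b z * c x * d y + a v * b z * c y * d x"
proof -
  have s: "{..<4::nat} = insert 0 (insert 1 (insert 2 (insert 3 {})))" by auto
  have "finite {1, 2, 3::nat}" "0 \<notin> {1, 2, 3::nat}" "finite {2, 3::nat}" "1 \<notin> {2, 3::nat}" "finite {3::nat}" "2 \<notin> {3::nat}"
    by auto
  note ins = sum_over_permutations_insert[OF this(1,2)] sum_over_permutations_insert[OF this(3,4)]
    sum_over_permutations_insert[OF this(5,6)]
  have perm: "permutation (Transposition.transpose i j)" "permutation (Transposition.transpose i j \<circ> Transposition.transpose k l)" for i j k l :: nat
    by (simp_all add: permutation_swap_id permutation_compose)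
  show ?thesis
    unfolding wedge1111_def s ins permutes_sing
    by (simp add: sign_compose perm sign_swap_id Transposition.transpose_def)
qed


lemma wedge1111_skew:
  "wedge1111 a b c d y x z v = - wedge1111 a b c d x y z v"
  "wedge1111 a b c d x z y v = - wedge1111 a b c d x y z v"
  "wedge1111 a b c d x y v z = - wedge1111 a b c d x y z v"
  unfolding wedge1111_expand by (simp_all add: algebra_simps)

lemma cayley_form_skew:
  "cayley_form e y x z v = - cayley_form e x y z v"
  "cayley_form e x z y v = - cayley_form e x y z v"
  "cayley_form e x y v z = - cayley_form e x y z v"
  unfolding cayley_form_def Let_def
    wedge1111_skew(1)[of _ _ _ _ y x] wedge1111_skew(2)[of _ _ _ _ x z y] wedge1111_skew(3)[of _ _ _ _ x y v z]
  by simp_all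

definition kronecker :: "nat \<Rightarrow> nat \<Rightarrow> real" where
  "kronecker i j = (if i = j then 1 else 0)"

text \<open>The components of the form in its own coframe: indices play the role of the dual frame
  and Kronecker deltas that of the coframe.\<close>

definition psi :: "nat \<Rightarrow> nat \<Rightarrow> nat \<Rightarrow> nat \<Rightarrow> real" where
  "psi = cayley_form kronecker"

lemma psi_skew:
  "psi b a c d = - psi a b c d" "psi a c b d = - psi a b c d" "psi a b d c = - psi a b c d"
  unfolding psi_def by (rule cayley_form_skew)+

lemma psi_eq: "psi a a c d = 0" "psi a b b d = 0" "psi a b c c = 0"
  using psi_skew(1)[of a a c d] psi_skew(2)[of a b b d] psi_skew(3)[of a b c c] by simp_all

lemma wedge1111_delta_sorted:
  assumes "i < j" "j < k" "k < l" "a < b" "b < c" "c < (d::nat)"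
  shows "wedge1111 (kronecker i) (kronecker j) (kronecker k) (kronecker l) a b c d =
    (if i = a \<and> j = b \<and> k = c \<and> l = d then 1 else 0)"
  using assms unfolding wedge1111_expand kronecker_def by auto

text \<open>On numerals the guarded swaps terminate as rewrite rules and bring each component to
  increasing indices, where \<open>psi_values\<close> decides it.\<close>

lemma psi_sort:
  "b < a \<Longrightarrow> psi a b c d = - psi b a c d" "c < b \<Longrightarrow> psi a b c d = - psi a c b d" "d < c \<Longrightarrow> psi a b c d = - psi a b d c"
  "psi a b a d = 0" "psi a b c a = 0" "psi a b c b = 0"
  by (rule psi_skew, rule psi_skew, rule psi_skew)
    (metis psi_skew(1,2) psi_eq(1) minus_zero, metis psi_skew(2,3) psi_eq(1) minus_zero, metis psi_skew(3) psi_eq(2) minus_zero)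

lemma psi_values:
    "psi 0 (Suc 0) 2 3 = 0" "psi 0 (Suc 0) 2 4 = 0" "psi 0 (Suc 0) 2 5 = 0" "psi 0 (Suc 0) 2 6 = 0"
    "psi 0 (Suc 0) 2 7 = -1" "psi 0 (Suc 0) 3 4 = 0" "psi 0 (Suc 0) 3 5 = -1" "psi 0 (Suc 0) 3 6 = 0"
    "psi 0 (Suc 0) 3 7 = 0" "psi 0 (Suc 0) 4 5 = 0" "psi 0 (Suc 0) 4 6 = 1" "psi 0 (Suc 0) 4 7 = 0"
    "psi 0 (Suc 0) 5 6 = 0" "psi 0 (Suc 0) 5 7 = 0" "psi 0 (Suc 0) 6 7 = 0" "psi 0 2 3 4 = 0" "psi 0 2 3 5 = 0"
    "psi 0 2 3 6 = 1" "psi 0 2 3 7 = 0" "psi 0 2 4 5 = 1" "psi 0 2 4 6 = 0" "psi 0 2 4 7 = 0" "psi 0 2 5 6 = 0"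
    "psi 0 2 5 7 = 0" "psi 0 2 6 7 = 0" "psi 0 3 4 5 = 0" "psi 0 3 4 6 = 0" "psi 0 3 4 7 = -1" "psi 0 3 5 6 = 0"
    "psi 0 3 5 7 = 0" "psi 0 3 6 7 = 0" "psi 0 4 5 6 = 0" "psi 0 4 5 7 = 0" "psi 0 4 6 7 = 0" "psi 0 5 6 7 = -1"
    "psi (Suc 0) 2 3 4 = -1" "psi (Suc 0) 2 3 5 = 0" "psi (Suc 0) 2 3 6 = 0" "psi (Suc 0) 2 3 7 = 0"
    "psi (Suc 0) 2 4 5 = 0" "psi (Suc 0) 2 4 6 = 0" "psi (Suc 0) 2 4 7 = 0" "psi (Suc 0) 2 5 6 = -1"
    "psi (Suc 0) 2 5 7 = 0" "psi (Suc 0) 2 6 7 = 0" "psi (Suc 0) 3 4 5 = 0" "psi (Suc 0) 3 4 6 = 0"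
    "psi (Suc 0) 3 4 7 = 0" "psi (Suc 0) 3 5 6 = 0" "psi (Suc 0) 3 5 7 = 0" "psi (Suc 0) 3 6 7 = -1"
    "psi (Suc 0) 4 5 6 = 0" "psi (Suc 0) 4 5 7 = -1" "psi (Suc 0) 4 6 7 = 0" "psi (Suc 0) 5 6 7 = 0"
    "psi 2 3 4 5 = 0" "psi 2 3 4 6 = 0" "psi 2 3 4 7 = 0" "psi 2 3 5 6 = 0" "psi 2 3 5 7 = -1" "psi 2 3 6 7 = 0"
    "psi 2 4 5 6 = 0" "psi 2 4 5 7 = 0" "psi 2 4 6 7 = 1" "psi 2 5 6 7 = 0" "psi 3 4 5 6 = -1" "psi 3 4 5 7 = 0"
    "psi 3 4 6 7 = 0" "psi 3 5 6 7 = 0" "psi 4 5 6 7 = 0"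
  by (simp_all add: psi_def cayley_form_def Let_def wedge1111_delta_sorted)

lemmas psi_eval = psi_eq psi_sort psi_values

text \<open>The matrix \<alpha> acting on a 4-tensor as a derivation. For skew \<alpha>, vanishing
  at \<open>psi\<close> says that \<alpha> lies in the Lie algebra of the stabiliser of the
  form.\<close>

definition act4 :: "(nat \<Rightarrow> nat \<Rightarrow> real) \<Rightarrow> (nat \<Rightarrow> nat \<Rightarrow> nat \<Rightarrow> nat \<Rightarrow> real) \<Rightarrow> nat \<Rightarrow> nat \<Rightarrow> nat \<Rightarrow> nat \<Rightarrow> real" where
  "act4 \<alpha> P a b c d = (\<Sum>s<8. \<alpha> a s * P s b c d + \<alpha> b s * P a s c d + \<alpha> c s * P a b s d + \<alpha> d s * P a b c s)"

lemma sum_lessThan_8: "(\<Sum>i<8::nat. f i) = f 0 + f (Suc 0) + f 2 + f 3 + f 4 + f 5 + f 6 + f 7"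
  by (simp add: eval_nat_numeral)

section \<open>The algebra spin(7), by its action and as an eigenspace\<close>

context
  fixes \<alpha> :: "nat \<Rightarrow> nat \<Rightarrow> real"
  assumes skew: "\<And>a b. \<alpha> b a = - \<alpha> a b"
begin

lemma diag_zero: "\<alpha> a a = 0"
  using skew[of a a] by simp

lemma skew_sort: "b < a \<Longrightarrow> \<alpha> a b = - \<alpha> b a"
  by (rule skew)

text \<open>The seven equations that cut \<open>spin(7)\<close> out of \<open>\<Lambda>\<^sup>2\<close>.\<close>

definition spin7_relations :: bool where
  "spin7_relations \<longleftrightarrow>
     \<alpha> 0 4 + \<alpha> 2 5 + \<alpha> 1 6 - \<alpha> 3 7 = 0 \<and>
     - \<alpha> 0 3 + \<alpha> 1 5 - \<alpha> 2 6 - \<alpha> 4 7 = 0 \<and>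
     - \<alpha> 2 3 - \<alpha> 1 4 + \<alpha> 0 6 - \<alpha> 5 7 = 0 \<and>
     - \<alpha> 1 3 + \<alpha> 2 4 - \<alpha> 0 5 - \<alpha> 6 7 = 0 \<and>
     \<alpha> 0 2 - \<alpha> 4 5 - \<alpha> 3 6 - \<alpha> 1 7 = 0 \<and>
     \<alpha> 1 2 + \<alpha> 3 4 + \<alpha> 5 6 + \<alpha> 0 7 = 0 \<and>
     - \<alpha> 0 1 - \<alpha> 3 5 + \<alpha> 4 6 - \<alpha> 2 7 = 0"

text \<open>The seven chosen components of the action are exactly the seven relations. This
  direction serves the last index pair of R, which annihilates \<Psi> because \<Psi> is
  parallel.\<close>

lemma spin7_relations_of_act4:
  assumes "\<And>a b c d. a < 8 \<Longrightarrow> b < 8 \<Longrightarrow> c < 8 \<Longrightarrow> d < 8 \<Longrightarrow> act4 \<alpha> psi a b c d = 0"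
  shows spin7_relations
  using assms[of 0 1 2 3] assms[of 0 1 2 4] assms[of 0 1 2 5] assms[of 0 1 2 6] assms[of 0 1 3 4] assms[of 0 1 3 6] assms[of 0 2 3 4]
  unfolding spin7_relations_def act4_def sum_lessThan_8
  by (simp add: psi_eval diag_zero skew_sort)

lemma spin7_eigen_values:
  assumes spin7_relations
  shows
    "(\<Sum>a<8. \<Sum>b<8. \<alpha> a b * psi a b 0 (Suc 0)) = 2 * \<alpha> 0 (Suc 0)"
    "(\<Sum>a<8. \<Sum>b<8. \<alpha> a b * psi a b 0 2) = 2 * \<alpha> 0 2"
    "(\<Sum>a<8. \<Sum>b<8. \<alpha> a b * psi a b 0 3) = 2 * \<alpha> 0 3"
    "(\<Sum>a<8. \<Sum>b<8. \<alpha> a b * psi a b 0 4) = 2 * \<alpha> 0 4"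
    "(\<Sum>a<8. \<Sum>b<8. \<alpha> a b * psi a b 0 5) = 2 * \<alpha> 0 5"
    "(\<Sum>a<8. \<Sum>b<8. \<alpha> a b * psi a b 0 6) = 2 * \<alpha> 0 6"
    "(\<Sum>a<8. \<Sum>b<8. \<alpha> a b * psi a b 0 7) = 2 * \<alpha> 0 7"
    "(\<Sum>a<8. \<Sum>b<8. \<alpha> a b * psi a b (Suc 0) 2) = 2 * \<alpha> (Suc 0) 2"
    "(\<Sum>a<8. \<Sum>b<8. \<alpha> a b * psi a b (Suc 0) 3) = 2 * \<alpha> (Suc 0) 3"
    "(\<Sum>a<8. \<Sum>b<8. \<alpha> a b * psi a b (Suc 0) 4) = 2 * \<alpha> (Suc 0) 4"
    "(\<Sum>a<8. \<Sum>b<8. \<alpha> a b * psi a b (Suc 0) 5) = 2 * \<alpha> (Suc 0) 5"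
    "(\<Sum>a<8. \<Sum>b<8. \<alpha> a b * psi a b (Suc 0) 6) = 2 * \<alpha> (Suc 0) 6"
    "(\<Sum>a<8. \<Sum>b<8. \<alpha> a b * psi a b (Suc 0) 7) = 2 * \<alpha> (Suc 0) 7"
    "(\<Sum>a<8. \<Sum>b<8. \<alpha> a b * psi a b 2 3) = 2 * \<alpha> 2 3"
    "(\<Sum>a<8. \<Sum>b<8. \<alpha> a b * psi a b 2 4) = 2 * \<alpha> 2 4"
    "(\<Sum>a<8. \<Sum>b<8. \<alpha> a b * psi a b 2 5) = 2 * \<alpha> 2 5"
    "(\<Sum>a<8. \<Sum>b<8. \<alpha> a b * psi a b 2 6) = 2 * \<alpha> 2 6"
    "(\<Sum>a<8. \<Sum>b<8. \<alpha> a b * psi a b 2 7) = 2 * \<alpha> 2 7"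
    "(\<Sum>a<8. \<Sum>b<8. \<alpha> a b * psi a b 3 4) = 2 * \<alpha> 3 4"
    "(\<Sum>a<8. \<Sum>b<8. \<alpha> a b * psi a b 3 5) = 2 * \<alpha> 3 5"
    "(\<Sum>a<8. \<Sum>b<8. \<alpha> a b * psi a b 3 6) = 2 * \<alpha> 3 6"
    "(\<Sum>a<8. \<Sum>b<8. \<alpha> a b * psi a b 3 7) = 2 * \<alpha> 3 7"
    "(\<Sum>a<8. \<Sum>b<8. \<alpha> a b * psi a b 4 5) = 2 * \<alpha> 4 5"
    "(\<Sum>a<8. \<Sum>b<8. \<alpha> a b * psi a b 4 6) = 2 * \<alpha> 4 6"
    "(\<Sum>a<8. \<Sum>b<8. \<alpha> a b * psi a b 4 7) = 2 * \<alpha> 4 7"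
    "(\<Sum>a<8. \<Sum>b<8. \<alpha> a b * psi a b 5 6) = 2 * \<alpha> 5 6"
    "(\<Sum>a<8. \<Sum>b<8. \<alpha> a b * psi a b 5 7) = 2 * \<alpha> 5 7"
    "(\<Sum>a<8. \<Sum>b<8. \<alpha> a b * psi a b 6 7) = 2 * \<alpha> 6 7"
  using assms unfolding spin7_relations_def sum_lessThan_8
  by (simp_all add: psi_eval diag_zero skew_sort)

lemma spin7_eigen_of_relations:
  assumes spin7_relations "k < 8" "l < 8"
  shows "(\<Sum>a<8. \<Sum>b<8. \<alpha> a b * psi a b k l) = 2 * \<alpha> k l"
proof -
  have *: "(\<Sum>a<8. \<Sum>b<8. \<alpha> a b * psi a b k l) = 2 * \<alpha> k l" if "k < l" "k < 8" "l < 8" for k l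
  proof -
    have "\<forall>l\<in>{0, Suc 0, 2, 3, 4, 5, 6, 7}. \<forall>k\<in>{0, Suc 0, 2, 3, 4, 5, 6, 7}. k < l \<longrightarrow>
      (\<Sum>a<8. \<Sum>b<8. \<alpha> a b * psi a b k l) = 2 * \<alpha> k l"
      by (simp add: spin7_eigen_values[OF assms(1)])
    moreover have "k \<in> {0, Suc 0, 2, 3, 4, 5, 6, 7}" "l \<in> {0, Suc 0, 2, 3, 4, 5, 6, 7}" using that by auto
    ultimately show ?thesis using that by blast
  qed
  consider "k < l" | "k = l" | "l < k" by linarith
  then show ?thesis
  proof cases
    case 3
    have "(\<Sum>a<8. \<Sum>b<8. \<alpha> a b * psi a b k l) = - (\<Sum>a<8. \<Sum>b<8. \<alpha> a b * psi a b l k)"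
      by (simp add: psi_skew(3)[of _ _ l k] sum_negf)
    then show ?thesis using *[OF 3 assms(3,2)] skew[of l k] by simp
  qed (use * assms in \<open>simp_all add: psi_eq diag_zero\<close>)
qed

text \<open>Each of the 28 index pairs occurs in exactly one relation, and the eigenvalue equation
  at a pair is a multiple of that relation. This direction serves the first index pair of an
  instanton.\<close>

lemma spin7_relations_of_eigen:
  assumes "\<And>k l. k < 8 \<Longrightarrow> l < 8 \<Longrightarrow> (\<Sum>a<8. \<Sum>b<8. \<alpha> a b * psi a b k l) = 2 * \<alpha> k l"
  shows spin7_relations
  using assms[of 0 4] assms[of 0 3] assms[of 2 3] assms[of 1 3] assms[of 0 2] assms[of 1 2] assms[of 0 1]
  unfolding spin7_relations_def sum_lessThan_8
  by (simp add: psi_eval diag_zero skew_sort)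

lemma act4_values:
  assumes spin7_relations
  shows
    "act4 \<alpha> psi 0 (Suc 0) 2 3 = 0"
    "act4 \<alpha> psi 0 (Suc 0) 2 4 = 0"
    "act4 \<alpha> psi 0 (Suc 0) 2 5 = 0"
    "act4 \<alpha> psi 0 (Suc 0) 2 6 = 0"
    "act4 \<alpha> psi 0 (Suc 0) 2 7 = 0"
    "act4 \<alpha> psi 0 (Suc 0) 3 4 = 0"
    "act4 \<alpha> psi 0 (Suc 0) 3 5 = 0"
    "act4 \<alpha> psi 0 (Suc 0) 3 6 = 0"
    "act4 \<alpha> psi 0 (Suc 0) 3 7 = 0"
    "act4 \<alpha> psi 0 (Suc 0) 4 5 = 0"
    "act4 \<alpha> psi 0 (Suc 0) 4 6 = 0"
    "act4 \<alpha> psi 0 (Suc 0) 4 7 = 0"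
    "act4 \<alpha> psi 0 (Suc 0) 5 6 = 0"
    "act4 \<alpha> psi 0 (Suc 0) 5 7 = 0"
    "act4 \<alpha> psi 0 (Suc 0) 6 7 = 0"
    "act4 \<alpha> psi 0 2 3 4 = 0"
    "act4 \<alpha> psi 0 2 3 5 = 0"
    "act4 \<alpha> psi 0 2 3 6 = 0"
    "act4 \<alpha> psi 0 2 3 7 = 0"
    "act4 \<alpha> psi 0 2 4 5 = 0"
    "act4 \<alpha> psi 0 2 4 6 = 0"
    "act4 \<alpha> psi 0 2 4 7 = 0"
    "act4 \<alpha> psi 0 2 5 6 = 0"
    "act4 \<alpha> psi 0 2 5 7 = 0"
    "act4 \<alpha> psi 0 2 6 7 = 0"
    "act4 \<alpha> psi 0 3 4 5 = 0"
    "act4 \<alpha> psi 0 3 4 6 = 0"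
    "act4 \<alpha> psi 0 3 4 7 = 0"
    "act4 \<alpha> psi 0 3 5 6 = 0"
    "act4 \<alpha> psi 0 3 5 7 = 0"
    "act4 \<alpha> psi 0 3 6 7 = 0"
    "act4 \<alpha> psi 0 4 5 6 = 0"
    "act4 \<alpha> psi 0 4 5 7 = 0"
    "act4 \<alpha> psi 0 4 6 7 = 0"
    "act4 \<alpha> psi 0 5 6 7 = 0"
    "act4 \<alpha> psi (Suc 0) 2 3 4 = 0"
    "act4 \<alpha> psi (Suc 0) 2 3 5 = 0"
    "act4 \<alpha> psi (Suc 0) 2 3 6 = 0"
    "act4 \<alpha> psi (Suc 0) 2 3 7 = 0"
    "act4 \<alpha> psi (Suc 0) 2 4 5 = 0"
    "act4 \<alpha> psi (Suc 0) 2 4 6 = 0"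
    "act4 \<alpha> psi (Suc 0) 2 4 7 = 0"
    "act4 \<alpha> psi (Suc 0) 2 5 6 = 0"
    "act4 \<alpha> psi (Suc 0) 2 5 7 = 0"
    "act4 \<alpha> psi (Suc 0) 2 6 7 = 0"
    "act4 \<alpha> psi (Suc 0) 3 4 5 = 0"
    "act4 \<alpha> psi (Suc 0) 3 4 6 = 0"
    "act4 \<alpha> psi (Suc 0) 3 4 7 = 0"
    "act4 \<alpha> psi (Suc 0) 3 5 6 = 0"
    "act4 \<alpha> psi (Suc 0) 3 5 7 = 0"
    "act4 \<alpha> psi (Suc 0) 3 6 7 = 0"
    "act4 \<alpha> psi (Suc 0) 4 5 6 = 0"
    "act4 \<alpha> psi (Suc 0) 4 5 7 = 0"
    "act4 \<alpha> psi (Suc 0) 4 6 7 = 0"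
    "act4 \<alpha> psi (Suc 0) 5 6 7 = 0"
    "act4 \<alpha> psi 2 3 4 5 = 0"
    "act4 \<alpha> psi 2 3 4 6 = 0"
    "act4 \<alpha> psi 2 3 4 7 = 0"
    "act4 \<alpha> psi 2 3 5 6 = 0"
    "act4 \<alpha> psi 2 3 5 7 = 0"
    "act4 \<alpha> psi 2 3 6 7 = 0"
    "act4 \<alpha> psi 2 4 5 6 = 0"
    "act4 \<alpha> psi 2 4 5 7 = 0"
    "act4 \<alpha> psi 2 4 6 7 = 0"
    "act4 \<alpha> psi 2 5 6 7 = 0"
    "act4 \<alpha> psi 3 4 5 6 = 0"
    "act4 \<alpha> psi 3 4 5 7 = 0"
    "act4 \<alpha> psi 3 4 6 7 = 0"
    "act4 \<alpha> psi 3 5 6 7 = 0"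
    "act4 \<alpha> psi 4 5 6 7 = 0"
  using assms unfolding spin7_relations_def act4_def sum_lessThan_8
  by (simp_all add: psi_eval diag_zero skew_sort)

text \<open>The derivation of a skew form is again skew in all four slots, so the 70 components with
  increasing indices in \<open>act4_values\<close> suffice.\<close>

lemma act4_of_relations:
  assumes spin7_relations "a < 8" "b < 8" "c < 8" "d < 8"
  shows "act4 \<alpha> psi a b c d = 0"
proof -
  let ?F = "act4 \<alpha> psi"
  have sk1: "?F b a c d = - ?F a b c d" for a b c d
    unfolding act4_def sum_negf[symmetric]
  proof (rule sum.cong[OF refl])
    fix s
    show "\<alpha> b s * psi s a c d + \<alpha> a s * psi b s c d + \<alpha> c s * psi b a s d + \<alpha> d s * psi b a c s =
      - (\<alpha> a s * psi s b c d + \<alpha> b s * psi a s c d + \<alpha> c s * psi a b s d + \<alpha> d s * psi a b c s)"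
      unfolding psi_skew(1)[of s a] psi_skew(1)[of b s] psi_skew(1)[of b a] by simp
  qed
  have sk2: "?F a c b d = - ?F a b c d" for a b c d
    unfolding act4_def sum_negf[symmetric]
  proof (rule sum.cong[OF refl])
    fix s
    show "\<alpha> a s * psi s c b d + \<alpha> c s * psi a s b d + \<alpha> b s * psi a c s d + \<alpha> d s * psi a c b s =
      - (\<alpha> a s * psi s b c d + \<alpha> b s * psi a s c d + \<alpha> c s * psi a b s d + \<alpha> d s * psi a b c s)"
      unfolding psi_skew(2)[of _ s b] psi_skew(2)[of _ c s] psi_skew(2)[of _ c b] by simp
  qed
  have sk3: "?F a b d c = - ?F a b c d" for a b c d
    unfolding act4_def sum_negf[symmetric]
  proof (rule sum.cong[OF refl])
    fix s
    show "\<alpha> a s * psi s b d c + \<alpha> b s * psi a s d c + \<alpha> d s * psi a b s c + \<alpha> c s * psi a b d s =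
      - (\<alpha> a s * psi s b c d + \<alpha> b s * psi a s c d + \<alpha> c s * psi a b s d + \<alpha> d s * psi a b c s)"
      unfolding psi_skew(3)[of _ _ s c] psi_skew(3)[of _ _ d s] psi_skew(3)[of _ _ d c] by simp
  qed
  note sk = sk1 sk2 sk3
  have z: "?F a a c d = 0" "?F a b b d = 0" "?F a b c c = 0" for a b c d
    using sk(1)[of a a c d] sk(2)[of a b b d] sk(3)[of a b c c] by simp_all
  have sorted: "?F a b c d = 0" if "a < b" "b < c" "c < d" "a < 8" "b < 8" "c < 8" "d < 8" for a b c d
  proof -
    let ?S = "{0, Suc 0, 2, 3, 4, 5, 6, 7}"
    have "\<forall>d\<in>?S. \<forall>c\<in>?S. c < d \<longrightarrow> (\<forall>b\<in>?S. b < c \<longrightarrow> (\<forall>a\<in>?S. a < b \<longrightarrow> ?F a b c d = 0))"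
      by (simp add: act4_values[OF assms(1)])
    moreover have "a \<in> ?S" "b \<in> ?S" "c \<in> ?S" "d \<in> ?S" using that by auto
    ultimately show ?thesis using that by blast
  qed
  \<comment> \<open>Insertion sort on the indices: here a is arbitrary among increasing b, c, d;
    then b is freed, and finally the order of c and d.\<close>
  have S3: "?F a b c d = 0" if "b < c" "c < d" "a < 8" "b < 8" "c < 8" "d < 8" for a b c d
  proof -
    consider "a < b" | "a = b" | "b < a" "a < c" | "a = c" | "c < a" "a < d" | "a = d" | "d < a" using that by linarith
    then show ?thesis
    proof cases
      case 1 then show ?thesis using sorted[of a b c d] that by simp
    next
      case 2 then show ?thesis using z(1)[of a c d] by simp
    next
      case 3 then show ?thesis using sorted[of b a c d] sk1[of a b c d] that by simp
    next
      case 4 then show ?thesis using z(2)[of b a d] sk1[of a b c d] by simp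
    next
      case 5 then show ?thesis using sorted[of b c a d] sk1[of a b c d] sk2[of b a c d] that by simp
    next
      case 6 then show ?thesis using z(3)[of b c a] sk1[of a b c d] sk2[of b a c d] by simp
    next
      case 7 then show ?thesis using sorted[of b c d a] sk1[of a b c d] sk2[of b a c d] sk3[of b c a d] that by simp
    qed
  qed
  have S2: "?F a b c d = 0" if "c < d" "a < 8" "b < 8" "c < 8" "d < 8" for a b c d
  proof -
    consider "b < c" | "b = c" | "c < b" "b < d" | "b = d" | "d < b" using that by linarith
    then show ?thesis
    proof cases
      case 1 then show ?thesis using S3[of b c d a] that by simp
    next
      case 2 then show ?thesis using z(2)[of a b d] by simp
    next
      case 3 then show ?thesis using S3[of c b d a] sk2[of a b c d] that by simp
    next
      case 4 then show ?thesis using z(3)[of a c b] sk2[of a b c d] by simp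
    next
      case 5 then show ?thesis using S3[of c d b a] sk2[of a b c d] sk3[of a c b d] that by simp
    qed
  qed
  consider "c < d" | "c = d" | "d < c" by linarith
  then show ?thesis
  proof cases
    case 1 then show ?thesis using S2[of c d a b] assms by simp
  next
    case 2 then show ?thesis using z(3)[of a b c] by simp
  next
    case 3 then show ?thesis using S2[of d c a b] sk3[of a b c d] assms by simp
  qed
qed

end

section \<open>Orthonormal frames\<close>

locale spin7_manifold = manifold A for A :: "'a::t2_space chart set" +
  fixes \<Psi> :: "'a form4" and g :: "'a metric2"
  assumes spin7: "spin7_structure A \<Psi>" and metric: "induced_metric A \<Psi> g"
begin

lemma coframe_ex:
  obtains U \<theta> where "p \<in> U" "open U" "adapted_coframe A \<Psi> U \<theta>"
proof -
  obtain U \<theta> where "p \<in> U" "adapted_coframe A \<Psi> U \<theta>"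
    using spin7 unfolding spin7_structure_def by blast
  moreover from this(2) have "open U" unfolding adapted_coframe_def local_coframe_def by simp
  ultimately show thesis using that by blast
qed

section \<open>Frames dual to an adapted coframe\<close>

context
  fixes U \<theta>
  assumes cof: "adapted_coframe A \<Psi> U \<theta>"
begin

lemma cof_open: "open U"
  using cof unfolding adapted_coframe_def local_coframe_def by simp

lemma cof_lin: "i < 8 \<Longrightarrow> q \<in> U \<Longrightarrow> v \<in> tangent_space A q \<Longrightarrow> w \<in> tangent_space A q \<Longrightarrow>
    \<theta> i q (\<lambda>f. a * v f + b * w f) = a * \<theta> i q v + b * \<theta> i q w"
  using cof unfolding adapted_coframe_def local_coframe_def by simp

lemma cof_smooth: "i < 8 \<Longrightarrow> X \<in> vfields A \<Longrightarrow> smooth_fun_on A U (\<lambda>q. \<theta> i q (X q))"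
  using cof unfolding adapted_coframe_def local_coframe_def by simp

lemma cof_indep: "q \<in> U \<Longrightarrow> (\<And>v. v \<in> tangent_space A q \<Longrightarrow> (\<Sum>i<8. c i * \<theta> i q v) = 0) \<Longrightarrow> i < 8 \<Longrightarrow> c i = (0::real)"
  using cof unfolding adapted_coframe_def local_coframe_def by simp

lemma cof_metric: "q \<in> U \<Longrightarrow> v \<in> tangent_space A q \<Longrightarrow> w \<in> tangent_space A q \<Longrightarrow> g q v w = (\<Sum>i<8. \<theta> i q v * \<theta> i q w)"
  using metric cof unfolding induced_metric_def by blast

lemma cof_form: "q \<in> U \<Longrightarrow> x \<in> tangent_space A q \<Longrightarrow> y \<in> tangent_space A q \<Longrightarrow> z \<in> tangent_space A q \<Longrightarrow> v \<in> tangent_space A q \<Longrightarrow>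
    \<Psi> q x y z v = cayley_form (\<lambda>i. \<theta> i q) x y z v"
  using cof unfolding adapted_coframe_def by simp

lemma cof_zero: "i < 8 \<Longrightarrow> q \<in> U \<Longrightarrow> \<theta> i q (\<lambda>f. 0) = 0"
  using cof_lin[of i q "\<lambda>f. 0" "\<lambda>f. 0" 0 0] by (simp add: tangent_zero)

lemma cof_sum:
  assumes "i < 8" "q \<in> U"
  shows "(\<And>j. j \<in> J \<Longrightarrow> v j \<in> tangent_space A q) \<Longrightarrow> \<theta> i q (\<lambda>f. \<Sum>j\<in>J. c j * v j f) = (\<Sum>j\<in>J. c j * \<theta> i q (v j))"
proof (induction J rule: infinite_finite_induct)
  case (insert j J)
  then show ?case
    using cof_lin[OF assms, of "v j" "\<lambda>f. \<Sum>j\<in>J. c j * v j f" "c j" 1] tangent_sum[of J v q c] by simp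
qed (simp_all add: cof_zero assms)

text \<open>Components of \<open>real^8\<close> are indexed by the type 8, coframes by the naturals
  below 8.\<close>

lemma index_bij: obtains n :: "8 \<Rightarrow> nat" where "bij_betw n UNIV {..<8}"
proof -
  obtain h :: "8 \<Rightarrow> nat" where "bij_betw h UNIV {0..<card (UNIV :: 8 set)}"
    using ex_bij_betw_finite_nat[of "UNIV :: 8 set"] by auto
  then have "bij_betw h UNIV {..<8}" by (simp add: lessThan_atLeast0)
  then show thesis by (rule that)
qed

text \<open>Coordinates write every tangent vector as the image of a vector of
  \<open>real^8\<close>, so the coframe becomes a linear endomorphism of \<open>real^8\<close>. If
  it were not onto, its range would lie in a hyperplane, whose normal vector is a linear relation
  among the coframe. Being onto it is bijective, which yields both the dual vectors and
  injectivity.\<close>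

lemma cof_dual_inj:
  assumes q: "q \<in> U"
  shows "\<exists>e. \<forall>i<8. e i \<in> tangent_space A q \<and> (\<forall>j<8. \<theta> j q (e i) = (if i = j then 1 else 0))"
    and "v \<in> tangent_space A q \<Longrightarrow> (\<And>i. i < 8 \<Longrightarrow> \<theta> i q v = 0) \<Longrightarrow> v = (\<lambda>f. 0)"
proof -
  obtain V \<phi> where c: "(V, \<phi>) \<in> A" "q \<in> V" using chart_ex by blast
  obtain x N where x: "\<And>b. b \<in> Basis \<Longrightarrow> x b \<in> smooth_funs A" "open N" "q \<in> N" "N \<subseteq> V"
    "\<And>b q'. b \<in> Basis \<Longrightarrow> q' \<in> N \<Longrightarrow> x b q' = (\<phi> q' - \<phi> q) \<bullet> b" using coord_funs_ex[OF c] by metis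
  obtain n :: "8 \<Rightarrow> nat" where n: "bij_betw n UNIV {..<8}" using index_bij by blast
  have n8: "n i < 8" for i using n bij_betwE by blast
  let ?d = "\<lambda>b. coord_deriv V \<phi> b q"
  have td: "?d b \<in> tangent_space A q" for b by (rule coord_deriv_tangent[OF c])
  define w where "w y = (\<lambda>f. \<Sum>b\<in>Basis. (y \<bullet> b) * ?d b f)" for y :: "real^8"
  have wt: "w y \<in> tangent_space A q" for y unfolding w_def by (rule tangent_sum[OF td])
  have \<theta>w: "\<theta> i q (w y) = (\<Sum>b\<in>Basis. (y \<bullet> b) * \<theta> i q (?d b))" if "i < 8" for i y
    unfolding w_def by (rule cof_sum[OF that q td])
  define \<Phi> where "\<Phi> y = (\<chi> i. \<theta> (n i) q (w y))" for y :: "real^8"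
  have lin: "linear \<Phi>"
  proof (rule linearI)
    show "\<Phi> (y + z) = \<Phi> y + \<Phi> z" for y z
      by (simp add: vec_eq_iff \<Phi>_def \<theta>w[OF n8] inner_add_left distrib_right sum.distrib)
    show "\<Phi> (r *\<^sub>R y) = r *\<^sub>R \<Phi> y" for r y
      by (simp add: vec_eq_iff \<Phi>_def \<theta>w[OF n8] sum_distrib_left mult.assoc)
  qed
  have tangent_w: "\<exists>y. v = w y" if v: "v \<in> tangent_space A q" for v
  proof
    let ?y = "\<Sum>b\<in>Basis. v (x b) *\<^sub>R b :: real^8"
    have "?y \<bullet> b = v (x b)" if "b \<in> Basis" for b using that by (simp add: inner_sum_left inner_Basis if_distrib sum.delta cong: if_cong)
    then show "v = w ?y" unfolding w_def by (subst tangent_expansion[OF c v x]) simp_all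
  qed
  have "range \<Phi> = UNIV"
  proof (rule ccontr)
    assume ne: "range \<Phi> \<noteq> UNIV"
    have "span (range \<Phi>) = range \<Phi>" using lin by (simp add: span_eq_iff linear_subspace_image)
    then have "dim (range \<Phi>) \<noteq> DIM(real^8)" using ne dim_eq_full by metis
    then have "dim (range \<Phi>) < DIM(real^8)" using dim_subset_UNIV[of "range \<Phi>"] by simp
    from lowdim_subset_hyperplane[OF this] obtain a where a: "a \<noteq> 0" "span (range \<Phi>) \<subseteq> {x. a \<bullet> x = 0}" by blast
    have orth: "a \<bullet> \<Phi> y = 0" for y using a(2) span_base[of "\<Phi> y" "range \<Phi>"] by blast
    define k where "k j = a $ (inv_into UNIV n j)" for j
    have kn: "k (n i) = a $ i" for i unfolding k_def using n by (simp add: bij_betw_def)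
    have "(\<Sum>j<8. k j * \<theta> j q v) = 0" if v: "v \<in> tangent_space A q" for v
    proof -
      obtain y where y: "v = w y" using tangent_w[OF v] by blast
      have "(\<Sum>j<8. k j * \<theta> j q v) = (\<Sum>i\<in>UNIV. k (n i) * \<theta> (n i) q v)"
        by (rule sum.reindex_bij_betw[OF n, symmetric])
      also have "\<dots> = a \<bullet> \<Phi> y" by (simp add: kn y \<Phi>_def inner_vec_def)
      finally show ?thesis using orth by simp
    qed
    then have "k j = 0" if "j < 8" for j using cof_indep[OF q _ that] by blast
    then have "a $ i = 0" for i using kn n8 by metis
    then have "a = 0" by (simp add: vec_eq_iff)
    with a(1) show False by simp
  qed
  then have surj: "surj \<Phi>" .
  have inj: "inj \<Phi>" by (rule linear_surjective_imp_injective[OF lin surj]) simp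
  have nn: "\<exists>i. n i = j" if "j < 8" for j using n that unfolding bij_betw_def by (metis imageE lessThan_iff)
  show "\<exists>e. \<forall>i<8. e i \<in> tangent_space A q \<and> (\<forall>j<8. \<theta> j q (e i) = (if i = j then 1 else 0))"
  proof (intro exI allI impI conjI)
    fix i :: nat assume i: "i < 8"
    let ?e = "\<lambda>i. w (SOME y. \<Phi> y = (\<chi> m. if i = n m then 1 else 0))"
    show "?e i \<in> tangent_space A q" by (rule wt)
    fix j :: nat assume j: "j < 8"
    then obtain m where m: "n m = j" using nn by blast
    have "\<exists>y. \<Phi> y = (\<chi> m. if i = n m then 1 else 0)" using surj by (metis surjD)
    then have "\<Phi> (SOME y. \<Phi> y = (\<chi> m. if i = n m then 1 else 0)) = (\<chi> m. if i = n m then 1 else 0)" by (rule someI_ex)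
    from arg_cong[OF this, of "\<lambda>z. z $ m"]
    show "\<theta> j q (?e i) = (if i = j then 1 else 0)" by (simp add: \<Phi>_def m)
  qed
  show "v = (\<lambda>f. 0)" if v: "v \<in> tangent_space A q" and z: "\<And>i. i < 8 \<Longrightarrow> \<theta> i q v = 0"
  proof -
    obtain y where y: "v = w y" using tangent_w[OF v] by blast
    have "\<Phi> y = 0" using z y n8 by (simp add: \<Phi>_def vec_eq_iff)
    then have "y = 0" using inj lin by (metis injD linear_0)
    then show ?thesis using y by (simp add: w_def)
  qed
qed

text \<open>Gram-Schmidt style induction: the \<open>k\<close>-th step dualises against \<open>\<theta> k\<close> near \<open>p\<close> without changing values at \<open>p\<close>.\<close>

lemma cof_local_dual:
  assumes p: "p \<in> U" and k: "k \<le> 8"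
  shows "\<exists>Y N. (\<forall>i<8. Y i \<in> vfields A) \<and> open N \<and> p \<in> N \<and> N \<subseteq> U \<and>
    (\<forall>q\<in>N. \<forall>i<8. \<forall>j<k. \<theta> j q (Y i q) = (if i = j then 1 else 0)) \<and>
    (\<forall>i<8. \<forall>j<8. \<theta> j p (Y i p) = (if i = j then 1 else 0))"
  using k
proof (induction k)
  case 0
  obtain e where e: "\<And>i. i < 8 \<Longrightarrow> e i \<in> tangent_space A p \<and> (\<forall>j<8. \<theta> j p (e i) = (if i = j then 1 else 0))"
    using cof_dual_inj(1)[OF p] by blast
  have "\<exists>X. i < 8 \<longrightarrow> X \<in> vfields A \<and> X p = e i" for i using vfield_through[of "e i" p] e by metis
  then obtain Y where "\<And>i. i < 8 \<longrightarrow> Y i \<in> vfields A \<and> Y i p = e i" by metis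
  then have "(\<forall>i<8. Y i \<in> vfields A) \<and> open U \<and> p \<in> U \<and> U \<subseteq> U \<and>
    (\<forall>q\<in>U. \<forall>i<8. \<forall>j<0. \<theta> j q (Y i q) = (if i = j then 1 else 0)) \<and>
    (\<forall>i<8. \<forall>j<8. \<theta> j p (Y i p) = (if i = j then 1 else 0))" using e p cof_open by simp
  then show ?case by blast
next
  case (Suc k)
  then have "k \<le> 8" by simp
  from Suc.IH[OF this] obtain Y N where YN0: "(\<forall>i<8. Y i \<in> vfields A) \<and> open N \<and> p \<in> N \<and> N \<subseteq> U \<and>
    (\<forall>q\<in>N. \<forall>i<8. \<forall>j<k. \<theta> j q (Y i q) = (if i = j then 1 else 0)) \<and>
    (\<forall>i<8. \<forall>j<8. \<theta> j p (Y i p) = (if i = j then 1 else 0))"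
    by (elim exE)
  then have Y: "\<And>i. i < 8 \<Longrightarrow> Y i \<in> vfields A" and N: "open N" "p \<in> N" "N \<subseteq> U"
    and YN: "\<And>q i j. q \<in> N \<Longrightarrow> i < 8 \<Longrightarrow> j < k \<Longrightarrow> \<theta> j q (Y i q) = (if i = j then 1 else 0)"
    and Yp: "\<And>i j. i < 8 \<Longrightarrow> j < 8 \<Longrightarrow> \<theta> j p (Y i p) = (if i = j then 1 else 0)"
    by simp_all
  have k8: "k < 8" using Suc.prems by simp
  let ?u = "\<lambda>q. \<theta> k q (Y k q)"
  have su: "smooth_fun_on A N ?u" by (rule smooth_fun_on_subset[OF cof_smooth[OF k8 Y[OF k8]] N(3)])
  have cu: "continuous_on N ?u" by (rule smooth_fun_on_continuous[OF N(1) su])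
  define N1 where "N1 = ?u -` (- {0}) \<inter> N"
  have oN1: "open N1" unfolding N1_def
    using cu unfolding continuous_on_open_vimage[OF N(1)] by (elim allE[of _ "- {0}"]) (simp add: open_Compl)
  have pN1: "p \<in> N1" using N(2) Yp[OF k8 k8] by (simp add: N1_def)
  have "smooth_fun_on A N1 (\<lambda>q. 1 / ?u q)"
    by (rule smooth_fun_on_inverse[OF oN1 smooth_fun_on_subset[OF su]]) (auto simp: N1_def)
  from smooth_extension[OF oN1 pN1 this] obtain s N2 where
    s: "s \<in> smooth_funs A" "open N2" "p \<in> N2" "N2 \<subseteq> N1" "\<And>q. q \<in> N2 \<Longrightarrow> s q = 1 / ?u q" by metis
  have "\<exists>h M. h \<in> smooth_funs A \<and> open M \<and> p \<in> M \<and> M \<subseteq> N \<and> (\<forall>q\<in>M. h q = \<theta> k q (Y i q))" if i: "i < 8" for i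
    using smooth_extension[OF N(1,2) smooth_fun_on_subset[OF cof_smooth[OF k8 Y[OF i]] N(3)]] by metis
  then obtain h M where h: "\<And>i. i < 8 \<Longrightarrow> h i \<in> smooth_funs A \<and> open (M i) \<and> p \<in> M i \<and> M i \<subseteq> N \<and> (\<forall>q\<in>M i. h i q = \<theta> k q (Y i q))"
    by metis
  define N3 where "N3 = N2 \<inter> (\<Inter>i\<in>{..<8}. M i)"
  have oN3: "open N3" unfolding N3_def using h by (intro open_Int s(2) open_INT) auto
  have pN3: "p \<in> N3" using s(3) h by (auto simp: N3_def)
  have N3N: "N3 \<subseteq> N" using s(4) by (auto simp: N3_def N1_def)
  \<comment> \<open>\<theta> k of Z is 1 near p, so subtracting h i times Z removes \<theta> k of Y
    i. The pairings with j < k survive because \<theta> j of Y k already vanishes there.\<close>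
  define Z where "Z = vf_scale s (Y k)"
  define Y' where "Y' i = (if i = k then Z else vf_diff (Y i) (vf_scale (h i) Z))" for i
  have Zv: "Z \<in> vfields A" unfolding Z_def by (rule vf_scale_vfields[OF s(1) Y[OF k8]])
  have Y'v: "Y' i \<in> vfields A" if "i < 8" for i
    unfolding Y'_def using Zv h[OF that] Y[OF that] by (simp add: vf_diff_vfields vf_scale_vfields)
  have \<theta>Z: "\<theta> j q (Z q) = s q * \<theta> j q (Y k q)" if "j < 8" "q \<in> U" for j q
    using cof_lin[OF that vfieldsD(1)[OF Y[OF k8], of q] tangent_zero[of q], of "s q" 0] by (simp add: Z_def vf_scale_def)
  have \<theta>Y': "\<theta> j q (Y' i q) = \<theta> j q (Y i q) - h i q * (s q * \<theta> j q (Y k q))" if "i < 8" "i \<noteq> k" "j < 8" "q \<in> U" for i j q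
    using cof_lin[OF that(3,4) vfieldsD(1)[OF Y[OF that(1)], of q] vfieldsD(1)[OF Zv, of q], of 1 "- h i q"] \<theta>Z[OF that(3,4)] that(2)
    by (simp add: Y'_def vf_diff_def vf_scale_def)
  have su1: "s q * ?u q = 1" if "q \<in> N3" for q
    using that s(4) s(5)[of q] by (auto simp: N3_def N1_def)
  have hq: "h i q = \<theta> k q (Y i q)" if "q \<in> N3" "i < 8" for i q
    using h[OF that(2)] that(1) that(2) by (auto simp: N3_def)
  have 1: "\<theta> j q (Y' i q) = (if i = j then 1 else 0)" if q: "q \<in> N3" and i: "i < 8" and j: "j < Suc k" for q i j
  proof -
    have qU: "q \<in> U" "q \<in> N" using q N3N N(3) by auto
    have j8: "j < 8" using j k8 by simp
    show ?thesis
    proof (cases "i = k")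
      case True
      then have "\<theta> j q (Y' i q) = s q * \<theta> j q (Y k q)" using \<theta>Z[OF j8 qU(1)] by (simp add: Y'_def)
      then show ?thesis using True su1[OF q] YN[OF qU(2) k8, of j] j by (cases "j = k") auto
    next
      case False
      have e: "\<theta> j q (Y' i q) = \<theta> j q (Y i q) - h i q * (s q * \<theta> j q (Y k q))" by (rule \<theta>Y'[OF i False j8 qU(1)])
      show ?thesis
      proof (cases "j = k")
        case True
        then show ?thesis using e su1[OF q] hq[OF q i] False by simp
      next
        case jk: False
        then have "j < k" using j by simp
        then show ?thesis using e YN[OF qU(2) k8, of j] YN[OF qU(2) i, of j] jk by simp
      qed
    qed
  qed
  have 2: "\<theta> j p (Y' i p) = (if i = j then 1 else 0)" if i: "i < 8" and j: "j < 8" for i j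
  proof (cases "i = k")
    case True
    then have "\<theta> j p (Y' i p) = s p * \<theta> j p (Y k p)" using \<theta>Z[OF j p] by (simp add: Y'_def)
    then show ?thesis using True su1[OF pN3] Yp[OF k8 j] by (cases "j = k") auto
  next
    case False
    have e: "\<theta> j p (Y' i p) = \<theta> j p (Y i p) - h i p * (s p * \<theta> j p (Y k p))" by (rule \<theta>Y'[OF i False j p])
    have "h i p = 0" using hq[OF pN3 i] Yp[OF i k8] False by simp
    then show ?thesis using e Yp[OF i j] by simp
  qed
  have "(\<forall>i<8. Y' i \<in> vfields A) \<and> open N3 \<and> p \<in> N3 \<and> N3 \<subseteq> U \<and>
    (\<forall>q\<in>N3. \<forall>i<8. \<forall>j<Suc k. \<theta> j q (Y' i q) = (if i = j then 1 else 0)) \<and>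
    (\<forall>i<8. \<forall>j<8. \<theta> j p (Y' i p) = (if i = j then 1 else 0))"
    using Y'v oN3 pN3 N3N N(3) 1 2 by blast
  then show ?case by blast
qed

end

lemma local_adapted_frame:
  "\<exists>E N U \<theta>. (\<forall>a<8. E a \<in> vfields A) \<and> open N \<and> p \<in> N \<and> N \<subseteq> U \<and> adapted_coframe A \<Psi> U \<theta> \<and>
    (\<forall>q\<in>N. \<forall>a<8. \<forall>b<8. \<theta> a q (E b q) = (if b = a then 1 else 0))"
proof -
  obtain U \<theta> where U: "p \<in> U" "open U" "adapted_coframe A \<Psi> U \<theta>" by (rule coframe_ex)
  from cof_local_dual[OF U(3,1) order_refl] obtain E N where E: "(\<forall>i<8. E i \<in> vfields A) \<and> open N \<and> p \<in> N \<and> N \<subseteq> U \<and>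
    (\<forall>q\<in>N. \<forall>i<8. \<forall>j<8. \<theta> j q (E i q) = (if i = j then 1 else 0)) \<and>
    (\<forall>i<8. \<forall>j<8. \<theta> j p (E i p) = (if i = j then 1 else 0))" by (elim exE)
  then show ?thesis using U(3) by (intro exI[of _ E] exI[of _ N] exI[of _ U] exI[of _ \<theta>]) simp
qed

lemma local_orthonormal_frame:
  "\<exists>E N. (\<forall>a<8. E a \<in> vfields A) \<and> open N \<and> p \<in> N \<and> (\<forall>q\<in>N. orthonormal_at A g q E)"
proof -
  from local_adapted_frame[of p] obtain E N U \<theta> where E0: "(\<forall>a<8. E a \<in> vfields A) \<and> open N \<and> p \<in> N \<and> N \<subseteq> U \<and> adapted_coframe A \<Psi> U \<theta> \<and>
    (\<forall>q\<in>N. \<forall>a<8. \<forall>b<8. \<theta> a q (E b q) = (if b = a then 1 else 0))" by (elim exE)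
  then have E: "\<And>a. a < 8 \<Longrightarrow> E a \<in> vfields A" "open N" "p \<in> N" "N \<subseteq> U" "adapted_coframe A \<Psi> U \<theta>"
    "\<And>q a b. q \<in> N \<Longrightarrow> a < 8 \<Longrightarrow> b < 8 \<Longrightarrow> \<theta> a q (E b q) = (if b = a then 1 else 0)" by simp_all
  have "orthonormal_at A g q E" if q: "q \<in> N" for q
  proof -
    have "g q (E a q) (E b q) = (if a = b then 1 else 0)" if ab: "a < 8" "b < 8" for a b
    proof -
      have "g q (E a q) (E b q) = (\<Sum>i<8. \<theta> i q (E a q) * \<theta> i q (E b q))"
        using cof_metric[OF E(5)] q E(4) vfieldsD(1)[OF E(1)[OF ab(1)]] vfieldsD(1)[OF E(1)[OF ab(2)]] by blast
      also have "\<dots> = (\<Sum>i<8. (if a = i then if b = i then 1 else 0 else 0))"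
        by (rule sum.cong[OF refl]) (simp add: E(6)[OF q] ab)
      also have "\<dots> = (if a = b then 1 else 0)" using ab by (simp add: sum.delta)
      finally show ?thesis .
    qed
    then show ?thesis using E(1) by (simp add: orthonormal_at_def)
  qed
  then show ?thesis using E(1,2,3) by (intro exI[of _ E] exI[of _ N]) simp
qed

lemma frame_at: "orthonormal_at A g p (frame_at A g p)"
proof -
  have "\<exists>E. orthonormal_at A g p E" using local_orthonormal_frame[of p] by blast
  then show ?thesis unfolding frame_at_def by (rule someI_ex)
qed

section \<open>Algebra of the induced metric\<close>

lemma metric_lin:
  assumes "u \<in> tangent_space A q" "v \<in> tangent_space A q" "w \<in> tangent_space A q"
  shows "g q (\<lambda>f. a * u f + b * v f) w = a * g q u w + b * g q v w"
    and metric_sym: "g q v w = g q w v"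
proof -
  obtain U \<theta> where U: "q \<in> U" "open U" "adapted_coframe A \<Psi> U \<theta>" by (rule coframe_ex)
  show "g q v w = g q w v" by (simp add: cof_metric[OF U(3,1)] assms mult.commute)
  show "g q (\<lambda>f. a * u f + b * v f) w = a * g q u w + b * g q v w"
    by (simp add: cof_metric[OF U(3,1)] tangent_lin assms cof_lin[OF U(3) _ U(1)] sum_distrib_left sum.distrib algebra_simps)
qed

lemma metric_sum:
  assumes "\<And>i. i \<in> I \<Longrightarrow> v i \<in> tangent_space A q" "w \<in> tangent_space A q"
  shows "g q (\<lambda>f. \<Sum>i\<in>I. c i * v i f) w = (\<Sum>i\<in>I. c i * g q (v i) w)"
  using assms(1)
proof (induction I rule: infinite_finite_induct)
  case (insert i I)
  then show ?case
    using metric_lin(1)[of "v i" q "\<lambda>f. \<Sum>i\<in>I. c i * v i f" w "c i" 1] tangent_sum[of I v q c] assms(2) by simp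
qed (use metric_lin(1)[OF tangent_zero tangent_zero assms(2), of 0 0] in simp_all)

lemma metric_definite:
  assumes v: "v \<in> tangent_space A q" and z: "g q v v = 0"
  shows "v = (\<lambda>f. 0)"
proof -
  obtain U \<theta> where U: "q \<in> U" "open U" "adapted_coframe A \<Psi> U \<theta>" by (rule coframe_ex)
  have "(\<Sum>i<8. \<theta> i q v * \<theta> i q v) = 0" using z by (simp add: cof_metric[OF U(3,1) v v])
  then have "\<theta> i q v = 0" if "i < 8" for i using that by (simp add: sum_nonneg_eq_0_iff)
  then show ?thesis by (rule cof_dual_inj(2)[OF U(3,1) v])
qed

lemma metric_smooth:
  assumes X: "X \<in> vfields A" and Y: "Y \<in> vfields A"
  shows "metric_tensor g X Y \<in> smooth_funs A"
proof (rule smooth_funs_local)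
  fix p
  obtain U \<theta> where U: "p \<in> U" "open U" "adapted_coframe A \<Psi> U \<theta>" by (rule coframe_ex)
  have "smooth_fun_on A U (\<lambda>q. \<Sum>i<8. \<theta> i q (X q) * \<theta> i q (Y q))"
    by (intro smooth_fun_on_sum smooth_fun_on_mult U(2) cof_smooth[OF U(3)] X Y) simp_all
  then have "smooth_fun_on A U (metric_tensor g X Y)"
    by (rule smooth_fun_on_cong[OF U(2), rotated]) (simp add: metric_tensor_def cof_metric[OF U(3)] vfieldsD X Y)
  then show "\<exists>N. open N \<and> p \<in> N \<and> smooth_fun_on A N (metric_tensor g X Y)" using U by blast
qed

text \<open>The frame E need not be dual to any adapted coframe. A coframe maps the tangent space
  isometrically into \<open>real^8\<close>, where eight orthonormal vectors span; the difference of
  v and its expansion is orthogonal to all of them, so it is zero.\<close>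

lemma orthonormal_expansion:
  assumes E: "orthonormal_at A g q E" and v: "v \<in> tangent_space A q"
  shows "v = (\<lambda>f. \<Sum>a<8. g q v (E a q) * E a q f)"
proof -
  obtain U \<theta> where U: "q \<in> U" "open U" "adapted_coframe A \<Psi> U \<theta>" by (rule coframe_ex)
  obtain n :: "8 \<Rightarrow> nat" where n: "bij_betw n UNIV {..<8}" by (rule index_bij[OF U(3)])
  have Et: "E a q \<in> tangent_space A q" if "a < 8" for a using E that by (simp add: orthonormal_at_def vfieldsD)
  have EE: "g q (E a q) (E b q) = (if a = b then 1 else 0)" if "a < 8" "b < 8" for a b
    using E that by (simp add: orthonormal_at_def)
  let ?s = "\<lambda>f. \<Sum>a<8. g q v (E a q) * E a q f"
  define w where "w = (\<lambda>f. 1 * v f + (-1) * ?s f)"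
  have st: "?s \<in> tangent_space A q" by (rule tangent_sum) (use Et in simp)
  have wt: "w \<in> tangent_space A q" unfolding w_def by (rule tangent_lin[OF v st])
  have gw: "g q w (E b q) = 0" if b: "b < 8" for b
  proof -
    have "g q ?s (E b q) = (\<Sum>a<8. g q v (E a q) * g q (E a q) (E b q))"
      by (rule metric_sum) (use Et b in simp_all)
    also have "\<dots> = (\<Sum>a<8. if b = a then g q v (E a q) else 0)"
      by (rule sum.cong[OF refl]) (simp add: EE b)
    also have "\<dots> = g q v (E b q)" using b by (simp add: sum.delta)
    finally show ?thesis unfolding w_def metric_lin(1)[OF v st Et[OF b]] by simp
  qed
  define u where "u x = (\<chi> i. \<theta> (n i) q x)" for x
  have inner: "u x \<bullet> u y = g q x y" if "x \<in> tangent_space A q" "y \<in> tangent_space A q" for x y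
    unfolding cof_metric[OF U(3,1) that] u_def
    using sum.reindex_bij_betw[OF n, of "\<lambda>i. \<theta> i q x * \<theta> i q y"] by (simp add: inner_vec_def)
  let ?B = "(\<lambda>a. u (E a q)) ` {..<8}"
  have ue: "u (E a q) \<bullet> u (E b q) = (if a = b then 1 else 0)" if "a < 8" "b < 8" for a b
    using inner[OF Et Et] EE that by simp
  have inj: "inj_on (\<lambda>a. u (E a q)) {..<8}"
  proof (rule inj_onI)
    fix a b assume ab: "a \<in> {..<8}" "b \<in> {..<8}" "u (E a q) = u (E b q)"
    then have "u (E a q) \<bullet> u (E b q) = u (E a q) \<bullet> u (E a q)" by simp
    then show "a = b" using ue[of a b] ue[of a a] ab(1,2) by (simp split: if_splits)
  qed
  have "pairwise orthogonal ?B"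
  proof (rule pairwiseI)
    fix x y assume "x \<in> ?B" "y \<in> ?B" "x \<noteq> y"
    then obtain a b where "a < 8" "b < 8" "x = u (E a q)" "y = u (E b q)" "a \<noteq> b" by auto
    then show "orthogonal x y" using ue[of a b] by (simp add: orthogonal_def)
  qed
  moreover have "0 \<notin> ?B"
  proof
    assume "0 \<in> ?B"
    then obtain a where "a < 8" "u (E a q) = 0" by auto
    then show False using ue[of a a] by simp
  qed
  ultimately have ind: "independent ?B" by (rule pairwise_orthogonal_independent)
  have "card ?B = 8" using card_image[OF inj] by simp
  then have "dim ?B = DIM(real^8)" using dim_eq_card_independent[OF ind] by simp
  then have sp: "span ?B = UNIV" using dim_eq_full by metis
  have "orthogonal (u w) (u w)"
  proof (rule orthogonal_to_span)
    show "u w \<in> span ?B" using sp by simp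
    show "orthogonal (u w) y" if "y \<in> ?B" for y using that inner[OF wt Et] gw by (auto simp: orthogonal_def)
  qed
  then have "g q w w = 0" using inner[OF wt wt] by (simp add: orthogonal_def)
  then have "w = (\<lambda>f. 0)" by (rule metric_definite[OF wt])
  then show ?thesis unfolding w_def by (simp add: fun_eq_iff)
qed

end

section \<open>Tensor fields of arbitrary rank\<close>

type_synonym 'a tensor = "'a vfield list \<Rightarrow> 'a \<Rightarrow> real"

text \<open>The direction of differentiation is the first entry of the argument list.\<close>

definition nabla :: "'a connection \<Rightarrow> 'a tensor \<Rightarrow> 'a tensor" where
  "nabla D S Xs = (\<lambda>p. hd Xs p (S (tl Xs)) - (\<Sum>i<length (tl Xs). S ((tl Xs)[i := D (hd Xs) (tl Xs ! i)]) p))"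

lemma nabla_Cons: "nabla D S (X # Ys) p = X p (S Ys) - (\<Sum>i<length Ys. S (Ys[i := D X (Ys ! i)]) p)"
  by (simp add: nabla_def)

context manifold
begin

text \<open>Multilinearity over smooth functions, in any rank, on lists of the right length. Keeping
  the rank as a parameter allows one set of rules for products, traces and derivatives to serve all
  contractions used later.\<close>

definition tens :: "nat \<Rightarrow> 'a tensor \<Rightarrow> bool" where
  "tens n S \<longleftrightarrow> (\<forall>Xs. length Xs = n \<and> set Xs \<subseteq> vfields A \<longrightarrow> S Xs \<in> smooth_funs A \<and>
     (\<forall>i<n. (\<forall>X\<in>vfields A. \<forall>Y\<in>vfields A. \<forall>p. S (Xs[i := vf_add X Y]) p = S (Xs[i := X]) p + S (Xs[i := Y]) p) \<and>
       (\<forall>u\<in>smooth_funs A. \<forall>X\<in>vfields A. \<forall>p. S (Xs[i := vf_scale u X]) p = u p * S (Xs[i := X]) p)))"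

lemma tensI:
  assumes "\<And>Xs. length Xs = n \<Longrightarrow> set Xs \<subseteq> vfields A \<Longrightarrow> S Xs \<in> smooth_funs A"
    and "\<And>Xs i X Y p. length Xs = n \<Longrightarrow> set Xs \<subseteq> vfields A \<Longrightarrow> i < n \<Longrightarrow> X \<in> vfields A \<Longrightarrow> Y \<in> vfields A \<Longrightarrow>
      S (Xs[i := vf_add X Y]) p = S (Xs[i := X]) p + S (Xs[i := Y]) p"
    and "\<And>Xs i X u p. length Xs = n \<Longrightarrow> set Xs \<subseteq> vfields A \<Longrightarrow> i < n \<Longrightarrow> X \<in> vfields A \<Longrightarrow> u \<in> smooth_funs A \<Longrightarrow>
      S (Xs[i := vf_scale u X]) p = u p * S (Xs[i := X]) p"
  shows "tens n S"
  using assms unfolding tens_def by simp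

context
  fixes n S Xs
  assumes S: "tens n S" and Xs: "length Xs = n" "set Xs \<subseteq> vfields A"
begin

lemma tens_smooth: "S Xs \<in> smooth_funs A"
  using S Xs unfolding tens_def by simp

lemma tens_add: "i < n \<Longrightarrow> X \<in> vfields A \<Longrightarrow> Y \<in> vfields A \<Longrightarrow>
    S (Xs[i := vf_add X Y]) p = S (Xs[i := X]) p + S (Xs[i := Y]) p"
  using S Xs unfolding tens_def by simp

lemma tens_scale: "i < n \<Longrightarrow> u \<in> smooth_funs A \<Longrightarrow> X \<in> vfields A \<Longrightarrow>
    S (Xs[i := vf_scale u X]) p = u p * S (Xs[i := X]) p"
  using S Xs unfolding tens_def by simp

lemma tens_zero: "i < n \<Longrightarrow> S (Xs[i := vf_zero]) p = 0"
proof -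
  assume "i < n"
  have "vf_scale (\<lambda>q. 0) vf_zero = (vf_zero :: 'a vfield)" by (simp add: vf_scale_def vf_zero_def)
  then show ?thesis using tens_scale[OF \<open>i < n\<close> smooth_const[of 0] vf_zero_vfields, of p] by simp
qed

lemma tens_sum:
  assumes i: "i < n"
  shows "finite I \<Longrightarrow> (\<And>j. j \<in> I \<Longrightarrow> X j \<in> vfields A) \<Longrightarrow> S (Xs[i := vf_sum X I]) p = (\<Sum>j\<in>I. S (Xs[i := X j]) p)"
proof (induction I rule: finite_induct)
  case empty
  then show ?case by (simp add: vf_sum_empty tens_zero[OF i])
next
  case (insert j I)
  then show ?case by (simp add: vf_sum_insert tens_add[OF i] vf_sum_vfields)
qed

end

lemma update_vfields: "set Xs \<subseteq> vfields A \<Longrightarrow> X \<in> vfields A \<Longrightarrow> set (Xs[i := X]) \<subseteq> vfields A"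
  by (rule set_update_subsetI)

lemma nth_vfields: "set Xs \<subseteq> vfields A \<Longrightarrow> i < length Xs \<Longrightarrow> Xs ! i \<in> vfields A"
  using nth_mem by blast

lemma vfield_diff_app: "X \<in> vfields A \<Longrightarrow> f \<in> smooth_funs A \<Longrightarrow> h \<in> smooth_funs A \<Longrightarrow> X p (\<lambda>q. f q - h q) = X p f - X p h"
  and vfield_add_app: "X \<in> vfields A \<Longrightarrow> f \<in> smooth_funs A \<Longrightarrow> h \<in> smooth_funs A \<Longrightarrow> X p (\<lambda>q. f q + h q) = X p f + X p h"
  and vfield_mult_app: "X \<in> vfields A \<Longrightarrow> f \<in> smooth_funs A \<Longrightarrow> h \<in> smooth_funs A \<Longrightarrow> X p (\<lambda>q. f q * h q) = f p * X p h + h p * X p f"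
  and vfield_const_app: "X \<in> vfields A \<Longrightarrow> X p (\<lambda>q. c) = 0"
  and vfield_cmult_app: "X \<in> vfields A \<Longrightarrow> f \<in> smooth_funs A \<Longrightarrow> X p (\<lambda>q. c * f q) = c * X p f"
  and vfield_uminus_app: "X \<in> vfields A \<Longrightarrow> f \<in> smooth_funs A \<Longrightarrow> X p (\<lambda>q. - f q) = - X p f"
  by ((rule tangent_diff[OF vfieldsD(1)] tangent_add[OF vfieldsD(1)] tangent_mult[OF vfieldsD(1)] tangent_const[OF vfieldsD(1)]
      tangent_scale[OF vfieldsD(1)] tangent_uminus[OF vfieldsD(1)]; assumption)+)

lemma vfield_sum_app: "X \<in> vfields A \<Longrightarrow> (\<And>i. i \<in> I \<Longrightarrow> f i \<in> smooth_funs A) \<Longrightarrow> X p (\<lambda>q. \<Sum>i\<in>I. f i q) = (\<Sum>i\<in>I. X p (f i))"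
  by (rule tangent_sum_fun[OF vfieldsD(1)])

end

section \<open>Tensors at a point, and traces\<close>

context spin7_manifold
begin

context
  fixes n S Xs i
  assumes S: "tens n S" and Xs: "length Xs = n" "set Xs \<subseteq> vfields A" and i: "i < n"
begin

text \<open>A cut-off multiple of X is a global combination of a local orthonormal frame whose
  smooth coefficients vanish at q, and S is linear over smooth functions.\<close>

lemma tens_pointwise_zero:
  assumes X: "X \<in> vfields A" and z: "X q = (\<lambda>f. 0)"
  shows "S (Xs[i := X]) q = 0"
proof -
  from local_orthonormal_frame[of q] obtain H N where
    HN: "(\<forall>a<8. H a \<in> vfields A) \<and> open N \<and> q \<in> N \<and> (\<forall>q\<in>N. orthonormal_at A g q H)" by (elim exE)
  then have H: "\<And>a. a < 8 \<Longrightarrow> H a \<in> vfields A" and N: "open N" "q \<in> N" and on: "\<And>q. q \<in> N \<Longrightarrow> orthonormal_at A g q H"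
    by simp_all
  obtain \<rho> N' K where \<rho>: "\<rho> \<in> smooth_funs A" "open N'" "q \<in> N'" "N' \<subseteq> N" "\<And>q. q \<in> N' \<Longrightarrow> \<rho> q = 1"
    "closed K" "K \<subseteq> N" "\<And>q. q \<notin> K \<Longrightarrow> \<rho> q = 0" using bump_ex[OF N] by metis
  let ?c = "\<lambda>a q. \<rho> q * metric_tensor g X (H a) q"
  have sc: "?c a \<in> smooth_funs A" if "a < 8" for a
    by (rule smooth_mult[OF \<rho>(1) metric_smooth[OF X H[OF that]]])
  \<comment> \<open>An identity on the whole manifold: inside K the frame expands X, and outside K
    both sides are zero with \<rho>.\<close>
  have eq: "vf_scale \<rho> X = vf_sum (\<lambda>a. vf_scale (?c a) (H a)) {..<8}"
  proof (intro ext)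
    fix q' f
    show "vf_scale \<rho> X q' f = vf_sum (\<lambda>a. vf_scale (?c a) (H a)) {..<8} q' f"
    proof (cases "q' \<in> K")
      case True
      then have "q' \<in> N" using \<rho>(7) by blast
      from fun_cong[OF orthonormal_expansion[OF on[OF this] vfieldsD(1)[OF X]], of f]
      show ?thesis by (simp add: vf_scale_def vf_sum_def metric_tensor_def sum_distrib_left mult.assoc)
    next
      case False
      then show ?thesis using \<rho>(8) by (simp add: vf_scale_def vf_sum_def)
    qed
  qed
  have mz: "metric_tensor g X (H a) q = 0" if "a < 8" for a
    using metric_lin(1)[OF tangent_zero tangent_zero vfieldsD(1)[OF H[OF that], of q], of 0 0]
    by (simp add: metric_tensor_def z)
  have "S (Xs[i := vf_scale \<rho> X]) q = (\<Sum>a<8. S (Xs[i := vf_scale (?c a) (H a)]) q)"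
    unfolding eq by (rule tens_sum[OF S Xs i]) (simp_all add: vf_scale_vfields sc H)
  also have "\<dots> = (\<Sum>a<8. ?c a q * S (Xs[i := H a]) q)"
    by (rule sum.cong[OF refl]) (use tens_scale[OF S Xs i sc H] in simp)
  also have "\<dots> = 0" by (rule sum.neutral) (simp add: mz)
  finally have "S (Xs[i := vf_scale \<rho> X]) q = 0" .
  moreover have "\<rho> q = 1" using \<rho>(3,5) by simp
  ultimately show ?thesis using tens_scale[OF S Xs i \<rho>(1) X, of q] by simp
qed

text \<open>The frame is orthonormal only at q. Subtracting from X its expansion at q, with constant
  coefficients, leaves a field vanishing at q, to which \<open>tens_pointwise_zero\<close>
  applies.\<close>

lemma tens_expand:
  assumes E: "orthonormal_at A g q E" and X: "X \<in> vfields A"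
  shows "S (Xs[i := X]) q = (\<Sum>a<8. g q (X q) (E a q) * S (Xs[i := E a]) q)"
proof -
  have Ev: "E a \<in> vfields A" if "a < 8" for a using E that by (simp add: orthonormal_at_def)
  let ?s = "vf_sum (\<lambda>a. vf_scale (\<lambda>_. - g q (X q) (E a q)) (E a)) {..<8}"
  have sv: "?s \<in> vfields A" by (intro vf_sum_vfields vf_scale_vfields smooth_const Ev) simp
  have "vf_add X ?s q = (\<lambda>f. 0)"
  proof
    fix f
    show "vf_add X ?s q f = 0"
      using fun_cong[OF orthonormal_expansion[OF E vfieldsD(1)[OF X]], of f]
      by (simp add: vf_add_def vf_sum_def vf_scale_def sum_negf)
  qed
  then have "S (Xs[i := vf_add X ?s]) q = 0"
    by (rule tens_pointwise_zero[OF vf_add_vfields[OF X sv]])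
  then have "S (Xs[i := X]) q + S (Xs[i := ?s]) q = 0" using tens_add[OF S Xs i X sv] by simp
  moreover have "S (Xs[i := ?s]) q = (\<Sum>a<8. - g q (X q) (E a q) * S (Xs[i := E a]) q)"
  proof -
    have "S (Xs[i := ?s]) q = (\<Sum>a<8. S (Xs[i := vf_scale (\<lambda>_. - g q (X q) (E a q)) (E a)]) q)"
      by (rule tens_sum[OF S Xs i]) (simp_all add: vf_scale_vfields smooth_const Ev)
    also have "\<dots> = (\<Sum>a<8. - g q (X q) (E a q) * S (Xs[i := E a]) q)"
      by (rule sum.cong[OF refl]) (use tens_scale[OF S Xs i smooth_const Ev] in simp)
    finally show ?thesis .
  qed
  ultimately show ?thesis by (simp add: sum_negf)
qed

lemma tens_cong:
  assumes "X \<in> vfields A" "Y \<in> vfields A" "X q = Y q"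
  shows "S (Xs[i := X]) q = S (Xs[i := Y]) q"
  unfolding tens_expand[OF frame_at assms(1)] tens_expand[OF frame_at assms(2)] assms(3) ..

end

text \<open>The frame is chosen separately at each point, without continuity. By
  \<open>contr_frame\<close> the choice is immaterial, so smoothness can be read off from a smooth
  local frame.\<close>

definition contr :: "'a tensor \<Rightarrow> 'a tensor" where
  "contr S Ys = (\<lambda>p. \<Sum>a<8. S (frame_at A g p a # frame_at A g p a # Ys) p)"

lemma orthonormal_vfields: "orthonormal_at A g q E \<Longrightarrow> a < 8 \<Longrightarrow> E a \<in> vfields A"
  by (simp add: orthonormal_at_def)

lemma metric_parseval:
  assumes E: "orthonormal_at A g q E" and v: "v \<in> tangent_space A q" and w: "w \<in> tangent_space A q"
  shows "(\<Sum>a<8. g q v (E a q) * g q w (E a q)) = g q v w"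
proof -
  have Et: "E a q \<in> tangent_space A q" if "a < 8" for a using vfieldsD(1)[OF orthonormal_vfields[OF E that]] .
  have "g q v w = g q (\<lambda>f. \<Sum>a<8. g q v (E a q) * E a q f) w" using orthonormal_expansion[OF E v] by simp
  also have "\<dots> = (\<Sum>a<8. g q v (E a q) * g q (E a q) w)" by (rule metric_sum) (use Et w in simp_all)
  also have "\<dots> = (\<Sum>a<8. g q v (E a q) * g q w (E a q))"
    by (rule sum.cong[OF refl]) (use metric_sym[OF w _ w] Et w in \<open>metis lessThan_iff metric_sym\<close>)
  finally show ?thesis by simp
qed

text \<open>Expanding one frame in the other produces the product of the transition matrix with its
  transpose, which is the identity by Parseval.\<close>

lemma contr_frame:
  assumes S: "tens (Suc (Suc n)) S" and Ys: "length Ys = n" "set Ys \<subseteq> vfields A" and E: "orthonormal_at A g q E"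
  shows "contr S Ys q = (\<Sum>a<8. S (E a # E a # Ys) q)"
proof -
  let ?F = "frame_at A g q"
  have F: "orthonormal_at A g q ?F" by (rule frame_at)
  note Ev = orthonormal_vfields[OF E] and Fv = orthonormal_vfields[OF F]
  have 1: "S (?F a # ?F a # Ys) q = (\<Sum>b<8. \<Sum>c<8. g q (E b q) (?F a q) * g q (E c q) (?F a q) * S (E b # E c # Ys) q)"
    if a: "a < 8" for a
  proof -
    have Ft: "?F a q \<in> tangent_space A q" by (rule vfieldsD(1)[OF Fv[OF a]])
    have "S (?F a # ?F a # Ys) q = (\<Sum>b<8. g q (?F a q) (E b q) * S (E b # ?F a # Ys) q)"
      using tens_expand[OF S, of "?F a # ?F a # Ys" 0 q E "?F a"] Ys E Fv[OF a] by simp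
    also have "\<dots> = (\<Sum>b<8. g q (?F a q) (E b q) * (\<Sum>c<8. g q (?F a q) (E c q) * S (E b # E c # Ys) q))"
    proof (rule sum.cong[OF refl])
      fix b :: nat assume "b \<in> {..<8}"
      then show "g q (?F a q) (E b q) * S (E b # ?F a # Ys) q =
          g q (?F a q) (E b q) * (\<Sum>c<8. g q (?F a q) (E c q) * S (E b # E c # Ys) q)"
        using tens_expand[OF S, of "E b # ?F a # Ys" 1 q E "?F a"] Ys E Fv[OF a] Ev by simp
    qed
    also have "\<dots> = (\<Sum>b<8. \<Sum>c<8. g q (E b q) (?F a q) * g q (E c q) (?F a q) * S (E b # E c # Ys) q)"
      unfolding sum_distrib_left
    proof (intro sum.cong[OF refl])
      fix b c :: nat assume "b \<in> {..<8}" "c \<in> {..<8}"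
      then have "E b q \<in> tangent_space A q" "E c q \<in> tangent_space A q" using vfieldsD(1)[OF Ev] by simp_all
      then show "g q (?F a q) (E b q) * (g q (?F a q) (E c q) * S (E b # E c # Ys) q) =
          g q (E b q) (?F a q) * g q (E c q) (?F a q) * S (E b # E c # Ys) q"
        using metric_sym[OF Ft, of "?F a q" "E b q"] metric_sym[OF Ft, of "?F a q" "E c q"] Ft by simp
    qed
    finally show ?thesis .
  qed
  have "contr S Ys q = (\<Sum>a<8. \<Sum>b<8. \<Sum>c<8. g q (E b q) (?F a q) * g q (E c q) (?F a q) * S (E b # E c # Ys) q)"
    unfolding contr_def by (rule sum.cong[OF refl]) (simp add: 1)
  also have "\<dots> = (\<Sum>b<8. \<Sum>a<8. \<Sum>c<8. g q (E b q) (?F a q) * g q (E c q) (?F a q) * S (E b # E c # Ys) q)"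
    by (rule sum.swap)
  also have "\<dots> = (\<Sum>b<8. \<Sum>c<8. \<Sum>a<8. g q (E b q) (?F a q) * g q (E c q) (?F a q) * S (E b # E c # Ys) q)"
    by (rule sum.cong[OF refl], rule sum.swap)
  also have "\<dots> = (\<Sum>b<8. \<Sum>c<8. if b = c then S (E b # E c # Ys) q else 0)"
  proof (intro sum.cong[OF refl])
    fix b c :: nat assume bc: "b \<in> {..<8}" "c \<in> {..<8}"
    then have "(\<Sum>a<8. g q (E b q) (?F a q) * g q (E c q) (?F a q)) = g q (E b q) (E c q)"
      using metric_parseval[OF F] vfieldsD(1)[OF Ev] by simp
    also have "\<dots> = (if b = c then 1 else 0)" using E bc by (simp add: orthonormal_at_def)
    finally show "(\<Sum>a<8. g q (E b q) (?F a q) * g q (E c q) (?F a q) * S (E b # E c # Ys) q) =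
        (if b = c then S (E b # E c # Ys) q else 0)"
      by (simp add: sum_distrib_right[symmetric])
  qed
  also have "\<dots> = (\<Sum>b<8. S (E b # E b # Ys) q)" by (rule sum.cong[OF refl]) simp
  finally show ?thesis .
qed

lemma tens_contr:
  assumes S: "tens (Suc (Suc n)) S"
  shows "tens n (contr S)"
proof (rule tensI)
  fix Xs :: "'a vfield list" assume Xs: "length Xs = n" "set Xs \<subseteq> vfields A"
  note Fv = orthonormal_vfields[OF frame_at]
  show "contr S Xs \<in> smooth_funs A"
  proof (rule smooth_funs_local)
    fix p
    from local_orthonormal_frame[of p] obtain H N where
      HN: "(\<forall>a<8. H a \<in> vfields A) \<and> open N \<and> p \<in> N \<and> (\<forall>q\<in>N. orthonormal_at A g q H)" by (elim exE)
    then have H: "\<And>a. a < 8 \<Longrightarrow> H a \<in> vfields A" and N: "open N" "p \<in> N" and on: "\<And>q. q \<in> N \<Longrightarrow> orthonormal_at A g q H"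
      by simp_all
    have "smooth_fun_on A N (\<lambda>q. \<Sum>a<8. S (H a # H a # Xs) q)"
      by (rule smooth_funs_on, rule smooth_sum, rule tens_smooth[OF S]) (use H Xs in simp_all)
    then have "smooth_fun_on A N (contr S Xs)"
      by (rule smooth_fun_on_cong[OF N(1), rotated]) (simp add: contr_frame[OF S Xs on])
    then show "\<exists>N. open N \<and> p \<in> N \<and> smooth_fun_on A N (contr S Xs)" using N by blast
  qed
  fix i p and X :: "'a vfield" assume i: "i < n" and X: "X \<in> vfields A"
  have len: "length (frame_at A g p a # frame_at A g p a # Xs) = Suc (Suc n)" for a using Xs by simp
  have sub: "set (frame_at A g p a # frame_at A g p a # Xs) \<subseteq> vfields A" if "a < 8" for a using Xs Fv[OF that] by simp
  have i2: "Suc (Suc i) < Suc (Suc n)" using i by simp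
  show "contr S (Xs[i := vf_add X Y]) p = contr S (Xs[i := X]) p + contr S (Xs[i := Y]) p" if "Y \<in> vfields A" for Y
    unfolding contr_def sum.distrib[symmetric]
    by (rule sum.cong[OF refl]) (use tens_add[OF S len sub i2 X that, of _ p] in simp)
  show "contr S (Xs[i := vf_scale u X]) p = u p * contr S (Xs[i := X]) p" if "u \<in> smooth_funs A" for u
    unfolding contr_def sum_distrib_left
    by (rule sum.cong[OF refl]) (use tens_scale[OF S len sub i2 that X, of _ p] in simp)
qed

end

text \<open>The lists \<open>is\<close> and \<open>js\<close> say which slots are fed to \<open>S\<close> and to \<open>P\<close>; \<open>contr\<close> always traces the first two slots.\<close>

definition tprod :: "nat list \<Rightarrow> nat list \<Rightarrow> 'a tensor \<Rightarrow> 'a tensor \<Rightarrow> 'a tensor" where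
  "tprod is js S P Xs = (\<lambda>p. S (map ((!) Xs) is) p * P (map ((!) Xs) js) p)"

definition shuffle :: "nat \<Rightarrow> nat \<Rightarrow> nat list \<Rightarrow> nat list \<Rightarrow> bool" where
  "shuffle n m is js \<longleftrightarrow> length is = n \<and> length js = m \<and> distinct (is @ js) \<and> set (is @ js) = {..<n + m}"

lemma map_nth_update:
  assumes "distinct is" "j < length is" "set is \<subseteq> {..<length Xs}"
  shows "map ((!) (Xs[is ! j := X])) is = (map ((!) Xs) is)[j := X]"
proof (rule nth_equalityI)
  fix i assume "i < length (map ((!) (Xs[is ! j := X])) is)"
  then have i: "i < length is" by simp
  have "is ! i < length Xs" using assms(3) nth_mem[OF i] by blast
  then show "map ((!) (Xs[is ! j := X])) is ! i = (map ((!) Xs) is)[j := X] ! i"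
    using i assms(2) nth_eq_iff_index_eq[OF assms(1) i assms(2)] by (auto simp: nth_list_update)
qed simp

lemma map_nth_update_neq: "k \<notin> set is \<Longrightarrow> map ((!) (Xs[k := X])) is = map ((!) Xs) is"
  by (auto intro!: map_cong nth_list_update_neq)

section \<open>Tensor products and the Leibniz rule\<close>

context manifold
begin

lemma tens_tprod:
  assumes S: "tens n S" and P: "tens m P" and sh: "shuffle n m is js"
  shows "tens (n + m) (tprod is js S P)"
proof -
  have len: "length is = n" "length js = m" and dist: "distinct is" "distinct js" "set is \<inter> set js = {}"
    and un: "set is \<union> set js = {..<n + m}"
    using sh by (auto simp: shuffle_def)
  have sub: "length (map ((!) Xs) is) = n" "set (map ((!) Xs) is) \<subseteq> vfields A"
    "length (map ((!) Xs) js) = m" "set (map ((!) Xs) js) \<subseteq> vfields A"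
    if "length Xs = n + m" "set Xs \<subseteq> vfields A" for Xs :: "'a vfield list"
    using that un len by (auto intro!: nth_vfields)
  have upd: "(\<exists>j<n. \<forall>X. map ((!) (Xs[k := X])) is = (map ((!) Xs) is)[j := X] \<and> map ((!) (Xs[k := X])) js = map ((!) Xs) js) \<or>
    (\<exists>j<m. \<forall>X. map ((!) (Xs[k := X])) js = (map ((!) Xs) js)[j := X] \<and> map ((!) (Xs[k := X])) is = map ((!) Xs) is)"
    if "length Xs = n + m" "k < n + m" for Xs :: "'a vfield list" and k
  proof (cases "k \<in> set is")
    case True
    then obtain j where j: "j < n" "is ! j = k" using len by (metis in_set_conv_nth)
    have "set is \<subseteq> {..<length Xs}" using un that by auto
    then have "map ((!) (Xs[k := X])) is = (map ((!) Xs) is)[j := X]" for X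
      using map_nth_update[OF dist(1), of j Xs X] j len by simp
    moreover have "k \<notin> set js" using True dist(3) by blast
    ultimately show ?thesis using j(1) map_nth_update_neq by metis
  next
    case False
    then have "k \<in> set js" using un that(2) by blast
    then obtain j where j: "j < m" "js ! j = k" using len by (metis in_set_conv_nth)
    have "set js \<subseteq> {..<length Xs}" using un that by auto
    then have "map ((!) (Xs[k := X])) js = (map ((!) Xs) js)[j := X]" for X
      using map_nth_update[OF dist(2), of j Xs X] j len by simp
    then show ?thesis using j(1) map_nth_update_neq[OF False] by metis
  qed
  show ?thesis
  proof (rule tensI)
    fix Xs :: "'a vfield list" assume Xs: "length Xs = n + m" "set Xs \<subseteq> vfields A"
    note s = sub[OF Xs]
    show "tprod is js S P Xs \<in> smooth_funs A"
      unfolding tprod_def by (rule smooth_mult[OF tens_smooth[OF S s(1,2)] tens_smooth[OF P s(3,4)]])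
    fix k p and X :: "'a vfield" assume k: "k < n + m" and X: "X \<in> vfields A"
    show "tprod is js S P (Xs[k := vf_add X Y]) p = tprod is js S P (Xs[k := X]) p + tprod is js S P (Xs[k := Y]) p"
      if Y: "Y \<in> vfields A" for Y
      using upd[OF Xs(1) k]
    proof (elim disjE exE conjE)
      fix j assume j: "j < n" and u': "\<forall>X. map ((!) (Xs[k := X])) is = (map ((!) Xs) is)[j := X] \<and> map ((!) (Xs[k := X])) js = map ((!) Xs) js"
      show ?thesis unfolding tprod_def conjunct1[OF u'[THEN spec]] conjunct2[OF u'[THEN spec]]
        using tens_add[OF S s(1,2) j X Y] by (simp add: distrib_right)
    next
      fix j assume j: "j < m" and u': "\<forall>X. map ((!) (Xs[k := X])) js = (map ((!) Xs) js)[j := X] \<and> map ((!) (Xs[k := X])) is = map ((!) Xs) is"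
      show ?thesis unfolding tprod_def conjunct1[OF u'[THEN spec]] conjunct2[OF u'[THEN spec]]
        using tens_add[OF P s(3,4) j X Y] by (simp add: distrib_left)
    qed
    show "tprod is js S P (Xs[k := vf_scale u X]) p = u p * tprod is js S P (Xs[k := X]) p"
      if u: "u \<in> smooth_funs A" for u
      using upd[OF Xs(1) k]
    proof (elim disjE exE conjE)
      fix j assume j: "j < n" and u': "\<forall>X. map ((!) (Xs[k := X])) is = (map ((!) Xs) is)[j := X] \<and> map ((!) (Xs[k := X])) js = map ((!) Xs) js"
      show ?thesis unfolding tprod_def conjunct1[OF u'[THEN spec]] conjunct2[OF u'[THEN spec]]
        using tens_scale[OF S s(1,2) j u X] by simp
    next
      fix j assume j: "j < m" and u': "\<forall>X. map ((!) (Xs[k := X])) js = (map ((!) Xs) js)[j := X] \<and> map ((!) (Xs[k := X])) is = map ((!) Xs) is"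
      show ?thesis unfolding tprod_def conjunct1[OF u'[THEN spec]] conjunct2[OF u'[THEN spec]]
        using tens_scale[OF P s(3,4) j u X] by simp
    qed
  qed
qed

lemma nabla_tprod:
  assumes S: "tens n S" and P: "tens m P" and sh: "shuffle n m is js"
    and X: "X \<in> vfields A" and Ys: "length Ys = n + m" "set Ys \<subseteq> vfields A"
  shows "nabla D (tprod is js S P) (X # Ys) p =
    nabla D S (X # map ((!) Ys) is) p * P (map ((!) Ys) js) p + S (map ((!) Ys) is) p * nabla D P (X # map ((!) Ys) js) p"
proof -
  have len: "length is = n" "length js = m" and dist: "distinct is" "distinct js" "set is \<inter> set js = {}"
    and un: "set is \<union> set js = {..<n + m}"
    using sh by (auto simp: shuffle_def)
  have sub: "length (map ((!) Ys) is) = n" "set (map ((!) Ys) is) \<subseteq> vfields A"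
    "length (map ((!) Ys) js) = m" "set (map ((!) Ys) js) \<subseteq> vfields A"
    using Ys un len by (auto intro!: nth_vfields)
  let ?t = "\<lambda>k. tprod is js S P (Ys[k := D X (Ys ! k)]) p"
  have subs: "set is \<subseteq> {..<length Ys}" "set js \<subseteq> {..<length Ys}" using un Ys by auto
  have "(\<Sum>k<n + m. ?t k) = (\<Sum>k\<in>set is. ?t k) + (\<Sum>k\<in>set js. ?t k)"
    unfolding un[symmetric] using dist(3) by (intro sum.union_disjoint) auto
  also have "(\<Sum>k\<in>set is. ?t k) = (\<Sum>j<n. ?t (is ! j))"
    by (rule sum.reindex_bij_betw[OF bij_betw_nth[OF dist(1)], symmetric]) (simp_all add: len)
  also have "\<dots> = (\<Sum>j<n. S ((map ((!) Ys) is)[j := D X (map ((!) Ys) is ! j)]) p) * P (map ((!) Ys) js) p"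
    unfolding sum_distrib_right
  proof (rule sum.cong[OF refl])
    fix j assume "j \<in> {..<n}"
    then have j: "j < length is" using len by simp
    have "is ! j \<notin> set js" using j dist(3) nth_mem by blast
    then show "?t (is ! j) = S ((map ((!) Ys) is)[j := D X (map ((!) Ys) is ! j)]) p * P (map ((!) Ys) js) p"
      using j by (simp add: tprod_def map_nth_update[OF dist(1) j subs(1)] map_nth_update_neq)
  qed
  also have "(\<Sum>k\<in>set js. ?t k) = (\<Sum>j<m. ?t (js ! j))"
    by (rule sum.reindex_bij_betw[OF bij_betw_nth[OF dist(2)], symmetric]) (simp_all add: len)
  also have "\<dots> = S (map ((!) Ys) is) p * (\<Sum>j<m. P ((map ((!) Ys) js)[j := D X (map ((!) Ys) js ! j)]) p)"
    unfolding sum_distrib_left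
  proof (rule sum.cong[OF refl])
    fix j assume "j \<in> {..<m}"
    then have j: "j < length js" using len by simp
    have "js ! j \<notin> set is" using j dist(3) nth_mem by blast
    then show "?t (js ! j) = S (map ((!) Ys) is) p * P ((map ((!) Ys) js)[j := D X (map ((!) Ys) js ! j)]) p"
      using j by (simp add: tprod_def map_nth_update[OF dist(2) j subs(2)] map_nth_update_neq)
  qed
  finally have sums: "(\<Sum>k<n + m. ?t k) = (\<Sum>j<n. S ((map ((!) Ys) is)[j := D X (map ((!) Ys) is ! j)]) p) * P (map ((!) Ys) js) p +
      S (map ((!) Ys) is) p * (\<Sum>j<m. P ((map ((!) Ys) js)[j := D X (map ((!) Ys) js ! j)]) p)" .
  have "X p (tprod is js S P Ys) = S (map ((!) Ys) is) p * X p (P (map ((!) Ys) js)) + P (map ((!) Ys) js) p * X p (S (map ((!) Ys) is))"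
    unfolding tprod_def by (rule vfield_mult_app[OF X tens_smooth[OF S sub(1,2)] tens_smooth[OF P sub(3,4)]])
  then show ?thesis unfolding nabla_Cons Ys(1) sums by (simp add: sub(1,3) len algebra_simps)
qed

text \<open>Covariant derivatives involve S at all fields \<open>D X Y\<close>, so equality on every
  list of vector fields is what permits differentiating an identity.\<close>

lemma nabla_cong:
  assumes "\<And>Xs. length Xs = n \<Longrightarrow> set Xs \<subseteq> vfields A \<Longrightarrow> S Xs = S' Xs"
    and "\<And>X Y. X \<in> vfields A \<Longrightarrow> Y \<in> vfields A \<Longrightarrow> D X Y \<in> vfields A"
    and "X \<in> vfields A" "length Ys = n" "set Ys \<subseteq> vfields A"
  shows "nabla D S (X # Ys) p = nabla D S' (X # Ys) p"
proof -
  have "S (Ys[i := D X (Ys ! i)]) = S' (Ys[i := D X (Ys ! i)])" if "i < length Ys" for i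
    using assms that by (intro assms(1)) (simp_all add: update_vfields nth_vfields)
  then show ?thesis unfolding nabla_Cons using assms by simp
qed

end

section \<open>Covariant derivatives for the torsion connection\<close>

locale spin7_connection = spin7_manifold A \<Psi> g for A :: "'a::t2_space chart set" and \<Psi> g +
  fixes D :: "'a connection"
  assumes torsion_conn: "torsion_connection A \<Psi> g D"
begin

lemma D_vfields: "X \<in> vfields A \<Longrightarrow> Y \<in> vfields A \<Longrightarrow> D X Y \<in> vfields A"
  and D_add1: "X \<in> vfields A \<Longrightarrow> Y \<in> vfields A \<Longrightarrow> Z \<in> vfields A \<Longrightarrow> D (vf_add X Y) Z = vf_add (D X Z) (D Y Z)"
  and D_add2: "X \<in> vfields A \<Longrightarrow> Y \<in> vfields A \<Longrightarrow> Z \<in> vfields A \<Longrightarrow> D X (vf_add Y Z) = vf_add (D X Y) (D X Z)"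
  and D_scale1: "u \<in> smooth_funs A \<Longrightarrow> X \<in> vfields A \<Longrightarrow> Y \<in> vfields A \<Longrightarrow> D (vf_scale u X) Y = vf_scale u (D X Y)"
  and D_scale2: "u \<in> smooth_funs A \<Longrightarrow> X \<in> vfields A \<Longrightarrow> Y \<in> vfields A \<Longrightarrow>
    D X (vf_scale u Y) = vf_add (vf_scale (\<lambda>p. X p u) Y) (vf_scale u (D X Y))"
  using torsion_conn unfolding torsion_connection_def linear_connection_def by simp_all

lemma vf_diff_eq: "vf_diff X Y = vf_add X (vf_scale (\<lambda>_. -1) Y)"
  by (simp add: vf_diff_def vf_add_def vf_scale_def)

lemma D_diff1: "X \<in> vfields A \<Longrightarrow> Y \<in> vfields A \<Longrightarrow> Z \<in> vfields A \<Longrightarrow> D (vf_diff X Y) Z = vf_diff (D X Z) (D Y Z)"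
  unfolding vf_diff_eq by (simp add: D_add1 D_scale1 vf_scale_vfields smooth_const)

lemma D_diff2:
  assumes "X \<in> vfields A" "Y \<in> vfields A" "Z \<in> vfields A"
  shows "D X (vf_diff Y Z) = vf_diff (D X Y) (D X Z)"
proof -
  have "vf_scale (\<lambda>p. X p (\<lambda>_. -1)) Z = vf_zero"
    by (simp add: vf_scale_def vf_zero_def vfield_const_app[OF assms(1)])
  then show ?thesis unfolding vf_diff_eq
    using assms by (simp add: D_add2 D_scale2 vf_scale_vfields smooth_const) (simp add: vf_add_def vf_zero_def)
qed

lemma metric_parallel:
  assumes "X \<in> vfields A" "Y \<in> vfields A" "Z \<in> vfields A"
  shows "X p (metric_tensor g Y Z) = metric_tensor g (D X Y) Z p + metric_tensor g Y (D X Z) p"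
proof -
  have "cov_deriv2 D X (metric_tensor g) Y Z p = 0"
    using torsion_conn assms unfolding torsion_connection_def parallel2_def vanishing2_def by blast
  then show ?thesis unfolding cov_deriv2_def by simp
qed

lemma form_parallel:
  assumes "X \<in> vfields A" "Y \<in> vfields A" "Z \<in> vfields A" "V \<in> vfields A" "W \<in> vfields A"
  shows "X p (form4_tensor \<Psi> Y Z V W) = form4_tensor \<Psi> (D X Y) Z V W p + form4_tensor \<Psi> Y (D X Z) V W p
    + form4_tensor \<Psi> Y Z (D X V) W p + form4_tensor \<Psi> Y Z V (D X W) p"
proof -
  have "cov_deriv4 D X (form4_tensor \<Psi>) Y Z V W p = 0"
    using torsion_conn assms unfolding torsion_connection_def parallel4_def vanishing4_def vanishing3_def vanishing2_def by blast
  then show ?thesis unfolding cov_deriv4_def by simp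
qed

text \<open>Linearity over functions in the differentiated slots holds because the term X u from
  differentiating S of u Y cancels the one from \<open>D X\<close> applied to u Y.\<close>

lemma tens_nabla:
  assumes S: "tens n S"
  shows "tens (Suc n) (nabla D S)"
proof (rule tensI)
  fix Xs :: "'a vfield list" assume Xs: "length Xs = Suc n" "set Xs \<subseteq> vfields A"
  then obtain X Ys where XY: "Xs = X # Ys" by (cases Xs) auto
  have X: "X \<in> vfields A" and Ys: "length Ys = n" "set Ys \<subseteq> vfields A" using Xs XY by auto
  have len: "length (Ys[i := Y]) = n" for i Y using Ys by simp
  have sv: "set (Ys[i := D X (Ys ! i)]) \<subseteq> vfields A" if "i < n" for i
    using that Ys X by (intro update_vfields D_vfields nth_vfields) simp_all
  show "nabla D S Xs \<in> smooth_funs A"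
  proof -
    have "(\<lambda>p. X p (S Ys) - (\<Sum>i<length Ys. S (Ys[i := D X (Ys ! i)]) p)) \<in> smooth_funs A"
      by (rule smooth_diff[OF vfieldsD(2)[OF X tens_smooth[OF S Ys]] smooth_sum[OF tens_smooth[OF S len]]])
        (use sv Ys in simp)
    then show ?thesis unfolding XY by (simp add: nabla_def)
  qed
  fix k p assume k: "k < Suc n"
  show "nabla D S (Xs[k := vf_add Y Z]) p = nabla D S (Xs[k := Y]) p + nabla D S (Xs[k := Z]) p"
    if Y: "Y \<in> vfields A" and Z: "Z \<in> vfields A" for Y Z
  proof (cases k)
    case 0
    have "S (Ys[i := D (vf_add Y Z) (Ys ! i)]) p = S (Ys[i := D Y (Ys ! i)]) p + S (Ys[i := D Z (Ys ! i)]) p" if "i < n" for i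
      using that Ys Y Z tens_add[OF S Ys that, of "D Y (Ys ! i)" "D Z (Ys ! i)" p] nth_vfields[OF Ys(2), of i]
      by (simp add: D_add1 D_vfields)
    then show ?thesis unfolding XY 0 by (simp add: nabla_Cons Ys(1) vf_add_def sum.distrib)
  next
    case (Suc j)
    then have j: "j < n" using k by simp
    have Sadd: "S (Ys[j := vf_add Y Z]) = (\<lambda>p. S (Ys[j := Y]) p + S (Ys[j := Z]) p)"
      by (rule ext) (rule tens_add[OF S Ys j Y Z])
    have "S (Ys[j := vf_add Y Z, i := D X (Ys[j := vf_add Y Z] ! i)]) p =
        S (Ys[j := Y, i := D X (Ys[j := Y] ! i)]) p + S (Ys[j := Z, i := D X (Ys[j := Z] ! i)]) p" if i: "i < n" for i
    proof (cases "i = j")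
      case True
      then show ?thesis using tens_add[OF S Ys j D_vfields[OF X Y] D_vfields[OF X Z], of p] j Ys
        by (simp add: D_add2[OF X Y Z])
    next
      case False
      have "S (Ys[i := D X (Ys ! i), j := vf_add Y Z]) p = S (Ys[i := D X (Ys ! i), j := Y]) p + S (Ys[i := D X (Ys ! i), j := Z]) p"
        by (rule tens_add[OF S len sv[OF i] j Y Z])
      then show ?thesis using False by (simp add: list_update_swap[OF False])
    qed
    moreover have "X p (S (Ys[j := vf_add Y Z])) = X p (S (Ys[j := Y])) + X p (S (Ys[j := Z]))"
      unfolding Sadd by (rule vfield_add_app[OF X tens_smooth[OF S len] tens_smooth[OF S len]])
        (use Ys Y Z in \<open>simp_all add: update_vfields\<close>)
    ultimately show ?thesis unfolding XY Suc by (simp add: nabla_Cons Ys(1) sum.distrib)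
  qed
  show "nabla D S (Xs[k := vf_scale u Y]) p = u p * nabla D S (Xs[k := Y]) p"
    if Y: "Y \<in> vfields A" and u: "u \<in> smooth_funs A" for u Y
  proof (cases k)
    case 0
    have "S (Ys[i := D (vf_scale u Y) (Ys ! i)]) p = u p * S (Ys[i := D Y (Ys ! i)]) p" if "i < n" for i
      using that Ys Y u tens_scale[OF S Ys that u, of "D Y (Ys ! i)" p] nth_vfields[OF Ys(2), of i]
      by (simp add: D_scale1 D_vfields)
    then show ?thesis unfolding XY 0 by (simp add: nabla_Cons Ys(1) vf_scale_def right_diff_distrib sum_distrib_left)
  next
    case (Suc j)
    then have j: "j < n" using k by simp
    have Ssc: "S (Ys[j := vf_scale u Y]) = (\<lambda>p. u p * S (Ys[j := Y]) p)"
      by (rule ext) (rule tens_scale[OF S Ys j u Y])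
    have Xu: "(\<lambda>p. X p u) \<in> smooth_funs A" by (rule vfieldsD(2)[OF X u])
    have "S (Ys[j := vf_scale u Y, i := D X (Ys[j := vf_scale u Y] ! i)]) p =
        u p * S (Ys[j := Y, i := D X (Ys[j := Y] ! i)]) p + (if i = j then X p u * S (Ys[j := Y]) p else 0)" if i: "i < n" for i
    proof (cases "i = j")
      case True
      then show ?thesis
        using tens_add[OF S Ys j vf_scale_vfields[OF Xu Y] vf_scale_vfields[OF u D_vfields[OF X Y]], of p]
          tens_scale[OF S Ys j Xu Y, of p] tens_scale[OF S Ys j u D_vfields[OF X Y], of p] j Ys
        by (simp add: D_scale2[OF u X Y])
    next
      case False
      have "S (Ys[i := D X (Ys ! i), j := vf_scale u Y]) p = u p * S (Ys[i := D X (Ys ! i), j := Y]) p"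
        by (rule tens_scale[OF S len sv[OF i] j u Y])
      then show ?thesis using False by (simp add: list_update_swap[OF False])
    qed
    then have "(\<Sum>i<n. S (Ys[j := vf_scale u Y, i := D X (Ys[j := vf_scale u Y] ! i)]) p) =
        u p * (\<Sum>i<n. S (Ys[j := Y, i := D X (Ys[j := Y] ! i)]) p) + X p u * S (Ys[j := Y]) p"
      using j by (simp add: sum.distrib sum_distrib_left sum.delta)
    moreover have "X p (S (Ys[j := vf_scale u Y])) = u p * X p (S (Ys[j := Y])) + S (Ys[j := Y]) p * X p u"
      unfolding Ssc by (rule vfield_mult_app[OF X u tens_smooth[OF S len]]) (use Ys Y in \<open>simp add: update_vfields\<close>)
    ultimately show ?thesis unfolding XY Suc by (simp add: nabla_Cons Ys(1) algebra_simps)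
  qed
qed

text \<open>Traces commute with \<nabla> because the connection is metric: the coefficients \<omega>
  of an orthonormal frame are skew, so the corrections from the two traced slots cancel.\<close>

lemma nabla_contr_local:
  assumes S: "tens (Suc (Suc n)) S" and X: "X \<in> vfields A" and Ys: "length Ys = n" "set Ys \<subseteq> vfields A"
    and H: "\<And>a. a < 8 \<Longrightarrow> H a \<in> vfields A" and N: "open N" "p \<in> N" and on: "\<And>q. q \<in> N \<Longrightarrow> orthonormal_at A g q H"
  shows "nabla D (contr S) (X # Ys) p = (\<Sum>a<8. nabla D S (X # H a # H a # Ys) p)"
proof -
  have sHH: "S (H a # H b # Zs) \<in> smooth_funs A" if "a < 8" "b < 8" "length Zs = n" "set Zs \<subseteq> vfields A" for a b Zs
    by (rule tens_smooth[OF S]) (use that H in simp_all)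
  have "X p (contr S Ys) = X p (\<lambda>q. \<Sum>a<8. S (H a # H a # Ys) q)"
  proof (rule tangent_local[OF vfieldsD(1)[OF X] _ _ N])
    show "contr S Ys \<in> smooth_funs A" by (rule tens_smooth[OF tens_contr[OF S] Ys])
    show "(\<lambda>q. \<Sum>a<8. S (H a # H a # Ys) q) \<in> smooth_funs A"
      by (rule smooth_sum) (use sHH Ys in simp)
    show "contr S Ys q = (\<Sum>a<8. S (H a # H a # Ys) q)" if "q \<in> N" for q
      by (rule contr_frame[OF S Ys on[OF that]])
  qed
  also have "\<dots> = (\<Sum>a<8. X p (S (H a # H a # Ys)))"
    by (rule vfield_sum_app[OF X]) (use sHH Ys in simp)
  finally have 1: "X p (contr S Ys) = (\<Sum>a<8. X p (S (H a # H a # Ys)))" .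
  have "(\<Sum>i<n. contr S (Ys[i := D X (Ys ! i)]) p) = (\<Sum>i<n. \<Sum>a<8. S (H a # H a # Ys[i := D X (Ys ! i)]) p)"
  proof (rule sum.cong[OF refl], rule contr_frame[OF S _ _ on[OF N(2)]])
    fix i assume "i \<in> {..<n}"
    then show "length (Ys[i := D X (Ys ! i)]) = n" "set (Ys[i := D X (Ys ! i)]) \<subseteq> vfields A"
      using Ys X by (simp_all add: update_vfields D_vfields nth_vfields)
  qed
  also have "\<dots> = (\<Sum>a<8. \<Sum>i<n. S (H a # H a # Ys[i := D X (Ys ! i)]) p)" by (rule sum.swap)
  finally have 2: "(\<Sum>i<n. contr S (Ys[i := D X (Ys ! i)]) p) = (\<Sum>a<8. \<Sum>i<n. S (H a # H a # Ys[i := D X (Ys ! i)]) p)" .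
  have 3: "nabla D S (X # H a # H a # Ys) p = X p (S (H a # H a # Ys)) -
      (S (D X (H a) # H a # Ys) p + S (H a # D X (H a) # Ys) p + (\<Sum>i<n. S (H a # H a # Ys[i := D X (Ys ! i)]) p))" for a
    by (simp add: nabla_Cons Ys(1) sum.lessThan_Suc_shift del: sum.lessThan_Suc)
  define \<omega> where "\<omega> a b = g p (D X (H a) p) (H b p)" for a b
  have onp: "orthonormal_at A g p H" by (rule on[OF N(2)])
  have skew: "\<omega> b a = - \<omega> a b" if "a < 8" "b < 8" for a b
  proof -
    have "X p (metric_tensor g (H a) (H b)) = X p (\<lambda>q. if a = b then 1 else 0)"
      by (rule tangent_local[OF vfieldsD(1)[OF X] metric_smooth[OF H[OF that(1)] H[OF that(2)]] smooth_const N])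
        (use on that in \<open>simp add: metric_tensor_def orthonormal_at_def\<close>)
    also have "\<dots> = 0" by (rule vfield_const_app[OF X])
    finally have "g p (D X (H a) p) (H b p) + g p (H a p) (D X (H b) p) = 0"
      using metric_parallel[OF X H[OF that(1)] H[OF that(2)], of p] by (simp add: metric_tensor_def)
    moreover have "g p (H a p) (D X (H b) p) = g p (D X (H b) p) (H a p)"
      by (rule metric_sym) (use vfieldsD(1)[OF H[OF that(1)]] vfieldsD(1)[OF D_vfields[OF X H[OF that(2)]]] in auto)
    ultimately show ?thesis by (simp add: \<omega>_def)
  qed
  have e1: "S (D X (H a) # H a # Ys) p = (\<Sum>b<8. \<omega> a b * S (H b # H a # Ys) p)" if a: "a < 8" for a
    using tens_expand[OF S, of "H a # H a # Ys" 0 p H "D X (H a)"] Ys onp D_vfields[OF X H[OF a]] H[OF a]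
    by (simp add: \<omega>_def)
  have e2: "S (H a # D X (H a) # Ys) p = (\<Sum>b<8. \<omega> a b * S (H a # H b # Ys) p)" if a: "a < 8" for a
    using tens_expand[OF S, of "H a # H a # Ys" 1 p H "D X (H a)"] Ys onp D_vfields[OF X H[OF a]] H[OF a]
    by (simp add: \<omega>_def)
  have "(\<Sum>a<8. S (H a # D X (H a) # Ys) p) = (\<Sum>a<8. \<Sum>b<8. \<omega> a b * S (H a # H b # Ys) p)"
    by (rule sum.cong[OF refl]) (simp add: e2)
  also have "\<dots> = (\<Sum>b<8. \<Sum>a<8. \<omega> a b * S (H a # H b # Ys) p)" by (rule sum.swap)
  also have "\<dots> = (\<Sum>b<8. \<Sum>a<8. - (\<omega> b a * S (H a # H b # Ys) p))"
  proof (intro sum.cong[OF refl])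
    fix a b :: nat assume "a \<in> {..<8}" "b \<in> {..<8}"
    then show "\<omega> a b * S (H a # H b # Ys) p = - (\<omega> b a * S (H a # H b # Ys) p)" using skew[of b a] by simp
  qed
  also have "\<dots> = - (\<Sum>a<8. S (D X (H a) # H a # Ys) p)"
    unfolding sum_negf by (rule arg_cong[of _ _ uminus], rule sum.cong[OF refl]) (simp add: e1)
  finally have 4: "(\<Sum>a<8. S (D X (H a) # H a # Ys) p) + (\<Sum>a<8. S (H a # D X (H a) # Ys) p) = 0" by simp
  show ?thesis unfolding nabla_Cons[of D "contr S"] Ys(1) 1 2 3 sum_subtractf sum.distrib using 4 by simp
qed

end

section \<open>Tensors of rank three and four, and Lie brackets\<close>

context manifold
begin

lemma tens_const: "tens 0 (\<lambda>Xs p. 1)"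
  by (rule tensI) (simp_all add: smooth_const)

lemma tens3I:
  assumes "\<And>X Y Z. X \<in> vfields A \<Longrightarrow> Y \<in> vfields A \<Longrightarrow> Z \<in> vfields A \<Longrightarrow> F X Y Z \<in> smooth_funs A"
    and "\<And>X Y Z W p. X \<in> vfields A \<Longrightarrow> Y \<in> vfields A \<Longrightarrow> Z \<in> vfields A \<Longrightarrow> W \<in> vfields A \<Longrightarrow>
      F (vf_add X W) Y Z p = F X Y Z p + F W Y Z p \<and> F X (vf_add Y W) Z p = F X Y Z p + F X W Z p \<and> F X Y (vf_add Z W) p = F X Y Z p + F X Y W p"
    and "\<And>X Y Z u p. X \<in> vfields A \<Longrightarrow> Y \<in> vfields A \<Longrightarrow> Z \<in> vfields A \<Longrightarrow> u \<in> smooth_funs A \<Longrightarrow>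
      F (vf_scale u X) Y Z p = u p * F X Y Z p \<and> F X (vf_scale u Y) Z p = u p * F X Y Z p \<and> F X Y (vf_scale u Z) p = u p * F X Y Z p"
  shows "tens 3 (\<lambda>Xs. F (Xs ! 0) (Xs ! 1) (Xs ! 2))"
proof (rule tensI)
  fix Xs :: "'a vfield list" assume Xs: "length Xs = 3" "set Xs \<subseteq> vfields A"
  then obtain X Y Z where e: "Xs = [X, Y, Z]" by (auto simp: length_Suc_conv numeral_eq_Suc)
  have v: "X \<in> vfields A" "Y \<in> vfields A" "Z \<in> vfields A" using Xs e by auto
  show "F (Xs ! 0) (Xs ! 1) (Xs ! 2) \<in> smooth_funs A" using assms(1)[OF v] e by simp
  fix i :: nat and p and W V :: "'a vfield" assume i: "i < 3" and W: "W \<in> vfields A"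
  have i3: "i = 0 \<or> i = 1 \<or> i = 2" using i by linarith
  show "F (Xs[i := vf_add W V] ! 0) (Xs[i := vf_add W V] ! 1) (Xs[i := vf_add W V] ! 2) p =
    F (Xs[i := W] ! 0) (Xs[i := W] ! 1) (Xs[i := W] ! 2) p + F (Xs[i := V] ! 0) (Xs[i := V] ! 1) (Xs[i := V] ! 2) p"
    if "V \<in> vfields A"
    using i3 assms(2)[OF W v(2,3) that] assms(2)[OF v(1) W v(3) that] assms(2)[OF v(1,2) W that] unfolding e by auto
  show "F (Xs[i := vf_scale u W] ! 0) (Xs[i := vf_scale u W] ! 1) (Xs[i := vf_scale u W] ! 2) p =
    u p * F (Xs[i := W] ! 0) (Xs[i := W] ! 1) (Xs[i := W] ! 2) p" if "u \<in> smooth_funs A" for u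
    using i3 assms(3)[OF W v(2,3) that] assms(3)[OF v(1) W v(3) that] assms(3)[OF v(1,2) W that] unfolding e by auto
qed

lemma tens4I:
  assumes "\<And>X Y Z V. X \<in> vfields A \<Longrightarrow> Y \<in> vfields A \<Longrightarrow> Z \<in> vfields A \<Longrightarrow> V \<in> vfields A \<Longrightarrow> F X Y Z V \<in> smooth_funs A"
    and "\<And>X Y Z V W p. X \<in> vfields A \<Longrightarrow> Y \<in> vfields A \<Longrightarrow> Z \<in> vfields A \<Longrightarrow> V \<in> vfields A \<Longrightarrow> W \<in> vfields A \<Longrightarrow>
      F (vf_add X W) Y Z V p = F X Y Z V p + F W Y Z V p \<and> F X (vf_add Y W) Z V p = F X Y Z V p + F X W Z V p \<and>
      F X Y (vf_add Z W) V p = F X Y Z V p + F X Y W V p \<and> F X Y Z (vf_add V W) p = F X Y Z V p + F X Y Z W p"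
    and "\<And>X Y Z V u p. X \<in> vfields A \<Longrightarrow> Y \<in> vfields A \<Longrightarrow> Z \<in> vfields A \<Longrightarrow> V \<in> vfields A \<Longrightarrow> u \<in> smooth_funs A \<Longrightarrow>
      F (vf_scale u X) Y Z V p = u p * F X Y Z V p \<and> F X (vf_scale u Y) Z V p = u p * F X Y Z V p \<and>
      F X Y (vf_scale u Z) V p = u p * F X Y Z V p \<and> F X Y Z (vf_scale u V) p = u p * F X Y Z V p"
  shows "tens 4 (\<lambda>Xs. F (Xs ! 0) (Xs ! 1) (Xs ! 2) (Xs ! 3))"
proof (rule tensI)
  fix Xs :: "'a vfield list" assume Xs: "length Xs = 4" "set Xs \<subseteq> vfields A"
  then obtain X Y Z U where e: "Xs = [X, Y, Z, U]" by (auto simp: length_Suc_conv numeral_eq_Suc)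
  have v: "X \<in> vfields A" "Y \<in> vfields A" "Z \<in> vfields A" "U \<in> vfields A" using Xs e by auto
  show "F (Xs ! 0) (Xs ! 1) (Xs ! 2) (Xs ! 3) \<in> smooth_funs A" using assms(1)[OF v] e by simp
  fix i :: nat and p and W V :: "'a vfield" assume i: "i < 4" and W: "W \<in> vfields A"
  have i4: "i = 0 \<or> i = 1 \<or> i = 2 \<or> i = 3" using i by linarith
  show "F (Xs[i := vf_add W V] ! 0) (Xs[i := vf_add W V] ! 1) (Xs[i := vf_add W V] ! 2) (Xs[i := vf_add W V] ! 3) p =
    F (Xs[i := W] ! 0) (Xs[i := W] ! 1) (Xs[i := W] ! 2) (Xs[i := W] ! 3) p + F (Xs[i := V] ! 0) (Xs[i := V] ! 1) (Xs[i := V] ! 2) (Xs[i := V] ! 3) p"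
    if "V \<in> vfields A"
    using i4 assms(2)[OF W v(2,3,4) that] assms(2)[OF v(1) W v(3,4) that] assms(2)[OF v(1,2) W v(4) that] assms(2)[OF v(1,2,3) W that]
    unfolding e by auto
  show "F (Xs[i := vf_scale u W] ! 0) (Xs[i := vf_scale u W] ! 1) (Xs[i := vf_scale u W] ! 2) (Xs[i := vf_scale u W] ! 3) p =
    u p * F (Xs[i := W] ! 0) (Xs[i := W] ! 1) (Xs[i := W] ! 2) (Xs[i := W] ! 3) p" if "u \<in> smooth_funs A" for u
    using i4 assms(3)[OF W v(2,3,4) that] assms(3)[OF v(1) W v(3,4) that] assms(3)[OF v(1,2) W v(4) that] assms(3)[OF v(1,2,3) W that]
    unfolding e by auto
qed

lemma lie_bracket_app: "lie_bracket X Y p f = X p (\<lambda>q. Y q f) - Y p (\<lambda>q. X q f)"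
  by (simp add: lie_bracket_def)

lemma vfield_nonsmooth: "X \<in> vfields A \<Longrightarrow> f \<notin> smooth_funs A \<Longrightarrow> X p f = 0"
  by (rule tangent_nonsmooth[OF vfieldsD(1)])

lemma vfield_eqI: "X \<in> vfields A \<Longrightarrow> Y \<in> vfields A \<Longrightarrow> (\<And>p f. f \<in> smooth_funs A \<Longrightarrow> X p f = Y p f) \<Longrightarrow> X = Y"
  by (intro ext) (metis vfield_nonsmooth)

lemma lie_bracket_skew: "lie_bracket Y X p f = - lie_bracket X Y p f"
  by (simp add: lie_bracket_app)

lemma lie_bracket_add1:
  assumes "X \<in> vfields A" "Y \<in> vfields A" "Z \<in> vfields A"
  shows "lie_bracket (vf_add X Y) Z = vf_add (lie_bracket X Z) (lie_bracket Y Z)"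
proof (rule vfield_eqI)
  fix p f assume f: "f \<in> smooth_funs A"
  show "lie_bracket (vf_add X Y) Z p f = vf_add (lie_bracket X Z) (lie_bracket Y Z) p f"
    using vfield_add_app[OF assms(3) vfieldsD(2)[OF assms(1) f] vfieldsD(2)[OF assms(2) f]]
    by (simp add: lie_bracket_app vf_add_def)
qed (intro lie_bracket_vfields vf_add_vfields assms)+

lemma lie_bracket_diff1:
  assumes "X \<in> vfields A" "Y \<in> vfields A" "Z \<in> vfields A"
  shows "lie_bracket (vf_diff X Y) Z = vf_diff (lie_bracket X Z) (lie_bracket Y Z)"
proof (rule vfield_eqI)
  fix p f assume f: "f \<in> smooth_funs A"
  show "lie_bracket (vf_diff X Y) Z p f = vf_diff (lie_bracket X Z) (lie_bracket Y Z) p f"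
    using vfield_diff_app[OF assms(3) vfieldsD(2)[OF assms(1) f] vfieldsD(2)[OF assms(2) f]]
    by (simp add: lie_bracket_app vf_diff_def)
qed (intro lie_bracket_vfields vf_diff_vfields assms)+

lemma lie_bracket_scale1:
  assumes "X \<in> vfields A" "Y \<in> vfields A" "u \<in> smooth_funs A"
  shows "lie_bracket (vf_scale u X) Y = vf_diff (vf_scale u (lie_bracket X Y)) (vf_scale (\<lambda>p. Y p u) X)"
proof (rule vfield_eqI)
  fix p f assume f: "f \<in> smooth_funs A"
  show "lie_bracket (vf_scale u X) Y p f = vf_diff (vf_scale u (lie_bracket X Y)) (vf_scale (\<lambda>p. Y p u) X) p f"
    using vfield_mult_app[OF assms(2,3) vfieldsD(2)[OF assms(1) f]]
    by (simp add: lie_bracket_app vf_diff_def vf_scale_def algebra_simps)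
next
  show "vf_diff (vf_scale u (lie_bracket X Y)) (vf_scale (\<lambda>p. Y p u) X) \<in> vfields A"
    by (rule vf_diff_vfields[OF vf_scale_vfields[OF assms(3) lie_bracket_vfields[OF assms(1,2)]]
          vf_scale_vfields[OF vfieldsD(2)[OF assms(2,3)] assms(1)]])
qed (rule lie_bracket_vfields[OF vf_scale_vfields[OF assms(3,1)] assms(2)])

lemma lie_bracket_jacobi:
  assumes "X \<in> vfields A" "Y \<in> vfields A" "Z \<in> vfields A"
  shows "lie_bracket (lie_bracket X Y) Z p f + lie_bracket (lie_bracket Y Z) X p f + lie_bracket (lie_bracket Z X) Y p f = 0"
proof (cases "f \<in> smooth_funs A")
  case f: True
  have s: "(\<lambda>q. U q (\<lambda>q. W q f)) \<in> smooth_funs A" if "U \<in> vfields A" "W \<in> vfields A" for U W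
    by (rule vfieldsD(2)[OF that(1) vfieldsD(2)[OF that(2) f]])
  have d: "U p (\<lambda>q. V q (\<lambda>q. W q f) - W q (\<lambda>q. V q f)) = U p (\<lambda>q. V q (\<lambda>q. W q f)) - U p (\<lambda>q. W q (\<lambda>q. V q f))"
    if "U \<in> vfields A" "V \<in> vfields A" "W \<in> vfields A" for U V W
    by (rule vfield_diff_app[OF that(1) s s]) (rule that)+
  show ?thesis by (simp add: lie_bracket_app d[OF assms(3,1,2)] d[OF assms(1,2,3)] d[OF assms(2,3,1)])
next
  case False
  then show ?thesis using assms by (simp add: vfield_nonsmooth lie_bracket_vfields)
qed

end

context spin7_manifold
begin

lemma metric_tensor_add1: "X \<in> vfields A \<Longrightarrow> Y \<in> vfields A \<Longrightarrow> Z \<in> vfields A \<Longrightarrow>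
    metric_tensor g (vf_add X Y) Z p = metric_tensor g X Z p + metric_tensor g Y Z p"
  using metric_lin(1)[OF vfieldsD(1)[of X p] vfieldsD(1)[of Y p] vfieldsD(1)[of Z p], of 1 1] by (simp add: metric_tensor_def vf_add_def)

lemma metric_tensor_diff1: "X \<in> vfields A \<Longrightarrow> Y \<in> vfields A \<Longrightarrow> Z \<in> vfields A \<Longrightarrow>
    metric_tensor g (vf_diff X Y) Z p = metric_tensor g X Z p - metric_tensor g Y Z p"
  using metric_lin(1)[OF vfieldsD(1)[of X p] vfieldsD(1)[of Y p] vfieldsD(1)[of Z p], of 1 "-1"] by (simp add: metric_tensor_def vf_diff_def)

lemma metric_tensor_scale1: "X \<in> vfields A \<Longrightarrow> Z \<in> vfields A \<Longrightarrow>
    metric_tensor g (vf_scale u X) Z p = u p * metric_tensor g X Z p"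
  using metric_lin(1)[OF vfieldsD(1)[of X p] tangent_zero[of p] vfieldsD(1)[of Z p], of "u p" 0] by (simp add: metric_tensor_def vf_scale_def)

lemma metric_tensor_sym: "X \<in> vfields A \<Longrightarrow> Y \<in> vfields A \<Longrightarrow> metric_tensor g X Y p = metric_tensor g Y X p"
  using metric_sym[OF vfieldsD(1)[of X p] vfieldsD(1)[of X p] vfieldsD(1)[of Y p]] by (simp add: metric_tensor_def)

lemma metric_tensor_add2: "X \<in> vfields A \<Longrightarrow> Y \<in> vfields A \<Longrightarrow> Z \<in> vfields A \<Longrightarrow>
    metric_tensor g Z (vf_add X Y) p = metric_tensor g Z X p + metric_tensor g Z Y p"
  using metric_tensor_add1[of X Y Z p] by (simp add: metric_tensor_sym[of Z] vf_add_vfields)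

lemma metric_tensor_diff2: "X \<in> vfields A \<Longrightarrow> Y \<in> vfields A \<Longrightarrow> Z \<in> vfields A \<Longrightarrow>
    metric_tensor g Z (vf_diff X Y) p = metric_tensor g Z X p - metric_tensor g Z Y p"
  using metric_tensor_diff1[of X Y Z p] by (simp add: metric_tensor_sym[of Z] vf_diff_vfields)

lemma metric_tensor_scale2: "X \<in> vfields A \<Longrightarrow> Z \<in> vfields A \<Longrightarrow> u \<in> smooth_funs A \<Longrightarrow>
    metric_tensor g Z (vf_scale u X) p = u p * metric_tensor g Z X p"
  using metric_tensor_scale1[of X Z u p] by (simp add: metric_tensor_sym[of Z] vf_scale_vfields)

lemma wedge1111_sum_smooth:
  assumes U: "open U" "adapted_coframe A \<Psi> U \<theta>" and ijkl: "i < 8" "j < 8" "k < 8" "l < 8"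
    and "X \<in> vfields A" "Y \<in> vfields A" "Z \<in> vfields A" "V \<in> vfields A"
  shows "smooth_fun_on A U (\<lambda>q. wedge1111 (\<theta> i q) (\<theta> j q) (\<theta> k q) (\<theta> l q) (X q) (Y q) (Z q) (V q))"
proof -
  have "smooth_fun_on A U (\<lambda>q. \<Sum>\<pi> | \<pi> permutes {..<4::nat}. of_int (sign \<pi>) *
      \<theta> i q (([X, Y, Z, V] ! \<pi> 0) q) * \<theta> j q (([X, Y, Z, V] ! \<pi> 1) q) *
      \<theta> k q (([X, Y, Z, V] ! \<pi> 2) q) * \<theta> l q (([X, Y, Z, V] ! \<pi> 3) q))"
  proof (rule smooth_fun_on_sum[OF U(1)])
    fix \<pi> assume "\<pi> \<in> {\<pi>. \<pi> permutes {..<4::nat}}"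
    then have "\<pi> m < 4" if "m < 4" for m using that permutes_in_image[of \<pi> "{..<4}" m] by simp
    then have p4: "\<pi> m = 0 \<or> \<pi> m = 1 \<or> \<pi> m = 2 \<or> \<pi> m = 3" if "m < 4" for m using that by fastforce
    have v: "[X, Y, Z, V] ! \<pi> m \<in> vfields A" if "m < 4" for m
      using p4[OF that] assms(7-10) by auto
    show "smooth_fun_on A U (\<lambda>q. of_int (sign \<pi>) *
      \<theta> i q (([X, Y, Z, V] ! \<pi> 0) q) * \<theta> j q (([X, Y, Z, V] ! \<pi> 1) q) *
      \<theta> k q (([X, Y, Z, V] ! \<pi> 2) q) * \<theta> l q (([X, Y, Z, V] ! \<pi> 3) q))"
      by (rule smooth_fun_on_mult[OF U(1) smooth_fun_on_mult[OF U(1) smooth_fun_on_mult[OF U(1)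
            smooth_fun_on_mult[OF U(1) smooth_fun_on_const[OF U(1)]]]]])
        (rule cof_smooth[OF U(2)], rule ijkl, rule v, simp)+
  qed
  moreover have "([X, Y, Z, V] ! m) q = [X q, Y q, Z q, V q] ! m" if "m < 4" for m q
  proof -
    have "m = 0 \<or> m = 1 \<or> m = 2 \<or> m = 3" using that by linarith
    then show ?thesis by auto
  qed
  then have "(\<Sum>\<pi> | \<pi> permutes {..<4::nat}. of_int (sign \<pi>) *
      \<theta> i q (([X, Y, Z, V] ! \<pi> 0) q) * \<theta> j q (([X, Y, Z, V] ! \<pi> 1) q) *
      \<theta> k q (([X, Y, Z, V] ! \<pi> 2) q) * \<theta> l q (([X, Y, Z, V] ! \<pi> 3) q)) =
      wedge1111 (\<theta> i q) (\<theta> j q) (\<theta> k q) (\<theta> l q) (X q) (Y q) (Z q) (V q)" for q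
    unfolding wedge1111_def
  proof (intro sum.cong[OF refl])
    fix \<pi> assume "\<pi> \<in> {\<pi>. \<pi> permutes {..<4::nat}}"
    then have "\<pi> m < 4" if "m < 4" for m using that permutes_in_image[of \<pi> "{..<4}" m] by simp
    then have e: "([X, Y, Z, V] ! \<pi> m) q = [X q, Y q, Z q, V q] ! \<pi> m" if "m < 4" for m
      using that \<open>\<And>q m. m < 4 \<Longrightarrow> ([X, Y, Z, V] ! m) q = [X q, Y q, Z q, V q] ! m\<close> by simp
    show "of_int (sign \<pi>) * \<theta> i q (([X, Y, Z, V] ! \<pi> 0) q) * \<theta> j q (([X, Y, Z, V] ! \<pi> 1) q) *
      \<theta> k q (([X, Y, Z, V] ! \<pi> 2) q) * \<theta> l q (([X, Y, Z, V] ! \<pi> 3) q) =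
      of_int (sign \<pi>) * \<theta> i q ([X q, Y q, Z q, V q] ! \<pi> 0) * \<theta> j q ([X q, Y q, Z q, V q] ! \<pi> 1) *
      \<theta> k q ([X q, Y q, Z q, V q] ! \<pi> 2) * \<theta> l q ([X q, Y q, Z q, V q] ! \<pi> 3)"
      by (simp only: e zero_less_numeral one_less_numeral_iff numeral_less_iff) (simp add: e)
  qed
  ultimately show ?thesis by simp
qed

lemma form4_smooth:
  assumes v: "X \<in> vfields A" "Y \<in> vfields A" "Z \<in> vfields A" "V \<in> vfields A"
  shows "form4_tensor \<Psi> X Y Z V \<in> smooth_funs A"
proof (rule smooth_funs_local)
  fix p
  obtain U \<theta> where U: "p \<in> U" "open U" "adapted_coframe A \<Psi> U \<theta>" by (rule coframe_ex)
  let ?w = "\<lambda>i j k l q. wedge1111 (\<theta> i q) (\<theta> j q) (\<theta> k q) (\<theta> l q) (X q) (Y q) (Z q) (V q)"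
  have w: "smooth_fun_on A U (?w i j k l)" if "i < 8" "j < 8" "k < 8" "l < 8" for i j k l
    by (rule wedge1111_sum_smooth[OF U(2,3) that v])
  have add: "smooth_fun_on A U (\<lambda>q. f q + ?w i j k l q)" and sub: "smooth_fun_on A U (\<lambda>q. f q - ?w i j k l q)"
    if "smooth_fun_on A U f" "i < 8" "j < 8" "k < 8" "l < 8" for f i j k l
    using smooth_fun_on_add[OF U(2) that(1) w[OF that(2-5)]]
      smooth_fun_on_add[OF U(2) that(1) smooth_fun_on_mult[OF U(2) smooth_fun_on_const[OF U(2), of "-1"] w[OF that(2-5)]]] by simp_all
  have base: "smooth_fun_on A U (\<lambda>q. - ?w 0 1 2 7 q)"
    using sub[OF smooth_fun_on_const[OF U(2), of 0], of 0 1 2 7] by simp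
  have "smooth_fun_on A U (\<lambda>q. cayley_form (\<lambda>i. \<theta> i q) (X q) (Y q) (Z q) (V q))"
    unfolding cayley_form_def Let_def
    by (intro add sub base) simp_all
  then have "smooth_fun_on A U (form4_tensor \<Psi> X Y Z V)"
    by (rule smooth_fun_on_cong[OF U(2), rotated]) (simp add: form4_tensor_def cof_form[OF U(3)] vfieldsD v)
  then show "\<exists>N. open N \<and> p \<in> N \<and> smooth_fun_on A N (form4_tensor \<Psi> X Y Z V)" using U by blast
qed

lemma form4_skew:
  assumes v: "X \<in> vfields A" "Y \<in> vfields A" "Z \<in> vfields A" "V \<in> vfields A"
  shows "form4_tensor \<Psi> Y X Z V p = - form4_tensor \<Psi> X Y Z V p"
    "form4_tensor \<Psi> X Z Y V p = - form4_tensor \<Psi> X Y Z V p"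
    "form4_tensor \<Psi> X Y V Z p = - form4_tensor \<Psi> X Y Z V p"
proof -
  obtain U \<theta> where U: "p \<in> U" "open U" "adapted_coframe A \<Psi> U \<theta>" by (rule coframe_ex)
  note f = cof_form[OF U(3,1)] vfieldsD(1)[OF v(1)] vfieldsD(1)[OF v(2)] vfieldsD(1)[OF v(3)] vfieldsD(1)[OF v(4)]
  show "form4_tensor \<Psi> Y X Z V p = - form4_tensor \<Psi> X Y Z V p"
    unfolding form4_tensor_def by (simp add: f, rule cayley_form_skew(1))
  show "form4_tensor \<Psi> X Z Y V p = - form4_tensor \<Psi> X Y Z V p"
    unfolding form4_tensor_def by (simp add: f, rule cayley_form_skew(2))
  show "form4_tensor \<Psi> X Y V Z p = - form4_tensor \<Psi> X Y Z V p"
    unfolding form4_tensor_def by (simp add: f, rule cayley_form_skew(3))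
qed

lemma form4_lin1:
  assumes v: "x \<in> tangent_space A p" "w \<in> tangent_space A p" "y \<in> tangent_space A p" "z \<in> tangent_space A p" "v \<in> tangent_space A p"
  shows "\<Psi> p (\<lambda>f. a * x f + b * w f) y z v = a * \<Psi> p x y z v + b * \<Psi> p w y z v"
proof -
  obtain U \<theta> where U: "p \<in> U" "open U" "adapted_coframe A \<Psi> U \<theta>" by (rule coframe_ex)
  have w: "wedge1111 (\<theta> i p) (\<theta> j p) (\<theta> k p) (\<theta> l p) (\<lambda>f. a * x f + b * w f) y z v =
    a * wedge1111 (\<theta> i p) (\<theta> j p) (\<theta> k p) (\<theta> l p) x y z v + b * wedge1111 (\<theta> i p) (\<theta> j p) (\<theta> k p) (\<theta> l p) w y z v"
    if "i < 8" "j < 8" "k < 8" "l < 8" for i j k l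
    unfolding wedge1111_expand using that by (simp add: cof_lin[OF U(3) _ U(1) v(1,2)] algebra_simps)
  show ?thesis
    by (simp add: cof_form[OF U(3,1)] tangent_lin v) (simp add: cayley_form_def w algebra_simps)
qed

lemma form4_add1:
  assumes v: "X \<in> vfields A" "W \<in> vfields A" "Y \<in> vfields A" "Z \<in> vfields A" "V \<in> vfields A"
  shows "form4_tensor \<Psi> (vf_add X W) Y Z V p = form4_tensor \<Psi> X Y Z V p + form4_tensor \<Psi> W Y Z V p"
  using form4_lin1[OF vfieldsD(1)[OF v(1)] vfieldsD(1)[OF v(2)] vfieldsD(1)[OF v(3)] vfieldsD(1)[OF v(4)] vfieldsD(1)[OF v(5)], of p 1 1]
  by (simp add: form4_tensor_def vf_add_def)

lemma form4_scale1:
  assumes v: "X \<in> vfields A" "Y \<in> vfields A" "Z \<in> vfields A" "V \<in> vfields A"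
  shows "form4_tensor \<Psi> (vf_scale u X) Y Z V p = u p * form4_tensor \<Psi> X Y Z V p"
  using form4_lin1[OF vfieldsD(1)[OF v(1)] tangent_zero vfieldsD(1)[OF v(2)] vfieldsD(1)[OF v(3)] vfieldsD(1)[OF v(4)], of p "u p" 0]
  by (simp add: form4_tensor_def vf_scale_def)

definition Pt :: "'a tensor" where
  "Pt Xs = form4_tensor \<Psi> (Xs ! 0) (Xs ! 1) (Xs ! 2) (Xs ! 3)"

lemma tens_Pt: "tens 4 Pt"
  unfolding Pt_def[abs_def]
proof (rule tens4I)
  fix X Y Z V W :: "'a vfield" and u p
  assume v: "X \<in> vfields A" "Y \<in> vfields A" "Z \<in> vfields A" "V \<in> vfields A"
  show "form4_tensor \<Psi> X Y Z V \<in> smooth_funs A" by (rule form4_smooth[OF v])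
  have s2: "form4_tensor \<Psi> X Q Z V p = - form4_tensor \<Psi> Q X Z V p" if "Q \<in> vfields A" for Q
    using form4_skew(1)[OF that v(1,3,4)] by simp
  have s3: "form4_tensor \<Psi> X Y Q V p = form4_tensor \<Psi> Q X Y V p" if "Q \<in> vfields A" for Q
    using form4_skew(1)[OF v(1) that v(2,4), of p] form4_skew(2)[OF v(1) that v(2,4), of p] by simp
  have s4: "form4_tensor \<Psi> X Y Z Q p = - form4_tensor \<Psi> Q X Y Z p" if "Q \<in> vfields A" for Q
    using form4_skew(1)[OF v(1) that v(2,3), of p] form4_skew(2)[OF v(1) that v(2,3), of p] form4_skew(3)[OF v(1,2) that v(3), of p] by simp
  note sk = s2[of "vf_add Y W"] s2[of Y] s2[of W] s3[of "vf_add Z W"] s3[of Z] s3[of W] s4[of "vf_add V W"] s4[of V] s4[of W]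
  show "form4_tensor \<Psi> (vf_add X W) Y Z V p = form4_tensor \<Psi> X Y Z V p + form4_tensor \<Psi> W Y Z V p \<and>
      form4_tensor \<Psi> X (vf_add Y W) Z V p = form4_tensor \<Psi> X Y Z V p + form4_tensor \<Psi> X W Z V p \<and>
      form4_tensor \<Psi> X Y (vf_add Z W) V p = form4_tensor \<Psi> X Y Z V p + form4_tensor \<Psi> X Y W V p \<and>
      form4_tensor \<Psi> X Y Z (vf_add V W) p = form4_tensor \<Psi> X Y Z V p + form4_tensor \<Psi> X Y Z W p" if w: "W \<in> vfields A"
    using s2[OF vf_add_vfields[OF v(2) w]] s2[OF v(2)] s2[OF w] s3[OF vf_add_vfields[OF v(3) w]] s3[OF v(3)] s3[OF w]
      s4[OF vf_add_vfields[OF v(4) w]] s4[OF v(4)] s4[OF w]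
      form4_add1[OF v(1) w v(2,3,4), of p] form4_add1[OF v(2) w v(1,3,4), of p] form4_add1[OF v(3) w v(1,2,4), of p] form4_add1[OF v(4) w v(1,2,3), of p]
    by linarith
  show "form4_tensor \<Psi> (vf_scale u X) Y Z V p = u p * form4_tensor \<Psi> X Y Z V p \<and>
      form4_tensor \<Psi> X (vf_scale u Y) Z V p = u p * form4_tensor \<Psi> X Y Z V p \<and>
      form4_tensor \<Psi> X Y (vf_scale u Z) V p = u p * form4_tensor \<Psi> X Y Z V p \<and>
      form4_tensor \<Psi> X Y Z (vf_scale u V) p = u p * form4_tensor \<Psi> X Y Z V p" if u: "u \<in> smooth_funs A"
    using s2[OF vf_scale_vfields[OF u v(2)]] s2[OF v(2)] s3[OF vf_scale_vfields[OF u v(3)]] s3[OF v(3)]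
      s4[OF vf_scale_vfields[OF u v(4)]] s4[OF v(4)]
      form4_scale1[OF v(1,2,3,4), of u p] form4_scale1[OF v(2,1,3,4), of u p] form4_scale1[OF v(3,1,2,4), of u p] form4_scale1[OF v(4,1,2,3), of u p]
    by simp
qed

end

section \<open>Torsion and curvature\<close>

context spin7_connection
begin

definition tau :: "'a vfield \<Rightarrow> 'a vfield \<Rightarrow> 'a vfield" where
  "tau X Y = vf_diff (vf_diff (D X Y) (D Y X)) (lie_bracket X Y)"

abbreviation Tor :: "'a ten3" where "Tor \<equiv> torsion g D"
abbreviation Rm :: "'a ten4" where "Rm \<equiv> curvature4 g D"

lemma Tor_eq: "Tor X Y Z = metric_tensor g (tau X Y) Z"
  by (simp add: torsion_def tau_def)

lemma tau_vfields: "X \<in> vfields A \<Longrightarrow> Y \<in> vfields A \<Longrightarrow> tau X Y \<in> vfields A"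
  unfolding tau_def by (intro vf_diff_vfields D_vfields lie_bracket_vfields)

lemma curvature_vfields: "X \<in> vfields A \<Longrightarrow> Y \<in> vfields A \<Longrightarrow> Z \<in> vfields A \<Longrightarrow> curvature D X Y Z \<in> vfields A"
  unfolding curvature_def by (intro vf_diff_vfields D_vfields lie_bracket_vfields)

lemma tau_app: "tau X Y p f = D X Y p f - D Y X p f - lie_bracket X Y p f"
  by (simp add: tau_def vf_diff_def)

lemma curvature_app: "curvature D X Y Z p f = D X (D Y Z) p f - D Y (D X Z) p f - D (lie_bracket X Y) Z p f"
  by (simp add: curvature_def vf_diff_def)

lemma Tor_skew:
  assumes "X \<in> vfields A" "Y \<in> vfields A" "Z \<in> vfields A"
  shows "Tor Y X Z p = - Tor X Y Z p" "Tor X Z Y p = - Tor X Y Z p"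
  using torsion_conn assms unfolding torsion_connection_def totally_skew3_def by blast+

lemma Tor_cyc:
  assumes "X \<in> vfields A" "Y \<in> vfields A" "Z \<in> vfields A"
  shows "Tor Y Z X p = Tor X Y Z p"
  using Tor_skew[OF assms(2,1,3)] Tor_skew[OF assms(1,2,3)] by simp

definition Tt :: "'a tensor" where "Tt Xs = Tor (Xs ! 0) (Xs ! 1) (Xs ! 2)"
definition Rt :: "'a tensor" where "Rt Xs = Rm (Xs ! 0) (Xs ! 1) (Xs ! 2) (Xs ! 3)"

lemma tens_Tt: "tens 3 Tt"
  unfolding Tt_def[abs_def]
proof (rule tens3I)
  fix X Y Z W :: "'a vfield" and u p
  assume v: "X \<in> vfields A" "Y \<in> vfields A" "Z \<in> vfields A"
  show "Tor X Y Z \<in> smooth_funs A" unfolding Tor_eq by (rule metric_smooth[OF tau_vfields[OF v(1,2)] v(3)])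
  have s1: "Tor Q Y Z p = Tor Y Z Q p" if "Q \<in> vfields A" for Q using Tor_cyc[OF that v(2,3)] by simp
  have s2: "Tor X Q Z p = - Tor X Z Q p" if "Q \<in> vfields A" for Q using Tor_skew(2)[OF v(1) that v(3)] by simp
  have add3: "Tor X' Y' (vf_add Z' W) p = Tor X' Y' Z' p + Tor X' Y' W p"
    if "X' \<in> vfields A" "Y' \<in> vfields A" "Z' \<in> vfields A" "W \<in> vfields A" for X' Y' Z' W
    using that unfolding Tor_eq by (simp add: metric_tensor_add2 tau_vfields)
  show "Tor (vf_add X W) Y Z p = Tor X Y Z p + Tor W Y Z p \<and> Tor X (vf_add Y W) Z p = Tor X Y Z p + Tor X W Z p \<and>
      Tor X Y (vf_add Z W) p = Tor X Y Z p + Tor X Y W p" if w: "W \<in> vfields A"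
    using s1[OF vf_add_vfields[OF v(1) w]] s1[OF v(1)] s1[OF w] s2[OF vf_add_vfields[OF v(2) w]] s2[OF v(2)] s2[OF w]
      add3[OF v(2,3,1) w] add3[OF v(1,3,2) w] add3[OF v(1,2,3) w] by linarith
  have sc3: "Tor X' Y' (vf_scale u Z') p = u p * Tor X' Y' Z' p"
    if "X' \<in> vfields A" "Y' \<in> vfields A" "Z' \<in> vfields A" "u \<in> smooth_funs A" for X' Y' Z'
    using that unfolding Tor_eq by (simp add: metric_tensor_scale2 tau_vfields)
  show "Tor (vf_scale u X) Y Z p = u p * Tor X Y Z p \<and> Tor X (vf_scale u Y) Z p = u p * Tor X Y Z p \<and>
      Tor X Y (vf_scale u Z) p = u p * Tor X Y Z p" if u: "u \<in> smooth_funs A"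
  proof -
    have "u p * Tor X Y Z p = u p * Tor Y Z X p" using s1[OF v(1)] by simp
    moreover have "u p * Tor X Y Z p = - (u p * Tor X Z Y p)" using s2[OF v(2)] by simp
    ultimately show ?thesis
      using s1[OF vf_scale_vfields[OF u v(1)]] s2[OF vf_scale_vfields[OF u v(2)]]
        sc3[OF v(2,3,1) u] sc3[OF v(1,3,2) u] sc3[OF v(1,2,3) u] by linarith
  qed
qed

lemma curvature_skew1:
  assumes v: "X \<in> vfields A" "Y \<in> vfields A" "Z \<in> vfields A"
  shows "curvature D Y X Z p f = - curvature D X Y Z p f"
proof -
  have "lie_bracket Y X = vf_scale (\<lambda>_. -1) (lie_bracket X Y)"
    by (intro ext) (simp add: lie_bracket_skew[of Y X] vf_scale_def)
  then have "D (lie_bracket Y X) Z = vf_scale (\<lambda>_. -1) (D (lie_bracket X Y) Z)"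
    using v by (simp add: D_scale1 smooth_const lie_bracket_vfields)
  then show ?thesis by (simp add: curvature_app vf_scale_def)
qed

lemma Rm_skew1:
  assumes v: "X \<in> vfields A" "Y \<in> vfields A" "Z \<in> vfields A" "V \<in> vfields A"
  shows "Rm Y X Z V p = - Rm X Y Z V p"
proof -
  have "curvature D Y X Z = vf_scale (\<lambda>_. -1) (curvature D X Y Z)"
    by (intro ext) (simp add: curvature_skew1[OF v(1,2,3)] vf_scale_def)
  then show ?thesis
    using v by (simp add: curvature4_def metric_tensor_scale1 curvature_vfields)
qed

lemma commutator:
  "lie_bracket X Y p h = X p (\<lambda>q. Y q h) - Y p (\<lambda>q. X q h)"
  by (rule lie_bracket_app)

lemma second_deriv_metric:
  assumes v: "X \<in> vfields A" "Y \<in> vfields A" "Z \<in> vfields A" "V \<in> vfields A"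
  shows "X p (\<lambda>q. Y q (metric_tensor g Z V)) = metric_tensor g (D X (D Y Z)) V p + metric_tensor g (D Y Z) (D X V) p
    + metric_tensor g (D X Z) (D Y V) p + metric_tensor g Z (D X (D Y V)) p"
proof -
  have "X p (\<lambda>q. Y q (metric_tensor g Z V)) = X p (\<lambda>q. metric_tensor g (D Y Z) V q + metric_tensor g Z (D Y V) q)"
    by (simp add: metric_parallel v)
  also have "\<dots> = X p (metric_tensor g (D Y Z) V) + X p (metric_tensor g Z (D Y V))"
    by (rule vfield_add_app[OF v(1) metric_smooth metric_smooth]) (simp_all add: v D_vfields)
  finally show ?thesis by (simp add: metric_parallel v D_vfields)
qed

text \<open>The bracket of X and Y is applied to g (Z, V) directly and as a commutator of
  derivatives; since the metric is parallel, comparison says that the curvature annihilates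
  g.\<close>

lemma Rm_skew2:
  assumes v: "X \<in> vfields A" "Y \<in> vfields A" "Z \<in> vfields A" "V \<in> vfields A"
  shows "Rm X Y V Z p = - Rm X Y Z V p"
proof -
  have "lie_bracket X Y p (metric_tensor g Z V) = metric_tensor g (D (lie_bracket X Y) Z) V p + metric_tensor g Z (D (lie_bracket X Y) V) p"
    by (rule metric_parallel) (simp_all add: v lie_bracket_vfields)
  then have "Rm X Y Z V p + metric_tensor g Z (curvature D X Y V) p = 0"
    using v commutator[of X Y p "metric_tensor g Z V"] second_deriv_metric[OF v, of p] second_deriv_metric[OF v(2,1,3,4), of p]
    by (simp add: curvature4_def curvature_def metric_tensor_diff1 metric_tensor_diff2 D_vfields lie_bracket_vfields vf_diff_vfields)
  moreover have "metric_tensor g Z (curvature D X Y V) p = Rm X Y V Z p"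
    unfolding curvature4_def by (rule metric_tensor_sym) (simp_all add: v curvature_vfields)
  ultimately show ?thesis by simp
qed

lemma curvature_add1:
  assumes v: "X \<in> vfields A" "W \<in> vfields A" "Y \<in> vfields A" "Z \<in> vfields A"
  shows "curvature D (vf_add X W) Y Z = vf_add (curvature D X Y Z) (curvature D W Y Z)"
  using v by (intro ext) (simp add: curvature_app vf_add_def[of "curvature D X Y Z"] lie_bracket_add1 D_add1 D_add2 D_vfields lie_bracket_vfields,
      simp add: vf_add_def)

lemma curvature_scale1:
  assumes v: "X \<in> vfields A" "Y \<in> vfields A" "Z \<in> vfields A" and u: "u \<in> smooth_funs A"
  shows "curvature D (vf_scale u X) Y Z = vf_scale u (curvature D X Y Z)"
proof (intro ext)
  fix p f
  have Yu: "(\<lambda>p. Y p u) \<in> smooth_funs A" by (rule vfieldsD(2)[OF v(2) u])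
  have 1: "D (lie_bracket (vf_scale u X) Y) Z = vf_diff (vf_scale u (D (lie_bracket X Y) Z)) (vf_scale (\<lambda>p. Y p u) (D X Z))"
    using v u Yu by (simp add: lie_bracket_scale1 D_diff1 D_scale1 vf_scale_vfields lie_bracket_vfields)
  have 2: "D Y (D (vf_scale u X) Z) = vf_add (vf_scale (\<lambda>p. Y p u) (D X Z)) (vf_scale u (D Y (D X Z)))"
    using v u by (simp add: D_scale1 D_scale2 D_vfields)
  have 3: "D (vf_scale u X) (D Y Z) = vf_scale u (D X (D Y Z))"
    using v u by (simp add: D_scale1 D_vfields)
  show "curvature D (vf_scale u X) Y Z p f = vf_scale u (curvature D X Y Z) p f"
    unfolding curvature_app vf_scale_def[of u "curvature D X Y Z"] 1 2 3
    by (simp add: vf_add_def vf_diff_def vf_scale_def algebra_simps)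
qed

lemma tens_Rt: "tens 4 Rt"
  unfolding Rt_def[abs_def]
proof (rule tens4I)
  fix X Y Z V W :: "'a vfield" and u p
  assume v: "X \<in> vfields A" "Y \<in> vfields A" "Z \<in> vfields A" "V \<in> vfields A"
  show "Rm X Y Z V \<in> smooth_funs A" unfolding curvature4_def by (rule metric_smooth[OF curvature_vfields[OF v(1,2,3)] v(4)])
  have s2: "Rm X Q Z V p = - Rm Q X Z V p" if "Q \<in> vfields A" for Q using Rm_skew1[OF that v(1,3,4)] by simp
  have s3: "Rm X Y Q V p = - Rm X Y V Q p" if "Q \<in> vfields A" for Q using Rm_skew2[OF v(1,2,4) that] by simp
  have add1: "Rm (vf_add X' W) Y' Z V p = Rm X' Y' Z V p + Rm W Y' Z V p" if "X' \<in> vfields A" "W \<in> vfields A" "Y' \<in> vfields A" for X' W Y'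
    using that v by (simp add: curvature4_def curvature_add1 metric_tensor_add1 curvature_vfields)
  have add4: "Rm X Y Z' (vf_add V' W) p = Rm X Y Z' V' p + Rm X Y Z' W p" if "Z' \<in> vfields A" "V' \<in> vfields A" "W \<in> vfields A" for Z' V' W
    using that v by (simp add: curvature4_def metric_tensor_add2 curvature_vfields)
  show "Rm (vf_add X W) Y Z V p = Rm X Y Z V p + Rm W Y Z V p \<and> Rm X (vf_add Y W) Z V p = Rm X Y Z V p + Rm X W Z V p \<and>
      Rm X Y (vf_add Z W) V p = Rm X Y Z V p + Rm X Y W V p \<and> Rm X Y Z (vf_add V W) p = Rm X Y Z V p + Rm X Y Z W p"
    if w: "W \<in> vfields A"
    using add1[OF v(1) w v(2)] add1[OF v(2) w v(1)] s2[OF vf_add_vfields[OF v(2) w]] s2[OF v(2)] s2[OF w]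
      add4[OF v(3,4) w] add4[OF v(4,3) w] s3[OF vf_add_vfields[OF v(3) w]] s3[OF v(3)] s3[OF w] by linarith
  have sc1: "Rm (vf_scale u X') Y' Z V p = u p * Rm X' Y' Z V p" if "X' \<in> vfields A" "Y' \<in> vfields A" "u \<in> smooth_funs A" for X' Y'
    using that v by (simp add: curvature4_def curvature_scale1 metric_tensor_scale1 curvature_vfields)
  have sc4: "Rm X Y Z' (vf_scale u V') p = u p * Rm X Y Z' V' p" if "Z' \<in> vfields A" "V' \<in> vfields A" "u \<in> smooth_funs A" for Z' V'
    using that v by (simp add: curvature4_def metric_tensor_scale2 curvature_vfields)
  show "Rm (vf_scale u X) Y Z V p = u p * Rm X Y Z V p \<and> Rm X (vf_scale u Y) Z V p = u p * Rm X Y Z V p \<and>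
      Rm X Y (vf_scale u Z) V p = u p * Rm X Y Z V p \<and> Rm X Y Z (vf_scale u V) p = u p * Rm X Y Z V p"
    if u: "u \<in> smooth_funs A"
    using sc1[OF v(1,2) u] sc1[OF v(2,1) u] sc4[OF v(3,4) u] sc4[OF v(4,3) u]
      s2[OF vf_scale_vfields[OF u v(2)]] s2[OF v(2)] s3[OF vf_scale_vfields[OF u v(3)]] s3[OF v(3)] by simp
qed

text \<open>The right side is a trace of the tensor \<open>nabla D S\<close> at p, hence independent
  of the frame, and with a smooth local frame it is \<open>nabla_contr_local\<close>.\<close>

lemma nabla_contr:
  assumes S: "tens (Suc (Suc n)) S" and X: "X \<in> vfields A" and Ys: "length Ys = n" "set Ys \<subseteq> vfields A"
    and E: "orthonormal_at A g p E"
  shows "nabla D (contr S) (X # Ys) p = (\<Sum>a<8. nabla D S (X # E a # E a # Ys) p)"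
proof -
  \<comment> \<open>The direction of differentiation moves behind the two traced slots, since
    \<open>contr\<close> traces the first two.\<close>
  let ?is = "2 # 0 # 1 # [3..<n + 3]"
  let ?S' = "tprod ?is [] (nabla D S) (\<lambda>_ _. 1)"
  have "shuffle (Suc (Suc (Suc n))) 0 ?is []"
    unfolding shuffle_def by auto
  from tens_tprod[OF tens_nabla[OF S] tens_const this]
  have S': "tens (Suc (Suc (Suc n))) ?S'" by simp
  have map: "map ((!) (a # b # X # Ys)) ?is = X # a # b # Ys" for a b
  proof -
    have "map ((!) (a # b # X # Ys)) [3..<n + 3] = Ys"
    proof (rule nth_equalityI)
      fix i assume "i < length (map ((!) (a # b # X # Ys)) [3..<n + 3])"
      then have "i < n" by simp
      then have "map ((!) (a # b # X # Ys)) [3..<n + 3] ! i = (a # b # X # Ys) ! (3 + i)" by (subst nth_map) simp_all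
      also have "\<dots> = Ys ! i" by (simp add: eval_nat_numeral)
      finally show "map ((!) (a # b # X # Ys)) [3..<n + 3] ! i = Ys ! i" .
    qed (simp add: Ys(1))
    then show ?thesis by (simp add: numeral_2_eq_2)
  qed
  have XYs: "length (X # Ys) = Suc n" "set (X # Ys) \<subseteq> vfields A" using X Ys by simp_all
  have c: "contr ?S' (X # Ys) p = (\<Sum>a<8. nabla D S (X # H a # H a # Ys) p)" if "orthonormal_at A g p H" for H
    unfolding contr_frame[OF S' XYs that] by (simp only: tprod_def map) simp
  from local_orthonormal_frame[of p] obtain H N where
    HN: "(\<forall>a<8. H a \<in> vfields A) \<and> open N \<and> p \<in> N \<and> (\<forall>q\<in>N. orthonormal_at A g q H)" by (elim exE)
  then have H: "\<And>a. a < 8 \<Longrightarrow> H a \<in> vfields A" and N: "open N" "p \<in> N" and on: "\<And>q. q \<in> N \<Longrightarrow> orthonormal_at A g q H"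
    by simp_all
  show ?thesis
    using nabla_contr_local[OF S X Ys H N on] c[OF on[OF N(2)]] c[OF E] by (simp only:)
qed

section \<open>The Bianchi identities with torsion\<close>

lemma first_Bianchi_vector:
  assumes v: "X \<in> vfields A" "Y \<in> vfields A" "Z \<in> vfields A"
  shows "curvature D X Y Z p f + curvature D Y Z X p f + curvature D Z X Y p f =
    (D X (tau Y Z) p f - tau (D X Y) Z p f - tau Y (D X Z) p f + tau (tau X Y) Z p f) +
    (D Y (tau Z X) p f - tau (D Y Z) X p f - tau Z (D Y X) p f + tau (tau Y Z) X p f) +
    (D Z (tau X Y) p f - tau (D Z X) Y p f - tau X (D Z Y) p f + tau (tau Z X) Y p f)"
proof -
  have 1: "D X' (tau Y' Z') p f - tau (D X' Y') Z' p f - tau Y' (D X' Z') p f + tau (tau X' Y') Z' p f =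
    D X' (D Y' Z') p f - D X' (D Z' Y') p f - D X' (lie_bracket Y' Z') p f
    + D (D X' Z') Y' p f - D Y' (D X' Z') p f + lie_bracket Y' (D X' Z') p f
    - D (D Y' X') Z' p f - D (lie_bracket X' Y') Z' p f + D Z' (D Y' X') p f + D Z' (lie_bracket X' Y') p f
    + lie_bracket (D Y' X') Z' p f + lie_bracket (lie_bracket X' Y') Z' p f"
    if "X' \<in> vfields A" "Y' \<in> vfields A" "Z' \<in> vfields A" for X' Y' Z'
    using that unfolding tau_def
    by (simp add: D_diff1 D_diff2 D_vfields lie_bracket_vfields vf_diff_vfields lie_bracket_diff1) (simp add: vf_diff_def)
  show ?thesis
    unfolding 1[OF v] 1[OF v(2,3,1)] 1[OF v(3,1,2)] curvature_app
    using lie_bracket_jacobi[OF v, of p f]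
      lie_bracket_skew[of Y "D X Z" p f] lie_bracket_skew[of Z "D Y X" p f] lie_bracket_skew[of X "D Z Y" p f]
    by simp
qed

lemma nabla_Tt: "nabla D Tt [X, Y, Z, V] p = X p (Tor Y Z V) - Tor (D X Y) Z V p - Tor Y (D X Z) V p - Tor Y Z (D X V) p"
  by (simp add: nabla_Cons Tt_def numeral_eq_Suc)

lemma nabla_Tt_metric:
  assumes v: "X \<in> vfields A" "Y \<in> vfields A" "Z \<in> vfields A" "V \<in> vfields A"
  shows "nabla D Tt [X, Y, Z, V] p = metric_tensor g (vf_diff (vf_diff (D X (tau Y Z)) (tau (D X Y) Z)) (tau Y (D X Z))) V p"
  using v unfolding nabla_Tt Tor_eq
  by (simp add: metric_parallel tau_vfields D_vfields metric_tensor_diff1 vf_diff_vfields)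

lemma first_Bianchi:
  assumes v: "X \<in> vfields A" "Y \<in> vfields A" "Z \<in> vfields A" "V \<in> vfields A"
  shows "Rm X Y Z V p + Rm Y Z X V p + Rm Z X Y V p =
    nabla D Tt [X, Y, Z, V] p + nabla D Tt [Y, Z, X, V] p + nabla D Tt [Z, X, Y, V] p +
    (Tor (tau X Y) Z V p + Tor (tau Y Z) X V p + Tor (tau Z X) Y V p)"
proof -
  let ?B = "\<lambda>X Y Z. vf_add (vf_diff (vf_diff (D X (tau Y Z)) (tau (D X Y) Z)) (tau Y (D X Z))) (tau (tau X Y) Z)"
  have "vf_add (vf_add (curvature D X Y Z) (curvature D Y Z X)) (curvature D Z X Y) = vf_add (vf_add (?B X Y Z) (?B Y Z X)) (?B Z X Y)"
    using first_Bianchi_vector[OF v(1,2,3)] by (intro ext) (simp add: vf_add_def vf_diff_def)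
  from arg_cong[OF this, of "\<lambda>U. metric_tensor g U V p"]
  show ?thesis
    using v unfolding nabla_Tt_metric[OF v] nabla_Tt_metric[OF v(2,3,1,4)] nabla_Tt_metric[OF v(3,1,2,4)] curvature4_def Tor_eq
    by (simp add: metric_tensor_add1 vf_add_vfields vf_diff_vfields D_vfields tau_vfields curvature_vfields)
qed

lemma D_jacobi:
  assumes v: "W \<in> vfields A" "X \<in> vfields A" "Y \<in> vfields A" "Z \<in> vfields A"
  shows "D (lie_bracket (lie_bracket W X) Y) Z p f + D (lie_bracket (lie_bracket X Y) W) Z p f + D (lie_bracket (lie_bracket Y W) X) Z p f = 0"
proof -
  let ?a = "lie_bracket (lie_bracket W X) Y" and ?b = "lie_bracket (lie_bracket X Y) W" and ?c = "lie_bracket (lie_bracket Y W) X"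
  have "vf_add (vf_add ?a ?b) ?c = vf_scale (\<lambda>_. 0) ?a"
    using lie_bracket_jacobi[OF v(1,2,3)] by (intro ext) (simp add: vf_add_def vf_scale_def)
  from arg_cong[OF this, of "\<lambda>U. D U Z p f"]
  show ?thesis using v by (simp add: D_add1 D_scale1 smooth_const lie_bracket_vfields vf_add_vfields) (simp add: vf_add_def vf_scale_def)
qed

lemma curvature_diff1:
  assumes v: "X \<in> vfields A" "W \<in> vfields A" "Y \<in> vfields A" "Z \<in> vfields A"
  shows "curvature D (vf_diff X W) Y Z = vf_diff (curvature D X Y Z) (curvature D W Y Z)"
  unfolding vf_diff_eq using v by (simp add: curvature_add1 curvature_scale1 vf_scale_vfields smooth_const)

text \<open>The torsion terms replace the difference of \<open>D W X\<close> and
  \<open>D X W\<close> by the bracket in the first slots of the curvature; the commutators then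
  cancel and the Jacobi identity removes what is left.\<close>

lemma second_Bianchi_vector:
  assumes v: "W \<in> vfields A" "X \<in> vfields A" "Y \<in> vfields A" "Z \<in> vfields A"
  shows "(D W (curvature D X Y Z) p f - curvature D (D W X) Y Z p f - curvature D X (D W Y) Z p f - curvature D X Y (D W Z) p f + curvature D (tau W X) Y Z p f) +
    (D X (curvature D Y W Z) p f - curvature D (D X Y) W Z p f - curvature D Y (D X W) Z p f - curvature D Y W (D X Z) p f + curvature D (tau X Y) W Z p f) +
    (D Y (curvature D W X Z) p f - curvature D (D Y W) X Z p f - curvature D W (D Y X) Z p f - curvature D W X (D Y Z) p f + curvature D (tau Y W) X Z p f) = 0"
proof -
  have 1: "curvature D (tau W' X') Y' Z p f = curvature D (D W' X') Y' Z p f - curvature D (D X' W') Y' Z p f - curvature D (lie_bracket W' X') Y' Z p f"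
    if "W' \<in> vfields A" "X' \<in> vfields A" "Y' \<in> vfields A" for W' X' Y'
    using that v(4) unfolding tau_def by (simp add: curvature_diff1 D_vfields lie_bracket_vfields vf_diff_vfields) (simp add: vf_diff_def)
  have 2: "curvature D X' (D W' Y') Z p f = - curvature D (D W' Y') X' Z p f"
    if "W' \<in> vfields A" "X' \<in> vfields A" "Y' \<in> vfields A" for W' X' Y'
    using curvature_skew1[OF D_vfields[OF that(1,3)] that(2) v(4)] by simp
  have 3: "D W' (curvature D X' Y' Z) p f = D W' (D X' (D Y' Z)) p f - D W' (D Y' (D X' Z)) p f - D W' (D (lie_bracket X' Y') Z) p f"
    if "W' \<in> vfields A" "X' \<in> vfields A" "Y' \<in> vfields A" for W' X' Y'
    using that v(4) unfolding curvature_def by (simp add: D_diff2 D_vfields lie_bracket_vfields vf_diff_vfields) (simp add: vf_diff_def)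
  show ?thesis
    unfolding 1[OF v(1,2,3)] 1[OF v(2,3,1)] 1[OF v(3,1,2)] 2[OF v(1,2,3)] 2[OF v(2,3,1)] 2[OF v(3,1,2)]
      3[OF v(1,2,3)] 3[OF v(2,3,1)] 3[OF v(3,1,2)]
      curvature_app[of _ _ "D _ Z"] curvature_app[of "lie_bracket _ _"]
    using D_jacobi[OF v, of p f] by simp
qed

lemma nabla_Rt: "nabla D Rt [W, X, Y, Z, V] p = W p (Rm X Y Z V) - Rm (D W X) Y Z V p - Rm X (D W Y) Z V p - Rm X Y (D W Z) V p - Rm X Y Z (D W V) p"
  by (simp add: nabla_Cons Rt_def numeral_eq_Suc)

lemma second_Bianchi:
  assumes v: "W \<in> vfields A" "X \<in> vfields A" "Y \<in> vfields A" "Z \<in> vfields A" "V \<in> vfields A"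
  shows "nabla D Rt [W, X, Y, Z, V] p + nabla D Rt [X, Y, W, Z, V] p + nabla D Rt [Y, W, X, Z, V] p +
    (Rm (tau W X) Y Z V p + Rm (tau X Y) W Z V p + Rm (tau Y W) X Z V p) = 0"
proof -
  let ?B = "\<lambda>W X Y. vf_add (vf_diff (vf_diff (vf_diff (D W (curvature D X Y Z)) (curvature D (D W X) Y Z)) (curvature D X (D W Y) Z)) (curvature D X Y (D W Z)))
      (curvature D (tau W X) Y Z)"
  have eq: "nabla D Rt [W', X', Y', Z, V] p + Rm (tau W' X') Y' Z V p = metric_tensor g (?B W' X' Y') V p"
    if "W' \<in> vfields A" "X' \<in> vfields A" "Y' \<in> vfields A" for W' X' Y'
    using that v(4,5) unfolding nabla_Rt curvature4_def
    by (simp add: metric_parallel curvature_vfields D_vfields tau_vfields vf_diff_vfields metric_tensor_add1 metric_tensor_diff1)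
  have Bv: "?B W' X' Y' \<in> vfields A" if "W' \<in> vfields A" "X' \<in> vfields A" "Y' \<in> vfields A" for W' X' Y'
    using that v(4) by (intro vf_add_vfields vf_diff_vfields D_vfields curvature_vfields tau_vfields)
  have "vf_add (vf_add (?B W X Y) (?B X Y W)) (?B Y W X) = vf_scale (\<lambda>_. 0) (?B W X Y)"
    using second_Bianchi_vector[OF v(1,2,3,4)] by (intro ext) (simp add: vf_add_def vf_diff_def vf_scale_def)
  from arg_cong[OF this, of "\<lambda>U. metric_tensor g U V p"]
  have "metric_tensor g (?B W X Y) V p + metric_tensor g (?B X Y W) V p + metric_tensor g (?B Y W X) V p = 0"
    using Bv[OF v(1,2,3)] Bv[OF v(2,3,1)] Bv[OF v(3,1,2)] v(5) by (simp add: metric_tensor_add1 metric_tensor_scale1 vf_add_vfields)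
  then show ?thesis using eq[OF v(1,2,3)] eq[OF v(2,3,1)] eq[OF v(3,1,2)] by linarith
qed

end

section \<open>Linear combinations of tensors, and tensor identities checked in a frame\<close>

context manifold
begin

lemma tens_lin:
  assumes "tens n S" "tens n S'"
  shows "tens n (\<lambda>Xs p. a * S Xs p + b * S' Xs p)"
proof (rule tensI)
  fix Xs :: "'a vfield list" assume Xs: "length Xs = n" "set Xs \<subseteq> vfields A"
  show "(\<lambda>p. a * S Xs p + b * S' Xs p) \<in> smooth_funs A"
    by (rule smooth_add[OF smooth_mult[OF smooth_const tens_smooth[OF assms(1) Xs]] smooth_mult[OF smooth_const tens_smooth[OF assms(2) Xs]]])
  fix i and X Y :: "'a vfield" and u p assume i: "i < n" and X: "X \<in> vfields A"
  show "a * S (Xs[i := vf_add X Y]) p + b * S' (Xs[i := vf_add X Y]) p =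
    a * S (Xs[i := X]) p + b * S' (Xs[i := X]) p + (a * S (Xs[i := Y]) p + b * S' (Xs[i := Y]) p)" if "Y \<in> vfields A"
    by (simp add: tens_add[OF assms(1) Xs i X that] tens_add[OF assms(2) Xs i X that] algebra_simps)
  show "a * S (Xs[i := vf_scale u X]) p + b * S' (Xs[i := vf_scale u X]) p = u p * (a * S (Xs[i := X]) p + b * S' (Xs[i := X]) p)"
    if "u \<in> smooth_funs A"
    by (simp add: tens_scale[OF assms(1) Xs i that X] tens_scale[OF assms(2) Xs i that X] algebra_simps)
qed

lemma nabla_lin:
  assumes S: "tens n S" "tens n S'" and X: "X \<in> vfields A" and Ys: "length Ys = n" "set Ys \<subseteq> vfields A"
  shows "nabla D (\<lambda>Xs p. a * S Xs p + b * S' Xs p) (X # Ys) p = a * nabla D S (X # Ys) p + b * nabla D S' (X # Ys) p"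
proof -
  note s = tens_smooth[OF S(1) Ys] tens_smooth[OF S(2) Ys]
  have "X p (\<lambda>p. a * S Ys p + b * S' Ys p) = a * X p (S Ys) + b * X p (S' Ys)"
    using vfield_add_app[OF X smooth_mult[OF smooth_const s(1)] smooth_mult[OF smooth_const s(2)], of p a b]
    by (simp add: vfield_cmult_app[OF X s(1)] vfield_cmult_app[OF X s(2)])
  then show ?thesis by (simp add: nabla_Cons sum.distrib sum_distrib_left right_diff_distrib)
qed

end

context spin7_manifold
begin

text \<open>Slots are expanded one at a time: in the induction the first j entries are arbitrary
  fields and the others are frame fields.\<close>

lemma tens_eq_of_frame:
  assumes S: "tens n S" "tens n S'" and E: "orthonormal_at A g q E"
    and eq: "\<And>Xs. length Xs = n \<Longrightarrow> (\<And>i. i < n \<Longrightarrow> \<exists>a<8. Xs ! i = E a) \<Longrightarrow> S Xs q = S' Xs q"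
    and Xs: "length Xs = n" "set Xs \<subseteq> vfields A"
  shows "S Xs q = S' Xs q"
proof -
  note Ev = orthonormal_vfields[OF E]
  have "j \<le> n \<Longrightarrow> length Xs = n \<Longrightarrow> set Xs \<subseteq> vfields A \<Longrightarrow> (\<And>i. j \<le> i \<Longrightarrow> i < n \<Longrightarrow> \<exists>a<8. Xs ! i = E a) \<Longrightarrow> S Xs q = S' Xs q" for j Xs
  proof (induction j arbitrary: Xs)
    case 0
    then show ?case by (intro eq) auto
  next
    case (Suc j)
    have j: "j < n" using Suc.prems(1) by simp
    have Xj: "Xs ! j \<in> vfields A" using Suc.prems j by (auto intro: nth_vfields)
    have IH: "S (Xs[j := E a]) q = S' (Xs[j := E a]) q" if a: "a < 8" for a
    proof (rule Suc.IH)
      show "j \<le> n" using j by simp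
      show "length (Xs[j := E a]) = n" using Suc.prems by simp
      show "set (Xs[j := E a]) \<subseteq> vfields A" by (rule update_vfields[OF Suc.prems(3) Ev[OF a]])
      fix i assume i: "j \<le> i" "i < n"
      show "\<exists>b<8. Xs[j := E a] ! i = E b"
      proof (cases "i = j")
        case True
        then show ?thesis using a Suc.prems(2) j by auto
      next
        case False
        then show ?thesis using Suc.prems(4)[of i] i by simp
      qed
    qed
    have "S Xs q = S (Xs[j := Xs ! j]) q" by simp
    also have "\<dots> = (\<Sum>a<8. g q ((Xs ! j) q) (E a q) * S (Xs[j := E a]) q)"
      by (rule tens_expand[OF S(1) Suc.prems(2,3) j E Xj])
    also have "\<dots> = (\<Sum>a<8. g q ((Xs ! j) q) (E a q) * S' (Xs[j := E a]) q)"
      by (rule sum.cong[OF refl]) (simp add: IH)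
    also have "\<dots> = S' (Xs[j := Xs ! j]) q"
      by (rule tens_expand[OF S(2) Suc.prems(2,3) j E Xj, symmetric])
    finally show ?case by simp
  qed
  from this[of n Xs] show ?thesis using Xs by simp
qed

lemma adapted_frame_at:
  "\<exists>E. orthonormal_at A g p E \<and> (\<forall>a<8. \<forall>b<8. \<forall>c<8. \<forall>d<8. form4_tensor \<Psi> (E a) (E b) (E c) (E d) p = psi a b c d)"
proof -
  from local_adapted_frame[of p] obtain E N U \<theta> where E0: "(\<forall>a<8. E a \<in> vfields A) \<and> open N \<and> p \<in> N \<and> N \<subseteq> U \<and> adapted_coframe A \<Psi> U \<theta> \<and>
    (\<forall>q\<in>N. \<forall>a<8. \<forall>b<8. \<theta> a q (E b q) = (if b = a then 1 else 0))" by (elim exE)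
  then have Ev: "\<And>a. a < 8 \<Longrightarrow> E a \<in> vfields A" and U: "p \<in> U" "adapted_coframe A \<Psi> U \<theta>"
    and \<theta>: "\<And>a b. a < 8 \<Longrightarrow> b < 8 \<Longrightarrow> \<theta> a p (E b p) = kronecker a b" by (auto simp: kronecker_def)
  have "g p (E a p) (E b p) = (if a = b then 1 else 0)" if ab: "a < 8" "b < 8" for a b
  proof -
    have "g p (E a p) (E b p) = (\<Sum>i<8. \<theta> i p (E a p) * \<theta> i p (E b p))"
      by (rule cof_metric[OF U(2,1) vfieldsD(1)[OF Ev[OF ab(1)]] vfieldsD(1)[OF Ev[OF ab(2)]]])
    also have "\<dots> = (\<Sum>i<8. (if i = a then if a = b then 1 else 0 else 0))"
      by (rule sum.cong[OF refl]) (simp add: \<theta> ab kronecker_def)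
    also have "\<dots> = (if a = b then 1 else 0)" using ab by (simp add: sum.delta)
    finally show ?thesis .
  qed
  then have "orthonormal_at A g p E" using Ev by (simp add: orthonormal_at_def)
  moreover have "form4_tensor \<Psi> (E a) (E b) (E c) (E d) p = psi a b c d" if abcd: "a < 8" "b < 8" "c < 8" "d < 8" for a b c d
  proof -
    have w: "wedge1111 (\<theta> i p) (\<theta> j p) (\<theta> k p) (\<theta> l p) (E a p) (E b p) (E c p) (E d p) =
        wedge1111 (kronecker i) (kronecker j) (kronecker k) (kronecker l) a b c d" if "i < 8" "j < 8" "k < 8" "l < 8" for i j k l
      unfolding wedge1111_expand by (simp only: \<theta> that abcd)
    have "form4_tensor \<Psi> (E a) (E b) (E c) (E d) p = cayley_form (\<lambda>i. \<theta> i p) (E a p) (E b p) (E c p) (E d p)"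
      unfolding form4_tensor_def by (rule cof_form[OF U(2,1)]; rule vfieldsD(1)[OF Ev]; rule abcd)
    also have "\<dots> = psi a b c d" unfolding psi_def cayley_form_def Let_def by (simp add: w)
    finally show ?thesis .
  qed
  ultimately show ?thesis by blast
qed

end

section \<open>The Ricci identity for T, and curvature acting on \<Psi>\<close>

context spin7_connection
begin

lemma nabla4: "nabla D S [M, X, Y, Z, V] p = M p (S [X, Y, Z, V]) - S [D M X, Y, Z, V] p - S [X, D M Y, Z, V] p - S [X, Y, D M Z, V] p - S [X, Y, Z, D M V] p"
  by (simp add: nabla_Cons numeral_eq_Suc)

lemma Tt_list: "Tt [X, Y, Z] = Tor X Y Z" and Rt_list: "Rt [X, Y, Z, V] = Rm X Y Z V" and Pt_list: "Pt [X, Y, Z, V] = form4_tensor \<Psi> X Y Z V"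
  by (simp_all add: Tt_def Rt_def Pt_def fun_eq_iff)

lemma nabla_Pt: 
  assumes "M \<in> vfields A" "X \<in> vfields A" "Y \<in> vfields A" "Z \<in> vfields A" "V \<in> vfields A"
  shows "nabla D Pt [M, X, Y, Z, V] p = 0"
  unfolding nabla4 Pt_list form_parallel[OF assms] by simp

lemma Tor_diff1:
  assumes v: "X \<in> vfields A" "W \<in> vfields A" "Y \<in> vfields A" "Z \<in> vfields A"
  shows "Tor (vf_diff X W) Y Z p = Tor X Y Z p - Tor W Y Z p"
    and "Tor Y (vf_diff X W) Z p = Tor Y X Z p - Tor Y W Z p"
    and "Tor Y Z (vf_diff X W) p = Tor Y Z X p - Tor Y Z W p"
proof -
  have 3: "Tor Y Z (vf_diff X W) p = Tor Y Z X p - Tor Y Z W p" if "Y \<in> vfields A" "Z \<in> vfields A" for Y Z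
    using that v unfolding Tor_eq by (simp add: metric_tensor_diff2 tau_vfields)
  show "Tor Y Z (vf_diff X W) p = Tor Y Z X p - Tor Y Z W p" by (rule 3[OF v(3,4)])
  show "Tor (vf_diff X W) Y Z p = Tor X Y Z p - Tor W Y Z p"
    using 3[OF v(3,4)] Tor_cyc[OF vf_diff_vfields[OF v(1,2)] v(3,4), of p] Tor_cyc[OF v(1,3,4), of p] Tor_cyc[OF v(2,3,4), of p] by simp
  show "Tor Y (vf_diff X W) Z p = Tor Y X Z p - Tor Y W Z p"
    using 3[OF v(3,4)] Tor_skew(2)[OF v(3) vf_diff_vfields[OF v(1,2)] v(4), of p] Tor_skew(2)[OF v(3,1,4), of p] Tor_skew(2)[OF v(3,2,4), of p] by simp
qed

lemma Tor_smooth: "X \<in> vfields A \<Longrightarrow> Y \<in> vfields A \<Longrightarrow> Z \<in> vfields A \<Longrightarrow> Tor X Y Z \<in> smooth_funs A"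
  unfolding Tor_eq by (rule metric_smooth[OF tau_vfields])

lemma second_nabla_Tt:
  assumes v: "X \<in> vfields A" "Y \<in> vfields A" "B \<in> vfields A" "C \<in> vfields A" "E \<in> vfields A"
  shows "X p (nabla D Tt [Y, B, C, E]) =
    X p (\<lambda>q. Y q (Tor B C E)) - X p (Tor (D Y B) C E) - X p (Tor B (D Y C) E) - X p (Tor B C (D Y E))"
proof -
  have e: "nabla D Tt [Y, B, C, E] = (\<lambda>q. Y q (Tor B C E) - Tor (D Y B) C E q - Tor B (D Y C) E q - Tor B C (D Y E) q)"
    by (rule ext) (rule nabla_Tt)
  have s0: "(\<lambda>q. Y q (Tor B C E)) \<in> smooth_funs A" by (rule vfieldsD(2)[OF v(2) Tor_smooth[OF v(3,4,5)]])
  have s1: "Tor (D Y B) C E \<in> smooth_funs A" by (rule Tor_smooth[OF D_vfields[OF v(2,3)] v(4,5)])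
  have s2: "Tor B (D Y C) E \<in> smooth_funs A" by (rule Tor_smooth[OF v(3) D_vfields[OF v(2,4)] v(5)])
  have s3: "Tor B C (D Y E) \<in> smooth_funs A" by (rule Tor_smooth[OF v(3,4) D_vfields[OF v(2,5)]])
  show ?thesis unfolding e
    by (simp only: vfield_diff_app[OF v(1) smooth_diff[OF smooth_diff[OF s0 s1] s2] s3]
        vfield_diff_app[OF v(1) smooth_diff[OF s0 s1] s2] vfield_diff_app[OF v(1) s0 s1])
qed

text \<open>The curvature acts on each of the three slots of T. The last term is the effect of
  torsion: \<open>D X Y\<close> minus \<open>D Y X\<close> exceeds the bracket by
  \<open>tau X Y\<close>.\<close>

lemma Ricci_identity_Tor:
  assumes v: "X \<in> vfields A" "Y \<in> vfields A" "B \<in> vfields A" "C \<in> vfields A" "E \<in> vfields A"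
  shows "nabla D (nabla D Tt) [X, Y, B, C, E] p - nabla D (nabla D Tt) [Y, X, B, C, E] p =
    - (Tor (curvature D X Y B) C E p + Tor B (curvature D X Y C) E p + Tor B C (curvature D X Y E) p) - nabla D Tt [tau X Y, B, C, E] p"
proof -
  note c = D_vfields lie_bracket_vfields vf_diff_vfields
  have 1: "Tor (curvature D X Y B) C E p = Tor (D X (D Y B)) C E p - Tor (D Y (D X B)) C E p - Tor (D (lie_bracket X Y) B) C E p"
    using v unfolding curvature_def by (simp add: Tor_diff1 c)
  have 2: "Tor B (curvature D X Y C) E p = Tor B (D X (D Y C)) E p - Tor B (D Y (D X C)) E p - Tor B (D (lie_bracket X Y) C) E p"
    using v unfolding curvature_def by (simp add: Tor_diff1 c)
  have 3: "Tor B C (curvature D X Y E) p = Tor B C (D X (D Y E)) p - Tor B C (D Y (D X E)) p - Tor B C (D (lie_bracket X Y) E) p"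
    using v unfolding curvature_def by (simp add: Tor_diff1 c)
  have d: "D (tau X Y) Z = vf_diff (vf_diff (D (D X Y) Z) (D (D Y X) Z)) (D (lie_bracket X Y) Z)" if "Z \<in> vfields A" for Z
    using v that unfolding tau_def by (simp add: D_diff1 c)
  have 4: "nabla D Tt [tau X Y, B, C, E] p =
     nabla D Tt [D X Y, B, C, E] p - nabla D Tt [D Y X, B, C, E] p - nabla D Tt [lie_bracket X Y, B, C, E] p"
    using v unfolding nabla_Tt tau_app[of X Y p "Tor B C E"] by (simp add: d Tor_diff1 c)
  have 5: "nabla D Tt [lie_bracket X Y, B, C, E] p = X p (\<lambda>q. Y q (Tor B C E)) - Y p (\<lambda>q. X q (Tor B C E))
     - Tor (D (lie_bracket X Y) B) C E p - Tor B (D (lie_bracket X Y) C) E p - Tor B C (D (lie_bracket X Y) E) p"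
    unfolding nabla_Tt using commutator[of X Y p "Tor B C E"] by simp
  show ?thesis
    unfolding nabla4[of "nabla D Tt"] second_nabla_Tt[OF v] second_nabla_Tt[OF v(2,1,3,4,5)] 1 2 3 4 5
    unfolding nabla_Tt by simp
qed

lemma form4_diff:
  assumes v: "X \<in> vfields A" "W \<in> vfields A" "B \<in> vfields A" "C \<in> vfields A" "E \<in> vfields A"
  shows "form4_tensor \<Psi> (vf_diff X W) B C E p = form4_tensor \<Psi> X B C E p - form4_tensor \<Psi> W B C E p"
    "form4_tensor \<Psi> B (vf_diff X W) C E p = form4_tensor \<Psi> B X C E p - form4_tensor \<Psi> B W C E p"
    "form4_tensor \<Psi> B C (vf_diff X W) E p = form4_tensor \<Psi> B C X E p - form4_tensor \<Psi> B C W E p"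
    "form4_tensor \<Psi> B C E (vf_diff X W) p = form4_tensor \<Psi> B C E X p - form4_tensor \<Psi> B C E W p"
proof -
  have 1: "form4_tensor \<Psi> (vf_diff X W) B C E p = form4_tensor \<Psi> X B C E p - form4_tensor \<Psi> W B C E p"
    if "B \<in> vfields A" "C \<in> vfields A" "E \<in> vfields A" for B C E
    using that v unfolding vf_diff_eq by (simp add: form4_add1 form4_scale1 vf_scale_vfields smooth_const)
  have s1: "form4_tensor \<Psi> B Q C E p = - form4_tensor \<Psi> Q B C E p" if "Q \<in> vfields A" for Q
    using form4_skew(1)[OF that v(3,4,5)] by simp
  have s2: "form4_tensor \<Psi> B C Q E p = form4_tensor \<Psi> Q B C E p" if "Q \<in> vfields A" for Q
    using form4_skew(1)[OF v(3) that v(4,5), of p] form4_skew(2)[OF v(3) that v(4,5), of p] by simp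
  have s3: "form4_tensor \<Psi> B C E Q p = - form4_tensor \<Psi> Q B C E p" if "Q \<in> vfields A" for Q
    using form4_skew(1)[OF v(3) that v(4,5), of p] form4_skew(2)[OF v(3) that v(4,5), of p] form4_skew(3)[OF v(3,4) that v(5), of p] by simp
  show "form4_tensor \<Psi> (vf_diff X W) B C E p = form4_tensor \<Psi> X B C E p - form4_tensor \<Psi> W B C E p"
    by (rule 1[OF v(3,4,5)])
  note d = vf_diff_vfields[OF v(1,2)]
  show "form4_tensor \<Psi> B (vf_diff X W) C E p = form4_tensor \<Psi> B X C E p - form4_tensor \<Psi> B W C E p"
    using 1[OF v(3,4,5)] s1[OF d] s1[OF v(1)] s1[OF v(2)] by linarith
  show "form4_tensor \<Psi> B C (vf_diff X W) E p = form4_tensor \<Psi> B C X E p - form4_tensor \<Psi> B C W E p"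
    using 1[OF v(3,4,5)] s2[OF d] s2[OF v(1)] s2[OF v(2)] by linarith
  show "form4_tensor \<Psi> B C E (vf_diff X W) p = form4_tensor \<Psi> B C E X p - form4_tensor \<Psi> B C E W p"
    using 1[OF v(3,4,5)] s3[OF d] s3[OF v(1)] s3[OF v(2)] by linarith
qed

lemma second_deriv_form:
  assumes v: "X \<in> vfields A" "Y \<in> vfields A" "B \<in> vfields A" "C \<in> vfields A" "E \<in> vfields A" "F \<in> vfields A"
  shows "X p (\<lambda>q. Y q (form4_tensor \<Psi> B C E F)) = X p (form4_tensor \<Psi> (D Y B) C E F) + X p (form4_tensor \<Psi> B (D Y C) E F)
    + X p (form4_tensor \<Psi> B C (D Y E) F) + X p (form4_tensor \<Psi> B C E (D Y F))"
proof -
  have e: "(\<lambda>q. Y q (form4_tensor \<Psi> B C E F)) = (\<lambda>q. form4_tensor \<Psi> (D Y B) C E F q + form4_tensor \<Psi> B (D Y C) E F q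
    + form4_tensor \<Psi> B C (D Y E) F q + form4_tensor \<Psi> B C E (D Y F) q)"
    by (rule ext) (rule form_parallel[OF v(2-6)])
  have s1: "form4_tensor \<Psi> (D Y B) C E F \<in> smooth_funs A" by (rule form4_smooth[OF D_vfields[OF v(2,3)] v(4,5,6)])
  have s2: "form4_tensor \<Psi> B (D Y C) E F \<in> smooth_funs A" by (rule form4_smooth[OF v(3) D_vfields[OF v(2,4)] v(5,6)])
  have s3: "form4_tensor \<Psi> B C (D Y E) F \<in> smooth_funs A" by (rule form4_smooth[OF v(3,4) D_vfields[OF v(2,5)] v(6)])
  have s4: "form4_tensor \<Psi> B C E (D Y F) \<in> smooth_funs A" by (rule form4_smooth[OF v(3,4,5) D_vfields[OF v(2,6)]])
  show ?thesis unfolding e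
    by (simp only: vfield_add_app[OF v(1) smooth_add[OF smooth_add[OF s1 s2] s3] s4]
        vfield_add_app[OF v(1) smooth_add[OF s1 s2] s3] vfield_add_app[OF v(1) s1 s2])
qed

text \<open>The two expressions for the bracket acting on a component of \<Psi> are compared, using
  that \<Psi> is parallel: the curvature endomorphism annihilates \<Psi>, so the last index pair of
  R lies in spin(7).\<close>

lemma curvature_form:
  assumes v: "X \<in> vfields A" "Y \<in> vfields A" "B \<in> vfields A" "C \<in> vfields A" "E \<in> vfields A" "F \<in> vfields A"
  shows "form4_tensor \<Psi> (curvature D X Y B) C E F p + form4_tensor \<Psi> B (curvature D X Y C) E F p
    + form4_tensor \<Psi> B C (curvature D X Y E) F p + form4_tensor \<Psi> B C E (curvature D X Y F) p = 0"
proof -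
  note c = D_vfields lie_bracket_vfields vf_diff_vfields
  have "lie_bracket X Y p (form4_tensor \<Psi> B C E F) = form4_tensor \<Psi> (D (lie_bracket X Y) B) C E F p + form4_tensor \<Psi> B (D (lie_bracket X Y) C) E F p
    + form4_tensor \<Psi> B C (D (lie_bracket X Y) E) F p + form4_tensor \<Psi> B C E (D (lie_bracket X Y) F) p"
    by (rule form_parallel[OF lie_bracket_vfields[OF v(1,2)] v(3-6)])
  then show ?thesis
    using v commutator[of X Y p "form4_tensor \<Psi> B C E F"] second_deriv_form[OF v, of p] second_deriv_form[OF v(2,1,3,4,5,6), of p]
    unfolding curvature_def by (simp add: form4_diff c form_parallel)
qed

context
  fixes q E
  assumes E: "orthonormal_at A g q E"
begin

lemma Tor_tau_expand:
  assumes v: "X \<in> vfields A" "Y \<in> vfields A" "Z \<in> vfields A" "V \<in> vfields A"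
  shows "Tor (tau X Y) Z V q = (\<Sum>s<8. Tor X Y (E s) q * Tor (E s) Z V q)"
  using tens_expand[OF tens_Tt, of "[X, Z, V]" 0 q E "tau X Y"] v E
  by (simp add: Tt_list tau_vfields) (simp add: Tor_eq metric_tensor_def)

lemma Tor_curvature_expand:
  assumes v: "X \<in> vfields A" "Y \<in> vfields A" "B \<in> vfields A" "Z \<in> vfields A" "V \<in> vfields A"
  shows "Tor (curvature D X Y B) Z V q = (\<Sum>s<8. Rm X Y B (E s) q * Tor (E s) Z V q)"
    "Tor Z (curvature D X Y B) V q = (\<Sum>s<8. Rm X Y B (E s) q * Tor Z (E s) V q)"
    "Tor Z V (curvature D X Y B) q = (\<Sum>s<8. Rm X Y B (E s) q * Tor Z V (E s) q)"
  using tens_expand[OF tens_Tt, of "[X, Z, V]" 0 q E "curvature D X Y B"] tens_expand[OF tens_Tt, of "[Z, X, V]" 1 q E "curvature D X Y B"]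
    tens_expand[OF tens_Tt, of "[Z, V, X]" 2 q E "curvature D X Y B"] v E
  by (simp_all add: Tt_list curvature_vfields curvature4_def metric_tensor_def)

lemma form_curvature_expand:
  assumes v: "X \<in> vfields A" "Y \<in> vfields A" "B \<in> vfields A" "Z \<in> vfields A" "V \<in> vfields A" "W \<in> vfields A"
  shows "form4_tensor \<Psi> (curvature D X Y B) Z V W q = (\<Sum>s<8. Rm X Y B (E s) q * form4_tensor \<Psi> (E s) Z V W q)"
    "form4_tensor \<Psi> Z (curvature D X Y B) V W q = (\<Sum>s<8. Rm X Y B (E s) q * form4_tensor \<Psi> Z (E s) V W q)"
    "form4_tensor \<Psi> Z V (curvature D X Y B) W q = (\<Sum>s<8. Rm X Y B (E s) q * form4_tensor \<Psi> Z V (E s) W q)"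
    "form4_tensor \<Psi> Z V W (curvature D X Y B) q = (\<Sum>s<8. Rm X Y B (E s) q * form4_tensor \<Psi> Z V W (E s) q)"
  using tens_expand[OF tens_Pt, of "[X, Z, V, W]" 0 q E "curvature D X Y B"] tens_expand[OF tens_Pt, of "[Z, X, V, W]" 1 q E "curvature D X Y B"]
    tens_expand[OF tens_Pt, of "[Z, V, X, W]" 2 q E "curvature D X Y B"] tens_expand[OF tens_Pt, of "[Z, V, W, X]" 3 q E "curvature D X Y B"] v E
  by (simp_all add: Pt_list curvature_vfields curvature4_def metric_tensor_def)

lemma Rm_tau_expand:
  assumes v: "X \<in> vfields A" "Y \<in> vfields A" "Z \<in> vfields A" "V \<in> vfields A" "W \<in> vfields A"
  shows "Rm (tau X Y) Z V W q = (\<Sum>s<8. Tor X Y (E s) q * Rm (E s) Z V W q)"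
  using tens_expand[OF tens_Rt, of "[X, Z, V, W]" 0 q E "tau X Y"] v E
  by (simp add: Rt_list tau_vfields) (simp add: Tor_eq metric_tensor_def)

lemma nabla_Tt_tau_expand:
  assumes v: "X \<in> vfields A" "Y \<in> vfields A" "Z \<in> vfields A" "V \<in> vfields A" "W \<in> vfields A"
  shows "nabla D Tt [tau X Y, Z, V, W] q = (\<Sum>s<8. Tor X Y (E s) q * nabla D Tt [E s, Z, V, W] q)"
  using tens_expand[OF tens_nabla[OF tens_Tt], of "[X, Z, V, W]" 0 q E "tau X Y"] v E
  by (simp add: tau_vfields numeral_eq_Suc) (simp add: Tor_eq metric_tensor_def)

end

end

section \<open>Algebra of the curvature at a point\<close>

abbreviation sum8 :: "(nat \<Rightarrow> real) \<Rightarrow> real" where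
  "sum8 f \<equiv> sum f {..<8}"

text \<open>Multiple sums are kept as opaque constants so that relabelling and linearity can be
  applied to the sum as a whole.\<close>

definition sum3 :: "(nat \<Rightarrow> nat \<Rightarrow> nat \<Rightarrow> real) \<Rightarrow> real" where
  "sum3 f = (\<Sum>a<8. \<Sum>b<8. \<Sum>c<8. f a b c)"

definition sum4 :: "(nat \<Rightarrow> nat \<Rightarrow> nat \<Rightarrow> nat \<Rightarrow> real) \<Rightarrow> real" where
  "sum4 f = (\<Sum>a<8. \<Sum>b<8. \<Sum>c<8. \<Sum>d<8. f a b c d)"

definition sum5 :: "(nat \<Rightarrow> nat \<Rightarrow> nat \<Rightarrow> nat \<Rightarrow> nat \<Rightarrow> real) \<Rightarrow> real" where
  "sum5 f = (\<Sum>a<8. \<Sum>b<8. \<Sum>c<8. \<Sum>d<8. \<Sum>e<8. f a b c d e)"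

lemma sum3_swap:
  "sum3 (\<lambda>a b c. f b a c) = sum3 f" "sum3 (\<lambda>a b c. f a c b) = sum3 f"
proof -
  show "sum3 (\<lambda>a b c. f b a c) = sum3 f" unfolding sum3_def by (rule sum.swap)
  show "sum3 (\<lambda>a b c. f a c b) = sum3 f" unfolding sum3_def by (rule sum.cong[OF refl], rule sum.swap)
qed

lemma sum4_swap:
  "sum4 (\<lambda>a b c d. f b a c d) = sum4 f" "sum4 (\<lambda>a b c d. f a c b d) = sum4 f" "sum4 (\<lambda>a b c d. f a b d c) = sum4 f"
proof -
  show "sum4 (\<lambda>a b c d. f b a c d) = sum4 f" unfolding sum4_def by (rule sum.swap)
  show "sum4 (\<lambda>a b c d. f a c b d) = sum4 f" unfolding sum4_def by (rule sum.cong[OF refl], rule sum.swap)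
  show "sum4 (\<lambda>a b c d. f a b d c) = sum4 f" unfolding sum4_def by (rule sum.cong[OF refl], rule sum.cong[OF refl], rule sum.swap)
qed

lemma sum5_swap:
  "sum5 (\<lambda>a b c d e. f b a c d e) = sum5 f" "sum5 (\<lambda>a b c d e. f a c b d e) = sum5 f"
  "sum5 (\<lambda>a b c d e. f a b d c e) = sum5 f" "sum5 (\<lambda>a b c d e. f a b c e d) = sum5 f"
proof -
  show "sum5 (\<lambda>a b c d e. f b a c d e) = sum5 f" unfolding sum5_def by (rule sum.swap)
  show "sum5 (\<lambda>a b c d e. f a c b d e) = sum5 f" unfolding sum5_def by (rule sum.cong[OF refl], rule sum.swap)
  show "sum5 (\<lambda>a b c d e. f a b d c e) = sum5 f" unfolding sum5_def by (rule sum.cong[OF refl], rule sum.cong[OF refl], rule sum.swap)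
  show "sum5 (\<lambda>a b c d e. f a b c e d) = sum5 f" unfolding sum5_def
    by (rule sum.cong[OF refl], rule sum.cong[OF refl], rule sum.cong[OF refl], rule sum.swap)
qed

lemma sum3_cong: "(\<And>a b c. f a b c = h a b c) \<Longrightarrow> sum3 f = sum3 h"
  and sum4_cong: "(\<And>a b c d. f' a b c d = h' a b c d) \<Longrightarrow> sum4 f' = sum4 h'"
  and sum5_cong: "(\<And>a b c d e. f'' a b c d e = h'' a b c d e) \<Longrightarrow> sum5 f'' = sum5 h''"
  by (simp_all add: sum3_def sum4_def sum5_def)

lemma sum3_linear:
  "sum3 (\<lambda>a b c. f a b c + h a b c) = sum3 f + sum3 h" "sum3 (\<lambda>a b c. f a b c - h a b c) = sum3 f - sum3 h"
  "sum3 (\<lambda>a b c. - f a b c) = - sum3 f" "sum3 (\<lambda>a b c. x * f a b c) = x * sum3 f" "sum3 (\<lambda>a b c. f a b c * x) = sum3 f * x"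
  unfolding sum3_def by (simp_all add: sum.distrib sum_subtractf sum_negf sum_distrib_left sum_distrib_right)

lemma sum4_linear:
  "sum4 (\<lambda>a b c d. f a b c d + h a b c d) = sum4 f + sum4 h" "sum4 (\<lambda>a b c d. f a b c d - h a b c d) = sum4 f - sum4 h"
  "sum4 (\<lambda>a b c d. - f a b c d) = - sum4 f" "sum4 (\<lambda>a b c d. x * f a b c d) = x * sum4 f"
  unfolding sum4_def by (simp_all add: sum.distrib sum_subtractf sum_negf sum_distrib_left)

lemma sum5_linear:
  "sum5 (\<lambda>a b c d e. f a b c d e + h a b c d e) = sum5 f + sum5 h"
  "sum5 (\<lambda>a b c d e. f a b c d e - h a b c d e) = sum5 f - sum5 h"
  "sum5 (\<lambda>a b c d e. - f a b c d e) = - sum5 f" "sum5 (\<lambda>a b c d e. x * f a b c d e) = x * sum5 f"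
  unfolding sum5_def by (simp_all add: sum.distrib sum_subtractf sum_negf sum_distrib_left)

text \<open>Components in an orthonormal frame: \<open>N\<close> is \<open>\<nabla>T\<close> with the direction of differentiation first, \<open>P\<close> is \<open>\<Psi>\<close>, and \<open>H0\<close> says \<open>d\<^sup>\<nabla>T = 0\<close>.\<close>

locale curvature_algebra =
  fixes T :: "nat \<Rightarrow> nat \<Rightarrow> nat \<Rightarrow> real" and N R P :: "nat \<Rightarrow> nat \<Rightarrow> nat \<Rightarrow> nat \<Rightarrow> real"
  assumes T_skew: "T j i k = - T i j k" "T i k j = - T i j k"
    and N_skew: "N m j i k = - N m i j k" "N m i k j = - N m i j k"
    and R_skew: "R j i k l = - R i j k l" "R i j l k = - R i j k l"
    and P_skew: "P j i k l = - P i j k l" "P i k j l = - P i j k l" "P i j l k = - P i j k l"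
    and Bianchi: "R i j k l + R j k i l + R k i j l = N i j k l + N j k i l + N k i j l +
      sum8 (\<lambda>s. T s i j * T s k l + T s j k * T s i l + T s k i * T s j l)"
    and H0: "N i j k l + N j k i l + N k i j l = N l i j k"
    and eig: "(\<Sum>k<8. \<Sum>l<8. R i j k l * P k l m n) = 2 * R i j m n"
begin

text \<open>The components of \<sigma>^T; see \<open>sigma_form_Tor\<close>.\<close>

definition sg :: "nat \<Rightarrow> nat \<Rightarrow> nat \<Rightarrow> nat \<Rightarrow> real" where
  "sg i j k l = sum8 (\<lambda>s. T s i j * T s k l + T s j k * T s i l + T s k i * T s j l)"

definition ric :: "nat \<Rightarrow> nat \<Rightarrow> real" where
  "ric j k = sum8 (\<lambda>a. R a j k a)"

text \<open>Since \<Psi> is parallel, this is the derivative in direction l of the one-form T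
  contracted with \<Psi>, evaluated on m.\<close>

definition n :: "nat \<Rightarrow> nat \<Rightarrow> real" where
  "n l m = sum3 (\<lambda>i j k. N l i j k * P i j k m)"

definition S :: "nat \<Rightarrow> nat \<Rightarrow> real" where
  "S l m = sum3 (\<lambda>i j k. sg i j k l * P i j k m)"

lemma sg_skew: "sg j i k l = - sg i j k l" "sg i k j l = - sg i j k l" "sg i j l k = - sg i j k l"
proof -
  show "sg j i k l = - sg i j k l"
    unfolding sg_def sum_negf[symmetric] by (rule sum.cong[OF refl])
      (simp add: T_skew(2)[of _ j i] T_skew(2)[of _ i k] T_skew(2)[of _ k j])
  show "sg i k j l = - sg i j k l"
    unfolding sg_def sum_negf[symmetric] by (rule sum.cong[OF refl])
      (simp add: T_skew(2)[of _ i k] T_skew(2)[of _ k j] T_skew(2)[of _ j i])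
  show "sg i j l k = - sg i j k l"
    unfolding sg_def sum_negf[symmetric] by (rule sum.cong[OF refl])
      (simp add: T_skew(2)[of _ l k] T_skew(2)[of _ i k] T_skew(2)[of _ l i])
qed

lemma Bianchi_sg: "R i j k l + R j k i l + R k i j l = sg i j k l + N l i j k"
  using Bianchi[of i j k l] H0[of i j k l] unfolding sg_def by simp

lemma N_cyc: "N m k i j = N m i j k"
  using N_skew(1)[of m i k j] N_skew(2)[of m i j k] by simp

lemma sg_cyc: "sg j k i l = sg i j k l"
  using sg_skew(1)[of j i k l] sg_skew(2)[of j k i l] by simp

lemma sg_rot: "sg l i j k = - sg i j k l"
  using sg_skew(1)[of l i j k] sg_skew(2)[of i l j k] sg_skew(3)[of i j l k] by simp

text \<open>The four cyclic identities with l, i, j, k in turn omitted from the cycle are added.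
  Skewness in both pairs cancels half of the curvature terms and doubles the rest; the 4-form
  \<sigma> enters once with sign plus and three times with sign minus.\<close>

lemma Bianchi_last: "R l i j k + R l j k i + R l k i j = - sg i j k l + N l i j k"
  using Bianchi_sg[of i j k l] Bianchi_sg[of l i j k] Bianchi_sg[of l j k i] Bianchi_sg[of l k i j]
    R_skew(2)[of i j l k] R_skew(2)[of j k l i] R_skew(2)[of k i l j]
    R_skew(1)[of l j i k] R_skew(2)[of l j k i] R_skew(1)[of l k j i] R_skew(2)[of l k i j]
    R_skew(1)[of l i k j] R_skew(2)[of l i j k]
    sg_rot[of l i j k] sg_rot[of l j k i] sg_rot[of l k i j] sg_cyc[of i j k l] sg_cyc[of j k i l]
    N_cyc[of k l i j] N_cyc[of i l j k] N_cyc[of j l k i] H0[of i j k l]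
  by linarith

text \<open>The classical octahedron argument. As \<sigma> is a 4-form its terms cancel and only N
  remains.\<close>

lemma pair_symmetry_defect: "R i j k l - R k l i j = N i j k l - N j i k l"
  using Bianchi_sg[of k i j l] Bianchi_sg[of i j l k] Bianchi_sg[of j l k i] Bianchi_sg[of l k i j]
    R_skew(2)[of i j l k] R_skew(2)[of k i l j] R_skew(1)[of l k i j] R_skew(1)[of l k j i] R_skew(2)[of k l i j]
    R_skew(2)[of j l i k] R_skew(1)[of k j l i] R_skew(2)[of j k i l] R_skew(1)[of i l k j] R_skew(2)[of l i j k]
    sg_cyc[of k i j l] sg_skew(3)[of i j k l] sg_skew(1)[of l j k i] sg_rot[of l j k i] sg_rot[of l k i j] sg_cyc[of i j k l] sg_cyc[of j k i l]
    N_cyc[of l k i j] N_skew(2)[of i j l k] N_cyc[of j l k i] N_skew(1)[of j k i l] H0[of i j k l]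
  by linarith

lemma P_cyc: "P j k i m = P i j k m"
  using P_skew(1)[of k j i m] P_skew(2)[of j k i m] P_skew(1)[of j i k m] P_skew(2)[of j i k m] by simp

lemma sum3_cyc: "sum3 (\<lambda>i j k. f j k i) = sum3 f" "sum3 (\<lambda>i j k. f k i j) = sum3 f"
proof -
  show "sum3 (\<lambda>i j k. f j k i) = sum3 f" for f
    using sum3_swap(2)[of "\<lambda>a b c. f c a b"] sum3_swap(1)[of "\<lambda>a b c. f a c b"] sum3_swap(2)[of f]
      sum3_swap(1)[of "\<lambda>a b c. f b c a"] sum3_swap(2)[of "\<lambda>a b c. f b a c"] sum3_swap(1)[of f] by simp
  from this[of "\<lambda>i j k. f j k i"] this[of f] show "sum3 (\<lambda>i j k. f k i j) = sum3 f" by simp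
qed

lemma ric_contraction: "sum3 (\<lambda>i j k. R l i j k * P i j k m) = 2 * ric l m"
proof -
  have "sum3 (\<lambda>i j k. R l i j k * P i j k m) = sum3 (\<lambda>i j k. R l i j k * P j k i m)"
    by (rule sum3_cong) (simp add: P_cyc[of _ _ _ m])
  also have "\<dots> = (\<Sum>i<8. \<Sum>j<8. \<Sum>k<8. R l i j k * P j k i m)"
    by (simp add: sum3_def)
  also have "\<dots> = (\<Sum>i<8. 2 * R l i i m)" by (simp only: eig)
  also have "\<dots> = (\<Sum>i<8. 2 * R i l m i)"
    by (rule sum.cong[OF refl]) (simp add: R_skew(1)[of l] R_skew(2)[of _ _ m])
  finally show ?thesis by (simp add: ric_def sum_distrib_left)
qed

text \<open>Contracting \<open>Bianchi_last\<close> with \<Psi> makes the three curvature terms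
  equal, and the eigenvalue 2 on the last index pair turns each into twice the Ricci tensor; hence
  the factor 6.\<close>

lemma ric_formula: "6 * ric l m = - S l m + n l m"
proof -
  have "sum3 (\<lambda>i j k. R l j k i * P i j k m) = sum3 (\<lambda>i j k. R l i j k * P i j k m)"
    using sum3_cyc(1)[of "\<lambda>i j k. R l i j k * P i j k m"] sum3_cong[of "\<lambda>i j k. R l j k i * P i j k m" "\<lambda>i j k. R l j k i * P j k i m"]
    by (metis P_cyc)
  moreover have "sum3 (\<lambda>i j k. R l k i j * P i j k m) = sum3 (\<lambda>i j k. R l i j k * P i j k m)"
    using sum3_cyc(2)[of "\<lambda>i j k. R l i j k * P i j k m"] sum3_cong[of "\<lambda>i j k. R l k i j * P i j k m" "\<lambda>i j k. R l k i j * P k i j m"]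
    by (metis P_cyc)
  moreover have "sum3 (\<lambda>i j k. (R l i j k + R l j k i + R l k i j) * P i j k m) = sum3 (\<lambda>i j k. (- sg i j k l + N l i j k) * P i j k m)"
    unfolding Bianchi_last ..
  ultimately show ?thesis
    unfolding S_def n_def using ric_contraction[of l m] by (simp add: distrib_right left_diff_distrib sum3_linear)
qed

lemma ric_antisym: "ric j k - ric k j = sum8 (\<lambda>a. N a a j k)"
proof -
  have "ric j k - ric k j = sum8 (\<lambda>a. R a j k a - R a k j a)" by (simp add: ric_def sum_subtractf)
  also have "\<dots> = sum8 (\<lambda>a. N a a j k)"
  proof (rule sum.cong[OF refl])
    fix a
    show "R a j k a - R a k j a = N a a j k"
      using pair_symmetry_defect[of a j k a] R_skew(1)[of k a a j] R_skew(2)[of a k a j] N_skew(1)[of j a k a] N_skew(2)[of j a k a]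
        N_skew(1)[of j k a a] N_skew(2)[of j k a a] N_skew(1)[of a j a k] N_skew(2)[of a j a k] by linarith
  qed
  finally show ?thesis .
qed

end

section \<open>Consequences of the instanton condition\<close>

locale instanton_algebra = curvature_algebra +
  assumes inst: "(\<Sum>a<8. \<Sum>b<8. R a b i j * P a b k l) = 2 * R k l i j"
begin

text \<open>The analogous contraction of the cyclic sum over the first three indices, where the
  eigenvalue 2 on the first index pair is used. Now S and n carry the same sign, unlike in
  \<open>ric_formula\<close>.\<close>

lemma ric_formula': "- 6 * ric m l = S l m + n l m"
proof -
  have 0: "sum3 (\<lambda>i j k. R i j k l * P i j k m) = - 2 * ric m l"
  proof -
    have "sum3 (\<lambda>i j k. R i j k l * P i j k m) = sum3 (\<lambda>k i j. R i j k l * P i j k m)"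
      by (rule sum3_cyc(1)[symmetric])
    also have "\<dots> = (\<Sum>k<8. 2 * R k m k l)" unfolding sum3_def by (simp only: inst)
    also have "\<dots> = - 2 * ric m l" unfolding ric_def sum_distrib_left
      by (rule sum.cong[OF refl]) (simp add: R_skew(2)[of _ _ l])
    finally show ?thesis .
  qed
  have "sum3 (\<lambda>i j k. R j k i l * P i j k m) = sum3 (\<lambda>i j k. R i j k l * P i j k m)"
    using sum3_cyc(1)[of "\<lambda>i j k. R i j k l * P i j k m"] sum3_cong[of "\<lambda>i j k. R j k i l * P i j k m" "\<lambda>i j k. R j k i l * P j k i m"]
    by (metis P_cyc)
  moreover have "sum3 (\<lambda>i j k. R k i j l * P i j k m) = sum3 (\<lambda>i j k. R i j k l * P i j k m)"
    using sum3_cyc(2)[of "\<lambda>i j k. R i j k l * P i j k m"] sum3_cong[of "\<lambda>i j k. R k i j l * P i j k m" "\<lambda>i j k. R k i j l * P k i j m"]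
    by (metis P_cyc)
  moreover have "sum3 (\<lambda>i j k. (R i j k l + R j k i l + R k i j l) * P i j k m) = sum3 (\<lambda>i j k. (sg i j k l + N l i j k) * P i j k m)"
    unfolding Bianchi_sg ..
  ultimately show ?thesis
    unfolding S_def n_def using 0 by (simp add: distrib_right left_diff_distrib sum3_linear)
qed

text \<open>Adding the two Ricci formulas cancels S and leaves n as three times the skew part ric l
  m - ric m l, which the traced pair defect identifies.\<close>

lemma star: "n l m = 3 * sum8 (\<lambda>a. N a a l m)"
  using ric_formula[of l m] ric_formula'[of m l] ric_antisym[of l m] by simp

lemma n_skew: "n m l = - n l m"
  using star[of l m] ric_formula[of l m] ric_formula'[of m l] ric_formula[of m l] ric_formula'[of l m] by simp

end

lemma sum4_tuple: "sum4 f = (\<Sum>(a, b, c, d)\<in>{..<8} \<times> {..<8} \<times> {..<8} \<times> {..<8}. f a b c d)"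
  by (simp add: sum4_def sum.cartesian_product)

lemma sum5_tuple: "sum5 f = (\<Sum>(a, b, c, d, e)\<in>{..<8} \<times> {..<8} \<times> {..<8} \<times> {..<8} \<times> {..<8}. f a b c d e)"
  by (simp add: sum5_def sum.cartesian_product)

lemma sum4_swap13: "sum4 (\<lambda>a b c d. f c b a d) = sum4 f"
  unfolding sum4_tuple
  by (rule sum.reindex_bij_witness[of _ "\<lambda>(a, b, c, d). (c, b, a, d)" "\<lambda>(a, b, c, d). (c, b, a, d)"]) auto

lemma sum4_rot:
  "sum4 (\<lambda>a b c d. f d a b c) = sum4 f" "sum4 (\<lambda>a b c d. f b c d a) = sum4 f"
proof -
  show "sum4 (\<lambda>a b c d. f d a b c) = sum4 f" unfolding sum4_tuple
    by (rule sum.reindex_bij_witness[of _ "\<lambda>(a, b, c, d). (b, c, d, a)" "\<lambda>(a, b, c, d). (d, a, b, c)"]) auto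
  show "sum4 (\<lambda>a b c d. f b c d a) = sum4 f" unfolding sum4_tuple
    by (rule sum.reindex_bij_witness[of _ "\<lambda>(a, b, c, d). (d, a, b, c)" "\<lambda>(a, b, c, d). (b, c, d, a)"]) auto
qed

lemma sum4_rot3:
  "sum4 (\<lambda>a b c d. f b c a d) = sum4 f" "sum4 (\<lambda>a b c d. f c a b d) = sum4 f" "sum4 (\<lambda>a b c d. f a c d b) = sum4 f" "sum4 (\<lambda>a b c d. f a d b c) = sum4 f"
proof -
  show "sum4 (\<lambda>a b c d. f b c a d) = sum4 f" unfolding sum4_tuple
    by (rule sum.reindex_bij_witness[of _ "\<lambda>(a, b, c, d). (c, a, b, d)" "\<lambda>(a, b, c, d). (b, c, a, d)"]) auto
  show "sum4 (\<lambda>a b c d. f c a b d) = sum4 f" unfolding sum4_tuple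
    by (rule sum.reindex_bij_witness[of _ "\<lambda>(a, b, c, d). (b, c, a, d)" "\<lambda>(a, b, c, d). (c, a, b, d)"]) auto
  show "sum4 (\<lambda>a b c d. f a c d b) = sum4 f" unfolding sum4_tuple
    by (rule sum.reindex_bij_witness[of _ "\<lambda>(a, b, c, d). (a, d, b, c)" "\<lambda>(a, b, c, d). (a, c, d, b)"]) auto
  show "sum4 (\<lambda>a b c d. f a d b c) = sum4 f" unfolding sum4_tuple
    by (rule sum.reindex_bij_witness[of _ "\<lambda>(a, b, c, d). (a, c, d, b)" "\<lambda>(a, b, c, d). (a, d, b, c)"]) auto
qed

lemma sum4_first: "sum8 (\<lambda>a. sum3 (f a)) = sum4 f"
  by (simp add: sum3_def sum4_def)

lemma sum4_last: "sum8 (\<lambda>d. sum3 (\<lambda>a b c. f a b c d)) = sum4 f"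
  using sum4_rot(2)[of f] sum4_first[of "\<lambda>d a b c. f a b c d"] by simp

lemma sum4_inner: "sum3 (\<lambda>a b c. sum8 (f a b c)) = sum4 f"
  by (simp add: sum3_def sum4_def)

lemma sum5_inner: "sum4 (\<lambda>a b c d. sum8 (f a b c d)) = sum5 f"
  by (simp add: sum4_def sum5_def)

lemma antisymmetric_sum4_zero:
  assumes "\<And>a b c d. f b a c d = - f a b c d"
  shows "sum4 f = 0"
proof -
  have "sum4 f = sum4 (\<lambda>a b c d. f b a c d)" by (rule sum4_swap(1)[symmetric])
  also have "\<dots> = sum4 (\<lambda>a b c d. - f a b c d)" by (rule sum4_cong) (rule assms)
  also have "\<dots> = - sum4 f" by (rule sum4_linear(3))
  finally show ?thesis by simp
qed

section \<open>Contractions with the torsion\<close>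

context curvature_algebra
begin

lemma T_cyc: "T j k i = T i j k"
  using T_skew(1)[of j i k] T_skew(2)[of j i k] by simp

lemma T_rev: "T k j i = - T i j k"
  using T_skew(1)[of k j i] T_skew(2)[of j i k] T_skew(1)[of j i k] by simp

definition t :: "nat \<Rightarrow> real" where
  "t l = sum3 (\<lambda>a b c. T a b c * P a b c l)"

text \<open>Half the derivative of the squared norm of T in direction l; accordingly
  \<open>gam\<close> is half the derivative of that norm along t.\<close>

definition G :: "nat \<Rightarrow> real" where
  "G l = sum3 (\<lambda>a b c. N l a b c * T a b c)"

definition gam :: real where
  "gam = sum8 (\<lambda>s. t s * G s)"

lemma T_sym_contraction: "sum4 (\<lambda>s k i j. T s i j * T k i j * h s k) = 0" if "\<And>s k. h k s = - h s k"
proof (rule antisymmetric_sum4_zero)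
  fix s k i j
  show "T k i j * T s i j * h k s = - (T s i j * T k i j * h s k)" using that[of s k] by simp
qed

text \<open>By cyclicity the three summands of \<sigma> contribute equally, and each contracts T_sij
  T_kij, symmetric in s and k, with T_skl, skew in them.\<close>

lemma sg_T: "sum3 (\<lambda>i j k. sg i j k l * T i j k) = 0"
proof -
  let ?f = "\<lambda>i j k. sum8 (\<lambda>s. T s i j * T s k l) * T i j k"
  have "sum3 (\<lambda>i j k. sg i j k l * T i j k) = sum3 (\<lambda>i j k. ?f i j k + ?f j k i + ?f k i j)"
  proof (rule sum3_cong)
    fix i j k
    show "sg i j k l * T i j k = ?f i j k + ?f j k i + ?f k i j"
      using T_cyc[of j k i] T_cyc[of k i j] by (simp add: sg_def sum.distrib algebra_simps)
  qed
  also have "\<dots> = 3 * sum3 ?f" by (simp add: sum3_linear sum3_cyc[of ?f])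
  also have "sum3 ?f = sum4 (\<lambda>i j k s. T s i j * T s k l * T i j k)"
    unfolding sum4_inner[symmetric] by (rule sum3_cong) (simp add: sum_distrib_right)
  also have "\<dots> = sum4 (\<lambda>s i j k. T s i j * T s k l * T i j k)" by (rule sum4_rot(1))
  also have "\<dots> = sum4 (\<lambda>s k i j. T s i j * T s k l * T i j k)" by (rule sum4_rot3(3)[symmetric])
  also have "\<dots> = sum4 (\<lambda>s k i j. T s i j * T k i j * T s k l)"
  proof (rule sum4_cong)
    fix s k i j
    show "T s i j * T s k l * T i j k = T s i j * T k i j * T s k l" using T_cyc[of i j k] by simp
  qed
  also have "\<dots> = 0" by (rule T_sym_contraction) (rule T_skew(1))
  finally show ?thesis by simp
qed

text \<open>Contraction with the cyclic T replaces R by a third of its cyclic sum over the last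
  three indices, from which \<sigma> drops out by \<open>sg_T\<close>.\<close>

lemma R_T_last: "sum3 (\<lambda>n i j. R l n i j * T n i j) = (1/3) * G l"
proof -
  let ?f = "\<lambda>i j k. R l i j k * T i j k"
  have "sum3 (\<lambda>i j k. (R l i j k + R l j k i + R l k i j) * T i j k) = sum3 (\<lambda>i j k. ?f i j k + ?f j k i + ?f k i j)"
  proof (rule sum3_cong)
    fix i j k
    show "(R l i j k + R l j k i + R l k i j) * T i j k = ?f i j k + ?f j k i + ?f k i j"
      using T_cyc[of j k i] T_cyc[of k i j] by (simp add: algebra_simps)
  qed
  also have "\<dots> = 3 * sum3 ?f" by (simp add: sum3_linear sum3_cyc[of ?f])
  finally have "3 * sum3 ?f = sum3 (\<lambda>i j k. (- sg i j k l + N l i j k) * T i j k)" unfolding Bianchi_last by simp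
  also have "\<dots> = - sum3 (\<lambda>i j k. sg i j k l * T i j k) + G l"
    unfolding G_def by (simp add: distrib_right left_diff_distrib sum3_linear)
  finally show ?thesis using sg_T[of l] by simp
qed

lemma R_T_first: "sum3 (\<lambda>k l j. R k l j s * T k l j) = (1/3) * G s"
proof -
  let ?f = "\<lambda>i j k. R i j k s * T i j k"
  have "sum3 (\<lambda>i j k. (R i j k s + R j k i s + R k i j s) * T i j k) = sum3 (\<lambda>i j k. ?f i j k + ?f j k i + ?f k i j)"
  proof (rule sum3_cong)
    fix i j k
    show "(R i j k s + R j k i s + R k i j s) * T i j k = ?f i j k + ?f j k i + ?f k i j"
      using T_cyc[of j k i] T_cyc[of k i j] by (simp add: algebra_simps)
  qed
  also have "\<dots> = 3 * sum3 ?f" by (simp add: sum3_linear sum3_cyc[of ?f])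
  finally have "3 * sum3 ?f = sum3 (\<lambda>i j k. (sg i j k s + N s i j k) * T i j k)" unfolding Bianchi_sg by simp
  also have "\<dots> = sum3 (\<lambda>i j k. sg i j k s * T i j k) + G s"
    unfolding G_def by (simp add: distrib_right sum3_linear)
  finally show ?thesis using sg_T[of s] by simp
qed

text \<open>d^\<nabla> T = 0 says that N has no totally skew part, so it is orthogonal to the 4-form
  \<sigma>.\<close>

lemma N_sg: "sum4 (\<lambda>i j k l. N i j k l * sg i j k l) = 0"
proof -
  let ?f = "\<lambda>i j k l. N i j k l * sg i j k l"
  have "0 = sum4 (\<lambda>i j k l. (N i j k l + N j k i l + N k i j l - N l i j k) * sg i j k l)"
    unfolding H0 by (simp add: sum4_def)
  also have "\<dots> = sum4 (\<lambda>i j k l. ?f i j k l + ?f j k i l + ?f k i j l + ?f l i j k)"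
  proof (rule sum4_cong)
    fix i j k l
    show "(N i j k l + N j k i l + N k i j l - N l i j k) * sg i j k l = ?f i j k l + ?f j k i l + ?f k i j l + ?f l i j k"
      using sg_cyc[of j k i l] sg_cyc[of k i j l] sg_rot[of l i j k] by (simp add: algebra_simps)
  qed
  also have "\<dots> = 4 * sum4 ?f" by (simp add: sum4_linear sum4_rot3[of ?f] sum4_rot(1)[of ?f])
  finally show ?thesis by simp
qed

lemma N_T_T: "sum5 (\<lambda>s i k l j. N s i k l * (T j s i * T j k l)) = 0"
proof -
  let ?h = "\<lambda>s i k l. N s i k l * sum8 (\<lambda>j. T j s i * T j k l)"
  have "0 = sum4 (\<lambda>s i k l. N s i k l * sg s i k l)" by (simp add: N_sg)
  also have "\<dots> = sum4 (\<lambda>s i k l. ?h s i k l + ?h s k l i + ?h s l i k)"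
  proof (rule sum4_cong)
    fix s i k l
    have 1: "sum8 (\<lambda>j. T j i k * T j s l) = sum8 (\<lambda>j. T j s l * T j i k)" by (simp add: mult.commute)
    have 2: "sum8 (\<lambda>j. T j k s * T j i l) = sum8 (\<lambda>j. T j s k * T j l i)"
      by (rule sum.cong[OF refl]) (simp add: T_skew(2)[of _ k s] T_skew(2)[of _ i l])
    have "sg s i k l = sum8 (\<lambda>j. T j s i * T j k l) + sum8 (\<lambda>j. T j s k * T j l i) + sum8 (\<lambda>j. T j s l * T j i k)"
      unfolding sg_def sum.distrib 1[symmetric] 2[symmetric] by simp
    moreover have "N s k l i = N s i k l" "N s l i k = N s i k l" using N_cyc[of s k l i] N_cyc[of s l i k] by simp_all
    ultimately show "N s i k l * sg s i k l = ?h s i k l + ?h s k l i + ?h s l i k" by (simp add: algebra_simps)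
  qed
  also have "\<dots> = 3 * sum4 ?h" by (simp add: sum4_linear sum4_rot3[of ?h])
  finally have "sum4 ?h = 0" by simp
  then show ?thesis unfolding sum5_inner[symmetric] by (simp add: sum_distrib_left)
qed

text \<open>This contraction arises twice: from the second Bianchi identity, with \<alpha> the first
  index pair of R, and from the Ricci identity, with \<alpha> the last.\<close>

definition Xc :: "(nat \<Rightarrow> nat \<Rightarrow> real) \<Rightarrow> nat \<Rightarrow> real" where
  "Xc \<alpha> v = sum4 (\<lambda>s m k l. T m k s * \<alpha> s l * P m k l v)"

text \<open>The vanishing action of \<alpha> on \<Psi> is contracted with T in three of the four
  slots. These three slots each give \<open>Xc\<close>, and the remaining one gives \<alpha> applied
  to t.\<close>

lemma Xc_invariance:
  assumes act: "\<And>a b c d. sum8 (\<lambda>s. \<alpha> a s * P s b c d + \<alpha> b s * P a s c d + \<alpha> c s * P a b s d + \<alpha> d s * P a b c s) = 0"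
  shows "3 * Xc \<alpha> v = - sum8 (\<lambda>l. \<alpha> v l * t l)"
proof -
  let ?F = "\<lambda>s m k l. T m k s * \<alpha> s l * P m k l v"
  let ?F1 = "\<lambda>s m k l. T m k s * \<alpha> s l * P l m k v"
  let ?F2 = "\<lambda>s m k l. T m k s * \<alpha> m l * P s l k v"
  let ?F3 = "\<lambda>s m k l. T m k s * \<alpha> k l * P s m l v"
  let ?F4 = "\<lambda>s m k l. T m k s * \<alpha> v l * P s m k l"
  have "0 = sum3 (\<lambda>s m k. T m k s * sum8 (\<lambda>l. \<alpha> s l * P l m k v + \<alpha> m l * P s l k v + \<alpha> k l * P s m l v + \<alpha> v l * P s m k l))"
    by (simp add: act sum3_def)
  also have "\<dots> = sum4 (\<lambda>s m k l. ?F1 s m k l + ?F2 s m k l + ?F3 s m k l + ?F4 s m k l)"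
    unfolding sum4_inner[symmetric] by (rule sum3_cong) (simp add: sum_distrib_left algebra_simps)
  also have "\<dots> = sum4 ?F1 + sum4 ?F2 + sum4 ?F3 + sum4 ?F4" by (simp add: sum4_linear)
  also have "sum4 ?F1 = sum4 ?F"
  proof (rule sum4_cong)
    fix s m k l show "?F1 s m k l = ?F s m k l" using P_cyc[of m k l v] by simp
  qed
  also have "sum4 ?F2 = sum4 (\<lambda>s m k l. ?F2 m s k l)" by (rule sum4_swap(1)[symmetric])
  also have "\<dots> = sum4 ?F"
  proof (rule sum4_cong)
    fix s m k l show "?F2 m s k l = ?F s m k l" using T_rev[of s k m] P_skew(2)[of m l k v] by simp
  qed
  also have "sum4 ?F3 = sum4 (\<lambda>s m k l. ?F3 k m s l)" by (rule sum4_swap13[symmetric])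
  also have "\<dots> = sum4 ?F"
  proof (rule sum4_cong)
    fix s m k l show "?F3 k m s l = ?F s m k l" using T_skew(2)[of m s k] P_skew(1)[of k m l v] by simp
  qed
  also have "sum4 ?F4 = sum4 (\<lambda>a b c d. \<alpha> v d * (T a b c * P a b c d))"
  proof (rule sum4_cong)
    fix s m k l show "?F4 s m k l = \<alpha> v l * (T s m k * P s m k l)" using T_cyc[of m k s] by simp
  qed
  also have "\<dots> = sum8 (\<lambda>l. \<alpha> v l * t l)"
    unfolding sum4_last[symmetric] t_def by (simp add: sum3_linear)
  finally show ?thesis unfolding Xc_def by simp
qed

end

lemma sum4_swap14: "sum4 (\<lambda>a b c d. f d b c a) = sum4 f"
  unfolding sum4_tuple
  by (rule sum.reindex_bij_witness[of _ "\<lambda>(a, b, c, d). (d, b, c, a)" "\<lambda>(a, b, c, d). (d, b, c, a)"]) auto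

lemma sum4_outer: "sum4 f = sum3 (\<lambda>b c d. sum8 (\<lambda>a. f a b c d))"
  unfolding sum4_inner by (rule sum4_rot(1)[symmetric])

section \<open>Differentiated identities and the rough Laplacian of T\<close>

text \<open>Here \<open>M\<close> is \<open>\<nabla>R\<close> and \<open>W\<close> is \<open>\<nabla>\<nabla>T\<close>.\<close>

locale derivative_algebra = instanton_algebra +
  fixes M W :: "nat \<Rightarrow> nat \<Rightarrow> nat \<Rightarrow> nat \<Rightarrow> nat \<Rightarrow> real"
  assumes M_skew: "M m j i k l = - M m i j k l" "M m i j l k = - M m i j k l"
    and W_skew: "W m i k j l = - W m i j k l" "W m i j l k = - W m i j k l"
    and act_first: "sum8 (\<lambda>s. R a s i j * P s b c d + R b s i j * P a s c d + R c s i j * P a b s d + R d s i j * P a b c s) = 0"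
    and act_last: "sum8 (\<lambda>s. R i j a s * P s b c d + R i j b s * P a s c d + R i j c s * P a b s d + R i j d s * P a b c s) = 0"
    and deriv_inst: "(\<Sum>a<8. \<Sum>b<8. M m a b i j * P a b k l) = 2 * M m k l i j"
    and Bianchi2: "M m k l i j + M k l m i j + M l m k i j +
      sum8 (\<lambda>s. T m k s * R s l i j + T k l s * R s m i j + T l m s * R s k i j) = 0"
    and deriv_defect: "M m i j k l - M m k l i j = W m i j k l - W m j i k l"
    and Ricci_identity: "W k l a b c - W l k a b c =
      - sum8 (\<lambda>s. R k l a s * T s b c + R k l b s * T a s c + R k l c s * T a b s) - sum8 (\<lambda>s. T k l s * N s a b c)"
    and deriv_H0: "W m i j k l + W m j k i l + W m k i j l = W m l i j k"
    and deriv_star: "sum3 (\<lambda>a b c. W k l a b c * P a b c j) = 3 * sum8 (\<lambda>a. W k a a l j)"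
begin

text \<open>The second Bianchi identity is contracted with \<Psi>. The differentiated instanton
  condition turns each derivative term into twice the divergence, and each torsion term is
  \<open>Xc\<close> of the first index pair, so \<open>Xc_invariance\<close> leaves only R and
  t.\<close>

lemma divergence_R: "sum8 (\<lambda>m. M m m v i j) = (1/6) * sum8 (\<lambda>l. R v l i j * t l)"
proof -
  let ?\<alpha> = "\<lambda>a b. R a b i j"
  let ?D = "\<lambda>m k l. M m k l i j * P m k l v"
  let ?E = "\<lambda>m k l. sum8 (\<lambda>s. T m k s * R s l i j) * P m k l v"
  have D: "sum3 ?D = 2 * sum8 (\<lambda>m. M m m v i j)"
  proof -
    have "sum3 ?D = sum3 (\<lambda>m k l. M m k l i j * P k l m v)"
    proof (rule sum3_cong)
      fix m k l show "?D m k l = M m k l i j * P k l m v" using P_cyc[of k l m v] by simp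
    qed
    also have "\<dots> = sum8 (\<lambda>m. 2 * M m m v i j)" unfolding sum3_def by (simp only: deriv_inst)
    finally show ?thesis by (simp add: sum_distrib_left)
  qed
  have E: "sum3 ?E = Xc ?\<alpha> v"
  proof -
    have "sum3 ?E = sum4 (\<lambda>m k l s. T m k s * R s l i j * P m k l v)"
      unfolding sum4_inner[symmetric] by (simp add: sum_distrib_right)
    also have "\<dots> = Xc ?\<alpha> v" unfolding Xc_def by (rule sum4_rot(1))
    finally show ?thesis .
  qed
  have "0 = sum3 (\<lambda>m k l. (M m k l i j + M k l m i j + M l m k i j +
      sum8 (\<lambda>s. T m k s * R s l i j + T k l s * R s m i j + T l m s * R s k i j)) * P m k l v)"
    unfolding Bianchi2 by (simp add: sum3_def)
  also have "\<dots> = sum3 (\<lambda>m k l. (?D m k l + ?D k l m + ?D l m k) + (?E m k l + ?E k l m + ?E l m k))"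
  proof (rule sum3_cong)
    fix m k l
    show "(M m k l i j + M k l m i j + M l m k i j +
      sum8 (\<lambda>s. T m k s * R s l i j + T k l s * R s m i j + T l m s * R s k i j)) * P m k l v =
      (?D m k l + ?D k l m + ?D l m k) + (?E m k l + ?E k l m + ?E l m k)"
      using P_cyc[of k l m v] P_cyc[of l m k v] by (simp add: sum.distrib algebra_simps)
  qed
  also have "\<dots> = 3 * sum3 ?D + 3 * sum3 ?E" by (simp add: sum3_linear sum3_cyc[of ?D] sum3_cyc[of ?E])
  finally have "6 * sum8 (\<lambda>m. M m m v i j) = - 3 * Xc ?\<alpha> v" unfolding D E by simp
  also have "\<dots> = sum8 (\<lambda>l. R v l i j * t l)" using Xc_invariance[of ?\<alpha> v, OF act_first] by simp
  finally show ?thesis by simp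
qed

lemma divergence_R_T: "sum3 (\<lambda>v i j. T v i j * sum8 (\<lambda>m. M m m v i j)) = - (1/18) * gam"
proof -
  have "sum3 (\<lambda>v i j. T v i j * sum8 (\<lambda>m. M m m v i j)) = (1/6) * sum3 (\<lambda>v i j. sum8 (\<lambda>l. T v i j * (R v l i j * t l)))"
    unfolding divergence_R by (simp add: sum3_linear(4)[symmetric] sum_distrib_left mult.left_commute)
  also have "sum3 (\<lambda>v i j. sum8 (\<lambda>l. T v i j * (R v l i j * t l))) = sum8 (\<lambda>l. sum3 (\<lambda>v i j. T v i j * (R v l i j * t l)))"
    unfolding sum4_inner sum4_last ..
  also have "\<dots> = sum8 (\<lambda>l. - (1/3) * (t l * G l))"
  proof (rule sum.cong[OF refl])
    fix l
    have "sum3 (\<lambda>v i j. T v i j * (R v l i j * t l)) = sum3 (\<lambda>v i j. (- t l) * (R l v i j * T v i j))"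
    proof (rule sum3_cong)
      fix v i j show "T v i j * (R v l i j * t l) = (- t l) * (R l v i j * T v i j)" using R_skew(1)[of v l i j] by simp
    qed
    also have "\<dots> = (- t l) * ((1/3) * G l)" unfolding sum3_linear(4) R_T_last ..
    finally show "sum3 (\<lambda>v i j. T v i j * (R v l i j * t l)) = - (1/3) * (t l * G l)" by simp
  qed
  also have "\<dots> = - (1/3) * gam" by (simp add: gam_def sum_distrib_left)
  finally show ?thesis by simp
qed

text \<open>The derivative in direction k of Ric_lj, as skewness in both pairs gives R_liij =
  R_ilji.\<close>

definition dric :: "nat \<Rightarrow> nat \<Rightarrow> nat \<Rightarrow> real" where
  "dric k l j = sum8 (\<lambda>i. M k l i i j)"

text \<open>The derivative of \<open>n\<close>, hence the second derivative of the one-form t;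
  \<Psi> is parallel.\<close>

definition V :: "nat \<Rightarrow> nat \<Rightarrow> nat \<Rightarrow> real" where
  "V k l j = sum3 (\<lambda>a b c. W k l a b c * P a b c j)"

text \<open>\<open>K1\<close> and \<open>K2\<close> are the cubic contractions of R with two factors
  T. They enter both evaluations of the Laplacian only as 2 K1 + K2 and are eliminated.\<close>

definition K1 :: real where "K1 = sum5 (\<lambda>i j k l s. T j k l * T i k s * R s l i j)"

definition K2 :: real where "K2 = sum4 (\<lambda>j k l s. T j k l * T k l s * ric s j)"

text \<open>The trace of the differentiated pair defect; \<open>deriv_star\<close> expresses the
  resulting trace of W by V.\<close>

lemma dric_antisym: "dric k l j - dric k j l = (1/3) * V k l j"
proof -
  have "dric k l j - dric k j l = sum8 (\<lambda>i. M k l i i j - M k j i i l)" by (simp add: dric_def sum_subtractf)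
  also have "\<dots> = sum8 (\<lambda>i. W k i i l j)"
  proof (rule sum.cong[OF refl])
    fix i
    show "M k l i i j - M k j i i l = W k i i l j"
      using deriv_defect[of k l i i j] M_skew(1)[of k i j l i] M_skew(2)[of k j i l i]
        W_skew(1)[of k l i i j] W_skew(1)[of k i l i j] by simp
  qed
  finally show ?thesis using deriv_star[of k l j] by (simp add: V_def)
qed

text \<open>This is the Ricci identity for the one-form t, derived from that for T: contracted with
  \<Psi>, the curvature terms on the three slots of T become equal, and \<open>Xc_invariance\<close>
  on the last index pair moves the curvature onto t.\<close>

lemma V_antisym: "V k l j - V l k j = - sum8 (\<lambda>s. R k l j s * t s) - sum8 (\<lambda>s. T k l s * n s j)"
proof -
  let ?\<alpha> = "\<lambda>a b. R k l a b"
  let ?Y1 = "\<lambda>a b c s. R k l a s * T s b c * P a b c j"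
  let ?Y2 = "\<lambda>a b c s. R k l b s * T a s c * P a b c j"
  let ?Y3 = "\<lambda>a b c s. R k l c s * T a b s * P a b c j"
  let ?Z = "\<lambda>a b c s. T k l s * (N s a b c * P a b c j)"
  have "V k l j - V l k j = sum3 (\<lambda>a b c. (W k l a b c - W l k a b c) * P a b c j)"
    by (simp add: V_def left_diff_distrib sum3_linear)
  also have "\<dots> = sum3 (\<lambda>a b c. sum8 (\<lambda>s. - ?Y1 a b c s - ?Y2 a b c s - ?Y3 a b c s - ?Z a b c s))"
  proof (rule sum3_cong)
    fix a b c
    show "(W k l a b c - W l k a b c) * P a b c j = sum8 (\<lambda>s. - ?Y1 a b c s - ?Y2 a b c s - ?Y3 a b c s - ?Z a b c s)"
      unfolding Ricci_identity by (simp add: left_diff_distrib distrib_right sum_distrib_right sum.distrib sum_subtractf sum_negf mult.assoc)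
  qed
  also have "\<dots> = - sum4 ?Y1 - sum4 ?Y2 - sum4 ?Y3 - sum4 ?Z" unfolding sum4_inner by (simp add: sum4_linear)
  also have "sum4 ?Y2 = sum4 (\<lambda>a b c s. ?Y2 b a c s)" by (rule sum4_swap(1)[symmetric])
  also have "\<dots> = sum4 ?Y1"
  proof (rule sum4_cong)
    fix a b c s show "?Y2 b a c s = ?Y1 a b c s" using T_skew(1)[of b s c] P_skew(1)[of b a c j] by simp
  qed
  also have "sum4 ?Y3 = sum4 (\<lambda>a b c s. ?Y3 c b a s)" by (rule sum4_swap13[symmetric])
  also have "\<dots> = sum4 ?Y1"
  proof (rule sum4_cong)
    fix a b c s
    have "P c b a j = - P a b c j" using P_skew(1)[of c b a j] P_cyc[of b c a j] by simp
    then show "?Y3 c b a s = ?Y1 a b c s" using T_rev[of c b s] by simp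
  qed
  also have "sum4 ?Y1 = - Xc ?\<alpha> j"
  proof -
    have "Xc ?\<alpha> j = sum4 (\<lambda>a b c d. - ?Y1 d b c a)" unfolding Xc_def
    proof (rule sum4_cong)
      fix a b c d
      show "T b c a * R k l a d * P b c d j = - (R k l d a * T a b c * P d b c j)"
        using T_cyc[of b c a] R_skew(2)[of k l a d] P_cyc[of b c d j] by simp
    qed
    also have "\<dots> = - sum4 ?Y1" unfolding sum4_linear(3) sum4_swap14[of ?Y1] ..
    finally show ?thesis by simp
  qed
  also have "sum4 ?Z = sum8 (\<lambda>s. T k l s * n s j)"
    unfolding sum4_last[symmetric] n_def by (simp add: sum3_linear)
  finally have "V k l j - V l k j = 3 * Xc ?\<alpha> j - sum8 (\<lambda>s. T k l s * n s j)" by simp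
  then show ?thesis using Xc_invariance[of ?\<alpha> j, OF act_last] by simp
qed

text \<open>The skewness of n meets the symmetric contraction T_sij T_kij.\<close>

lemma n_T_T: "sum4 (\<lambda>j k l s. T j k l * (T k l s * n s j)) = 0"
proof -
  have "sum4 (\<lambda>j k l s. T j k l * (T k l s * n s j)) = sum4 (\<lambda>j s k l. T j k l * (T k l s * n s j))"
    by (rule sum4_rot3(3)[symmetric])
  also have "\<dots> = sum4 (\<lambda>s k i j. T s i j * T k i j * n k s)"
  proof (rule sum4_cong)
    fix s k i j show "T s i j * (T i j k * n k s) = T s i j * T k i j * n k s" using T_cyc[of i j k] by simp
  qed
  also have "\<dots> = 0" by (rule T_sym_contraction) (rule n_skew)
  finally show ?thesis .
qed

text \<open>Against the skew T only the antisymmetric part of V in k and l counts, which is half of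
  \<open>V_antisym\<close>. Its term in n drops out by \<open>n_T_T\<close>, and
  \<open>R_T_first\<close> reduces the curvature term to a third of gam.\<close>

lemma T_V: "sum3 (\<lambda>j k l. T j k l * V k l j) = - (1/6) * gam"
proof -
  let ?f = "\<lambda>j k l. T j k l * V k l j"
  have "sum3 ?f = sum3 (\<lambda>j k l. ?f j l k)" by (rule sum3_swap(2)[symmetric])
  also have "\<dots> = sum3 (\<lambda>j k l. - (T j k l * V l k j))"
  proof (rule sum3_cong)
    fix j k l show "?f j l k = - (T j k l * V l k j)" using T_skew(2)[of j l k] by simp
  qed
  finally have "2 * sum3 ?f = sum3 (\<lambda>j k l. T j k l * V k l j - T j k l * V l k j)" by (simp add: sum3_linear)
  also have "\<dots> = sum3 (\<lambda>j k l. - sum8 (\<lambda>s. T j k l * (R k l j s * t s)) - sum8 (\<lambda>s. T j k l * (T k l s * n s j)))"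
  proof (rule sum3_cong)
    fix j k l
    show "T j k l * V k l j - T j k l * V l k j =
      - sum8 (\<lambda>s. T j k l * (R k l j s * t s)) - sum8 (\<lambda>s. T j k l * (T k l s * n s j))"
      unfolding right_diff_distrib[symmetric] V_antisym by (simp add: right_diff_distrib sum_distrib_left)
  qed
  also have "\<dots> = - sum4 (\<lambda>j k l s. T j k l * (R k l j s * t s))"
    using n_T_T by (simp add: sum3_linear sum4_inner)
  also have "sum4 (\<lambda>j k l s. T j k l * (R k l j s * t s)) = sum4 (\<lambda>k l j s. T j k l * (R k l j s * t s))"
    by (rule sum4_rot3(2)[symmetric])
  also have "\<dots> = sum8 (\<lambda>s. t s * sum3 (\<lambda>k l j. R k l j s * T k l j))"
    unfolding sum4_last[symmetric] sum3_linear(4)[symmetric]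
  proof (rule sum.cong[OF refl], rule sum3_cong)
    fix s k l j show "T j k l * (R k l j s * t s) = t s * (R k l j s * T k l j)" using T_cyc[of k l j] by simp
  qed
  also have "\<dots> = (1/3) * gam" unfolding R_T_first gam_def by (simp add: sum_distrib_left)
  finally show ?thesis by simp
qed

text \<open>Again only the antisymmetric part counts, now in l and j; \<open>dric_antisym\<close>
  and \<open>T_V\<close> give half of a third of -gam/6.\<close>

lemma T_dric: "sum3 (\<lambda>j k l. T j k l * dric k l j) = - (1/36) * gam"
proof -
  let ?f = "\<lambda>j k l. T j k l * dric k l j"
  have "sum3 ?f = sum3 (\<lambda>j k l. ?f l k j)" using sum3_swap(1)[of "\<lambda>a b c. ?f b c a"] sum3_cyc(1)[of ?f] sum3_swap(2)[of ?f] sum3_cyc(2)[of "\<lambda>a b c. ?f b a c"] sum3_swap(1)[of ?f]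
    sum3_cyc(1)[of "\<lambda>a b c. ?f b a c"] by simp
  also have "\<dots> = sum3 (\<lambda>j k l. - (T j k l * dric k j l))"
  proof (rule sum3_cong)
    fix j k l show "?f l k j = - (T j k l * dric k j l)" using T_rev[of l k j] by simp
  qed
  finally have "2 * sum3 ?f = sum3 (\<lambda>j k l. T j k l * dric k l j - T j k l * dric k j l)" by (simp add: sum3_linear)
  also have "\<dots> = sum3 (\<lambda>j k l. (1/3) * (T j k l * V k l j))"
    unfolding right_diff_distrib[symmetric] dric_antisym by (simp add: mult.left_commute)
  also have "\<dots> = (1/3) * (- (1/6) * gam)" unfolding sum3_linear(4) T_V ..
  finally show ?thesis by simp
qed

text \<open>The second Bianchi identity with one index traced, contracted with T. Two of its
  derivative terms are derivatives of the Ricci tensor, each worth -gam/36 by \<open>T_dric\<close>;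
  the torsion terms give K1 twice and K2 once.\<close>

lemma Q_formula: "sum4 (\<lambda>i j k l. T j k l * M i k l i j) = (1/18) * gam - 2 * K1 - K2"
proof -
  let ?A = "\<lambda>i j k l. T j k l * M i k l i j"
  let ?B = "\<lambda>i j k l. T j k l * M k l i i j"
  let ?C = "\<lambda>i j k l. T j k l * M l i k i j"
  let ?A' = "\<lambda>i j k l s. T j k l * T i k s * R s l i j"
  let ?B' = "\<lambda>i j k l s. T j k l * T k l s * R s i i j"
  let ?C' = "\<lambda>i j k l s. T j k l * T l i s * R s k i j"
  have "0 = sum4 (\<lambda>i j k l. T j k l * (M i k l i j + M k l i i j + M l i k i j +
      sum8 (\<lambda>s. T i k s * R s l i j + T k l s * R s i i j + T l i s * R s k i j)))"
    unfolding Bianchi2 by (simp add: sum4_def)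
  also have "\<dots> = sum4 (\<lambda>i j k l. ?A i j k l + ?B i j k l + ?C i j k l + sum8 (\<lambda>s. ?A' i j k l s + ?B' i j k l s + ?C' i j k l s))"
    by (rule sum4_cong) (simp add: distrib_left sum_distrib_left mult.assoc)
  also have "\<dots> = sum4 ?A + sum4 ?B + sum4 ?C + (sum5 ?A' + sum5 ?B' + sum5 ?C')"
    by (simp add: sum4_linear sum5_inner sum5_linear)
  also have "sum4 ?B = - (1/36) * gam"
  proof -
    have "sum4 ?B = sum3 (\<lambda>j k l. sum8 (\<lambda>i. ?B i j k l))" by (rule sum4_outer)
    also have "\<dots> = sum3 (\<lambda>j k l. T j k l * dric k l j)" by (simp add: dric_def sum_distrib_left)
    finally show ?thesis by (simp add: T_dric)
  qed
  also have "sum4 ?C = sum4 (\<lambda>i j k l. ?C i j l k)" by (rule sum4_swap(3)[symmetric])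
  also have "\<dots> = sum4 ?B"
  proof (rule sum4_cong)
    fix i j k l show "?C i j l k = ?B i j k l" using T_skew(2)[of j l k] M_skew(1)[of k i l i j] by simp
  qed
  also have "sum4 ?B = - (1/36) * gam" by fact
  also have "sum5 ?A' = K1" by (simp add: K1_def)
  also have "sum5 ?C' = sum5 (\<lambda>i j k l s. ?C' i j l k s)" by (rule sum5_swap(3)[symmetric])
  also have "\<dots> = K1" unfolding K1_def
  proof (rule sum5_cong)
    fix i j k l s show "?C' i j l k s = ?A' i j k l s" using T_skew(2)[of j l k] T_skew(1)[of k i s] by simp
  qed
  also have "sum5 ?B' = K2"
  proof -
    have "sum5 ?B' = sum4 (\<lambda>j k l s. sum8 (\<lambda>i. ?B' i j k l s))" unfolding sum5_inner sum5_tuple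
      by (rule sum.reindex_bij_witness[of _ "\<lambda>(j, k, l, s, i). (i, j, k, l, s)" "\<lambda>(i, j, k, l, s). (j, k, l, s, i)"]) auto
    also have "\<dots> = K2" unfolding K2_def
    proof (rule sum4_cong)
      fix j k l s
      have "sum8 (\<lambda>i. R s i i j) = ric s j" unfolding ric_def
        by (rule sum.cong[OF refl]) (simp add: R_skew(1)[of s] R_skew(2)[of _ _ j])
      then show "sum8 (\<lambda>i. ?B' i j k l s) = T j k l * T k l s * ric s j" by (simp add: sum_distrib_left[symmetric])
    qed
    finally show ?thesis .
  qed
  finally show ?thesis by simp
qed

text \<open>The differentiated pair defect converts the difference into two traces of \<nabla>R
  against T: a divergence, known from \<open>divergence_R_T\<close>, and the contraction of
  \<open>Q_formula\<close>.\<close>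

lemma rough_laplacian_defect: "sum4 (\<lambda>i j k l. T j k l * W i i j k l) - sum4 (\<lambda>i j k l. T j k l * W i j i k l) = 2 * K1 + K2 - (1/9) * gam"
proof -
  have "sum4 (\<lambda>i j k l. T j k l * W i i j k l) - sum4 (\<lambda>i j k l. T j k l * W i j i k l) =
      sum4 (\<lambda>i j k l. T j k l * (W i i j k l - W i j i k l))"
    by (simp add: right_diff_distrib sum4_linear)
  also have "\<dots> = sum4 (\<lambda>i j k l. T j k l * M i i j k l) - sum4 (\<lambda>i j k l. T j k l * M i k l i j)"
    unfolding deriv_defect[symmetric] by (simp add: right_diff_distrib sum4_linear)
  also have "sum4 (\<lambda>i j k l. T j k l * M i i j k l) = sum3 (\<lambda>v i j. T v i j * sum8 (\<lambda>m. M m m v i j))"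
    unfolding sum4_outer[of "\<lambda>i j k l. T j k l * M i i j k l"] sum_distrib_left ..
  finally show ?thesis unfolding divergence_R_T Q_formula by simp
qed

text \<open>The derivative of d^\<nabla> T = 0, taken in direction i with i repeated in the last
  slot, writes W_iijkl as three cyclic copies of the swapped term, which T cannot
  distinguish.\<close>

lemma rough_laplacian_swap: "sum4 (\<lambda>i j k l. T j k l * W i i j k l) = 3 * sum4 (\<lambda>i j k l. T j k l * W i j i k l)"
proof -
  let ?f = "\<lambda>i j k l. T j k l * W i j i k l"
  have "sum4 (\<lambda>i j k l. T j k l * W i i j k l) = sum4 (\<lambda>i j k l. ?f i j k l + ?f i k l j + ?f i l j k)"
  proof (rule sum4_cong)
    fix i j k l
    have "W i i j k l = W i j i k l + W i k i l j + W i l i j k"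
      using deriv_H0[of i j k l i] W_skew(2)[of i j k l i] W_skew(1)[of i j k i l] W_skew(2)[of i k l j i] W_skew(1)[of i k l i j]
        W_skew(2)[of i l j k i] W_skew(1)[of i l j i k] by linarith
    moreover have "T k l j = T j k l" "T l j k = T j k l" using T_cyc[of k l j] T_cyc[of l j k] by simp_all
    ultimately show "T j k l * W i i j k l = ?f i j k l + ?f i k l j + ?f i l j k" by (simp add: distrib_left)
  qed
  also have "\<dots> = 3 * sum4 ?f" by (simp add: sum4_linear sum4_rot3[of ?f])
  finally show ?thesis .
qed

text \<open>Commuting the two derivatives leaves the derivative of the trace N_aakl, which
  \<open>deriv_star\<close> and \<open>T_V\<close> evaluate to -gam/18. The curvature terms of the
  Ricci identity give 2 K1 + K2, and its torsion term vanishes by \<open>N_T_T\<close>.\<close>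

lemma swapped_laplacian: "sum4 (\<lambda>i j k l. T j k l * W i j i k l) = 2 * K1 + K2 - (1/18) * gam"
proof -
  let ?A = "\<lambda>i j k l s. T j k l * (R i j i s * T s k l)"
  let ?B = "\<lambda>i j k l s. T j k l * (R i j k s * T i s l)"
  let ?C = "\<lambda>i j k l s. T j k l * (R i j l s * T i k s)"
  let ?D = "\<lambda>i j k l s. T j k l * (T i j s * N s i k l)"
  have "sum4 (\<lambda>i j k l. T j k l * W i j i k l) =
      sum4 (\<lambda>i j k l. T j k l * W j i i k l + T j k l * (W i j i k l - W j i i k l))"
    by (rule sum4_cong) (simp add: algebra_simps)
  also have "\<dots> = sum4 (\<lambda>i j k l. T j k l * W j i i k l - sum8 (\<lambda>s. ?A i j k l s + ?B i j k l s + ?C i j k l s + ?D i j k l s))"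
    unfolding Ricci_identity
    by (rule sum4_cong) (simp add: distrib_left right_diff_distrib sum_distrib_left sum.distrib)
  also have "\<dots> = sum4 (\<lambda>i j k l. T j k l * W j i i k l) - (sum5 ?A + sum5 ?B + sum5 ?C + sum5 ?D)"
    by (simp add: sum4_linear sum5_inner sum5_linear)
  also have "sum4 (\<lambda>i j k l. T j k l * W j i i k l) = - (1/18) * gam"
  proof -
    have "sum4 (\<lambda>i j k l. T j k l * W j i i k l) = sum3 (\<lambda>j k l. T j k l * sum8 (\<lambda>i. W j i i k l))"
      unfolding sum4_outer[of "\<lambda>i j k l. T j k l * W j i i k l"] sum_distrib_left ..
    also have "\<dots> = sum3 (\<lambda>j k l. (1/3) * (T j k l * V j k l))"
    proof (rule sum3_cong)
      fix j k l
      show "T j k l * sum8 (\<lambda>i. W j i i k l) = (1/3) * (T j k l * V j k l)"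
        using deriv_star[of j k l] by (simp add: V_def)
    qed
    also have "\<dots> = (1/3) * sum3 (\<lambda>j k l. T j k l * V j k l)" by (rule sum3_linear(4))
    also have "sum3 (\<lambda>j k l. T j k l * V j k l) = sum3 (\<lambda>j k l. T k l j * V k l j)"
      by (rule sum3_cyc(1)[symmetric])
    also have "\<dots> = sum3 (\<lambda>j k l. T j k l * V k l j)"
    proof (rule sum3_cong)
      fix j k l show "T k l j * V k l j = T j k l * V k l j" using T_cyc[of k l j] by simp
    qed
    finally show ?thesis by (simp add: T_V)
  qed
  also have "sum5 ?A = - K2"
  proof -
    have "sum5 ?A = sum4 (\<lambda>j k l s. sum8 (\<lambda>i. ?A i j k l s))" unfolding sum5_inner sum5_tuple
      by (rule sum.reindex_bij_witness[of _ "\<lambda>(j, k, l, s, i). (i, j, k, l, s)" "\<lambda>(i, j, k, l, s). (j, k, l, s, i)"]) auto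
    also have "\<dots> = sum4 (\<lambda>j k l s. - (T j k l * T s k l * ric j s))"
    proof (rule sum4_cong)
      fix j k l s
      have "ric j s = - sum8 (\<lambda>i. R i j i s)" unfolding ric_def sum_negf[symmetric]
        by (rule sum.cong[OF refl]) (rule R_skew(2))
      then show "sum8 (\<lambda>i. ?A i j k l s) = - (T j k l * T s k l * ric j s)"
        by (simp add: sum_distrib_left[symmetric] sum_distrib_right[symmetric])
    qed
    also have "\<dots> = - sum4 (\<lambda>j k l s. T s k l * T j k l * ric s j)"
      unfolding sum4_linear(3) by (subst sum4_swap14[symmetric]) (rule refl)
    also have "sum4 (\<lambda>j k l s. T s k l * T j k l * ric s j) = K2" unfolding K2_def
    proof (rule sum4_cong)
      fix j k l s show "T s k l * T j k l * ric s j = T j k l * T k l s * ric s j" using T_cyc[of k l s] by simp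
    qed
    finally show ?thesis .
  qed
  also have "sum5 ?C = sum5 (\<lambda>i j k l s. ?C i j l k s)" by (rule sum5_swap(3)[symmetric])
  also have "\<dots> = sum5 ?B"
  proof (rule sum5_cong)
    fix i j k l s show "?C i j l k s = ?B i j k l s" using T_skew(2)[of j l k] T_skew(2)[of i l s] by simp
  qed
  also have "sum5 ?B = - K1"
  proof -
    have "K1 = sum5 (\<lambda>i j k l s. T s l j * T k l i * R i j k s)" unfolding K1_def sum5_tuple
      by (rule sum.reindex_bij_witness[of _ "\<lambda>(i, j, k, l, s). (k, s, l, j, i)" "\<lambda>(i, j, k, l, s). (s, l, i, k, j)"]) auto
    also have "\<dots> = sum5 (\<lambda>i j k l s. - ?B i j s l k)"
    proof (rule sum5_cong)
      fix i j k l s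
      show "T s l j * T k l i * R i j k s = - ?B i j s l k"
        using T_cyc[of s l j] T_cyc[of k l i] R_skew(2)[of i j k s] by simp
    qed
    also have "\<dots> = - sum5 ?B"
    proof -
      have "sum5 (\<lambda>i j k l s. ?B i j s l k) = sum5 ?B" unfolding sum5_tuple
        by (rule sum.reindex_bij_witness[of _ "\<lambda>(i, j, k, l, s). (i, j, s, l, k)" "\<lambda>(i, j, k, l, s). (i, j, s, l, k)"]) auto
      then show ?thesis by (simp add: sum5_linear)
    qed
    finally show ?thesis by simp
  qed
  also have "sum5 ?D = 0"
  proof -
    let ?F = "\<lambda>s i k l j. N s i k l * (T j s i * T j k l)"
    have "sum5 ?D = sum5 (\<lambda>i j k l s. ?F s i k l j)"
    proof (rule sum5_cong)
      fix i j k l s show "?D i j k l s = ?F s i k l j"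
        using T_cyc[of i j s] T_cyc[of s i j] by simp
    qed
    also have "\<dots> = sum5 ?F" unfolding sum5_tuple
      by (rule sum.reindex_bij_witness[of _ "\<lambda>(s, i, k, l, j). (i, j, k, l, s)" "\<lambda>(i, j, k, l, s). (s, i, k, l, j)"]) auto
    finally have "sum5 ?D = sum5 ?F" .
    then show ?thesis by (simp add: N_T_T)
  qed
  finally show ?thesis by simp
qed

text \<open>Let L be the sum in question, L' the one with W i j i k l, and Q = 2 K1 + K2. Then L -
  L' = Q - gam/9, L = 3 L' and L' = Q - gam/18; eliminating Q gives L' = -gam/18.\<close>

theorem T_rough_laplacian: "sum4 (\<lambda>i j k l. T j k l * W i i j k l) = - (1/6) * gam"
  using rough_laplacian_defect rough_laplacian_swap swapped_laplacian by simp

end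

section \<open>Permutations of slots\<close>

context manifold
begin

text \<open>A permutation of the slots together with a constant factor, encoded as a product with a
  constant tensor of rank 0 so that the rules for \<open>tprod\<close> apply.\<close>

definition permt :: "nat list \<Rightarrow> real \<Rightarrow> 'a tensor \<Rightarrow> 'a tensor" where
  "permt is c S = tprod is [] S (\<lambda>_ _. c)"

lemma permt_app: "permt is c S Xs p = S (map ((!) Xs) is) p * c"
  by (simp add: permt_def tprod_def)

lemma tens_scalar: "tens 0 (\<lambda>Xs p. c)"
  by (rule tensI) (simp_all add: smooth_const)

lemma tens_permt: "shuffle n 0 is [] \<Longrightarrow> tens n S \<Longrightarrow> tens n (permt is c S)"
  using tens_tprod[OF _ tens_scalar, of n S "is" "[]" c] by (simp add: permt_def)

lemma nabla_permt:
  assumes "shuffle n 0 is []" "tens n S" "X \<in> vfields A" "length Ys = n" "set Ys \<subseteq> vfields A"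
  shows "nabla D (permt is c S) (X # Ys) p = nabla D S (X # map ((!) Ys) is) p * c"
proof -
  have "nabla D (\<lambda>_ _. c) [X] p = 0"
    using vfield_const_app[OF assms(3)] by (simp add: nabla_Cons)
  then show ?thesis
    using nabla_tprod[OF assms(2) tens_scalar assms(1,3), of Ys D c p] assms(4,5) by (simp add: permt_def)
qed

end

text \<open>In the repeated traces each \<open>contr\<close> consumes slots 0 and 1, so the slots
  pair up as (0, 1), (2, 3), (4, 5). The first factor receives the even and the second the odd
  member of each pair, the outermost trace first; free slots follow at the end, except that in
  \<open>shuffle_NP\<close> and \<open>shuffle_NT\<close> the free slot of the first factor comes
  first, as the direction of \<nabla>.\<close>

lemma
  shows shuffle_swap: "shuffle 4 0 [1, 0, 2, 3] []" and shuffle_pairs: "shuffle 4 0 [2, 3, 0, 1] []"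
    and shuffle_ricci: "shuffle 4 0 [0, 2, 3, 1] []"
    and shuffle_id1: "shuffle 1 0 [0] []" and shuffle_id2: "shuffle 2 0 [0, 1] []" and shuffle_id4: "shuffle 4 0 [0, 1, 2, 3] []"
    and shuffle_sigma: "shuffle 3 3 [0, 2, 3] [1, 4, 5]" "shuffle 3 3 [0, 3, 4] [1, 2, 5]" "shuffle 3 3 [0, 4, 2] [1, 3, 5]"
    and shuffle_RP: "shuffle 4 4 [2, 0, 4, 5] [3, 1, 6, 7]" and shuffle_NP: "shuffle 4 4 [6, 4, 2, 0] [5, 3, 1, 7]"
    and shuffle_TT: "shuffle 3 3 [4, 2, 0] [5, 3, 1]" and shuffle_NT: "shuffle 4 3 [6, 4, 2, 0] [5, 3, 1]"
    and shuffle_TP: "shuffle 3 4 [4, 2, 0] [5, 3, 1, 6]" and shuffle_sigma_P: "shuffle 4 4 [4, 2, 0, 6] [5, 3, 1, 7]"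
  by (auto simp: shuffle_def lessThan_Suc eval_nat_numeral)

section \<open>Symmetries of the derivatives, and components in adapted frames\<close>

context spin7_connection
begin

abbreviation Nt :: "'a tensor" where "Nt \<equiv> nabla D Tt"
abbreviation Wt :: "'a tensor" where "Wt \<equiv> nabla D (nabla D Tt)"

lemma tens_Nt: "tens 4 Nt"
  using tens_nabla[OF tens_Tt] by simp

lemma Nt_skew:
  assumes v: "M \<in> vfields A" "X \<in> vfields A" "Y \<in> vfields A" "Z \<in> vfields A"
  shows "Nt [M, Y, X, Z] p = - Nt [M, X, Y, Z] p" "Nt [M, X, Z, Y] p = - Nt [M, X, Y, Z] p"
proof -
  have e: "Tor Y X Z = (\<lambda>q. - Tor X Y Z q)" "Tor X Z Y = (\<lambda>q. - Tor X Y Z q)"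
    using Tor_skew[OF v(2-4)] by (auto simp: fun_eq_iff)
  note s = vfield_uminus_app[OF v(1) Tor_smooth[OF v(2-4)]]
  show "Nt [M, Y, X, Z] p = - Nt [M, X, Y, Z] p"
    unfolding nabla_Tt e s using Tor_skew(1)[OF D_vfields[OF v(1,2)] v(3,4), of p] Tor_skew(1)[OF v(2) D_vfields[OF v(1,3)] v(4), of p]
      Tor_skew(1)[OF v(2,3) D_vfields[OF v(1,4)], of p] by simp
  show "Nt [M, X, Z, Y] p = - Nt [M, X, Y, Z] p"
    unfolding nabla_Tt e s using Tor_skew(2)[OF D_vfields[OF v(1,2)] v(3,4), of p] Tor_skew(2)[OF v(2) D_vfields[OF v(1,3)] v(4), of p]
      Tor_skew(2)[OF v(2,3) D_vfields[OF v(1,4)], of p] by simp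
qed

lemma Nt_smooth: "M \<in> vfields A \<Longrightarrow> X \<in> vfields A \<Longrightarrow> Y \<in> vfields A \<Longrightarrow> Z \<in> vfields A \<Longrightarrow> Nt [M, X, Y, Z] \<in> smooth_funs A"
  by (rule tens_smooth[OF tens_Nt]) simp_all

lemma Wt_skew:
  assumes v: "L \<in> vfields A" "M \<in> vfields A" "X \<in> vfields A" "Y \<in> vfields A" "Z \<in> vfields A"
  shows "Wt [L, M, Y, X, Z] p = - Wt [L, M, X, Y, Z] p" "Wt [L, M, X, Z, Y] p = - Wt [L, M, X, Y, Z] p"
proof -
  have e: "Nt [M, Y, X, Z] = (\<lambda>q. - Nt [M, X, Y, Z] q)" "Nt [M, X, Z, Y] = (\<lambda>q. - Nt [M, X, Y, Z] q)"
    using Nt_skew[OF v(2-5)] by (auto simp: fun_eq_iff)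
  note s = vfield_uminus_app[OF v(1) Nt_smooth[OF v(2-5)]]
  show "Wt [L, M, Y, X, Z] p = - Wt [L, M, X, Y, Z] p"
    unfolding nabla4[of Nt] e s using Nt_skew(1)[OF D_vfields[OF v(1,2)] v(3,4,5), of p] Nt_skew(1)[OF v(2) D_vfields[OF v(1,3)] v(4,5), of p]
      Nt_skew(1)[OF v(2,3) D_vfields[OF v(1,4)] v(5), of p] Nt_skew(1)[OF v(2,3,4) D_vfields[OF v(1,5)], of p] by simp
  show "Wt [L, M, X, Z, Y] p = - Wt [L, M, X, Y, Z] p"
    unfolding nabla4[of Nt] e s using Nt_skew(2)[OF D_vfields[OF v(1,2)] v(3,4,5), of p] Nt_skew(2)[OF v(2) D_vfields[OF v(1,3)] v(4,5), of p]
      Nt_skew(2)[OF v(2,3) D_vfields[OF v(1,4)] v(5), of p] Nt_skew(2)[OF v(2,3,4) D_vfields[OF v(1,5)], of p] by simp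
qed

lemma nabla_Rt_skew:
  assumes v: "M \<in> vfields A" "X \<in> vfields A" "Y \<in> vfields A" "Z \<in> vfields A" "V \<in> vfields A"
  shows "nabla D Rt [M, Y, X, Z, V] p = - nabla D Rt [M, X, Y, Z, V] p" "nabla D Rt [M, X, Y, V, Z] p = - nabla D Rt [M, X, Y, Z, V] p"
proof -
  have e: "Rm Y X Z V = (\<lambda>q. - Rm X Y Z V q)" "Rm X Y V Z = (\<lambda>q. - Rm X Y Z V q)"
    using Rm_skew1[OF v(2-5)] Rm_skew2[OF v(2-5)] by (auto simp: fun_eq_iff)
  have "Rm X Y Z V \<in> smooth_funs A" using tens_smooth[OF tens_Rt, of "[X, Y, Z, V]"] v by (simp add: Rt_list)
  note s = vfield_uminus_app[OF v(1) this]
  show "nabla D Rt [M, Y, X, Z, V] p = - nabla D Rt [M, X, Y, Z, V] p"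
    unfolding nabla_Rt e s using Rm_skew1[OF D_vfields[OF v(1,2)] v(3,4,5), of p] Rm_skew1[OF v(2) D_vfields[OF v(1,3)] v(4,5), of p]
      Rm_skew1[OF v(2,3) D_vfields[OF v(1,4)] v(5), of p] Rm_skew1[OF v(2,3,4) D_vfields[OF v(1,5)], of p] by simp
  show "nabla D Rt [M, X, Y, V, Z] p = - nabla D Rt [M, X, Y, Z, V] p"
    unfolding nabla_Rt e s using Rm_skew2[OF D_vfields[OF v(1,2)] v(3,4,5), of p] Rm_skew2[OF v(2) D_vfields[OF v(1,3)] v(4,5), of p]
      Rm_skew2[OF v(2,3) D_vfields[OF v(1,4)] v(5), of p] Rm_skew2[OF v(2,3,4) D_vfields[OF v(1,5)], of p] by simp
qed

text \<open>Frames are extended periodically so that the pointwise identities need no bounds on indices.\<close>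

definition adapted_at :: "'a \<Rightarrow> (nat \<Rightarrow> 'a vfield) \<Rightarrow> bool" where
  "adapted_at p F \<longleftrightarrow> orthonormal_at A g p F \<and> (\<forall>i. F i \<in> vfields A) \<and> (\<forall>i. F (i mod 8) = F i) \<and>
     (\<forall>a b c d. form4_tensor \<Psi> (F a) (F b) (F c) (F d) p = psi (a mod 8) (b mod 8) (c mod 8) (d mod 8))"

lemma adapted_at_ex: obtains F where "adapted_at p F"
proof -
  from adapted_frame_at[of p] obtain E where
    E0: "orthonormal_at A g p E \<and> (\<forall>a<8. \<forall>b<8. \<forall>c<8. \<forall>d<8. form4_tensor \<Psi> (E a) (E b) (E c) (E d) p = psi a b c d)" by (elim exE)
  let ?F = "\<lambda>i. E (i mod 8)"
  have "orthonormal_at A g p ?F" using E0 by (simp add: orthonormal_at_def)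
  moreover have "?F i \<in> vfields A" for i using orthonormal_vfields[of p E "i mod 8"] E0 by simp
  ultimately have "adapted_at p ?F" using E0 by (simp add: adapted_at_def)
  then show thesis by (rule that)
qed

context
  fixes p F
  assumes F: "adapted_at p F"
begin

lemma Fo: "orthonormal_at A g p F" and Fv: "F i \<in> vfields A" and Fmod: "F (i mod 8) = F i"
  and Fpsi: "form4_tensor \<Psi> (F a) (F b) (F c) (F d) p = psi (a mod 8) (b mod 8) (c mod 8) (d mod 8)"
  using F by (simp_all add: adapted_at_def)

lemma act_last_F:
  "(\<Sum>s<8. Rm (F i) (F j) (F a) (F s) p * form4_tensor \<Psi> (F s) (F b) (F c) (F d) p + Rm (F i) (F j) (F b) (F s) p * form4_tensor \<Psi> (F a) (F s) (F c) (F d) p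
     + Rm (F i) (F j) (F c) (F s) p * form4_tensor \<Psi> (F a) (F b) (F s) (F d) p + Rm (F i) (F j) (F d) (F s) p * form4_tensor \<Psi> (F a) (F b) (F c) (F s) p) = 0"
  using curvature_form[OF Fv[of i] Fv[of j] Fv[of a] Fv[of b] Fv[of c] Fv[of d], of p]
  by (simp add: form_curvature_expand[OF Fo] Fv sum.distrib)

text \<open>R annihilates \<Psi> through its last index pair; the seven relations translate this
  into the eigenvalue 2.\<close>

lemma eig_F: "(\<Sum>k<8. \<Sum>l<8. Rm (F i) (F j) (F k) (F l) p * form4_tensor \<Psi> (F k) (F l) (F m) (F n) p) = 2 * Rm (F i) (F j) (F m) (F n) p"
proof -
  let ?\<alpha> = "\<lambda>k l. Rm (F i) (F j) (F k) (F l) p"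
  have sk: "?\<alpha> b a = - ?\<alpha> a b" for a b by (rule Rm_skew2[OF Fv Fv Fv Fv])
  have "act4 ?\<alpha> psi a b c d = 0" if "a < 8" "b < 8" "c < 8" "d < 8" for a b c d
  proof -
    have "act4 ?\<alpha> psi a b c d = (\<Sum>s<8. ?\<alpha> a s * form4_tensor \<Psi> (F s) (F b) (F c) (F d) p + ?\<alpha> b s * form4_tensor \<Psi> (F a) (F s) (F c) (F d) p
     + ?\<alpha> c s * form4_tensor \<Psi> (F a) (F b) (F s) (F d) p + ?\<alpha> d s * form4_tensor \<Psi> (F a) (F b) (F c) (F s) p)"
      unfolding act4_def by (rule sum.cong[OF refl]) (simp add: Fpsi that)
    then show ?thesis using act_last_F by simp
  qed
  then have rel: "spin7_relations ?\<alpha>" by (rule spin7_relations_of_act4[OF sk])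
  have "(\<Sum>k<8. \<Sum>l<8. ?\<alpha> k l * psi k l (m mod 8) (n mod 8)) = 2 * ?\<alpha> (m mod 8) (n mod 8)"
    by (rule spin7_eigen_of_relations[OF sk rel]) simp_all
  moreover have "(\<Sum>k<8. \<Sum>l<8. ?\<alpha> k l * form4_tensor \<Psi> (F k) (F l) (F m) (F n) p) = (\<Sum>k<8. \<Sum>l<8. ?\<alpha> k l * psi k l (m mod 8) (n mod 8))"
    by (intro sum.cong[OF refl]) (simp add: Fpsi)
  ultimately show ?thesis by (simp add: Fmod)
qed

lemma Bianchi_F:
  "Rm (F i) (F j) (F k) (F l) p + Rm (F j) (F k) (F i) (F l) p + Rm (F k) (F i) (F j) (F l) p =
    Nt [F i, F j, F k, F l] p + Nt [F j, F k, F i, F l] p + Nt [F k, F i, F j, F l] p +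
    (\<Sum>s<8. Tor (F s) (F i) (F j) p * Tor (F s) (F k) (F l) p + Tor (F s) (F j) (F k) p * Tor (F s) (F i) (F l) p + Tor (F s) (F k) (F i) p * Tor (F s) (F j) (F l) p)"
proof -
  have e: "Tor (tau (F i) (F j)) (F k) (F l) p = (\<Sum>s<8. Tor (F s) (F i) (F j) p * Tor (F s) (F k) (F l) p)" for i j k l
    unfolding Tor_tau_expand[OF Fo Fv Fv Fv Fv]
  proof (rule sum.cong[OF refl])
    fix s
    show "Tor (F i) (F j) (F s) p * Tor (F s) (F k) (F l) p = Tor (F s) (F i) (F j) p * Tor (F s) (F k) (F l) p"
      using Tor_cyc[OF Fv[of s] Fv[of i] Fv[of j], of p] by simp
  qed
  show ?thesis
    using first_Bianchi[OF Fv[of i] Fv[of j] Fv[of k] Fv[of l], of p] unfolding e sum.distrib .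
qed

lemma curvature_algebra_at:
  assumes H0: "\<And>X Y Z V. X \<in> vfields A \<Longrightarrow> Y \<in> vfields A \<Longrightarrow> Z \<in> vfields A \<Longrightarrow> V \<in> vfields A \<Longrightarrow>
    Nt [X, Y, Z, V] p + Nt [Y, Z, X, V] p + Nt [Z, X, Y, V] p = Nt [V, X, Y, Z] p"
  shows "curvature_algebra (\<lambda>i j k. Tor (F i) (F j) (F k) p) (\<lambda>i j k l. Nt [F i, F j, F k, F l] p)
    (\<lambda>i j k l. Rm (F i) (F j) (F k) (F l) p) (\<lambda>i j k l. form4_tensor \<Psi> (F i) (F j) (F k) (F l) p)"
  by unfold_locales
    (rule Tor_skew Nt_skew Rm_skew1 Rm_skew2 form4_skew Bianchi_F H0 eig_F; (rule Fv)?)+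

end

end

section \<open>Repeated traces and their covariant derivatives\<close>

context spin7_manifold
begin

lemma contr2_frame:
  assumes S: "tens (n + 4) S" and Ys: "length Ys = n" "set Ys \<subseteq> vfields A" and E: "orthonormal_at A g q E"
  shows "contr (contr S) Ys q = (\<Sum>a<8. \<Sum>b<8. S (E b # E b # E a # E a # Ys) q)"
proof -
  have S': "tens (Suc (Suc (Suc (Suc n)))) S" using S by (simp add: numeral_eq_Suc)
  show ?thesis
    unfolding contr_frame[OF tens_contr[OF S'] Ys E]
    by (rule sum.cong[OF refl], rule contr_frame[OF S' _ _ E]) (use Ys orthonormal_vfields[OF E] in auto)
qed

lemma contr3_frame:
  assumes S: "tens (n + 6) S" and Ys: "length Ys = n" "set Ys \<subseteq> vfields A" and E: "orthonormal_at A g q E"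
  shows "contr (contr (contr S)) Ys q = (\<Sum>a<8. \<Sum>b<8. \<Sum>c<8. S (E c # E c # E b # E b # E a # E a # Ys) q)"
proof -
  have S': "tens (Suc (Suc (n + 4))) S" "tens (Suc (Suc n) + 4) S" using S by (simp_all add: numeral_eq_Suc)
  have c: "tens (n + 4) (contr S)" by (rule tens_contr[OF S'(1)])
  show ?thesis
    unfolding contr2_frame[OF c Ys E]
    by (intro sum.cong[OF refl], rule contr_frame[OF S'(1) _ _ E]) (use Ys orthonormal_vfields[OF E] in auto)
qed

end

context spin7_connection
begin

lemma nabla_contr2:
  assumes S: "tens (n + 4) S" and X: "X \<in> vfields A" and Ys: "length Ys = n" "set Ys \<subseteq> vfields A" and E: "orthonormal_at A g q E"
  shows "nabla D (contr (contr S)) (X # Ys) q = (\<Sum>a<8. \<Sum>b<8. nabla D S (X # E b # E b # E a # E a # Ys) q)"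
proof -
  have S': "tens (Suc (Suc (Suc (Suc n)))) S" using S by (simp add: numeral_eq_Suc)
  show ?thesis
    unfolding nabla_contr[OF tens_contr[OF S'] X Ys E]
    by (rule sum.cong[OF refl], rule nabla_contr[OF S' X _ _ E]) (use Ys orthonormal_vfields[OF E] in auto)
qed

lemma nabla_contr3:
  assumes S: "tens (n + 6) S" and X: "X \<in> vfields A" and Ys: "length Ys = n" "set Ys \<subseteq> vfields A" and E: "orthonormal_at A g q E"
  shows "nabla D (contr (contr (contr S))) (X # Ys) q = (\<Sum>a<8. \<Sum>b<8. \<Sum>c<8. nabla D S (X # E c # E c # E b # E b # E a # E a # Ys) q)"
proof -
  have S': "tens (Suc (Suc (n + 4))) S" using S by (simp_all add: numeral_eq_Suc)
  have c: "tens (n + 4) (contr S)" by (rule tens_contr[OF S'(1)])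
  show ?thesis
    unfolding nabla_contr2[OF c X Ys E]
    by (intro sum.cong[OF refl], rule nabla_contr[OF S' X _ _ E]) (use Ys orthonormal_vfields[OF E] in auto)
qed

lemma contr_Rt_Pt:
  assumes v: "X \<in> vfields A" "Y \<in> vfields A" "Z \<in> vfields A" "V \<in> vfields A" and E: "orthonormal_at A g q E"
  shows "contr (contr (tprod [2, 0, 4, 5] [3, 1, 6, 7] Rt Pt)) [X, Y, Z, V] q =
    (\<Sum>a<8. \<Sum>b<8. Rm (E a) (E b) X Y q * form4_tensor \<Psi> (E a) (E b) Z V q)"
proof -
  have t: "tens (4 + 4) (tprod [2, 0, 4, 5] [3, 1, 6, 7] Rt Pt)"
    by (rule tens_tprod[OF tens_Rt tens_Pt shuffle_RP])
  show ?thesis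
    using contr2_frame[OF t, of "[X, Y, Z, V]"] v E by (simp add: tprod_def Rt_list Pt_list)
qed

lemma tens_contr_Rt_Pt: "tens 4 (contr (contr (tprod [2, 0, 4, 5] [3, 1, 6, 7] Rt Pt)))"
proof -
  have t: "tens (4 + 4) (tprod [2, 0, 4, 5] [3, 1, 6, 7] Rt Pt)"
    by (rule tens_tprod[OF tens_Rt tens_Pt shuffle_RP])
  then show ?thesis by (intro tens_contr) (simp add: numeral_eq_Suc)
qed

lemma nabla_contr_Rt_Pt:
  assumes v: "M \<in> vfields A" "X \<in> vfields A" "Y \<in> vfields A" "Z \<in> vfields A" "V \<in> vfields A" and E: "orthonormal_at A g q E"
  shows "nabla D (contr (contr (tprod [2, 0, 4, 5] [3, 1, 6, 7] Rt Pt))) [M, X, Y, Z, V] q =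
    (\<Sum>a<8. \<Sum>b<8. nabla D Rt [M, E a, E b, X, Y] q * form4_tensor \<Psi> (E a) (E b) Z V q)"
proof -
  note sh = shuffle_RP
  have t: "tens (4 + 4) (tprod [2, 0, 4, 5] [3, 1, 6, 7] Rt Pt)"
    by (rule tens_tprod[OF tens_Rt tens_Pt sh])
  have Ev: "E a \<in> vfields A" if "a < 8" for a by (rule orthonormal_vfields[OF E that])
  have e: "nabla D (tprod [2, 0, 4, 5] [3, 1, 6, 7] Rt Pt) [M, E b, E b, E a, E a, X, Y, Z, V] q =
      nabla D Rt [M, E a, E b, X, Y] q * form4_tensor \<Psi> (E a) (E b) Z V q" if "a < 8" "b < 8" for a b
    using nabla_tprod[OF tens_Rt tens_Pt sh v(1), of "[E b, E b, E a, E a, X, Y, Z, V]" D q] that v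
    by (simp add: Ev nabla_Pt Pt_list)
  show ?thesis
    using nabla_contr2[OF t v(1), of "[X, Y, Z, V]" q E] v E by (simp del: One_nat_def add: e)
qed

lemma contr_Nt_Pt:
  assumes v: "X \<in> vfields A" "Y \<in> vfields A" and E: "orthonormal_at A g q E"
  shows "contr (contr (contr (tprod [6, 4, 2, 0] [5, 3, 1, 7] Nt Pt))) [X, Y] q =
    (\<Sum>a<8. \<Sum>b<8. \<Sum>c<8. Nt [X, E a, E b, E c] q * form4_tensor \<Psi> (E a) (E b) (E c) Y q)"
proof -
  have "tens (4 + 4) (tprod [6, 4, 2, 0] [5, 3, 1, 7] Nt Pt)"
    by (rule tens_tprod[OF tens_Nt tens_Pt shuffle_NP])
  then have t: "tens (2 + 6) (tprod [6, 4, 2, 0] [5, 3, 1, 7] Nt Pt)" by simp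
  show ?thesis
    using contr3_frame[OF t, of "[X, Y]"] v E by (simp add: tprod_def Pt_list)
qed

lemma tens_contr_Nt_Pt: "tens 2 (contr (contr (contr (tprod [6, 4, 2, 0] [5, 3, 1, 7] Nt Pt))))"
proof -
  have t: "tens (4 + 4) (tprod [6, 4, 2, 0] [5, 3, 1, 7] Nt Pt)"
    by (rule tens_tprod[OF tens_Nt tens_Pt shuffle_NP])
  then show ?thesis by (intro tens_contr) (simp add: numeral_eq_Suc)
qed

lemma nabla_contr_Nt_Pt:
  assumes v: "M \<in> vfields A" "X \<in> vfields A" "Y \<in> vfields A" and E: "orthonormal_at A g q E"
  shows "nabla D (contr (contr (contr (tprod [6, 4, 2, 0] [5, 3, 1, 7] Nt Pt)))) [M, X, Y] q =
    (\<Sum>a<8. \<Sum>b<8. \<Sum>c<8. Wt [M, X, E a, E b, E c] q * form4_tensor \<Psi> (E a) (E b) (E c) Y q)"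
proof -
  note sh = shuffle_NP
  have "tens (4 + 4) (tprod [6, 4, 2, 0] [5, 3, 1, 7] Nt Pt)"
    by (rule tens_tprod[OF tens_Nt tens_Pt sh])
  then have t: "tens (2 + 6) (tprod [6, 4, 2, 0] [5, 3, 1, 7] Nt Pt)" by simp
  have Ev: "E a \<in> vfields A" if "a < 8" for a by (rule orthonormal_vfields[OF E that])
  have e: "nabla D (tprod [6, 4, 2, 0] [5, 3, 1, 7] Nt Pt) [M, E c, E c, E b, E b, E a, E a, X, Y] q =
      Wt [M, X, E a, E b, E c] q * form4_tensor \<Psi> (E a) (E b) (E c) Y q" if "a < 8" "b < 8" "c < 8" for a b c
    using nabla_tprod[OF tens_Nt tens_Pt sh v(1), of "[E c, E c, E b, E b, E a, E a, X, Y]" D q] that v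
    by (simp add: Ev nabla_Pt Pt_list)
  show ?thesis
    using nabla_contr3[OF t v(1), of "[X, Y]" q E] v E by (simp del: One_nat_def add: e)
qed

lemma contr_Nt:
  assumes v: "X \<in> vfields A" "Y \<in> vfields A" and E: "orthonormal_at A g q E"
  shows "contr Nt [X, Y] q = (\<Sum>a<8. Nt [E a, E a, X, Y] q)"
proof -
  have "tens (Suc (Suc 2)) Nt" using tens_Nt by (simp add: numeral_eq_Suc)
  from contr_frame[OF this] show ?thesis using v E by simp
qed

lemma tens_contr_Nt: "tens 2 (contr Nt)"
  using tens_Nt by (intro tens_contr) (simp add: numeral_eq_Suc)

lemma nabla_contr_Nt:
  assumes v: "M \<in> vfields A" "X \<in> vfields A" "Y \<in> vfields A" and E: "orthonormal_at A g q E"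
  shows "nabla D (contr Nt) [M, X, Y] q = (\<Sum>a<8. Wt [M, E a, E a, X, Y] q)"
proof -
  have "tens (Suc (Suc 2)) Nt" using tens_Nt by (simp add: numeral_eq_Suc)
  from nabla_contr[OF this] show ?thesis using v E by simp
qed

lemma length_4_frame:
  fixes E :: "nat \<Rightarrow> 'b"
  assumes "length Xs = 4" "\<And>i. i < 4 \<Longrightarrow> \<exists>a<8. Xs ! i = E a"
  shows "\<exists>a b c d. Xs = [E a, E b, E c, E d] \<and> a < 8 \<and> b < 8 \<and> c < 8 \<and> d < 8"
  using assms(1) assms(2)[of 0] assms(2)[of 1] assms(2)[of 2] assms(2)[of 3]
  by (simp add: length_Suc_conv numeral_eq_Suc) (elim exE conjE; simp; blast)

lemma length_2_frame:
  fixes E :: "nat \<Rightarrow> 'b"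
  assumes "length Xs = 2" "\<And>i. i < 2 \<Longrightarrow> \<exists>a<8. Xs ! i = E a"
  shows "\<exists>a b. Xs = [E a, E b] \<and> a < 8 \<and> b < 8"
  using assms(1) assms(2)[of 0] assms(2)[of 1]
  by (simp add: length_Suc_conv numeral_eq_Suc) (elim exE conjE; simp; blast)

end

section \<open>The instanton condition and its derivatives\<close>

context spin7_connection
begin

text \<open>Both sides are tensors, so the eigenvalue equation in one adapted frame extends to all
  vector fields and hence to every orthonormal frame at q.\<close>

lemma contr_Rt_Pt_eq_of_frame:
  assumes F: "adapted_at q F"
    and eig: "\<And>i j k l. (\<Sum>a<8. \<Sum>b<8. Rm (F a) (F b) (F i) (F j) q * form4_tensor \<Psi> (F a) (F b) (F k) (F l) q) = 2 * Rm (F k) (F l) (F i) (F j) q"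
    and v: "X \<in> vfields A" "Y \<in> vfields A" "Z \<in> vfields A" "V \<in> vfields A"
  shows "contr (contr (tprod [2, 0, 4, 5] [3, 1, 6, 7] Rt Pt)) [X, Y, Z, V] q = 2 * Rm Z V X Y q"
proof -
  note Fo = Fo[OF F]
  have "contr (contr (tprod [2, 0, 4, 5] [3, 1, 6, 7] Rt Pt)) [X, Y, Z, V] q = permt [2, 3, 0, 1] 2 Rt [X, Y, Z, V] q"
  proof (rule tens_eq_of_frame[OF tens_contr_Rt_Pt tens_permt[OF shuffle_pairs tens_Rt] Fo])
    fix Xs assume "length Xs = 4" "\<And>i. i < 4 \<Longrightarrow> \<exists>a<8. Xs ! i = F a"
    from length_4_frame[OF this] obtain a b c d where Xs: "Xs = [F a, F b, F c, F d]" by blast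
    show "contr (contr (tprod [2, 0, 4, 5] [3, 1, 6, 7] Rt Pt)) Xs q = permt [2, 3, 0, 1] 2 Rt Xs q"
      unfolding Xs contr_Rt_Pt[OF Fv[OF F] Fv[OF F] Fv[OF F] Fv[OF F] Fo] eig permt_app
      by (simp add: Rt_list)
  qed (use v in simp_all)
  then show ?thesis by (simp add: permt_app Rt_list)
qed

definition d_nabla_zero :: bool where
  "d_nabla_zero \<longleftrightarrow> (\<forall>X\<in>vfields A. \<forall>Y\<in>vfields A. \<forall>Z\<in>vfields A. \<forall>V\<in>vfields A. \<forall>p.
    Nt [X, Y, Z, V] p + Nt [Y, Z, X, V] p + Nt [Z, X, Y, V] p = Nt [V, X, Y, Z] p)"

lemma H0: "d_nabla_zero \<Longrightarrow> X \<in> vfields A \<Longrightarrow> Y \<in> vfields A \<Longrightarrow> Z \<in> vfields A \<Longrightarrow> V \<in> vfields A \<Longrightarrow>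
    Nt [X, Y, Z, V] p + Nt [Y, Z, X, V] p + Nt [Z, X, Y, V] p = Nt [V, X, Y, Z] p"
  unfolding d_nabla_zero_def by blast

lemma Rm_smooth: "X \<in> vfields A \<Longrightarrow> Y \<in> vfields A \<Longrightarrow> Z \<in> vfields A \<Longrightarrow> V \<in> vfields A \<Longrightarrow> Rm X Y Z V \<in> smooth_funs A"
  using tens_smooth[OF tens_Rt, of "[X, Y, Z, V]"] by (simp add: Rt_list)

text \<open>The componentwise identity is restated for all fields at all points, the form in which
  \<open>deriv_defect\<close> differentiates it.\<close>

lemma pair_defect:
  assumes cc: d_nabla_zero and v: "X \<in> vfields A" "Y \<in> vfields A" "Z \<in> vfields A" "V \<in> vfields A"
  shows "Rm X Y Z V q - Rm Z V X Y q = Nt [X, Y, Z, V] q - Nt [Y, X, Z, V] q"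
proof -
  obtain F where F: "adapted_at q F" by (rule adapted_at_ex)
  note sh = shuffle_pairs shuffle_swap
  have "(\<lambda>Xs p. 1 * Rt Xs p + -1 * permt [2, 3, 0, 1] 1 Rt Xs p) [X, Y, Z, V] q = (\<lambda>Xs p. 1 * Nt Xs p + -1 * permt [1, 0, 2, 3] 1 Nt Xs p) [X, Y, Z, V] q"
  proof (rule tens_eq_of_frame[OF tens_lin[OF tens_Rt tens_permt[OF sh(1) tens_Rt]] tens_lin[OF tens_Nt tens_permt[OF sh(2) tens_Nt]] Fo[OF F]])
    fix Xs assume "length Xs = 4" "\<And>i. i < 4 \<Longrightarrow> \<exists>a<8. Xs ! i = F a"
    from length_4_frame[OF this] obtain a b c d where Xs: "Xs = [F a, F b, F c, F d]" by blast
    show "1 * Rt Xs q + -1 * permt [2, 3, 0, 1] 1 Rt Xs q = 1 * Nt Xs q + -1 * permt [1, 0, 2, 3] 1 Nt Xs q"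
      using curvature_algebra.pair_symmetry_defect[OF curvature_algebra_at[OF F H0[OF cc]], of a b c d]
      by (simp add: Xs permt_app Rt_list)
  qed (use v in simp_all)
  then show ?thesis by (simp add: permt_app Rt_list)
qed

context
  assumes cc: d_nabla_zero and inst: "spin7_instanton A \<Psi> g D"
begin

lemma instanton_F:
  assumes F: "adapted_at p F"
  shows "(\<Sum>a<8. \<Sum>b<8. Rm (F a) (F b) (F i) (F j) p * form4_tensor \<Psi> (F a) (F b) (F k) (F l) p) = 2 * Rm (F k) (F l) (F i) (F j) p"
proof -
  let ?i = "i mod 8" and ?j = "j mod 8" and ?k = "k mod 8" and ?l = "l mod 8"
  have "?i < 8" "?j < 8" "?k < 8" "?l < 8" by simp_all
  then have "(\<Sum>a<8. \<Sum>b<8. Rm (F a) (F b) (F ?i) (F ?j) p * form4_tensor \<Psi> (F a) (F b) (F ?k) (F ?l) p) = 2 * Rm (F ?k) (F ?l) (F ?i) (F ?j) p"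
    using inst Fo[OF F] unfolding spin7_instanton_def by blast
  then show ?thesis by (simp only: Fmod[OF F])
qed

lemma instanton_algebra_at:
  assumes F: "adapted_at p F"
  shows "instanton_algebra (\<lambda>i j k. Tor (F i) (F j) (F k) p) (\<lambda>i j k l. Nt [F i, F j, F k, F l] p)
    (\<lambda>i j k l. Rm (F i) (F j) (F k) (F l) p) (\<lambda>i j k l. form4_tensor \<Psi> (F i) (F j) (F k) (F l) p)"
  by (rule instanton_algebra.intro[OF curvature_algebra_at[OF F]], rule H0[OF cc], assumption+)
    (unfold_locales, rule instanton_F[OF F])

text \<open>The eigenvalue 2 on the first index pair gives the seven relations and hence the
  vanishing action on \<Psi>, the reverse of the passage in \<open>eig_F\<close>.\<close>

lemma act_first_F:
  assumes F: "adapted_at p F"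
  shows "(\<Sum>s<8. Rm (F a) (F s) (F i) (F j) p * form4_tensor \<Psi> (F s) (F b) (F c) (F d) p + Rm (F b) (F s) (F i) (F j) p * form4_tensor \<Psi> (F a) (F s) (F c) (F d) p
     + Rm (F c) (F s) (F i) (F j) p * form4_tensor \<Psi> (F a) (F b) (F s) (F d) p + Rm (F d) (F s) (F i) (F j) p * form4_tensor \<Psi> (F a) (F b) (F c) (F s) p) = 0"
proof -
  note Fv = Fv[OF F] and Fpsi = Fpsi[OF F] and Fmod = Fmod[OF F]
  let ?\<alpha> = "\<lambda>k l. Rm (F k) (F l) (F i) (F j) p"
  have sk: "?\<alpha> b a = - ?\<alpha> a b" for a b by (rule Rm_skew1[OF Fv Fv Fv Fv])
  have "(\<Sum>a<8. \<Sum>b<8. ?\<alpha> a b * psi a b k l) = 2 * ?\<alpha> k l" if "k < 8" "l < 8" for k l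
  proof -
    have "(\<Sum>a<8. \<Sum>b<8. ?\<alpha> a b * psi a b k l) = (\<Sum>a<8. \<Sum>b<8. ?\<alpha> a b * form4_tensor \<Psi> (F a) (F b) (F k) (F l) p)"
      by (intro sum.cong[OF refl]) (simp add: Fpsi that)
    then show ?thesis using instanton_F[OF F, of i j k l] by simp
  qed
  then have rel: "spin7_relations ?\<alpha>" by (rule spin7_relations_of_eigen[OF sk])
  have "act4 ?\<alpha> psi (a mod 8) (b mod 8) (c mod 8) (d mod 8) = 0"
    by (rule act4_of_relations[OF sk rel]) simp_all
  moreover have "act4 ?\<alpha> psi (a mod 8) (b mod 8) (c mod 8) (d mod 8) =
    (\<Sum>s<8. Rm (F a) (F s) (F i) (F j) p * form4_tensor \<Psi> (F s) (F b) (F c) (F d) p + Rm (F b) (F s) (F i) (F j) p * form4_tensor \<Psi> (F a) (F s) (F c) (F d) p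
     + Rm (F c) (F s) (F i) (F j) p * form4_tensor \<Psi> (F a) (F b) (F s) (F d) p + Rm (F d) (F s) (F i) (F j) p * form4_tensor \<Psi> (F a) (F b) (F c) (F s) p)"
    unfolding act4_def by (rule sum.cong[OF refl]) (simp add: Fpsi Fmod)
  ultimately show ?thesis by simp
qed

lemma contr_Rt_Pt_eq:
  assumes v: "X \<in> vfields A" "Y \<in> vfields A" "Z \<in> vfields A" "V \<in> vfields A"
  shows "contr (contr (tprod [2, 0, 4, 5] [3, 1, 6, 7] Rt Pt)) [X, Y, Z, V] q = 2 * Rm Z V X Y q"
proof -
  obtain F where F: "adapted_at q F" by (rule adapted_at_ex)
  show ?thesis by (rule contr_Rt_Pt_eq_of_frame[OF F instanton_F[OF F] v])
qed

text \<open>The instanton condition is an equality of tensor fields, so both sides may be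
  differentiated; on the left \<Psi> is parallel and only R contributes.\<close>

lemma deriv_instanton_F:
  assumes F: "adapted_at p F"
  shows "(\<Sum>a<8. \<Sum>b<8. nabla D Rt [F m, F a, F b, F i, F j] p * form4_tensor \<Psi> (F a) (F b) (F k) (F l) p) = 2 * nabla D Rt [F m, F k, F l, F i, F j] p"
proof -
  note Fv = Fv[OF F]
  have "nabla D (contr (contr (tprod [2, 0, 4, 5] [3, 1, 6, 7] Rt Pt))) [F m, F i, F j, F k, F l] p = nabla D (permt [2, 3, 0, 1] 2 Rt) [F m, F i, F j, F k, F l] p"
  proof (rule nabla_cong)
    fix Xs :: "'a vfield list" assume Xs: "length Xs = 4" "set Xs \<subseteq> vfields A"
    then obtain X Y Z V where "Xs = [X, Y, Z, V]" by (auto simp: length_Suc_conv numeral_eq_Suc)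
    then show "contr (contr (tprod [2, 0, 4, 5] [3, 1, 6, 7] Rt Pt)) Xs = permt [2, 3, 0, 1] 2 Rt Xs"
      using Xs(2) contr_Rt_Pt_eq[of X Y Z V] by (intro ext) (simp add: permt_app Rt_list)
  qed (use Fv in \<open>simp_all add: D_vfields\<close>)
  then show ?thesis
    unfolding nabla_contr_Rt_Pt[OF Fv Fv Fv Fv Fv Fo[OF F]]
    using nabla_permt[OF shuffle_pairs tens_Rt Fv[of m], of "[F i, F j, F k, F l]" D 2 p] Fv by simp
qed

lemma star_eq:
  assumes v: "X \<in> vfields A" "Y \<in> vfields A"
  shows "contr (contr (contr (tprod [6, 4, 2, 0] [5, 3, 1, 7] Nt Pt))) [X, Y] q = 3 * contr Nt [X, Y] q"
proof -
  obtain F where F: "adapted_at q F" by (rule adapted_at_ex)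
  note Fo = Fo[OF F] and Fv = Fv[OF F]
  have "contr (contr (contr (tprod [6, 4, 2, 0] [5, 3, 1, 7] Nt Pt))) [X, Y] q = permt [0, 1] 3 (contr Nt) [X, Y] q"
  proof (rule tens_eq_of_frame[OF tens_contr_Nt_Pt tens_permt[OF shuffle_id2 tens_contr_Nt] Fo])
    fix Xs assume "length Xs = 2" "\<And>i. i < 2 \<Longrightarrow> \<exists>a<8. Xs ! i = F a"
    from length_2_frame[OF this] obtain a b where Xs: "Xs = [F a, F b]" by blast
    show "contr (contr (contr (tprod [6, 4, 2, 0] [5, 3, 1, 7] Nt Pt))) Xs q = permt [0, 1] 3 (contr Nt) Xs q"
      using instanton_algebra.star[OF instanton_algebra_at[OF F], of a b]
      unfolding Xs contr_Nt_Pt[OF Fv Fv Fo] curvature_algebra.n_def[OF curvature_algebra_at[OF F H0[OF cc]], simplified] sum3_def permt_app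
      by (simp add: contr_Nt[OF Fv Fv Fo])
  qed (use v in simp_all)
  then show ?thesis by (simp add: permt_app)
qed

lemma deriv_star_F:
  assumes F: "adapted_at p F"
  shows "(\<Sum>a<8. \<Sum>b<8. \<Sum>c<8. Wt [F k, F l, F a, F b, F c] p * form4_tensor \<Psi> (F a) (F b) (F c) (F j) p) = 3 * (\<Sum>a<8. Wt [F k, F a, F a, F l, F j] p)"
proof -
  note Fv = Fv[OF F]
  have "nabla D (contr (contr (contr (tprod [6, 4, 2, 0] [5, 3, 1, 7] Nt Pt)))) [F k, F l, F j] p = nabla D (permt [0, 1] 3 (contr Nt)) [F k, F l, F j] p"
  proof (rule nabla_cong)
    fix Xs :: "'a vfield list" assume Xs: "length Xs = 2" "set Xs \<subseteq> vfields A"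
    then obtain X Y where "Xs = [X, Y]" by (auto simp: length_Suc_conv numeral_eq_Suc)
    then show "contr (contr (contr (tprod [6, 4, 2, 0] [5, 3, 1, 7] Nt Pt))) Xs = permt [0, 1] 3 (contr Nt) Xs"
      using Xs(2) star_eq[of X Y] by (intro ext) (simp add: permt_app)
  qed (use Fv in \<open>simp_all add: D_vfields\<close>)
  then show ?thesis
    unfolding nabla_contr_Nt_Pt[OF Fv Fv Fv Fo[OF F]]
    using nabla_permt[OF shuffle_id2 tens_contr_Nt Fv[of k], of "[F l, F j]" D 3 p] Fv
    by (simp add: nabla_contr_Nt[OF Fv Fv Fv Fo[OF F]])
qed

lemma deriv_H0:
  assumes v: "M \<in> vfields A" "X \<in> vfields A" "Y \<in> vfields A" "Z \<in> vfields A" "V \<in> vfields A"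
  shows "Wt [M, X, Y, Z, V] p + Wt [M, Y, Z, X, V] p + Wt [M, Z, X, Y, V] p = Wt [M, V, X, Y, Z] p"
proof -
  have "Nt [V, X, Y, Z] = (\<lambda>q. Nt [X, Y, Z, V] q + Nt [Y, Z, X, V] q + Nt [Z, X, Y, V] q)"
    using H0[OF cc v(2-5)] by (auto simp: fun_eq_iff)
  then have "M p (Nt [V, X, Y, Z]) = M p (\<lambda>q. Nt [X, Y, Z, V] q + Nt [Y, Z, X, V] q + Nt [Z, X, Y, V] q)" by simp
  also have "\<dots> = M p (Nt [X, Y, Z, V]) + M p (Nt [Y, Z, X, V]) + M p (Nt [Z, X, Y, V])"
    by (simp add: vfield_add_app[OF v(1)] smooth_add Nt_smooth v)
  finally have "M p (Nt [V, X, Y, Z]) = M p (Nt [X, Y, Z, V]) + M p (Nt [Y, Z, X, V]) + M p (Nt [Z, X, Y, V])" .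
  then show ?thesis
    unfolding nabla4[of Nt]
    using H0[OF cc D_vfields[OF v(1,2)] v(3,4,5), of p] H0[OF cc v(2) D_vfields[OF v(1,3)] v(4,5), of p]
      H0[OF cc v(2,3) D_vfields[OF v(1,4)] v(5), of p] H0[OF cc v(2,3,4) D_vfields[OF v(1,5)], of p] by linarith
qed

lemma deriv_defect:
  assumes v: "M \<in> vfields A" "X \<in> vfields A" "Y \<in> vfields A" "Z \<in> vfields A" "V \<in> vfields A"
  shows "nabla D Rt [M, X, Y, Z, V] p - nabla D Rt [M, Z, V, X, Y] p = Wt [M, X, Y, Z, V] p - Wt [M, Y, X, Z, V] p"
proof -
  have "(\<lambda>q. Rm X Y Z V q - Rm Z V X Y q) = (\<lambda>q. Nt [X, Y, Z, V] q - Nt [Y, X, Z, V] q)"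
    using pair_defect[OF cc v(2-5)] by auto
  then have "M p (\<lambda>q. Rm X Y Z V q - Rm Z V X Y q) = M p (\<lambda>q. Nt [X, Y, Z, V] q - Nt [Y, X, Z, V] q)" by simp
  then have "M p (Rm X Y Z V) - M p (Rm Z V X Y) = M p (Nt [X, Y, Z, V]) - M p (Nt [Y, X, Z, V])"
    by (simp add: vfield_diff_app[OF v(1)] Nt_smooth Rm_smooth v)
  then show ?thesis
    unfolding nabla4[of Nt] nabla_Rt
    using pair_defect[OF cc D_vfields[OF v(1,2)] v(3,4,5), of p] pair_defect[OF cc v(2) D_vfields[OF v(1,3)] v(4,5), of p]
      pair_defect[OF cc v(2,3) D_vfields[OF v(1,4)] v(5), of p] pair_defect[OF cc v(2,3,4) D_vfields[OF v(1,5)], of p] by linarith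
qed

lemma derivative_algebra_at:
  assumes F: "adapted_at p F"
  shows "derivative_algebra (\<lambda>i j k. Tor (F i) (F j) (F k) p) (\<lambda>i j k l. Nt [F i, F j, F k, F l] p)
    (\<lambda>i j k l. Rm (F i) (F j) (F k) (F l) p) (\<lambda>i j k l. form4_tensor \<Psi> (F i) (F j) (F k) (F l) p)
    (\<lambda>m i j k l. nabla D Rt [F m, F i, F j, F k, F l] p) (\<lambda>m i j k l. Wt [F m, F i, F j, F k, F l] p)"
proof (rule derivative_algebra.intro[OF instanton_algebra_at[OF F]], unfold_locales)
  note Fv = Fv[OF F] and Fo = Fo[OF F]
  fix m i j k l a b c d
  show "nabla D Rt [F m, F j, F i, F k, F l] p = - nabla D Rt [F m, F i, F j, F k, F l] p"
    by (rule nabla_Rt_skew(1)[OF Fv Fv Fv Fv Fv])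
  show "nabla D Rt [F m, F i, F j, F l, F k] p = - nabla D Rt [F m, F i, F j, F k, F l] p"
    by (rule nabla_Rt_skew(2)[OF Fv Fv Fv Fv Fv])
  show "Wt [F m, F i, F k, F j, F l] p = - Wt [F m, F i, F j, F k, F l] p" by (rule Wt_skew(1)[OF Fv Fv Fv Fv Fv])
  show "Wt [F m, F i, F j, F l, F k] p = - Wt [F m, F i, F j, F k, F l] p" by (rule Wt_skew(2)[OF Fv Fv Fv Fv Fv])
  show "nabla D Rt [F m, F k, F l, F i, F j] p + nabla D Rt [F k, F l, F m, F i, F j] p + nabla D Rt [F l, F m, F k, F i, F j] p +
      (\<Sum>s<8. Tor (F m) (F k) (F s) p * Rm (F s) (F l) (F i) (F j) p + Tor (F k) (F l) (F s) p * Rm (F s) (F m) (F i) (F j) p +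
        Tor (F l) (F m) (F s) p * Rm (F s) (F k) (F i) (F j) p) = 0"
    using second_Bianchi[OF Fv[of m] Fv[of k] Fv[of l] Fv[of i] Fv[of j], of p]
    unfolding Rm_tau_expand[OF Fo Fv Fv Fv Fv Fv] sum.distrib .
  show "nabla D Rt [F m, F i, F j, F k, F l] p - nabla D Rt [F m, F k, F l, F i, F j] p = Wt [F m, F i, F j, F k, F l] p - Wt [F m, F j, F i, F k, F l] p"
    by (rule deriv_defect[OF Fv Fv Fv Fv Fv])
  show "Wt [F k, F l, F a, F b, F c] p - Wt [F l, F k, F a, F b, F c] p =
      - (\<Sum>s<8. Rm (F k) (F l) (F a) (F s) p * Tor (F s) (F b) (F c) p + Rm (F k) (F l) (F b) (F s) p * Tor (F a) (F s) (F c) p +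
        Rm (F k) (F l) (F c) (F s) p * Tor (F a) (F b) (F s) p) - (\<Sum>s<8. Tor (F k) (F l) (F s) p * Nt [F s, F a, F b, F c] p)"
    using Ricci_identity_Tor[OF Fv[of k] Fv[of l] Fv[of a] Fv[of b] Fv[of c], of p]
    unfolding Tor_curvature_expand[OF Fo Fv Fv Fv Fv Fv] nabla_Tt_tau_expand[OF Fo Fv Fv Fv Fv Fv] sum.distrib .
  show "Wt [F m, F i, F j, F k, F l] p + Wt [F m, F j, F k, F i, F l] p + Wt [F m, F k, F i, F j, F l] p = Wt [F m, F l, F i, F j, F k] p"
    by (rule deriv_H0[OF Fv Fv Fv Fv Fv])
  show "sum3 (\<lambda>a b c. Wt [F k, F l, F a, F b, F c] p * form4_tensor \<Psi> (F a) (F b) (F c) (F j) p) = 3 * (\<Sum>a<8. Wt [F k, F a, F a, F l, F j] p)"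
    unfolding sum3_def by (rule deriv_star_F[OF F])
qed (rule act_first_F[OF F] act_last_F[OF F] deriv_instanton_F[OF F])+

end

end

section \<open>The strong maximum principle\<close>

context manifold
begin

lemma vfield_power_app:
  assumes X: "X \<in> vfields A" and w: "w \<in> smooth_funs A"
  shows "X p (\<lambda>q. w q ^ Suc k) = real (Suc k) * w p ^ k * X p w"
proof (induction k)
  case (Suc k)
  have "X p (\<lambda>q. w q * w q ^ Suc k) = w p * X p (\<lambda>q. w q ^ Suc k) + w p ^ Suc k * X p w"
    by (rule vfield_mult_app[OF X w smooth_power[OF w]])
  then show ?case unfolding Suc by (simp add: algebra_simps)
qed simp

end

lemma second_derivative_local_max:
  fixes f f' :: "real \<Rightarrow> real"
  assumes d: "d > 0" and f: "\<And>t. \<bar>t\<bar> < d \<Longrightarrow> (f has_real_derivative f' t) (at t)"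
    and f': "(f' has_real_derivative l) (at 0)" and max: "\<And>t. \<bar>t\<bar> < d \<Longrightarrow> f t \<le> f 0"
  shows "f' 0 = 0" "l \<le> 0"
proof -
  show z: "f' 0 = 0" by (rule DERIV_local_max[OF f[of 0] d]) (use d max in auto)
  show "l \<le> 0"
  proof (rule ccontr)
    assume "\<not> l \<le> 0"
    then have "l > 0" by simp
    from DERIV_pos_inc_right[OF f' this] z obtain e where e: "e > 0" "\<And>h. 0 < h \<Longrightarrow> h < e \<Longrightarrow> 0 < f' h" by auto
    define h where "h = min d e / 2"
    have h: "0 < h" "h < d" "h < e" using d e(1) by (auto simp: h_def)
    have "\<exists>z>0. z < h \<and> f h - f 0 = (h - 0) * f' z"
      by (rule MVT2[OF h(1)]) (use h f in auto)
    then obtain z where "0 < z" "z < h" "f h - f 0 = h * f' z" by auto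
    moreover have "0 < h * f' z" using calculation h e by simp
    ultimately show False using max[of h] h by simp
  qed
qed

context spin7_connection
begin

lemma tens_fun: "u \<in> smooth_funs A \<Longrightarrow> tens 0 (\<lambda>_. u)"
  by (rule tensI) simp_all

text \<open>The connection has torsion, so this need not be symmetric; only its diagonal values and
  its trace are used.\<close>

definition hess :: "('a \<Rightarrow> real) \<Rightarrow> 'a tensor" where
  "hess u = nabla D (nabla D (\<lambda>_. u))"

lemma tens_hess: "u \<in> smooth_funs A \<Longrightarrow> tens 2 (hess u)"
  using tens_nabla[OF tens_nabla[OF tens_fun]] by (simp add: hess_def numeral_eq_Suc)

lemma nabla_fun: "nabla D (\<lambda>_. u) [X] = (\<lambda>p. X p u)"
  by (simp add: nabla_Cons fun_eq_iff)

lemma hess_app: "hess u [X, Y] p = X p (\<lambda>q. Y q u) - D X Y p u"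
  by (simp add: hess_def nabla_Cons nabla_fun)

context
  fixes u N p
  assumes u: "u \<in> smooth_funs A" and N: "open N" "p \<in> N" "\<And>q. q \<in> N \<Longrightarrow> u q \<le> u p"
begin

text \<open>Y agrees with X at p and has constant coefficients in a chart near p. There its integral
  curves are straight coordinate segments, on which the one-variable second derivative test
  applies.\<close>

lemma second_derivative_local_max_field:
  assumes X: "X \<in> vfields A"
  obtains Y where "Y \<in> vfields A" "Y p = X p" "Y p u = 0" "Y p (\<lambda>q. Y q u) \<le> 0"
proof -
  obtain U \<phi> where c: "(U, \<phi>) \<in> A" and p: "p \<in> U" using chart_ex by blast
  obtain x N1 where x: "\<And>b. b \<in> Basis \<Longrightarrow> x b \<in> smooth_funs A" "open N1" "p \<in> N1" "N1 \<subseteq> U"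
    "\<And>b q. b \<in> Basis \<Longrightarrow> q \<in> N1 \<Longrightarrow> x b q = (\<phi> q - \<phi> p) \<bullet> b" using coord_funs_ex[OF c p] by metis
  obtain C M where C: "\<And>b. b \<in> Basis \<Longrightarrow> C b \<in> vfields A" "open M" "p \<in> M" "M \<subseteq> U"
    "\<And>b q. b \<in> Basis \<Longrightarrow> q \<in> M \<Longrightarrow> C b q = coord_deriv U \<phi> b q" using coord_field_ex[OF c p] by metis
  define \<xi> where "\<xi> = (\<Sum>b\<in>Basis. X p (x b) *\<^sub>R b)"
  define Y where "Y = vf_sum (\<lambda>b. vf_scale (\<lambda>_. X p (x b)) (C b)) Basis"
  have Y: "Y \<in> vfields A" unfolding Y_def by (intro vf_sum_vfields vf_scale_vfields smooth_const C(1))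
  have YX: "Y p = X p"
  proof -
    have "Y p = (\<lambda>f. \<Sum>b\<in>Basis. X p (x b) * coord_deriv U \<phi> b p f)"
      using C(3,5) by (simp add: Y_def vf_sum_def vf_scale_def fun_eq_iff)
    then show ?thesis using tangent_expansion[OF c p vfieldsD(1)[OF X] x] by (rule trans[OF _ sym])
  qed
  let ?r = "\<lambda>f y. f (inv_into U \<phi> y)"
  let ?c = "\<lambda>t. \<phi> p + t *\<^sub>R \<xi>"
  have Yq: "Y q f = frechet_derivative (?r f) (at (\<phi> q)) \<xi>" if "q \<in> M" "f \<in> smooth_funs A" for q f
  proof -
    have "q \<in> U" using that C(4) by blast
    from has_derivative_linear[OF chart_rep_deriv[OF c that(2) this]]
    have "frechet_derivative (?r f) (at (\<phi> q)) \<xi> = (\<Sum>b\<in>Basis. X p (x b) * frechet_derivative (?r f) (at (\<phi> q)) b)"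
      unfolding \<xi>_def by (simp add: linear_sum linear_cmul)
    then show ?thesis using that C(5) by (simp add: Y_def vf_sum_def vf_scale_def coord_deriv_def)
  qed
  have "open (\<phi> ` (M \<inter> N))" by (rule chart_open_image_subset[OF c]) (use C N in auto)
  then obtain e where e: "e > 0" "ball (\<phi> p) e \<subseteq> \<phi> ` (M \<inter> N)" using C(3) N(2) open_contains_ball_eq by blast
  \<comment> \<open>Chosen so that the segment stays in the coordinate ball; the summand 1 covers
    \<xi> = 0.\<close>
  define d where "d = e / (norm \<xi> + 1)"
  have d: "d > 0" using e(1) by (simp add: d_def add_nonneg_pos)
  have ball: "\<exists>q\<in>M \<inter> N. ?c t = \<phi> q" if "\<bar>t\<bar> < d" for t
  proof -
    have "\<bar>t\<bar> * (norm \<xi> + 1) < e" using that by (simp add: d_def pos_less_divide_eq add_nonneg_pos)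
    moreover have "\<bar>t\<bar> * norm \<xi> \<le> \<bar>t\<bar> * (norm \<xi> + 1)" by (rule mult_left_mono) auto
    ultimately have "norm (t *\<^sub>R \<xi>) < e" by simp
    then have "?c t \<in> ball (\<phi> p) e" by (simp add: dist_norm)
    then show ?thesis using e(2) by blast
  qed
  have der: "((\<lambda>t. ?r f (?c t)) has_real_derivative Y (inv_into U \<phi> (?c t)) f) (at t)"
    if f: "f \<in> smooth_funs A" and t: "\<bar>t\<bar> < d" for f t
  proof -
    obtain q where q: "q \<in> M" "?c t = \<phi> q" using ball[OF t] by blast
    then have qU: "q \<in> U" using C(4) by blast
    have 1: "(?c has_derivative (\<lambda>s. s *\<^sub>R \<xi>)) (at t)" by (auto intro!: derivative_eq_intros)
    have "(?r f has_derivative frechet_derivative (?r f) (at (\<phi> q))) (at (?c t))"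
      unfolding q(2) by (rule chart_rep_deriv[OF c f qU])
    from has_derivative_compose[OF 1 this]
    have "((\<lambda>t. ?r f (?c t)) has_derivative (\<lambda>s. frechet_derivative (?r f) (at (\<phi> q)) (s *\<^sub>R \<xi>))) (at t)" .
    moreover have "frechet_derivative (?r f) (at (\<phi> q)) (s *\<^sub>R \<xi>) = s * Y (inv_into U \<phi> (?c t)) f" for s
      using linear_cmul[OF has_derivative_linear[OF chart_rep_deriv[OF c f qU]], of s \<xi>]
      unfolding q(2) chart_inv[OF c qU] Yq[OF q(1) f] by simp
    ultimately show ?thesis by (simp add: has_field_derivative_def mult.commute[of _ "Y _ _"])
  qed
  have Yu: "(\<lambda>q. Y q u) \<in> smooth_funs A" by (rule vfieldsD(2)[OF Y u])
  have max: "?r u (?c t) \<le> ?r u (?c 0)" if t: "\<bar>t\<bar> < d" for t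
  proof -
    obtain q where q: "q \<in> M" "q \<in> N" "?c t = \<phi> q" using ball[OF t] by blast
    then have "?r u (?c t) = u q" using chart_inv[OF c, of q] C(4) by auto
    then show ?thesis using N(3)[OF q(2)] chart_inv[OF c p] by simp
  qed
  have "Y (inv_into U \<phi> (?c 0)) u = 0" "Y (inv_into U \<phi> (?c 0)) (\<lambda>q. Y q u) \<le> 0"
    using second_derivative_local_max[OF d der[OF u] der[OF Yu, of 0]] max d by simp_all
  then have "Y p u = 0" "Y p (\<lambda>q. Y q u) \<le> 0" using chart_inv[OF c p] by simp_all
  with Y YX show thesis by (rule that)
qed

lemma gradient_local_max: "X \<in> vfields A \<Longrightarrow> X p u = 0"
  by (rule second_derivative_local_max_field[of X]) simp_all

text \<open>The Hessian depends only on the value of X at p, so X may be exchanged for the straight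
  field Y; its correction term is a first derivative at a critical point.\<close>

lemma hess_local_max:
  assumes X: "X \<in> vfields A"
  shows "hess u [X, X] p \<le> 0"
proof -
  obtain Y where Y: "Y \<in> vfields A" "Y p = X p" "Y p (\<lambda>q. Y q u) \<le> 0"
    by (rule second_derivative_local_max_field[OF X])
  have th: "tens 2 (hess u)" by (rule tens_hess[OF u])
  have h: "hess u [X, X] p = hess u [Y, Y] p"
    using tens_cong[OF th, of "[X, X]" 0 X Y p] tens_cong[OF th, of "[Y, X]" 1 X Y p] X Y by simp
  show ?thesis
    unfolding h unfolding hess_app gradient_local_max[OF D_vfields[OF Y(1) Y(1)]] using Y(3) by simp
qed

end

end

section \<open>The Laplacian with a drift\<close>

context spin7_connection
begin

definition gradsq :: "('a \<Rightarrow> real) \<Rightarrow> 'a \<Rightarrow> real" where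
  "gradsq u = contr (tprod [0] [1] (nabla D (\<lambda>_. u)) (nabla D (\<lambda>_. u))) []"

text \<open>As the torsion is skew, \<open>D X X\<close> is the Levi-Civita one, so the trace of the
  Hessian is the Riemannian Laplacian; \<beta> supplies an arbitrary first-order term.\<close>

definition drift_laplace :: "'a tensor \<Rightarrow> ('a \<Rightarrow> real) \<Rightarrow> 'a \<Rightarrow> real" where
  "drift_laplace \<beta> u = (\<lambda>p. contr (hess u) [] p + contr (tprod [0] [1] \<beta> (nabla D (\<lambda>_. u))) [] p)"

lemma shuffle_1_1: "shuffle 1 1 [0] [Suc 0]"
  by (auto simp: shuffle_def)

lemma tens_grad: "u \<in> smooth_funs A \<Longrightarrow> tens 1 (nabla D (\<lambda>_. u))"
  using tens_nabla[OF tens_fun] by simp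

lemma tens_tprod_1_1: "tens 1 S \<Longrightarrow> tens 1 P \<Longrightarrow> tens (Suc (Suc 0)) (tprod [0] [1] S P)"
  using tens_tprod[OF _ _ shuffle_1_1] by (simp add: numeral_2_eq_2)

lemma gradsq_smooth:
  assumes "u \<in> smooth_funs A"
  shows "gradsq u \<in> smooth_funs A"
  unfolding gradsq_def by (rule tens_smooth[OF tens_contr[OF tens_tprod_1_1[OF tens_grad tens_grad]]]) (use assms in simp_all)

lemma drift_laplace_smooth:
  assumes "u \<in> smooth_funs A" "tens 1 \<beta>"
  shows "drift_laplace \<beta> u \<in> smooth_funs A"
proof -
  have h: "tens (Suc (Suc 0)) (hess u)" using tens_hess[OF assms(1)] by (simp add: numeral_2_eq_2)
  show ?thesis
    unfolding drift_laplace_def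
    by (rule smooth_add[OF tens_smooth[OF tens_contr[OF h]] tens_smooth[OF tens_contr[OF tens_tprod_1_1[OF assms(2) tens_grad[OF assms(1)]]]]]) simp_all
qed

context
  fixes p E
  assumes E: "orthonormal_at A g p E"
begin

lemma gradsq_frame:
  assumes "u \<in> smooth_funs A"
  shows "gradsq u p = (\<Sum>a<8. (E a p u)\<^sup>2)"
  unfolding gradsq_def
  by (simp add: contr_frame[OF tens_tprod_1_1[OF tens_grad[OF assms] tens_grad[OF assms]] _ _ E, of "[]", simplified] tprod_def nabla_fun power2_eq_square)

lemma drift_laplace_frame:
  assumes u: "u \<in> smooth_funs A" and b: "tens 1 \<beta>"
  shows "drift_laplace \<beta> u p = (\<Sum>a<8. E a p (\<lambda>q. E a q u) - D (E a) (E a) p u + \<beta> [E a] p * E a p u)"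
proof -
  have h: "tens (Suc (Suc 0)) (hess u)" using tens_hess[OF u] by (simp add: numeral_2_eq_2)
  show ?thesis
    unfolding drift_laplace_def
    by (simp add: contr_frame[OF tens_tprod_1_1[OF b tens_grad[OF u]] _ _ E, of "[]", simplified]
        contr_frame[OF h _ _ E, of "[]"] tprod_def nabla_fun hess_app sum.distrib)
qed

text \<open>The chain rule f''(w) |dw|^2 + f'(w) L w for f a power; the exponent is at least 2 so
  that w ^ k can be factored out.\<close>

lemma drift_laplace_power:
  assumes w: "w \<in> smooth_funs A" and b: "tens 1 \<beta>"
  shows "drift_laplace \<beta> (\<lambda>q. w q ^ Suc (Suc k)) p =
    real (Suc (Suc k)) * w p ^ k * (real (Suc k) * gradsq w p + w p * drift_laplace \<beta> w p)"
proof -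
  let ?n = "real (Suc (Suc k))" and ?m = "real (Suc k)"
  have Ev: "E a \<in> vfields A" if "a < 8" for a by (rule orthonormal_vfields[OF E that])
  have 1: "X p (\<lambda>q. X q (\<lambda>q. w q ^ Suc (Suc k))) = ?n * ?m * w p ^ k * (X p w)\<^sup>2 + ?n * w p ^ Suc k * X p (\<lambda>q. X q w)"
    if X: "X \<in> vfields A" for X
  proof -
    have Xw: "(\<lambda>q. X q w) \<in> smooth_funs A" by (rule vfieldsD(2)[OF X w])
    have "(\<lambda>q. X q (\<lambda>q. w q ^ Suc (Suc k))) = (\<lambda>q. ?n * (w q ^ Suc k * X q w))"
      using vfield_power_app[OF X w, of _ "Suc k"] by (simp add: fun_eq_iff mult.assoc)
    then have "X p (\<lambda>q. X q (\<lambda>q. w q ^ Suc (Suc k))) = X p (\<lambda>q. ?n * (w q ^ Suc k * X q w))" by simp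
    also have "\<dots> = ?n * (w p ^ Suc k * X p (\<lambda>q. X q w) + X p w * (?m * w p ^ k * X p w))"
      unfolding vfield_cmult_app[OF X smooth_mult[OF smooth_power[OF w] Xw]]
        vfield_mult_app[OF X smooth_power[OF w] Xw] vfield_power_app[OF X w] ..
    finally show ?thesis by (simp add: algebra_simps power2_eq_square)
  qed
  have "E a p (\<lambda>q. E a q (\<lambda>q. w q ^ Suc (Suc k))) - D (E a) (E a) p (\<lambda>q. w q ^ Suc (Suc k)) + \<beta> [E a] p * E a p (\<lambda>q. w q ^ Suc (Suc k)) =
    ?n * w p ^ k * (?m * (E a p w)\<^sup>2 + w p * (E a p (\<lambda>q. E a q w) - D (E a) (E a) p w + \<beta> [E a] p * E a p w))" if "a < 8" for a
    unfolding 1[OF Ev[OF that]] unfolding vfield_power_app[OF Ev[OF that] w] vfield_power_app[OF D_vfields[OF Ev[OF that] Ev[OF that]] w]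
    by (simp add: algebra_simps)
  then show ?thesis
    unfolding drift_laplace_frame[OF smooth_power[OF w] b] drift_laplace_frame[OF w b] gradsq_frame[OF w]
    by (simp add: sum_distrib_left sum.distrib distrib_left)
qed

lemma drift_laplace_lin:
  assumes "u \<in> smooth_funs A" "h \<in> smooth_funs A" and b: "tens 1 \<beta>"
  shows "drift_laplace \<beta> (\<lambda>q. u q + c * h q) p = drift_laplace \<beta> u p + c * drift_laplace \<beta> h p"
proof -
  have 0: "X q (\<lambda>q. u q + c * h q) = X q u + c * X q h" if "X \<in> vfields A" for X q
    using vfield_add_app[OF that assms(1) smooth_mult[OF smooth_const assms(2)]] vfield_cmult_app[OF that assms(2)] by simp
  have 1: "X p (\<lambda>q. X q (\<lambda>q. u q + c * h q)) = X p (\<lambda>q. X q u) + c * X p (\<lambda>q. X q h)" if X: "X \<in> vfields A" for X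
    unfolding 0[OF X]
    using vfield_add_app[OF X vfieldsD(2)[OF X assms(1)] smooth_mult[OF smooth_const vfieldsD(2)[OF X assms(2)]]]
      vfield_cmult_app[OF X vfieldsD(2)[OF X assms(2)]] by simp
  have Ev: "E a \<in> vfields A" if "a < 8" for a by (rule orthonormal_vfields[OF E that])
  have s: "(\<lambda>q. u q + c * h q) \<in> smooth_funs A" by (rule smooth_add[OF assms(1) smooth_mult[OF smooth_const assms(2)]])
  have "E a p (\<lambda>q. E a q (\<lambda>q. u q + c * h q)) - D (E a) (E a) p (\<lambda>q. u q + c * h q) + \<beta> [E a] p * E a p (\<lambda>q. u q + c * h q) =
    (E a p (\<lambda>q. E a q u) - D (E a) (E a) p u + \<beta> [E a] p * E a p u) +
    c * (E a p (\<lambda>q. E a q h) - D (E a) (E a) p h + \<beta> [E a] p * E a p h)" if "a < 8" for a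
    unfolding 1[OF Ev[OF that]] unfolding 0[OF Ev[OF that]] 0[OF D_vfields[OF Ev[OF that] Ev[OF that]]]
    by (simp add: algebra_simps)
  then show ?thesis
    unfolding drift_laplace_frame[OF s b] drift_laplace_frame[OF assms(1) b] drift_laplace_frame[OF assms(2) b]
    by (simp add: sum_distrib_left sum.distrib[symmetric])
qed

end

lemma drift_laplace_local_max:
  assumes u: "u \<in> smooth_funs A" and N: "open N" "p \<in> N" "\<And>q. q \<in> N \<Longrightarrow> u q \<le> u p" and b: "tens 1 \<beta>"
  shows "drift_laplace \<beta> u p \<le> 0"
proof -
  note Ev = orthonormal_vfields[OF frame_at[of p]]
  show ?thesis
    unfolding drift_laplace_frame[OF frame_at u b]
  proof (rule sum_nonpos)
    fix a :: nat assume "a \<in> {..<8}"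
    then have a: "a < 8" by simp
    show "frame_at A g p a p (\<lambda>q. frame_at A g p a q u) - D (frame_at A g p a) (frame_at A g p a) p u + \<beta> [frame_at A g p a] p * frame_at A g p a p u \<le> 0"
      using hess_local_max[OF u N Ev[OF a]] gradient_local_max[OF u N Ev[OF a]] by (simp add: hess_app)
  qed
qed

end

section \<open>Hopf's barrier and the strong maximum principle\<close>

context spin7_connection
begin

lemma smooth_less_open: "f \<in> smooth_funs A \<Longrightarrow> open {q. 0 < f q}"
  by (rule open_Collect_less[OF continuous_on_const smooth_continuous])

text \<open>Hopf's barrier \<open>w ^ k - 1\<close> with \<open>w = 1 + \<bar>z - y\<bar>\<^sup>2 - \<bar>x - y\<bar>\<^sup>2\<close>: for large \<open>k\<close> the gradient term dominates.\<close>

lemma barrier_ex: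
  assumes c: "(U, \<phi>) \<in> A" and z: "z \<in> U" and y: "\<phi> z \<noteq> y" and b: "tens 1 \<beta>"
  obtains h N where "h \<in> smooth_funs A" "open N" "z \<in> N" "N \<subseteq> U" "h z = 0"
    "\<And>q. q \<in> N \<Longrightarrow> 0 < drift_laplace \<beta> h q" "\<And>q. q \<in> N \<Longrightarrow> dist (\<phi> z) y < dist (\<phi> q) y \<Longrightarrow> h q < 0"
proof -
  obtain x N1 where x: "\<And>b. b \<in> Basis \<Longrightarrow> x b \<in> smooth_funs A" "open N1" "z \<in> N1" "N1 \<subseteq> U"
    "\<And>b q. b \<in> Basis \<Longrightarrow> q \<in> N1 \<Longrightarrow> x b q = (\<phi> q - \<phi> z) \<bullet> b" using coord_funs_ex[OF c z] by metis
  define \<xi> where "\<xi> = \<phi> z - y"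
  define w where "w = (\<lambda>q. 1 + \<xi> \<bullet> \<xi> - (\<Sum>b\<in>Basis. (x b q + \<xi> \<bullet> b) * (x b q + \<xi> \<bullet> b)))"
  have w: "w \<in> smooth_funs A"
    unfolding w_def by (rule smooth_diff[OF smooth_const], rule smooth_sum, rule smooth_mult; rule smooth_add[OF x(1) smooth_const])
  have wN: "w q = 1 + \<xi> \<bullet> \<xi> - (\<phi> q - y) \<bullet> (\<phi> q - y)" if "q \<in> N1" for q
  proof -
    have "x b q + \<xi> \<bullet> b = (\<phi> q - y) \<bullet> b" if "b \<in> Basis" for b
      using x(5)[OF that \<open>q \<in> N1\<close>] by (simp add: \<xi>_def inner_diff_left)
    then show ?thesis unfolding w_def euclidean_inner[of "\<phi> q - y" "\<phi> q - y"] by simp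
  qed
  have wz: "w z = 1" using wN[OF x(3)] by (simp add: \<xi>_def)
  have "((\<lambda>x. 1 + \<xi> \<bullet> \<xi> - (x - y) \<bullet> (x - y)) has_derivative (\<lambda>v. - 2 * (\<xi> \<bullet> v))) (at (\<phi> z))"
    by (auto intro!: derivative_eq_intros simp: \<xi>_def inner_commute)
  from coord_deriv_of_local[OF c w x(3,2,4) wN this]
  have dw: "coord_deriv U \<phi> \<xi> z w = - 2 * (\<xi> \<bullet> \<xi>)" .
  have "\<xi> \<bullet> \<xi> > 0" using y by (simp add: \<xi>_def)
  note E = frame_at[of z]
  \<comment> \<open>The derivative of w along \<xi>, the radial direction at z, is -2 |\<xi>|^2 and
    does not vanish.\<close>
  have "gradsq w z > 0"
  proof (rule ccontr)
    assume "\<not> gradsq w z > 0"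
    then have "(\<Sum>a<8. (frame_at A g z a z w)\<^sup>2) = 0"
      unfolding gradsq_frame[OF E w] using sum_nonneg[of "{..<8}" "\<lambda>a. (frame_at A g z a z w)\<^sup>2"] by simp
    then have "frame_at A g z a z w = 0" if "a < 8" for a
      using that by (simp add: sum_nonneg_eq_0_iff)
    then have "coord_deriv U \<phi> \<xi> z w = 0"
      using fun_cong[OF orthonormal_expansion[OF E coord_deriv_tangent[OF c z]], of \<xi> w] by simp
    then show False using dw \<open>\<xi> \<bullet> \<xi> > 0\<close> by simp
  qed
  \<comment> \<open>At z, where w = 1, this choice makes F positive; by continuity it stays positive
    nearby.\<close>
  then obtain k where k: "- drift_laplace \<beta> w z < real k * gradsq w z"
    using reals_Archimedean3 by blast
  define F where "F = (\<lambda>q. real (Suc k) * gradsq w q + w q * drift_laplace \<beta> w q)"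
  have F: "F \<in> smooth_funs A"
    unfolding F_def by (rule smooth_add[OF smooth_mult[OF smooth_const gradsq_smooth[OF w]] smooth_mult[OF w drift_laplace_smooth[OF w b]]])
  define h where "h = (\<lambda>q. w q ^ Suc (Suc k) + (-1) * 1)"
  have h: "h \<in> smooth_funs A" unfolding h_def by (rule smooth_add[OF smooth_power[OF w] smooth_const])
  have Lh: "drift_laplace \<beta> h q = real (Suc (Suc k)) * w q ^ k * F q" for q
  proof -
    note Eq = frame_at[of q]
    have "drift_laplace \<beta> (\<lambda>_. 1) q = 0"
      unfolding drift_laplace_frame[OF Eq smooth_const b]
      by (rule sum.neutral) (simp add: vfield_const_app orthonormal_vfields[OF Eq] D_vfields)
    then show ?thesis
      unfolding h_def drift_laplace_lin[OF Eq smooth_power[OF w] smooth_const b] drift_laplace_power[OF Eq w b] F_def by simp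
  qed
  let ?N = "N1 \<inter> {q. 0 < F q} \<inter> {q. 0 < w q}"
  show thesis
  proof (rule that[OF h, of ?N])
    show "open ?N" using x(2) smooth_less_open[OF F] smooth_less_open[OF w] by auto
    show "z \<in> ?N" using x(3) k wz \<open>gradsq w z > 0\<close> by (simp add: F_def distrib_right)
    show "?N \<subseteq> U" using x(4) by blast
    show "h z = 0" by (simp add: h_def wz)
    fix q assume q: "q \<in> ?N"
    show "0 < drift_laplace \<beta> h q" unfolding Lh using q by simp
    assume "dist (\<phi> z) y < dist (\<phi> q) y"
    then have "\<xi> \<bullet> \<xi> < (\<phi> q - y) \<bullet> (\<phi> q - y)"
      unfolding dist_norm \<xi>_def dot_square_norm by (rule power_strict_mono) simp_all
    then have "w q < 1" using wN[of q] q by simp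
    then have "w q ^ Suc (Suc k) < 1" using q power_Suc_less_one[of "w q" "Suc k"] by simp
    then show "h q < 0" by (simp add: h_def)
  qed
qed

text \<open>Starting from a point y0 off the maximal level set, the largest ball about y0 missing
  that set touches it at some z. A smaller ball, tangent from inside at z, then touches it at z
  alone. Since y0 lies within R/2 of x0, all this happens inside the given ball.\<close>

lemma touching_ball:
  fixes f :: "real^8 \<Rightarrow> real"
  assumes f: "continuous_on (ball x0 R) f" and y0: "y0 \<in> ball x0 (R/2)" "f y0 \<noteq> f x0"
    and max: "\<And>x. x \<in> ball x0 R \<Longrightarrow> f x \<le> f x0"
  obtains z y where "z \<in> ball x0 R" "f z = f x0" "y \<noteq> z"
    "\<And>x. x \<in> ball x0 R \<Longrightarrow> dist x y \<le> dist z y \<Longrightarrow> x \<noteq> z \<Longrightarrow> f x < f x0"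
proof -
  let ?c = "cball y0 (dist y0 x0)"
  have sub: "?c \<subseteq> ball x0 R"
  proof
    fix x assume "x \<in> ?c"
    then have "dist x0 x \<le> dist x0 y0 + dist x0 y0" using dist_triangle[of x0 x y0] by (simp add: dist_commute)
    then show "x \<in> ball x0 R" using y0(1) by simp
  qed
  define K where "K = {x \<in> ?c. f x = f x0}"
  have "compact K"
    unfolding compact_eq_bounded_closed
  proof
    show "bounded K" by (rule bounded_subset[OF bounded_cball[of y0 "dist y0 x0"]]) (auto simp: K_def)
    show "closed K" unfolding K_def by (rule continuous_closed_preimage_constant[OF continuous_on_subset[OF f sub] closed_cball])
  qed
  moreover have "x0 \<in> K" by (simp add: K_def)
  moreover have "continuous_on K (dist y0)" by (intro continuous_intros)
  ultimately obtain z where z: "z \<in> K" "\<And>x. x \<in> K \<Longrightarrow> dist y0 z \<le> dist y0 x"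
    using continuous_attains_inf[of K "dist y0"] by blast
  have zy: "z \<noteq> y0" using z(1) y0(2) by (auto simp: K_def)
  \<comment> \<open>The ball about y through z has the segment from y0 to z as a diameter.\<close>
  define y where "y = (1/2) *\<^sub>R (y0 + z)"
  show thesis
  proof (rule that[of z y])
    show "z \<in> ball x0 R" "f z = f x0" using z(1) sub by (auto simp: K_def)
    show "y \<noteq> z"
    proof
      assume "y = z"
      then have "2 *\<^sub>R y = 2 *\<^sub>R z" by simp
      then have "y0 + z = z + z" by (simp add: y_def scaleR_2)
      then show False using zy by simp
    qed
    fix x assume x: "x \<in> ball x0 R" "dist x y \<le> dist z y" "x \<noteq> z"
    have "(x - y) \<bullet> (x - y) \<le> (z - y) \<bullet> (z - y)"
      using x(2) unfolding dist_norm dot_square_norm by (rule power_mono) simp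
    \<comment> \<open>Thales: x lies in the ball with diameter y0 z exactly when the angle at x is
      at least a right angle.\<close>
    then have 1: "(x - z) \<bullet> (x - y0) \<le> 0"
      by (simp add: y_def inner_diff_left inner_diff_right inner_add_left inner_add_right inner_commute algebra_simps)
    have 2: "(x - z) \<bullet> (x - z) > 0" using x(3) by simp
    have "(x - y0) \<bullet> (x - y0) + (x - z) \<bullet> (x - z) - 2 * ((x - z) \<bullet> (x - y0)) = (z - y0) \<bullet> (z - y0)"
      by (simp add: inner_diff_left inner_diff_right inner_commute)
    then have "(x - y0) \<bullet> (x - y0) < (z - y0) \<bullet> (z - y0)" using 1 2 by linarith
    then have lt: "dist y0 x < dist y0 z" unfolding dot_square_norm dist_norm
      by (metis norm_ge_zero norm_minus_commute power_less_imp_less_base)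
    have "x \<in> ?c" using lt z(1) by (auto simp: K_def)
    then have "f x \<noteq> f x0" using lt z(2)[of x] by (auto simp: K_def)
    then show "f x < f x0" using max[OF x(1)] by simp
  qed
qed

text \<open>If u were not constant near p, a ball would touch the maximal set at one point z only.
  Adding a small multiple of the barrier at z gives a function below the maximum on a small sphere
  around z but equal to it at z. It has an interior maximum, where the operator is nonpositive,
  although the operator is positive on the barrier.\<close>

lemma strong_maximum_local:
  assumes u: "u \<in> smooth_funs A" and b: "tens 1 \<beta>" and L: "\<And>q. 0 \<le> drift_laplace \<beta> u q"
    and N: "open N" "p \<in> N" "\<And>q. q \<in> N \<Longrightarrow> u q \<le> u p"
  shows "\<exists>N'. open N' \<and> p \<in> N' \<and> (\<forall>q\<in>N'. u q = u p)"
proof -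
  obtain U \<phi> where c: "(U, \<phi>) \<in> A" and p: "p \<in> U" using chart_ex by blast
  let ?i = "inv_into U \<phi>"
  have oN: "open (\<phi> ` (U \<inter> N))" by (rule chart_open_image_subset[OF c]) (use N chart_open[OF c] in auto)
  obtain R where R: "R > 0" "ball (\<phi> p) R \<subseteq> \<phi> ` (U \<inter> N)"
    using oN N(2) p open_contains_ball_eq by blast
  have pre: "open {q \<in> U. \<phi> q \<in> ball x r}" for x r
    using continuous_on_open_vimage[OF chart_open[OF c], THEN iffD1, OF chart_cont[OF c], rule_format, of "ball x r"]
    by (simp add: vimage_def Int_def conj_commute)
  define N' where "N' = {q \<in> U. \<phi> q \<in> ball (\<phi> p) (R / 2)}"
  have N': "open N'" "p \<in> N'" unfolding N'_def by (rule pre) (use p R(1) in simp)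
  have ip: "?i (\<phi> q) = q" if "q \<in> U" for q by (rule chart_inv[OF c that])
  have inB: "?i x \<in> U \<inter> N \<and> \<phi> (?i x) = x" if "x \<in> ball (\<phi> p) R" for x
    using R(2) that ip by auto
  have "u q = u p" if q: "q \<in> N'" for q
  proof (rule ccontr)
    assume ne: "u q \<noteq> u p"
    have rep: "continuous_on T (\<lambda>x. v (?i x))" if "v \<in> smooth_funs A" "T \<subseteq> \<phi> ` U" for v T
      by (rule continuous_on_subset[OF continuous_on_compose2[OF smooth_continuous[OF that(1), of UNIV] chart_inv_cont[OF c]] that(2)]) simp
    have Rsub: "ball (\<phi> p) R \<subseteq> \<phi> ` U" using R(2) by auto
    let ?f = "\<lambda>x. u (?i x)"
    have qU: "q \<in> U" "\<phi> q \<in> ball (\<phi> p) (R / 2)" using q by (auto simp: N'_def)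
    obtain z y where zy: "z \<in> ball (\<phi> p) R" "?f z = ?f (\<phi> p)" "y \<noteq> z"
      "\<And>x. x \<in> ball (\<phi> p) R \<Longrightarrow> dist x y \<le> dist z y \<Longrightarrow> x \<noteq> z \<Longrightarrow> ?f x < ?f (\<phi> p)"
    proof (rule touching_ball[OF rep[OF u Rsub] qU(2)])
      show "?f (\<phi> q) \<noteq> ?f (\<phi> p)" using ne ip[OF qU(1)] ip[OF p] by simp
      show "?f x \<le> ?f (\<phi> p)" if "x \<in> ball (\<phi> p) R" for x using N(3)[of "?i x"] inB[OF that] ip[OF p] by simp
    qed blast
    have zU: "?i z \<in> U" "\<phi> (?i z) = z" using inB[OF zy(1)] by auto
    obtain h M where h: "h \<in> smooth_funs A" "open M" "?i z \<in> M" "M \<subseteq> U" "h (?i z) = 0"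
      "\<And>q. q \<in> M \<Longrightarrow> 0 < drift_laplace \<beta> h q" "\<And>q. q \<in> M \<Longrightarrow> dist z y < dist (\<phi> q) y \<Longrightarrow> h q < 0"
      using barrier_ex[OF c zU(1) _ b, of y] zy(3) unfolding zU(2) by metis
    have "open (\<phi> ` M \<inter> ball (\<phi> p) R)" by (rule open_Int[OF chart_open_image_subset[OF c h(2,4)] open_ball])
    moreover have "z \<in> \<phi> ` M \<inter> ball (\<phi> p) R" using zU zy(1) h(3) by (auto intro: rev_image_eqI)
    ultimately obtain \<epsilon> where \<epsilon>: "\<epsilon> > 0" "cball z \<epsilon> \<subseteq> \<phi> ` M \<inter> ball (\<phi> p) R"
      using open_contains_cball_eq by blast
    have csub: "cball z \<epsilon> \<subseteq> \<phi> ` U" using \<epsilon>(2) h(4) by blast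
    have iM: "?i x \<in> M \<and> \<phi> (?i x) = x" if "x \<in> cball z \<epsilon>" for x
      using \<epsilon>(2) that h(4) ip by (metis (no_types, lifting) IntD1 imageE subsetD)
    let ?h = "\<lambda>x. h (?i x)"
    \<comment> \<open>The cap of the small sphere inside the touching ball. There u is strictly
      below its maximum; on the rest of the sphere the barrier is negative.\<close>
    define S where "S = sphere z \<epsilon> \<inter> cball y (dist z y)"
    have Ssub: "S \<subseteq> cball z \<epsilon>" unfolding S_def by auto
    have Sc: "compact S" unfolding S_def by (rule compact_Int[OF compact_sphere compact_cball])
    have Sf: "?f x < u p" if "x \<in> S" for x
    proof -
      have "x \<in> ball (\<phi> p) R" using that Ssub \<epsilon>(2) by blast
      moreover have "dist x y \<le> dist z y" "x \<noteq> z" using that \<epsilon>(1) by (auto simp: S_def dist_commute)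
      ultimately show ?thesis using zy(4) ip[OF p] by simp
    qed
    obtain \<delta> where \<delta>: "\<delta> > 0" "\<And>x. x \<in> S \<Longrightarrow> ?f x + \<delta> * ?h x < u p"
    proof (cases "S = {}")
      case True
      then show ?thesis using that[of 1] by simp
    next
      case False
      have Su: "S \<subseteq> \<phi> ` U" using Ssub csub by blast
      obtain a where a: "a \<in> S" "\<And>x. x \<in> S \<Longrightarrow> ?f x \<le> ?f a"
        using continuous_attains_sup[OF Sc False rep[OF u Su]] by blast
      obtain a' where a': "a' \<in> S" "\<And>x. x \<in> S \<Longrightarrow> ?h x \<le> ?h a'"
        using continuous_attains_sup[OF Sc False rep[OF h(1) Su]] by blast
      \<comment> \<open>Small enough that \<delta> times the barrier stays below the gap left by u
        on the compact cap.\<close>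
      define \<delta> where "\<delta> = (u p - ?f a) / (\<bar>?h a'\<bar> + 1)"
      have d: "\<delta> > 0" using Sf[OF a(1)] by (simp add: \<delta>_def add_nonneg_pos)
      have "?f x + \<delta> * ?h x < u p" if "x \<in> S" for x
      proof -
        have "\<delta> * ?h x \<le> \<delta> * \<bar>?h a'\<bar>" using a'(2)[OF that] d by (intro mult_left_mono) auto
        moreover have "\<delta> * (\<bar>?h a'\<bar> + 1) = u p - ?f a" by (simp add: \<delta>_def)
        ultimately show ?thesis using a(2)[OF that] d unfolding distrib_left by linarith
      qed
      with d show ?thesis by (rule that)
    qed
    define v where "v = (\<lambda>q. u q + \<delta> * h q)"
    have v: "v \<in> smooth_funs A" unfolding v_def by (rule smooth_add[OF u smooth_mult[OF smooth_const h(1)]])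
    obtain x where x: "x \<in> cball z \<epsilon>" "\<And>x'. x' \<in> cball z \<epsilon> \<Longrightarrow> v (?i x') \<le> v (?i x)"
      using continuous_attains_sup[OF compact_cball _ rep[OF v csub]] \<epsilon>(1) by force
    have "v (?i z) = u p" using zy(2) h(5) ip[OF p] by (simp add: v_def)
    then have vx: "u p \<le> v (?i x)" using x(2)[of z] \<epsilon>(1) by simp
    have "x \<in> ball z \<epsilon>"
    proof (rule ccontr)
      assume "x \<notin> ball z \<epsilon>"
      then have sph: "x \<in> sphere z \<epsilon>" using x(1) by auto
      have xR: "x \<in> ball (\<phi> p) R" using x(1) \<epsilon>(2) by blast
      have "v (?i x) < u p"
      proof (cases "dist x y \<le> dist z y")
        case True
        then have "x \<in> S" using sph by (simp add: S_def dist_commute)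
        then show ?thesis using \<delta>(2) by (simp add: v_def)
      next
        case False
        then have "?h x < 0" using h(7)[of "?i x"] iM[OF x(1)] by simp
        then have "\<delta> * ?h x < 0" using \<delta>(1) by (simp add: mult_pos_neg)
        then show ?thesis using N(3)[of "?i x"] inB[OF xR] by (simp add: v_def)
      qed
      then show False using vx by simp
    qed
    then have "drift_laplace \<beta> v (?i x) \<le> 0"
    proof (intro drift_laplace_local_max[OF v pre[of z \<epsilon>] _ _ b])
      show "?i x \<in> {q \<in> U. \<phi> q \<in> ball z \<epsilon>}" if "x \<in> ball z \<epsilon>" using iM[OF x(1)] h(4) that by auto
      show "v q \<le> v (?i x)" if "q \<in> {q \<in> U. \<phi> q \<in> ball z \<epsilon>}" for q
        using x(2)[of "\<phi> q"] that ip[of q] by simp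
    qed
    moreover have "drift_laplace \<beta> v (?i x) = drift_laplace \<beta> u (?i x) + \<delta> * drift_laplace \<beta> h (?i x)"
      unfolding v_def by (rule drift_laplace_lin[OF frame_at u h(1) b])
    moreover have "\<delta> * drift_laplace \<beta> h (?i x) > 0" using h(6) iM[OF x(1)] \<delta>(1) by simp
    ultimately show False using L[of "?i x"] by simp
  qed
  then show ?thesis using N' by blast
qed

text \<open>Across several components u is only locally constant, so Z collects the points near
  which it is. On the complement of Z, which is compact, u attains its maximum at some p; values
  above u p then occur only in Z, which forces p to be a local maximum and hence a point of
  Z.\<close>

lemma strong_maximum_compact:
  assumes comp: "compact (UNIV :: 'a set)"
    and u: "u \<in> smooth_funs A" and b: "tens 1 \<beta>" and L: "\<And>q. 0 \<le> drift_laplace \<beta> u q"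
  shows "drift_laplace \<beta> u p = 0"
proof -
  define Z where "Z = {q. \<exists>N. open N \<and> q \<in> N \<and> (\<forall>q'\<in>N. u q' = u q)}"
  have "open Z" unfolding open_subopen[of Z]
  proof
    fix q assume "q \<in> Z"
    then obtain N where N: "open N" "q \<in> N" "\<forall>q'\<in>N. u q' = u q" by (auto simp: Z_def)
    have "N \<subseteq> Z"
    proof
      fix q' assume q': "q' \<in> N"
      then have "\<forall>q''\<in>N. u q'' = u q'" using N(3) by simp
      then show "q' \<in> Z" using N(1) q' unfolding Z_def by blast
    qed
    then show "\<exists>N. open N \<and> q \<in> N \<and> N \<subseteq> Z" using N by blast
  qed
  have "- Z = {}"
  proof (rule ccontr)
    assume ne: "- Z \<noteq> {}"
    have "closed (- Z)" using \<open>open Z\<close> by (simp add: closed_def)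
    then have "compact (- Z)" using compact_Int_closed[OF comp, of "- Z"] by simp
    then obtain p where p: "p \<notin> Z" "\<And>q. q \<notin> Z \<Longrightarrow> u q \<le> u p"
      using continuous_attains_sup[OF _ ne smooth_continuous[OF u]] by blast
    obtain U \<phi> where c: "(U, \<phi>) \<in> A" "p \<in> U" using chart_ex by blast
    obtain R where R: "R > 0" "ball (\<phi> p) R \<subseteq> \<phi> ` U"
      using chart_open_image[OF c(1)] c(2) open_contains_ball_eq by blast
    let ?N = "inv_into U \<phi> ` ball (\<phi> p) R"
    have conn: "connected ?N"
      by (rule connected_continuous_image[OF continuous_on_subset[OF chart_inv_cont[OF c(1)] R(2)] connected_ball])
    have pN: "p \<in> ?N" using R(1) c by (auto simp: chart_inv_image[OF c(1) R(2)])
    have oN: "open ?N"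
      using continuous_on_open_vimage[OF chart_open[OF c(1)], THEN iffD1, OF chart_cont[OF c(1)], rule_format, of "ball (\<phi> p) R"]
      unfolding chart_inv_image[OF c(1) R(2)] by (simp add: vimage_def Int_def conj_commute)
    have "u q \<le> u p" if q: "q \<in> ?N" for q
    proof (rule ccontr)
      assume "\<not> u q \<le> u p"
      then have less: "u p < u q" by simp
      \<comment> \<open>All points with the value u q > u p lie in Z, so this level set is open as
        well as closed; that separates q from p inside the connected neighbourhood.\<close>
      let ?V = "{x. u x \<noteq> u q}" and ?W = "{x \<in> Z. u x = u q}"
      have "open ?V" by (rule open_Collect_neq[OF smooth_continuous[OF u] continuous_on_const])
      moreover have "open ?W" unfolding open_subopen[of ?W]
      proof
        fix x assume x: "x \<in> ?W"
        then obtain N where N: "open N" "x \<in> N" "\<forall>q'\<in>N. u q' = u x" unfolding Z_def by blast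
        have "N \<inter> Z \<subseteq> ?W"
        proof
          fix q' assume "q' \<in> N \<inter> Z"
          then have "q' \<in> Z" "u q' = u x" using N(3) by blast+
          then show "q' \<in> ?W" using x by simp
        qed
        moreover have "open (N \<inter> Z)" "x \<in> N \<inter> Z" using N(1,2) x \<open>open Z\<close> by (auto intro: open_Int)
        ultimately show "\<exists>N. open N \<and> x \<in> N \<and> N \<subseteq> ?W" by blast
      qed
      moreover have "?N \<subseteq> ?V \<union> ?W"
      proof
        fix x
        show "x \<in> ?V \<union> ?W" using p(2)[of x] less by (cases "x \<in> Z") auto
      qed
      ultimately have "?V \<inter> ?N = {} \<or> ?W \<inter> ?N = {}" using connectedD[OF conn, of ?V ?W] by blast
      moreover have "p \<in> ?V \<inter> ?N" using pN less by simp
      moreover have "q \<in> Z" using p(2)[of q] less by (cases "q \<in> Z") auto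
      then have "q \<in> ?W \<inter> ?N" using q by simp
      ultimately show False by blast
    qed
    from strong_maximum_local[OF u b L oN pN this] p(1) show False unfolding Z_def by blast
  qed
  then have "p \<in> Z" by blast
  then obtain N where N: "open N" "p \<in> N" "\<forall>q\<in>N. u q = u p" unfolding Z_def by blast
  have "drift_laplace \<beta> u p \<le> 0" by (rule drift_laplace_local_max[OF u N(1,2) _ b]) (use N(3) in \<open>metis order_refl\<close>)
  then show ?thesis using L[of p] by simp
qed

end

section \<open>Parallel torsion\<close>

context spin7_connection
begin

text \<open>The squared norm of T as a tensor: the sum over all ordered triples of indices.\<close>

definition Tsq :: "'a \<Rightarrow> real" where
  "Tsq = contr (contr (contr (tprod [4, 2, 0] [5, 3, 1] Tt Tt))) []"

text \<open>The drift t/6. Since t applied to the squared norm of T is 2 gam, it contributes gam/3,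
  which cancels twice the term -gam/6 of \<open>T_rough_laplacian\<close>.\<close>

definition lee :: "'a tensor" where
  "lee = permt [0] (1/6) (contr (contr (contr (tprod [4, 2, 0] [5, 3, 1, 6] Tt Pt))))"

lemma tens_TT: "tens (0 + 6) (tprod [4, 2, 0] [5, 3, 1] Tt Tt)"
  using tens_tprod[OF tens_Tt tens_Tt shuffle_TT] by simp

lemma tens_NT: "tens (1 + 6) (tprod [6, 4, 2, 0] [5, 3, 1] Nt Tt)"
  using tens_tprod[OF tens_Nt tens_Tt shuffle_NT] by simp

lemma tens_TP: "tens (1 + 6) (tprod [4, 2, 0] [5, 3, 1, 6] Tt Pt)"
  using tens_tprod[OF tens_Tt tens_Pt shuffle_TP] by simp

lemma tens_contr3: "tens (n + 6) S \<Longrightarrow> tens n (contr (contr (contr S)))"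
  by (intro tens_contr) (simp add: numeral_eq_Suc)

lemma Tsq_smooth: "Tsq \<in> smooth_funs A"
  unfolding Tsq_def by (rule tens_smooth[OF tens_contr3[OF tens_TT]]) simp_all

lemma tens_lee: "tens 1 lee"
  unfolding lee_def by (rule tens_permt[OF shuffle_id1 tens_contr3[OF tens_TP]])

context
  fixes p E
  assumes E: "orthonormal_at A g p E"
begin

lemma frame_vfield: "a < 8 \<Longrightarrow> E a \<in> vfields A"
  by (rule orthonormal_vfields[OF E])

lemma contr_NT:
  assumes "X \<in> vfields A"
  shows "contr (contr (contr (tprod [6, 4, 2, 0] [5, 3, 1] Nt Tt))) [X] p = (\<Sum>a<8. \<Sum>b<8. \<Sum>c<8. Nt [X, E a, E b, E c] p * Tor (E a) (E b) (E c) p)"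
  using contr3_frame[OF tens_NT, of "[X]" p E] assms E by (simp add: tprod_def Tt_list)

lemma lee_frame:
  assumes "X \<in> vfields A"
  shows "lee [X] p = 1/6 * (\<Sum>a<8. \<Sum>b<8. \<Sum>c<8. Tor (E a) (E b) (E c) p * form4_tensor \<Psi> (E a) (E b) (E c) X p)"
  using contr3_frame[OF tens_TP, of "[X]" p E] assms E by (simp add: lee_def permt_app tprod_def Tt_list Pt_list)

lemma Tsq_deriv_frame:
  assumes X: "X \<in> vfields A"
  shows "X p Tsq = 2 * (\<Sum>a<8. \<Sum>b<8. \<Sum>c<8. Nt [X, E a, E b, E c] p * Tor (E a) (E b) (E c) p)"
proof -
  have e: "nabla D (tprod [4, 2, 0] [5, 3, 1] Tt Tt) [X, E c, E c, E b, E b, E a, E a] p = 2 * (Nt [X, E a, E b, E c] p * Tor (E a) (E b) (E c) p)"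
    if "a < 8" "b < 8" "c < 8" for a b c
    using nabla_tprod[OF tens_Tt tens_Tt shuffle_TT X, of "[E c, E c, E b, E b, E a, E a]" D p] that
    by (simp add: frame_vfield Tt_list)
  have "X p Tsq = nabla D (contr (contr (contr (tprod [4, 2, 0] [5, 3, 1] Tt Tt)))) [X] p"
    by (simp add: nabla_Cons Tsq_def)
  also have "\<dots> = (\<Sum>a<8. \<Sum>b<8. \<Sum>c<8. nabla D (tprod [4, 2, 0] [5, 3, 1] Tt Tt) [X, E c, E c, E b, E b, E a, E a] p)"
    by (rule nabla_contr3[OF tens_TT X _ _ E, of "[]"]) simp_all
  also have "\<dots> = 2 * (\<Sum>a<8. \<Sum>b<8. \<Sum>c<8. Nt [X, E a, E b, E c] p * Tor (E a) (E b) (E c) p)"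
    unfolding sum_distrib_left by (intro sum.cong[OF refl] e) simp_all
  finally show ?thesis .
qed

end

lemma Tsq_hess_frame:
  assumes X: "X \<in> vfields A" and Y: "Y \<in> vfields A" and E: "orthonormal_at A g p E"
  shows "hess Tsq [Y, X] p = 2 * (\<Sum>a<8. \<Sum>b<8. \<Sum>c<8.
    Wt [Y, X, E a, E b, E c] p * Tor (E a) (E b) (E c) p + Nt [X, E a, E b, E c] p * Nt [Y, E a, E b, E c] p)"
proof -
  let ?C = "contr (contr (contr (tprod [6, 4, 2, 0] [5, 3, 1] Nt Tt)))"
  have e: "nabla D (tprod [6, 4, 2, 0] [5, 3, 1] Nt Tt) [Y, E c, E c, E b, E b, E a, E a, X] p =
      Wt [Y, X, E a, E b, E c] p * Tor (E a) (E b) (E c) p + Nt [X, E a, E b, E c] p * Nt [Y, E a, E b, E c] p"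
    if "a < 8" "b < 8" "c < 8" for a b c
    using nabla_tprod[OF tens_Nt tens_Tt shuffle_NT Y, of "[E c, E c, E b, E b, E a, E a, X]" D p] that X
    by (simp add: frame_vfield[OF E] Tt_list)
  have "hess Tsq [Y, X] p = nabla D (permt [0] 2 ?C) [Y, X] p"
    unfolding hess_def
  proof (rule nabla_cong)
    fix Xs :: "'a vfield list" assume "length Xs = 1" "set Xs \<subseteq> vfields A"
    then obtain Z where Z: "Xs = [Z]" "Z \<in> vfields A" by (auto simp: length_Suc_conv)
    show "nabla D (\<lambda>_. Tsq) Xs = permt [0] 2 ?C Xs"
      unfolding Z(1) nabla_fun
    proof
      fix q
      show "Z q Tsq = permt [0] 2 ?C [Z] q"
        unfolding Tsq_deriv_frame[OF frame_at Z(2)] permt_app using contr_NT[OF frame_at Z(2), of q] by simp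
    qed
  qed (use X Y in \<open>simp_all add: D_vfields\<close>)
  also have "\<dots> = nabla D ?C [Y, X] p * 2"
    using nabla_permt[OF shuffle_id1 tens_contr3[OF tens_NT] Y, of "[X]" D 2 p] X by simp
  also have "nabla D ?C [Y, X] p = (\<Sum>a<8. \<Sum>b<8. \<Sum>c<8. nabla D (tprod [6, 4, 2, 0] [5, 3, 1] Nt Tt) [Y, E c, E c, E b, E b, E a, E a, X] p)"
    using nabla_contr3[OF tens_NT Y _ _ E, of "[X]"] X by simp
  also have "\<dots> = (\<Sum>a<8. \<Sum>b<8. \<Sum>c<8.
    Wt [Y, X, E a, E b, E c] p * Tor (E a) (E b) (E c) p + Nt [X, E a, E b, E c] p * Nt [Y, E a, E b, E c] p)"
    by (intro sum.cong[OF refl] e) simp_all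
  finally show ?thesis by simp
qed

text \<open>The Laplacian of the squared norm is 2 |N|^2 plus twice the contraction of T with its
  rough Laplacian, and the drift is chosen to cancel the latter.\<close>

lemma Bochner:
  assumes cc: d_nabla_zero and inst: "spin7_instanton A \<Psi> g D" and F: "adapted_at p F"
  shows "drift_laplace lee Tsq p = 2 * (\<Sum>m<8. \<Sum>a<8. \<Sum>b<8. \<Sum>c<8. (Nt [F m, F a, F b, F c] p)\<^sup>2)"
proof -
  note Fv = Fv[OF F] and Fo = Fo[OF F]
  interpret d: derivative_algebra "\<lambda>i j k. Tor (F i) (F j) (F k) p" "\<lambda>i j k l. Nt [F i, F j, F k, F l] p"
    "\<lambda>i j k l. Rm (F i) (F j) (F k) (F l) p" "\<lambda>i j k l. form4_tensor \<Psi> (F i) (F j) (F k) (F l) p"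
    "\<lambda>m i j k l. nabla D Rt [F m, F i, F j, F k, F l] p" "\<lambda>m i j k l. Wt [F m, F i, F j, F k, F l] p"
    by (rule derivative_algebra_at[OF cc inst F])
  have "drift_laplace lee Tsq p = (\<Sum>m<8. hess Tsq [F m, F m] p + lee [F m] p * F m p Tsq)"
    unfolding drift_laplace_frame[OF Fo Tsq_smooth tens_lee] hess_app ..
  also have "\<dots> = 2 * (\<Sum>m<8. \<Sum>a<8. \<Sum>b<8. \<Sum>c<8. (Nt [F m, F a, F b, F c] p)\<^sup>2) +
      (2 * sum4 (\<lambda>m a b c. Tor (F a) (F b) (F c) p * Wt [F m, F m, F a, F b, F c] p) + (1/3) * d.gam)"
  proof -
    have "lee [F m] p * F m p Tsq = (1/3) * (d.t m * d.G m)" for m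
      unfolding lee_frame[OF Fo Fv] Tsq_deriv_frame[OF Fo Fv] d.t_def d.G_def sum3_def by simp
    then have "(\<Sum>m<8. lee [F m] p * F m p Tsq) = (1/3) * d.gam"
      unfolding d.gam_def sum_distrib_left by (intro sum.cong[OF refl])
    then show ?thesis
      unfolding Tsq_hess_frame[OF Fv Fv Fo] sum4_def
      by (simp add: sum.distrib sum_distrib_left distrib_left power2_eq_square mult.commute[of "Tor _ _ _ _"] mult.assoc)
  qed
  also have "\<dots> = 2 * (\<Sum>m<8. \<Sum>a<8. \<Sum>b<8. \<Sum>c<8. (Nt [F m, F a, F b, F c] p)\<^sup>2)"
    unfolding d.T_rough_laplacian by simp
  finally show ?thesis .
qed

lemma parallel_torsion_of_instanton:
  assumes comp: "compact (UNIV :: 'a set)" and cc: d_nabla_zero and inst: "spin7_instanton A \<Psi> g D"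
    and v: "X \<in> vfields A" "Y \<in> vfields A" "Z \<in> vfields A" "V \<in> vfields A"
  shows "Nt [X, Y, Z, V] p = 0"
proof -
  have nonneg: "0 \<le> (\<Sum>m<8::nat. \<Sum>a<8::nat. \<Sum>b<8::nat. \<Sum>c<8::nat. (r m a b c)\<^sup>2)" for r :: "nat \<Rightarrow> nat \<Rightarrow> nat \<Rightarrow> nat \<Rightarrow> real"
    by (intro sum_nonneg) simp
  have "0 \<le> drift_laplace lee Tsq q" for q
  proof -
    obtain F where F: "adapted_at q F" by (rule adapted_at_ex)
    show ?thesis unfolding Bochner[OF cc inst F] using nonneg by simp
  qed
  then have "drift_laplace lee Tsq p = 0" by (rule strong_maximum_compact[OF comp Tsq_smooth tens_lee])
  moreover obtain F where F: "adapted_at p F" by (rule adapted_at_ex)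
  ultimately have 0: "(\<Sum>m<8. \<Sum>a<8. \<Sum>b<8. \<Sum>c<8. (Nt [F m, F a, F b, F c] p)\<^sup>2) = 0"
    unfolding Bochner[OF cc inst F] by simp
  have z: "Nt [F m, F a, F b, F c] p = 0" if "m < 8" "a < 8" "b < 8" "c < 8" for m a b c
    using 0 that by (simp add: sum_nonneg_eq_0_iff sum_nonneg)
  \<comment> \<open>The zero tensor is written as a linear combination so that it is visibly a
    \<open>tens\<close>.\<close>
  have "Nt [X, Y, Z, V] p = (\<lambda>Xs p. 0 * Nt Xs p + 0 * Nt Xs p) [X, Y, Z, V] p"
  proof (rule tens_eq_of_frame[OF tens_Nt tens_lin[OF tens_Nt tens_Nt] Fo[OF F]])
    fix Xs assume "length Xs = 4" "\<And>i. i < 4 \<Longrightarrow> \<exists>a<8. Xs ! i = F a"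
    from length_4_frame[OF this] z show "Nt Xs p = 0 * Nt Xs p + 0 * Nt Xs p" by auto
  qed (use v in simp_all)
  then show ?thesis by simp
qed

end

section \<open>The exterior derivative of the torsion\<close>

context spin7_connection
begin

lemma cov_deriv3_Tor: "cov_deriv3 D X Tor Y Z V p = Nt [X, Y, Z, V] p"
  by (simp add: cov_deriv3_def nabla_Tt)

lemma d_nabla_Tor: "d_nabla D Tor X Y Z V p = Nt [X, Y, Z, V] p + Nt [Y, Z, X, V] p + Nt [Z, X, Y, V] p - Nt [V, X, Y, Z] p"
  by (simp add: d_nabla_def cov_deriv3_Tor)

lemma vanishing4_d_nabla: "vanishing4 A (d_nabla D Tor) \<longleftrightarrow> d_nabla_zero"
  unfolding vanishing4_def vanishing3_def vanishing2_def d_nabla_Tor d_nabla_zero_def by simp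

lemma parallel3_Tor: "parallel3 A D Tor \<longleftrightarrow> (\<forall>X\<in>vfields A. \<forall>Y\<in>vfields A. \<forall>Z\<in>vfields A. \<forall>V\<in>vfields A. \<forall>p. Nt [X, Y, Z, V] p = 0)"
  unfolding parallel3_def vanishing3_def vanishing2_def cov_deriv3_Tor ..

lemma Tor_tau_sum:
  assumes E: "orthonormal_at A g p E" and v: "B \<in> vfields A" "C \<in> vfields A" "M \<in> vfields A" "W \<in> vfields A"
  shows "Tor (tau B C) M W p = (\<Sum>s<8. Tor (E s) B C p * Tor (E s) M W p)"
  unfolding Tor_tau_expand[OF E v]
proof (rule sum.cong[OF refl])
  fix s :: nat assume "s \<in> {..<8}"
  then show "Tor B C (E s) p * Tor (E s) M W p = Tor (E s) B C p * Tor (E s) M W p"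
    using Tor_cyc[OF orthonormal_vfields[OF E, of s] v(1,2), of p] by simp
qed

lemma sigma_form_Tor:
  assumes v: "X \<in> vfields A" "Y \<in> vfields A" "Z \<in> vfields A" "V \<in> vfields A"
  shows "sigma_form A g Tor X Y Z V p = Tor (tau X Y) Z V p + Tor (tau Y Z) X V p + Tor (tau Z X) Y V p"
proof -
  let ?E = "frame_at A g p"
  note E = frame_at[of p]
  have Ev: "?E s \<in> vfields A" if "s < 8" for s by (rule orthonormal_vfields[OF E that])
  have e: "Tor (tau B C) M W p = (\<Sum>s<8. Tor (?E s) B C p * Tor (?E s) M W p)"
    if "B \<in> vfields A" "C \<in> vfields A" "M \<in> vfields A" "W \<in> vfields A" for B C M W
    by (rule Tor_tau_sum[OF E that])
  have "1/2 * (\<Sum>j<8. wedge22 (Tor (?E j)) (Tor (?E j)) X Y Z V p) =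
    (\<Sum>j<8. Tor (?E j) X Y p * Tor (?E j) Z V p + Tor (?E j) Y Z p * Tor (?E j) X V p + Tor (?E j) Z X p * Tor (?E j) Y V p)"
    unfolding sum_distrib_left
  proof (rule sum.cong[OF refl])
    fix j :: nat assume "j \<in> {..<8}"
    then have "Tor (?E j) Z X p = - Tor (?E j) X Z p" using Tor_skew(2)[OF Ev[of j] v(1,3)] by simp
    then show "1/2 * wedge22 (Tor (?E j)) (Tor (?E j)) X Y Z V p =
        Tor (?E j) X Y p * Tor (?E j) Z V p + Tor (?E j) Y Z p * Tor (?E j) X V p + Tor (?E j) Z X p * Tor (?E j) Y V p"
      by (simp add: wedge22_def)
  qed
  then show ?thesis unfolding sigma_form_def e[OF v] e[OF v(2,3,1,4)] e[OF v(3,1,2,4)] sum.distrib .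
qed

lemma Tor_tau_swap:
  assumes v: "X \<in> vfields A" "Y \<in> vfields A" "Z \<in> vfields A" "V \<in> vfields A"
  shows "Tor (tau Z V) X Y p = Tor (tau X Y) Z V p"
proof -
  have "Tor (tau X Y) Z V p = Tor Z V (tau X Y) p" using Tor_cyc[OF tau_vfields[OF v(1,2)] v(3,4)] by simp
  also have "\<dots> = Tor X Y (tau Z V) p"
    unfolding Tor_eq by (rule metric_tensor_sym) (use v tau_vfields in simp_all)
  also have "\<dots> = Tor (tau Z V) X Y p" using Tor_cyc[OF tau_vfields[OF v(3,4)] v(1,2)] by simp
  finally show ?thesis ..
qed

lemma Tor_lie_bracket:
  assumes v: "X \<in> vfields A" "Y \<in> vfields A" "Z \<in> vfields A" "V \<in> vfields A"
  shows "Tor (lie_bracket X Y) Z V p = Tor (D X Y) Z V p - Tor (D Y X) Z V p - Tor (tau X Y) Z V p"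
proof -
  have "lie_bracket X Y = vf_diff (vf_diff (D X Y) (D Y X)) (tau X Y)"
    by (simp add: tau_def vf_diff_def)
  then show ?thesis
    by (simp add: Tor_diff1(1) vf_diff_vfields D_vfields tau_vfields v)
qed

lemma tau_skew: "X \<in> vfields A \<Longrightarrow> Y \<in> vfields A \<Longrightarrow> Z \<in> vfields A \<Longrightarrow> V \<in> vfields A \<Longrightarrow> Tor (tau Y X) Z V p = - Tor (tau X Y) Z V p"
proof -
  assume v: "X \<in> vfields A" "Y \<in> vfields A" "Z \<in> vfields A" "V \<in> vfields A"
  have "Tor (tau Y X) Z V p = Tor Y X (tau Z V) p"
    using Tor_tau_swap[OF v(2,1,3,4)] Tor_cyc[OF tau_vfields[OF v(3,4)] v(2,1)] by simp
  moreover have "Tor (tau X Y) Z V p = Tor X Y (tau Z V) p"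
    using Tor_tau_swap[OF v] Tor_cyc[OF tau_vfields[OF v(3,4)] v(1,2)] by simp
  ultimately show ?thesis using Tor_skew(1)[OF v(1,2) tau_vfields[OF v(3,4)]] by simp
qed

text \<open>Each bracket is replaced by the difference of covariant derivatives minus
  \<open>tau\<close>. The former assemble to d^\<nabla> T; the six terms with \<open>tau\<close>
  pair up by symmetry and give \<sigma> twice.\<close>

lemma ext_deriv3_Tor:
  assumes v: "X \<in> vfields A" "Y \<in> vfields A" "Z \<in> vfields A" "V \<in> vfields A"
  shows "ext_deriv3 Tor X Y Z V p = d_nabla D Tor X Y Z V p + 2 * sigma_form A g Tor X Y Z V p"
proof -
  note X = v(1) and Y = v(2) and Z = v(3) and V = v(4)
  have n: "Nt [Y, Z, X, V] p = - Nt [Y, X, Z, V] p" by (rule Nt_skew(1)[OF Y X Z V])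
  have s: "Tor (tau Z V) X Y p = Tor (tau X Y) Z V p" "Tor (tau X V) Y Z p = Tor (tau Y Z) X V p"
    by (rule Tor_tau_swap[OF v], rule Tor_tau_swap[OF Y Z X V])
  have s3: "Tor (tau X Z) Y V p = - Tor (tau Z X) Y V p" by (rule tau_skew[OF Z X Y V])
  have s4: "Tor (tau Y V) X Z p = - Tor (tau Z X) Y V p"
    unfolding s3[symmetric] by (rule Tor_tau_swap[OF X Z Y V])
  have k: "Tor Y (D X Z) V p = - Tor (D X Z) Y V p" "Tor X (D Y Z) V p = - Tor (D Y Z) X V p" "Tor X (D Z Y) V p = - Tor (D Z Y) X V p"
    "Tor X (D V Y) Z p = - Tor (D V Y) X Z p"
    by (rule Tor_skew(1); (rule X Y Z V D_vfields)+)+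
  have l: "Tor Y Z (D X V) p = Tor (D X V) Y Z p" "Tor X Z (D Y V) p = Tor (D Y V) X Z p" "Tor X Y (D Z V) p = Tor (D Z V) X Y p" "Tor X Y (D V Z) p = Tor (D V Z) X Y p"
    by (rule Tor_cyc; (rule X Y Z V D_vfields)+)+
  show ?thesis
    unfolding sigma_form_Tor[OF v] d_nabla_Tor n ext_deriv3_def Tor_lie_bracket[OF X Y Z V] Tor_lie_bracket[OF X Z Y V]
      Tor_lie_bracket[OF X V Y Z] Tor_lie_bracket[OF Y Z X V] Tor_lie_bracket[OF Y V X Z] Tor_lie_bracket[OF Z V X Y] s s3 s4
    unfolding nabla_Tt k l by (simp add: algebra_simps)
qed

end

section \<open>Consequences of parallel torsion\<close>

context spin7_connection
begin

abbreviation TTt :: "nat list \<Rightarrow> nat list \<Rightarrow> 'a tensor" where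
  "TTt is js \<equiv> contr (tprod is js Tt Tt)"

text \<open>\<sigma>^T as traces of products of T, the form to which the Leibniz and trace rules for
  \<nabla> apply. The coefficients 1 match the shape of \<open>tens_lin\<close>.\<close>

definition sigt :: "'a tensor" where
  "sigt = (\<lambda>Xs p. 1 * (\<lambda>Xs p. 1 * TTt [0, 2, 3] [1, 4, 5] Xs p + 1 * TTt [0, 3, 4] [1, 2, 5] Xs p) Xs p + 1 * TTt [0, 4, 2] [1, 3, 5] Xs p)"

lemma tens_TTt: "shuffle 3 3 is js \<Longrightarrow> tens 4 (TTt is js)"
proof -
  assume "shuffle 3 3 is js"
  from tens_tprod[OF tens_Tt tens_Tt this] show ?thesis by (intro tens_contr) (simp add: numeral_eq_Suc)
qed

lemma tens_sigt: "tens 4 sigt"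
  unfolding sigt_def
  by (rule tens_lin[OF tens_lin[OF tens_TTt[OF shuffle_sigma(1)] tens_TTt[OF shuffle_sigma(2)]] tens_TTt[OF shuffle_sigma(3)]])

lemma sigt_frame:
  assumes v: "X \<in> vfields A" "Y \<in> vfields A" "Z \<in> vfields A" "V \<in> vfields A" and E: "orthonormal_at A g q E"
  shows "sigt [X, Y, Z, V] q = (\<Sum>s<8. Tor (E s) X Y q * Tor (E s) Z V q + Tor (E s) Y Z q * Tor (E s) X V q + Tor (E s) Z X q * Tor (E s) Y V q)"
proof -
  have t: "tens (Suc (Suc 4)) (tprod is js Tt Tt)" if "shuffle 3 3 is js" for "is" js
    using tens_tprod[OF tens_Tt tens_Tt that] by (simp add: numeral_eq_Suc)
  have c: "TTt is js [X, Y, Z, V] q = (\<Sum>s<8. tprod is js Tt Tt [E s, E s, X, Y, Z, V] q)" if "shuffle 3 3 is js" for "is" js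
    by (rule contr_frame[OF t[OF that] _ _ E]) (use v in simp_all)
  show ?thesis
    unfolding sigt_def c[OF shuffle_sigma(1)] c[OF shuffle_sigma(2)] c[OF shuffle_sigma(3)] tprod_def
    by (simp add: Tt_list sum.distrib)
qed

lemma sigt_eq_sigma_form:
  assumes v: "X \<in> vfields A" "Y \<in> vfields A" "Z \<in> vfields A" "V \<in> vfields A"
  shows "sigma_form A g Tor X Y Z V p = sigt [X, Y, Z, V] p"
proof -
  let ?E = "frame_at A g p"
  have e: "Tor (tau B C) M W p = (\<Sum>s<8. Tor (?E s) B C p * Tor (?E s) M W p)"
    if "B \<in> vfields A" "C \<in> vfields A" "M \<in> vfields A" "W \<in> vfields A" for B C M W
    by (rule Tor_tau_sum[OF frame_at that])
  show ?thesis
    unfolding sigma_form_Tor[OF v] sigt_frame[OF v frame_at] e[OF v] e[OF v(2,3,1,4)] e[OF v(3,1,2,4)] sum.distrib ..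
qed

definition Rict :: "'a tensor" where
  "Rict = contr (permt [0, 2, 3, 1] 1 Rt)"

lemma Rict_ricci: "Rict [X, Y] = ricci A g D X Y"
  by (simp add: Rict_def contr_def ricci_def permt_app Rt_list fun_eq_iff)

lemma tens_Rict: "tens 2 Rict"
  unfolding Rict_def using tens_permt[OF shuffle_ricci tens_Rt] by (intro tens_contr) (simp add: numeral_eq_Suc)

lemma Rict_frame:
  assumes v: "X \<in> vfields A" "Y \<in> vfields A" and E: "orthonormal_at A g q E"
  shows "Rict [X, Y] q = (\<Sum>a<8. Rm (E a) X Y (E a) q)"
proof -
  have "tens (Suc (Suc 2)) (permt [0, 2, 3, 1] 1 Rt)"
    using tens_permt[OF shuffle_ricci tens_Rt] by (simp add: numeral_eq_Suc)
  from contr_frame[OF this, of "[X, Y]" q E] v E show ?thesis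
    by (simp add: Rict_def permt_app Rt_list)
qed

text \<open>The contraction \<open>S\<close> of \<open>curvature_algebra\<close> as a tensor
  field.\<close>

definition sigPt :: "'a tensor" where
  "sigPt = contr (contr (contr (tprod [4, 2, 0, 6] [5, 3, 1, 7] sigt Pt)))"

lemma tens_sigP: "tens (2 + 6) (tprod [4, 2, 0, 6] [5, 3, 1, 7] sigt Pt)"
  using tens_tprod[OF tens_sigt tens_Pt shuffle_sigma_P] by simp

context
  assumes par: "\<And>X Y Z V p. X \<in> vfields A \<Longrightarrow> Y \<in> vfields A \<Longrightarrow> Z \<in> vfields A \<Longrightarrow> V \<in> vfields A \<Longrightarrow> Nt [X, Y, Z, V] p = 0"
begin

lemma par_closed: d_nabla_zero
  unfolding d_nabla_zero_def using par by simp

lemma pair_symmetry: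
  "X \<in> vfields A \<Longrightarrow> Y \<in> vfields A \<Longrightarrow> Z \<in> vfields A \<Longrightarrow> V \<in> vfields A \<Longrightarrow> Rm Z V X Y q = Rm X Y Z V q"
  using pair_defect[OF par_closed, of X Y Z V q] par by simp

text \<open>Pair symmetry carries the eigenvalue 2 from the last index pair to the first. This is
  done in an adapted frame and then transferred to the given orthonormal frame.\<close>

lemma par_instanton: "spin7_instanton A \<Psi> g D"
  unfolding spin7_instanton_def
proof (intro allI impI)
  fix p E i j k l assume E: "orthonormal_at A g p E" and ijkl: "i < (8::nat)" "j < (8::nat)" "k < (8::nat)" "l < (8::nat)"
  obtain F where F: "adapted_at p F" by (rule adapted_at_ex)
  note Fv = Fv[OF F]
  have eq: "(\<Sum>a<8. \<Sum>b<8. Rm (F a) (F b) (F i) (F j) p * form4_tensor \<Psi> (F a) (F b) (F k) (F l) p) = 2 * Rm (F k) (F l) (F i) (F j) p" for i j k l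
  proof -
    have "Rm (F a) (F b) (F i) (F j) p = Rm (F i) (F j) (F a) (F b) p" for a b by (rule pair_symmetry[OF Fv Fv Fv Fv])
    moreover have "Rm (F k) (F l) (F i) (F j) p = Rm (F i) (F j) (F k) (F l) p" by (rule pair_symmetry[OF Fv Fv Fv Fv])
    ultimately show ?thesis using eig_F[OF F, of i j k l] by simp
  qed
  have Ev: "E a \<in> vfields A" if "a < 8" for a by (rule orthonormal_vfields[OF E that])
  show "(\<Sum>a<8. \<Sum>b<8. Rm (E a) (E b) (E i) (E j) p * form4_tensor \<Psi> (E a) (E b) (E k) (E l) p) = 2 * Rm (E k) (E l) (E i) (E j) p"
    using contr_Rt_Pt_eq_of_frame[OF F eq Ev Ev Ev Ev, OF ijkl] contr_Rt_Pt[OF Ev Ev Ev Ev E, OF ijkl] by simp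
qed

lemma nabla_TTt:
  assumes sh: "shuffle 3 3 is js" and v: "M \<in> vfields A" "X \<in> vfields A" "Y \<in> vfields A" "Z \<in> vfields A" "V \<in> vfields A"
  shows "nabla D (TTt is js) [M, X, Y, Z, V] p = 0"
proof -
  note E = frame_at[of p]
  have t: "tens (Suc (Suc 4)) (tprod is js Tt Tt)"
    using tens_tprod[OF tens_Tt tens_Tt sh] by (simp add: numeral_eq_Suc)
  have N0: "Nt (M # Xs) p = 0" if Xs: "length Xs = 3" "set Xs \<subseteq> vfields A" for Xs
  proof -
    obtain B C W where "Xs = [B, C, W]" using Xs(1) by (auto simp: length_Suc_conv numeral_eq_Suc)
    then show ?thesis using Xs(2) par[OF v(1), of B C W] by simp
  qed
  have "nabla D (tprod is js Tt Tt) (M # Ys) p = 0" if Ys: "length Ys = 6" "set Ys \<subseteq> vfields A" for Ys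
  proof -
    have "length is = 3" "length js = 3" "set is \<subseteq> {..<6}" "set js \<subseteq> {..<6}"
      using sh by (auto simp: shuffle_def)
    then have "length (map ((!) Ys) is) = 3" "set (map ((!) Ys) is) \<subseteq> vfields A" "length (map ((!) Ys) js) = 3" "set (map ((!) Ys) js) \<subseteq> vfields A"
      using Ys by (auto simp: subset_iff)
    then show ?thesis using nabla_tprod[OF tens_Tt tens_Tt sh v(1), of Ys D p] Ys by (simp add: N0)
  qed
  then show ?thesis
    using nabla_contr[OF t v(1), of "[X, Y, Z, V]" p "frame_at A g p"] v E
    by (simp add: orthonormal_vfields[OF E])
qed

lemma nabla_sigt:
  assumes v: "M \<in> vfields A" "X \<in> vfields A" "Y \<in> vfields A" "Z \<in> vfields A" "V \<in> vfields A"
  shows "nabla D sigt [M, X, Y, Z, V] p = 0"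
proof -
  have Ys: "length [X, Y, Z, V] = 4" "set [X, Y, Z, V] \<subseteq> vfields A" using v by simp_all
  show ?thesis
    unfolding sigt_def
      nabla_lin[OF tens_lin[OF tens_TTt[OF shuffle_sigma(1)] tens_TTt[OF shuffle_sigma(2)]] tens_TTt[OF shuffle_sigma(3)] v(1) Ys]
      nabla_lin[OF tens_TTt[OF shuffle_sigma(1)] tens_TTt[OF shuffle_sigma(2)] v(1) Ys]
      nabla_TTt[OF shuffle_sigma(1) v] nabla_TTt[OF shuffle_sigma(2) v] nabla_TTt[OF shuffle_sigma(3) v] by simp
qed

lemma par_ext_deriv: "parallel4 A D (ext_deriv3 Tor)"
  unfolding parallel4_def vanishing4_def vanishing3_def vanishing2_def
proof (intro ballI allI)
  fix M X Y Z V p assume v: "M \<in> vfields A" "X \<in> vfields A" "Y \<in> vfields A" "Z \<in> vfields A" "V \<in> vfields A"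
  have e: "ext_deriv3 Tor X Y Z V = permt [0, 1, 2, 3] 2 sigt [X, Y, Z, V]"
    if "X \<in> vfields A" "Y \<in> vfields A" "Z \<in> vfields A" "V \<in> vfields A" for X Y Z V
    using ext_deriv3_Tor[OF that] sigt_eq_sigma_form[OF that] that
    by (intro ext) (simp add: permt_app d_nabla_Tor par)
  have "cov_deriv4 D M (ext_deriv3 Tor) X Y Z V p = nabla D (permt [0, 1, 2, 3] 2 sigt) [M, X, Y, Z, V] p"
    unfolding cov_deriv4_def nabla4 by (simp only: e v D_vfields)
  also have "\<dots> = nabla D sigt [M, X, Y, Z, V] p * 2"
    using nabla_permt[OF shuffle_id4 tens_sigt v(1), of "[X, Y, Z, V]" D 2 p] v by simp
  finally show "cov_deriv4 D M (ext_deriv3 Tor) X Y Z V p = 0" using nabla_sigt[OF v] by simp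
qed

lemma par_ricci_sym:
  assumes "X \<in> vfields A" "Y \<in> vfields A"
  shows "ricci A g D X Y p = ricci A g D Y X p"
  unfolding ricci_def
proof (rule sum.cong[OF refl])
  let ?E = "frame_at A g p"
  fix a :: nat assume "a \<in> {..<8}"
  then have a: "?E a \<in> vfields A" using orthonormal_vfields[OF frame_at] by simp
  have "Rm (?E a) X Y (?E a) p = Rm Y (?E a) (?E a) X p" by (rule pair_symmetry[OF assms(2) a a assms(1)])
  then show "Rm (?E a) X Y (?E a) p = Rm (?E a) Y X (?E a) p"
    using Rm_skew1[OF a assms(2) a assms(1), of p] Rm_skew2[OF a assms(2,1) a, of p] by simp
qed

text \<open>\<open>ric_formula\<close> with n = 0, stated as an equality of tensor fields so that it
  can be differentiated.\<close>

lemma Rict_sigPt: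
  assumes v: "X \<in> vfields A" "Y \<in> vfields A"
  shows "Rict [X, Y] q = permt [0, 1] (- 1/6) sigPt [X, Y] q"
proof -
  obtain F where F: "adapted_at q F" by (rule adapted_at_ex)
  note Fo = Fo[OF F] and Fv = Fv[OF F]
  show ?thesis
  proof (rule tens_eq_of_frame[OF tens_Rict tens_permt[OF shuffle_id2 tens_contr3[OF tens_sigP, folded sigPt_def]] Fo])
    fix Xs assume "length Xs = 2" "\<And>i. i < 2 \<Longrightarrow> \<exists>a<8. Xs ! i = F a"
    from length_2_frame[OF this] obtain a b where Xs: "Xs = [F a, F b]" by blast
    interpret d: curvature_algebra "\<lambda>i j k. Tor (F i) (F j) (F k) q" "\<lambda>i j k l. Nt [F i, F j, F k, F l] q"
      "\<lambda>i j k l. Rm (F i) (F j) (F k) (F l) q" "\<lambda>i j k l. form4_tensor \<Psi> (F i) (F j) (F k) (F l) q"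
      by (rule curvature_algebra_at[OF F H0[OF par_closed]])
    have "sigPt [F a, F b] q = d.S a b"
      using contr3_frame[OF tens_sigP _ _ Fo, of "[F a, F b]"] Fv
      by (simp add: sigPt_def d.S_def d.sg_def sum3_def tprod_def Pt_list sigt_frame[OF Fv Fv Fv Fv Fo])
    moreover have "d.n a b = 0" unfolding d.n_def sum3_def by (simp add: par Fv)
    moreover have "Rict [F a, F b] q = d.ric a b" unfolding Rict_frame[OF Fv Fv Fo] d.ric_def ..
    ultimately show "Rict Xs q = permt [0, 1] (- 1/6) sigPt Xs q"
      using d.ric_formula[of a b] by (simp add: Xs permt_app)
  qed (use v in simp_all)
qed

lemma nabla_sigPt:
  assumes v: "M \<in> vfields A" "X \<in> vfields A" "Y \<in> vfields A"
  shows "nabla D sigPt [M, X, Y] p = 0"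
proof -
  note E = frame_at[of p]
  let ?E = "frame_at A g p"
  have Ev: "?E s \<in> vfields A" if "s < 8" for s by (rule orthonormal_vfields[OF E that])
  have e: "nabla D (tprod [4, 2, 0, 6] [5, 3, 1, 7] sigt Pt) [M, ?E c, ?E c, ?E b, ?E b, ?E a, ?E a, X, Y] p = 0"
    if "a < 8" "b < 8" "c < 8" for a b c
    using nabla_tprod[OF tens_sigt tens_Pt shuffle_sigma_P v(1), of "[?E c, ?E c, ?E b, ?E b, ?E a, ?E a, X, Y]" D p] that v
    by (simp add: Ev nabla_Pt nabla_sigt)
  show ?thesis
    unfolding sigPt_def using nabla_contr3[OF tens_sigP v(1), of "[X, Y]" p ?E] v E by (simp del: One_nat_def add: e)
qed

lemma par_ricci_parallel: "parallel2 A D (ricci A g D)"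
  unfolding parallel2_def vanishing2_def
proof (intro ballI allI)
  fix M X Y p assume v: "M \<in> vfields A" "X \<in> vfields A" "Y \<in> vfields A"
  have "cov_deriv2 D M (ricci A g D) X Y p = nabla D Rict [M, X, Y] p"
    by (simp add: cov_deriv2_def nabla_Cons Rict_ricci lessThan_Suc eval_nat_numeral)
  also have "\<dots> = nabla D (permt [0, 1] (- 1/6) sigPt) [M, X, Y] p"
  proof (rule nabla_cong)
    fix Xs :: "'a vfield list" assume Xs: "length Xs = 2" "set Xs \<subseteq> vfields A"
    then obtain X Y where "Xs = [X, Y]" by (auto simp: length_Suc_conv numeral_eq_Suc)
    then show "Rict Xs = permt [0, 1] (- 1/6) sigPt Xs" using Xs(2) Rict_sigPt by (intro ext) simp
  qed (use v in \<open>simp_all add: D_vfields\<close>)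
  also have "\<dots> = nabla D sigPt [M, X, Y] p * (- 1/6)"
    using nabla_permt[OF shuffle_id2 tens_contr3[OF tens_sigP, folded sigPt_def] v(1), of "[X, Y]" D "- 1/6" p] v by simp
  finally show "cov_deriv2 D M (ricci A g D) X Y p = 0" using nabla_sigPt[OF v] by simp
qed

end

end

theorem theorem1p5:
  fixes A :: "'a::{t2_space, second_countable_topology} chart set"
    and \<Psi> :: "'a form4" and g :: "'a metric2" and D :: "'a connection" and T :: "'a ten3"
  assumes "smooth_atlas A"
    and "compact (UNIV :: 'a set)"
    and "spin7_structure A \<Psi>"
    and "induced_metric A \<Psi> g"
    and "torsion_connection A \<Psi> g D"
    and "T = torsion g D"
  shows "(spin7_instanton A \<Psi> g D \<and> vanishing4 A (d_nabla D T) \<longleftrightarrow> parallel3 A D T) \<and>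
    (vanishing4 A (d_nabla D T) \<longleftrightarrow>
       (\<forall>X\<in>vfields A. \<forall>Y\<in>vfields A. \<forall>Z\<in>vfields A. \<forall>V\<in>vfields A. \<forall>p.
          ext_deriv3 T X Y Z V p = 2 * sigma_form A g T X Y Z V p)) \<and>
    (parallel3 A D T \<longrightarrow>
       (\<forall>X\<in>vfields A. \<forall>Y\<in>vfields A. \<forall>p. ricci A g D X Y p = ricci A g D Y X p) \<and>
       parallel2 A D (ricci A g D) \<and>
       parallel4 A D (ext_deriv3 T))"
proof -
  interpret spin7_connection A \<Psi> g D
    using assms by unfold_locales simp_all
  have par: "Nt [X, Y, Z, V] p = 0" if "parallel3 A D (torsion g D)"
    "X \<in> vfields A" "Y \<in> vfields A" "Z \<in> vfields A" "V \<in> vfields A" for X Y Z V p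
    using that unfolding parallel3_Tor by blast
  have "spin7_instanton A \<Psi> g D \<and> vanishing4 A (d_nabla D (torsion g D)) \<longleftrightarrow> parallel3 A D (torsion g D)"
  proof
    assume "spin7_instanton A \<Psi> g D \<and> vanishing4 A (d_nabla D (torsion g D))"
    then have inst: "spin7_instanton A \<Psi> g D" and cc: d_nabla_zero by (simp_all add: vanishing4_d_nabla)
    show "parallel3 A D (torsion g D)"
      unfolding parallel3_Tor using parallel_torsion_of_instanton[OF assms(2) cc inst] by blast
  next
    assume "parallel3 A D (torsion g D)"
    note par = par[OF this]
    show "spin7_instanton A \<Psi> g D \<and> vanishing4 A (d_nabla D (torsion g D))"
      unfolding vanishing4_d_nabla using par_instanton[OF par] par_closed[OF par] by blast
  qed
  moreover have "vanishing4 A (d_nabla D (torsion g D)) \<longleftrightarrow>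
       (\<forall>X\<in>vfields A. \<forall>Y\<in>vfields A. \<forall>Z\<in>vfields A. \<forall>V\<in>vfields A. \<forall>p.
          ext_deriv3 (torsion g D) X Y Z V p = 2 * sigma_form A g (torsion g D) X Y Z V p)"
    unfolding vanishing4_def vanishing3_def vanishing2_def by (simp add: ext_deriv3_Tor)
  moreover have "(\<forall>X\<in>vfields A. \<forall>Y\<in>vfields A. \<forall>p. ricci A g D X Y p = ricci A g D Y X p) \<and>
       parallel2 A D (ricci A g D) \<and> parallel4 A D (ext_deriv3 (torsion g D))" if "parallel3 A D (torsion g D)"
  proof -
    note par = par[OF that]
    show ?thesis using par_ricci_sym[OF par] par_ricci_parallel[OF par] par_ext_deriv[OF par] by blast
  qed
  ultimately show ?thesis unfolding assms(6) by blast
qed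

end
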